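(* Let $c$ be a positive integer, $\mu,\nu\in\mathbb{R}$, and let $\{X,Y,Z\}$ be the given basis of the Heisenberg Lie algebra $\mathfrak{h}$ with $[X,Y]=cZ$. The action functional of the sigma model on the set of projections $P$ (i.e. $P=P^2=P^*$) of the smooth algebra $(D^c_{\mu\nu})^\infty$ is given by \[ S(P):=-\tau_D(\psi_2(\mathrm{Id},P,P))=2\,\tau_D\big((\delta_XP)^2+(\delta_YP)^2+(\delta_ZP)^2\big). \]
   Context: Notation: $\mathbb{T}=\mathbb{R}/\mathbb{Z}$, $M=\mathbb{R}\times\mathbb{T}$, $e(t)=\exp(2\pi it)$, $\overline{e}(t)=\overline{e(t)}$. Quantum Heisenberg manifold: $D_0$ is the set of bounded continuous functions $\Phi$ on $M\times\mathbb{Z}$ with compact support in the $\mathbb{Z}$-variable satisfying $\overline{e}(ckp(y-p\nu))\Phi(x+k,y,p)=\Phi(x,y,p)$ for all $k\in\mathbb{Z}$, with product $(\Phi*\Psi)(x,y,p)=\sum_{q}\Phi(x,y,q)\Psi(x-2q\mu,y-2q\nu,p-q)$ and involution $\Phi^*(x,y,p)=\overline{\Phi}(x-2p\mu,y-2p\nu,-p)$. $D^c_{\mu\nu}$ is the closure of $D_0$ in the multiplier algebra of the crossed product $C_b(M)\rtimes_\lambda\mathbb{Z}$, $\lambda_p(x,y)=(x+2p\mu,y+2p\nu)$. Its unit $\mathrm{Id}$ is $(x,y,p)\mapsto\delta_0(p)$. Heisenberg action: $H$ is $\mathbb{R}^3$ with product $(x,y,z)(x',y',z')=(x+x',y+y',z+z'+cyx')$;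 it acts on $D^c_{\mu\nu}$ by $(L_{(r,s,t)}\Phi)(x,y,p)=e(p(t+cs(x-r-p\mu)))\Phi(x-r,y-s,p)$. $(D^c_{\mu\nu})^\infty$ is the subalgebra of elements $\Phi$ for which $h\mapsto L_h(\Phi)$ is smooth in norm. The Lie algebra $\mathfrak{h}$ has basis $X=(0,1,0)$, $Y=(1,0,0)$, $Z=(0,0,1)$ with $[X,Y]=cZ$, and the infinitesimal action is \[ \delta_X\Phi=2\pi icp(x-p\mu)\Phi-\partial_y\Phi,\quad \delta_Y\Phi=-\partial_x\Phi,\quad\delta_Z\Phi=2\pi ip\,\Phi . \] Trace: $\tau_D(\Phi)=\int_{\mathbb{T}^2}\Phi(x,y,0)\,dx\,dy$, a faithful trace. Representation: let $\mathcal{H}=L^2([0,1]\times\mathbb{T}\times\mathbb{Z})$. An algebra element $a$ is identified with its restriction to $[0,1]\times\mathbb{T}\times\mathbb{Z}$; a function $\phi$ on $[0,1]\times\mathbb{T}\times\mathbb{Z}$ has the extension $\tilde\phi(x,y,p)=e(cp\lfloor x\rfloor(y-p\nu))\phi(x-\lfloor x\rfloor,y,p)$ to $M\times\mathbb{Z}$. The algebra acts on $\mathcal{H}$ by \[ (\tilde\pi(a)\xi)(x,y,p)=\sum_{q\in\mathbb{Z}}\tilde a(x-2p\mu,y-2p\nu,q)\,\xi(x,y,p-q), \] and on $\mathcal{H}\otimes\mathbb{C}^2$ by $\tilde\pi(a)(\xi\otimes u)=(\tilde\pi(a)\xi)\otimes u$. Dirac operator: on $\mathcal{H}\otimes\mathbb{C}^2$,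 $D(f\otimes u)=\sum_{j=X,Y,Z}i\,\tilde\delta_j(f)\otimes\sigma_j(u)$, where $\tilde\delta_jf=(\delta_j\tilde f)|_{[0,1]\times\mathbb{T}\times\mathbb{Z}}$ and $\sigma_X=\begin{pmatrix}0&1\\1&0\end{pmatrix}$, $\sigma_Y=\begin{pmatrix}0&-i\\ i&0\end{pmatrix}$, $\sigma_Z=\begin{pmatrix}1&0\\0&-1\end{pmatrix}$. Its domain consists of the functions $\Phi\in\mathcal{H}$ (tensored with $\mathbb{C}^2$) with $\Phi(\cdot,\cdot,p)\in H^1([0,1]\times\mathbb{T})$ (Sobolev space) for all $p$, with $\Phi(0,y,p)=\overline{e}(cp(y-p\nu))\Phi(1,y,p)$ in the sense of traces, and with $p\Phi$ and $\partial_y(e(\lfloor cp^2\mu\rfloor y)\Phi)$ in $\mathcal{H}$. The 2-chain: \[ \psi_2(a,a_1,a_2)=\mathrm{Tr}\big(a[D,a_1][D,a_2]\big), \] where $a,a_1,a_2$ act through $\tilde\pi$, so $[D,a_i]$ means the commutator $[D,\tilde\pi(a_i)]$, and $\mathrm{Tr}$ is the (unnormalized) matrix trace over the factor $\mathbb{C}^2$. The trace $\tau_D$ is applied to $\psi_2(\mathrm{Id},P,P)$ by identifying an operator of the form $\tilde\pi(b)$ with the algebra element $b$.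
   Formalization: The algebra for (μ,ν) acts through the representation and Dirac operator with (−μ,−ν), since with the printed signs the representation is not multiplicative and does not preserve dom D; dom D also requires ∂_xΦ in the Hilbert space, so that D takes values there. *)

theory Defs
  imports "HOL-Analysis.Analysis"
begin

text \<open>
  A function on \<open>M \<times> \<int>\<close>, with \<open>M = \<real> \<times> \<T>\<close>, is a curried function of \<open>x\<close>, \<open>y\<close>, \<open>p\<close>;
  for elements of the algebra the circle variable \<open>y\<close> ranges over \<open>\<real>\<close> with period 1.
\<close>

type_synonym qfun = "real \<Rightarrow> real \<Rightarrow> int \<Rightarrow> complex"

definition ee :: "real \<Rightarrow> complex" where
  "ee t = exp (2 * of_real pi * \<i> * of_real t)"

section \<open>The quantum Heisenberg manifold\<close>

definition D0 :: "int \<Rightarrow> real \<Rightarrow> real \<Rightarrow> qfun set" where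
  "D0 c \<mu> \<nu> = {\<Phi>.
     (\<forall>p. continuous_on UNIV (\<lambda>z. \<Phi> (fst z) (snd z) p)) \<and>
     (\<exists>B. \<forall>x y p. cmod (\<Phi> x y p) \<le> B) \<and>
     (\<forall>x y p. \<Phi> x (y + 1) p = \<Phi> x y p) \<and>
     finite {p. \<exists>x y. \<Phi> x y p \<noteq> 0} \<and>
     (\<forall>(k::int) x y p.
        cnj (ee (of_int (c * k * p) * (y - of_int p * \<nu>))) * \<Phi> (x + of_int k) y p = \<Phi> x y p)}"

definition qmult :: "real \<Rightarrow> real \<Rightarrow> qfun \<Rightarrow> qfun \<Rightarrow> qfun" where
  "qmult \<mu> \<nu> \<Phi> \<Psi> = (\<lambda>x y p. \<Sum>\<^sub>\<infinity>q\<in>UNIV.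
     \<Phi> x y q * \<Psi> (x - 2 * of_int q * \<mu>) (y - 2 * of_int q * \<nu>) (p - q))"

definition qstar :: "real \<Rightarrow> real \<Rightarrow> qfun \<Rightarrow> qfun" where
  "qstar \<mu> \<nu> \<Phi> = (\<lambda>x y p. cnj (\<Phi> (x - 2 * of_int p * \<mu>) (y - 2 * of_int p * \<nu>) (- p)))"

definition qunit :: qfun where
  "qunit = (\<lambda>x y p. if p = 0 then 1 else 0)"

text \<open>
  The norm of \<open>C\<^sub>b(M) \<rtimes> \<int>\<close> is that of the regular representation, the group \<open>\<int>\<close> being
  amenable. The regular representation is the sum over \<open>m \<in> M\<close> of the representations on
  \<open>\<ell>\<^sup>2(\<int>)\<close> induced from the evaluation at \<open>m\<close>, in which \<open>\<Phi>\<close> acts by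
  \<open>p \<mapsto> \<Sum>q. \<Phi> (\<lambda>\<^sub>p m) q * \<xi> (p - q)\<close>. The norm below is the least bound for these
  operators on the finitely supported vectors; it is infinite if there is no bound. As
  \<open>C\<^sub>b(M) \<rtimes> \<int>\<close> has a unit, it is its own multiplier algebra.

  An element of the completion is given by its matrix coefficients in the regular representation,
  that is, by a function on \<open>M \<times> \<int>\<close> (in general no longer of finite support in \<open>p\<close>). The
  closure of \<open>D0\<close> is therefore formed inside the functions on \<open>M \<times> \<int>\<close>.
\<close>

definition regular_rep :: "real \<Rightarrow> real \<Rightarrow> qfun \<Rightarrow> real \<Rightarrow> real \<Rightarrow> (int \<Rightarrow> complex) \<Rightarrow> int \<Rightarrow> complex" where
  "regular_rep \<mu> \<nu> \<Phi> x y \<xi> = (\<lambda>p. \<Sum>\<^sub>\<infinity>q\<in>UNIV.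
     \<Phi> (x + 2 * of_int p * \<mu>) (y + 2 * of_int p * \<nu>) q * \<xi> (p - q))"

definition l2_int :: "(int \<Rightarrow> complex) \<Rightarrow> ennreal" where
  "l2_int \<xi> = (\<integral>\<^sup>+p. ennreal ((cmod (\<xi> p))\<^sup>2) \<partial>count_space UNIV)"

definition qnorm :: "real \<Rightarrow> real \<Rightarrow> qfun \<Rightarrow> ennreal" where
  "qnorm \<mu> \<nu> \<Phi> = Inf {C. \<forall>x y \<xi>. finite {r. \<xi> r \<noteq> 0} \<longrightarrow>
     l2_int (regular_rep \<mu> \<nu> \<Phi> x y \<xi>) \<le> C\<^sup>2 * l2_int \<xi>}"

definition qhm :: "int \<Rightarrow> real \<Rightarrow> real \<Rightarrow> qfun set" where
  "qhm c \<mu> \<nu> = {\<Phi>. \<forall>\<epsilon>>0. \<exists>\<Psi>\<in>D0 c \<mu> \<nu>. qnorm \<mu> \<nu> (\<lambda>x y p. \<Phi> x y p - \<Psi> x y p) < \<epsilon>}"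

section \<open>The Heisenberg action and the smooth subalgebra\<close>

definition heis_act :: "int \<Rightarrow> real \<Rightarrow> real \<times> real \<times> real \<Rightarrow> qfun \<Rightarrow> qfun" where
  "heis_act c \<mu> = (\<lambda>(r, s, t) \<Phi> x y p.
     ee (of_int p * (t + of_int c * s * (x - r - of_int p * \<mu>))) * \<Phi> (x - r) (y - s) p)"

text \<open>\<open>C\<^sup>k\<close> maps from \<open>\<real>\<^sup>3\<close> to the algebra, through iterated partial derivatives in norm.\<close>

primrec norm_Ck :: "real \<Rightarrow> real \<Rightarrow> nat \<Rightarrow> (real \<times> real \<times> real \<Rightarrow> qfun) \<Rightarrow> bool" where
  "norm_Ck \<mu> \<nu> 0 F \<longleftrightarrow>
     (\<forall>h. ((\<lambda>h'. qnorm \<mu> \<nu> (\<lambda>x y p. F h' x y p - F h x y p)) \<longlongrightarrow> 0) (at h))"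
| "norm_Ck \<mu> \<nu> (Suc k) F \<longleftrightarrow>
     (\<forall>b\<in>Basis. \<exists>G.
        (\<forall>h. ((\<lambda>t. qnorm \<mu> \<nu> (\<lambda>x y p.
           (F (h + t *\<^sub>R b) x y p - F h x y p) / of_real t - G h x y p)) \<longlongrightarrow> 0) (at 0)) \<and>
        norm_Ck \<mu> \<nu> k G)"

definition smooth_qhm :: "int \<Rightarrow> real \<Rightarrow> real \<Rightarrow> qfun set" where
  "smooth_qhm c \<mu> \<nu> = {\<Phi> \<in> qhm c \<mu> \<nu>. \<forall>k. norm_Ck \<mu> \<nu> k (\<lambda>h. heis_act c \<mu> h \<Phi>)}"

definition qprojections :: "int \<Rightarrow> real \<Rightarrow> real \<Rightarrow> qfun set" where
  "qprojections c \<mu> \<nu> = {P \<in> smooth_qhm c \<mu> \<nu>. qmult \<mu> \<nu> P P = P \<and> qstar \<mu> \<nu> P = P}"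

datatype heis_basis = HX | HY | HZ

text \<open>
  The derivatives at 0 of the action along the one-parameter groups of \<open>X = (0,1,0)\<close>,
  \<open>Y = (1,0,0)\<close>, \<open>Z = (0,0,1)\<close>.
\<close>

fun qdelta :: "int \<Rightarrow> real \<Rightarrow> heis_basis \<Rightarrow> qfun \<Rightarrow> qfun" where
  "qdelta c \<mu> HX \<Phi> = (\<lambda>x y p.
     2 * of_real pi * \<i> * of_int c * of_int p * of_real (x - of_int p * \<mu>) * \<Phi> x y p
       - vector_derivative (\<lambda>s. \<Phi> x s p) (at y))"
| "qdelta c \<mu> HY \<Phi> = (\<lambda>x y p. - vector_derivative (\<lambda>s. \<Phi> s y p) (at x))"
| "qdelta c \<mu> HZ \<Phi> = (\<lambda>x y p. 2 * of_real pi * \<i> * of_int p * \<Phi> x y p)"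

abbreviation unit_square :: "(real \<times> real) set" where
  "unit_square \<equiv> {0..1} \<times> {0..1}"

definition qtrace :: "qfun \<Rightarrow> complex" where
  "qtrace \<Phi> = (LINT z|lebesgue_on unit_square. \<Phi> (fst z) (snd z) 0)"

section \<open>Sobolev functions on the cylinder \<open>[0,1] \<times> \<T>\<close>\<close>

text \<open>
  Functions on \<open>[0,1] \<times> \<T>\<close> are considered up to null sets, on the unit square; their values
  elsewhere are irrelevant. The gluing of the edges \<open>y = 0\<close> and \<open>y = 1\<close> enters through the
  periodicity of the test functions.
\<close>

definition l2_square :: "(real \<Rightarrow> real \<Rightarrow> complex) \<Rightarrow> ennreal" where
  "l2_square f = (\<integral>\<^sup>+z. ennreal ((cmod (f (fst z) (snd z)))\<^sup>2) \<partial>lebesgue_on unit_square)"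

definition L2_cyl :: "(real \<Rightarrow> real \<Rightarrow> complex) set" where
  "L2_cyl = {f. (\<lambda>z. f (fst z) (snd z)) \<in> borel_measurable (lebesgue_on unit_square) \<and>
     l2_square f < \<infinity>}"

primrec plane_Ck :: "nat \<Rightarrow> (real \<Rightarrow> real \<Rightarrow> complex) \<Rightarrow> bool" where
  "plane_Ck 0 f \<longleftrightarrow> continuous_on UNIV (\<lambda>z. f (fst z) (snd z))"
| "plane_Ck (Suc k) f \<longleftrightarrow> (\<exists>fx fy.
     (\<forall>x y. ((\<lambda>s. f s y) has_vector_derivative fx x y) (at x) \<and>
            ((\<lambda>s. f x s) has_vector_derivative fy x y) (at y)) \<and>
     plane_Ck k fx \<and> plane_Ck k fy)"

definition smooth_cyl :: "(real \<Rightarrow> real \<Rightarrow> complex) set" where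
  "smooth_cyl = {f. (\<forall>k. plane_Ck k f) \<and> (\<forall>x y. f x (y + 1) = f x y)}"

definition test_cyl :: "(real \<Rightarrow> real \<Rightarrow> complex) set" where
  "test_cyl = {\<phi> \<in> smooth_cyl.
     \<exists>a b. 0 < a \<and> b < 1 \<and> (\<forall>x y. \<phi> x y \<noteq> 0 \<longrightarrow> a \<le> x \<and> x \<le> b)}"

definition pdx :: "(real \<Rightarrow> real \<Rightarrow> complex) \<Rightarrow> real \<Rightarrow> real \<Rightarrow> complex" where
  "pdx f = (\<lambda>x y. vector_derivative (\<lambda>s. f s y) (at x))"

definition pdy :: "(real \<Rightarrow> real \<Rightarrow> complex) \<Rightarrow> real \<Rightarrow> real \<Rightarrow> complex" where
  "pdy f = (\<lambda>x y. vector_derivative (\<lambda>s. f x s) (at y))"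

definition is_weak_dx :: "(real \<Rightarrow> real \<Rightarrow> complex) \<Rightarrow> (real \<Rightarrow> real \<Rightarrow> complex) \<Rightarrow> bool" where
  "is_weak_dx f g \<longleftrightarrow> g \<in> L2_cyl \<and> (\<forall>\<phi>\<in>test_cyl.
     (LINT z|lebesgue_on unit_square. f (fst z) (snd z) * pdx \<phi> (fst z) (snd z)) =
     - (LINT z|lebesgue_on unit_square. g (fst z) (snd z) * \<phi> (fst z) (snd z)))"

definition is_weak_dy :: "(real \<Rightarrow> real \<Rightarrow> complex) \<Rightarrow> (real \<Rightarrow> real \<Rightarrow> complex) \<Rightarrow> bool" where
  "is_weak_dy f g \<longleftrightarrow> g \<in> L2_cyl \<and> (\<forall>\<phi>\<in>test_cyl.
     (LINT z|lebesgue_on unit_square. f (fst z) (snd z) * pdy \<phi> (fst z) (snd z)) =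
     - (LINT z|lebesgue_on unit_square. g (fst z) (snd z) * \<phi> (fst z) (snd z)))"

text \<open>A weak derivative is unique up to a null set; one representative is chosen.\<close>

definition weak_dx :: "(real \<Rightarrow> real \<Rightarrow> complex) \<Rightarrow> real \<Rightarrow> real \<Rightarrow> complex" where
  "weak_dx f = (SOME g. is_weak_dx f g)"

definition weak_dy :: "(real \<Rightarrow> real \<Rightarrow> complex) \<Rightarrow> real \<Rightarrow> real \<Rightarrow> complex" where
  "weak_dy f = (SOME g. is_weak_dy f g)"

definition H1_cyl :: "(real \<Rightarrow> real \<Rightarrow> complex) set" where
  "H1_cyl = {f \<in> L2_cyl. (\<exists>g. is_weak_dx f g) \<and> (\<exists>g. is_weak_dy f g)}"

text \<open>
  The trace of \<open>f\<close> on the circle \<open>{x0} \<times> \<T>\<close>, as the continuous extension to \<open>H\<^sup>1\<close> of the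
  restriction of smooth functions.
\<close>

definition has_sobolev_trace ::
  "(real \<Rightarrow> real \<Rightarrow> complex) \<Rightarrow> real \<Rightarrow> (real \<Rightarrow> complex) \<Rightarrow> bool" where
  "has_sobolev_trace f x0 g \<longleftrightarrow>
     g \<in> borel_measurable (lebesgue_on {0..1}) \<and>
     (\<exists>F. (\<forall>n. F n \<in> smooth_cyl) \<and>
        (\<lambda>n. l2_square (\<lambda>x y. F n x y - f x y)) \<longlonglongrightarrow> 0 \<and>
        (\<lambda>n. l2_square (\<lambda>x y. pdx (F n) x y - weak_dx f x y)) \<longlonglongrightarrow> 0 \<and>
        (\<lambda>n. l2_square (\<lambda>x y. pdy (F n) x y - weak_dy f x y)) \<longlonglongrightarrow> 0 \<and>
        (\<lambda>n::nat. \<integral>\<^sup>+y. ennreal ((cmod (F n x0 y - g y))\<^sup>2) \<partial>lebesgue_on {0..1}) \<longlonglongrightarrow> 0)"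

section \<open>The representation and the Dirac operator\<close>

text \<open>
  Vectors of \<open>L\<^sup>2([0,1] \<times> \<T> \<times> \<int>)\<close> are represented by functions, with \<open>heq\<close> as equality, and
  operators by maps on representatives.
\<close>

definition hnorm2 :: "qfun \<Rightarrow> ennreal" where
  "hnorm2 \<xi> = (\<integral>\<^sup>+p. l2_square (\<lambda>x y. \<xi> x y p) \<partial>count_space UNIV)"

definition hilb :: "qfun set" where
  "hilb = {\<xi>. (\<forall>p. (\<lambda>x y. \<xi> x y p) \<in> L2_cyl) \<and> hnorm2 \<xi> < \<infinity>}"

definition heq :: "qfun \<Rightarrow> qfun \<Rightarrow> bool" where
  "heq \<xi> \<eta> \<longleftrightarrow> (\<forall>p. AE z in lebesgue_on unit_square. \<xi> (fst z) (snd z) p = \<eta> (fst z) (snd z) p)"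

text \<open>
  An element \<open>a\<close> of the algebra is a function on all of \<open>M \<times> \<int>\<close>, hence equal to the
  quasi-periodic extension of its restriction to \<open>[0,1] \<times> \<T> \<times> \<int>\<close>.
\<close>

definition rep :: "real \<Rightarrow> real \<Rightarrow> qfun \<Rightarrow> qfun \<Rightarrow> qfun" where
  "rep \<mu> \<nu> a \<xi> = (\<lambda>x y p. \<Sum>\<^sub>\<infinity>q\<in>UNIV.
     a (x - 2 * of_int p * \<mu>) (y - 2 * of_int p * \<nu>) q * \<xi> x y (p - q))"

text \<open>
  The restriction to \<open>[0,1] \<times> \<T> \<times> \<int>\<close> of the derivative of the quasi-periodic extension is the
  weak derivative in the interior: for \<open>f\<close> in the domain of the Dirac operator the boundary
  condition makes the extension free of jumps.
\<close>

fun hdelta :: "int \<Rightarrow> real \<Rightarrow> heis_basis \<Rightarrow> qfun \<Rightarrow> qfun" where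
  "hdelta c \<mu> HX f = (\<lambda>x y p.
     2 * of_real pi * \<i> * of_int c * of_int p * of_real (x - of_int p * \<mu>) * f x y p
       - weak_dy (\<lambda>x y. f x y p) x y)"
| "hdelta c \<mu> HY f = (\<lambda>x y p. - weak_dx (\<lambda>x y. f x y p) x y)"
| "hdelta c \<mu> HZ f = (\<lambda>x y p. 2 * of_real pi * \<i> * of_int p * f x y p)"

text \<open>
  The last condition on \<open>\<Phi>\<close> (square integrability of the \<open>x\<close>-derivative also over \<open>p\<close>) is what
  is needed, besides the others, for the Dirac operator to take values in the Hilbert space.
\<close>

definition dirac_dom1 :: "int \<Rightarrow> real \<Rightarrow> real \<Rightarrow> qfun set" where
  "dirac_dom1 c \<mu> \<nu> = {\<Phi> \<in> hilb.
     (\<forall>p. (\<lambda>x y. \<Phi> x y p) \<in> H1_cyl) \<and>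
     (\<forall>p. \<exists>g. has_sobolev_trace (\<lambda>x y. \<Phi> x y p) 1 g \<and>
        has_sobolev_trace (\<lambda>x y. \<Phi> x y p) 0
          (\<lambda>y. cnj (ee (of_int (c * p) * (y - of_int p * \<nu>))) * g y)) \<and>
     (\<lambda>x y p. of_int p * \<Phi> x y p) \<in> hilb \<and>
     (\<lambda>x y p. weak_dy (\<lambda>x y.
        ee (of_int \<lfloor>of_int c * (of_int p)\<^sup>2 * \<mu>\<rfloor> * y) * \<Phi> x y p) x y) \<in> hilb \<and>
     (\<lambda>x y p. weak_dx (\<lambda>x y. \<Phi> x y p) x y) \<in> hilb}"

text \<open>An element of the tensor product of the Hilbert space with \<open>\<complex>\<^sup>2\<close> is a pair of vectors.\<close>

type_synonym spinor = "qfun ^ 2"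

definition tensor :: "qfun \<Rightarrow> complex ^ 2 \<Rightarrow> spinor" where
  "tensor f u = (\<chi> k. (\<lambda>x y p. f x y p * u $ k))"

definition hilb2 :: "spinor set" where
  "hilb2 = {F. \<forall>k. F $ k \<in> hilb}"

definition heq2 :: "spinor \<Rightarrow> spinor \<Rightarrow> bool" where
  "heq2 F G \<longleftrightarrow> (\<forall>k. heq (F $ k) (G $ k))"

definition lincomb2 :: "complex \<Rightarrow> spinor \<Rightarrow> complex \<Rightarrow> spinor \<Rightarrow> spinor" where
  "lincomb2 \<alpha> F \<beta> G = (\<chi> k. (\<lambda>x y p. \<alpha> * (F $ k) x y p + \<beta> * (G $ k) x y p))"

definition bounded_op2 :: "(spinor \<Rightarrow> spinor) \<Rightarrow> bool" where
  "bounded_op2 T \<longleftrightarrow>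
     (\<forall>F\<in>hilb2. T F \<in> hilb2) \<and>
     (\<forall>F\<in>hilb2. \<forall>G\<in>hilb2. \<forall>\<alpha> \<beta>. heq2 (T (lincomb2 \<alpha> F \<beta> G)) (lincomb2 \<alpha> (T F) \<beta> (T G))) \<and>
     (\<exists>C::real. \<forall>F\<in>hilb2. (\<Sum>k\<in>UNIV. hnorm2 (T F $ k)) \<le> ennreal C * (\<Sum>k\<in>UNIV. hnorm2 (F $ k)))"

definition rep2 :: "real \<Rightarrow> real \<Rightarrow> qfun \<Rightarrow> spinor \<Rightarrow> spinor" where
  "rep2 \<mu> \<nu> a F = (\<chi> k. rep \<mu> \<nu> a (F $ k))"

fun pauli :: "heis_basis \<Rightarrow> complex ^ 2 ^ 2" where
  "pauli HX = vector [vector [0, 1], vector [1, 0]]"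
| "pauli HY = vector [vector [0, - \<i>], vector [\<i>, 0]]"
| "pauli HZ = vector [vector [1, 0], vector [0, - 1]]"

definition dirac_dom :: "int \<Rightarrow> real \<Rightarrow> real \<Rightarrow> spinor set" where
  "dirac_dom c \<mu> \<nu> = {F. \<forall>k. F $ k \<in> dirac_dom1 c \<mu> \<nu>}"

definition dirac :: "int \<Rightarrow> real \<Rightarrow> spinor \<Rightarrow> spinor" where
  "dirac c \<mu> F = (\<chi> k. (\<lambda>x y p.
     \<Sum>j\<in>{HX, HY, HZ}. \<i> * (\<Sum>l\<in>UNIV. pauli j $ k $ l * hdelta c \<mu> j (F $ l) x y p)))"

text \<open>
  \<open>T\<close> is the bounded operator that extends the commutator of the Dirac operator with \<open>a\<close>. The
  commutator is defined on the domain of the Dirac operator, which \<open>a\<close> has to preserve.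
\<close>

definition is_dirac_commutator ::
  "int \<Rightarrow> real \<Rightarrow> real \<Rightarrow> qfun \<Rightarrow> (spinor \<Rightarrow> spinor) \<Rightarrow> bool" where
  "is_dirac_commutator c \<mu> \<nu> a T \<longleftrightarrow>
     bounded_op2 T \<and>
     (\<forall>F\<in>dirac_dom c \<mu> \<nu>. rep2 \<mu> \<nu> a F \<in> dirac_dom c \<mu> \<nu> \<and>
        heq2 (T F) (lincomb2 1 (dirac c \<mu> (rep2 \<mu> \<nu> a F)) (- 1) (rep2 \<mu> \<nu> a (dirac c \<mu> F))))"

definition dirac_commutator :: "int \<Rightarrow> real \<Rightarrow> real \<Rightarrow> qfun \<Rightarrow> spinor \<Rightarrow> spinor" where
  "dirac_commutator c \<mu> \<nu> a = (SOME T. is_dirac_commutator c \<mu> \<nu> a T)"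

definition matrix_trace :: "(spinor \<Rightarrow> spinor) \<Rightarrow> qfun \<Rightarrow> qfun" where
  "matrix_trace T \<xi> = (\<lambda>x y p. \<Sum>k\<in>UNIV. (T (tensor \<xi> (axis k 1)) $ k) x y p)"

definition psi2 :: "int \<Rightarrow> real \<Rightarrow> real \<Rightarrow> qfun \<Rightarrow> qfun \<Rightarrow> qfun \<Rightarrow> qfun \<Rightarrow> qfun" where
  "psi2 c \<mu> \<nu> a a1 a2 = matrix_trace
     (rep2 \<mu> \<nu> a \<circ> dirac_commutator c \<mu> \<nu> a1 \<circ> dirac_commutator c \<mu> \<nu> a2)"

section \<open>The action functional\<close>

text \<open>
  Pitfall: the signs of \<open>\<mu>\<close> and \<open>\<nu>\<close>. With the product \<open>qmult \<mu> \<nu>\<close>, the algebra is not represented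
  by \<open>rep \<mu> \<nu>\<close>, and \<open>hdelta c \<mu> HX\<close> does not implement \<open>qdelta c \<mu> HX\<close>: on the Hilbert space, the
  formulas for the representation, for the quasi-periodicity of vectors and for the Dirac operator
  (\<open>rep\<close>, \<open>dirac_dom1\<close>, \<open>hdelta\<close>) agree with each other, but with the algebra for the parameters
  \<open>- \<mu>\<close>, \<open>- \<nu>\<close>. Indeed the coefficients \<open>a (x - 2 p \<mu>) (y - 2 p \<nu>) q\<close> compose like
  \<open>qmult (- \<mu>) (- \<nu>)\<close>, and the commutator of \<open>hdelta c \<mu> HX\<close> and \<open>rep \<mu> \<nu> a\<close> has the multiplier
  \<open>2 \<pi> i c q ((x - 2 p \<mu>) + q \<mu>)\<close>, that is, the one of \<open>qdelta c (- \<mu>) HX a\<close> at the point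
  \<open>(x - 2 p \<mu>, y - 2 p \<nu>)\<close>. The algebra for \<open>\<mu>\<close>, \<open>\<nu>\<close> is therefore represented on the Hilbert space
  data for \<open>- \<mu>\<close>, \<open>- \<nu>\<close>; \<open>rep (- \<mu>) (- \<nu>)\<close> is the regular representation of the crossed product.
\<close>

definition represents :: "int \<Rightarrow> real \<Rightarrow> real \<Rightarrow> qfun \<Rightarrow> (qfun \<Rightarrow> qfun) \<Rightarrow> bool" where
  "represents c \<mu> \<nu> b T \<longleftrightarrow>
     b \<in> qhm c \<mu> \<nu> \<and> (\<forall>\<xi>\<in>hilb. heq (T \<xi>) (rep (- \<mu>) (- \<nu>) b \<xi>))"

definition qtrace_op :: "int \<Rightarrow> real \<Rightarrow> real \<Rightarrow> (qfun \<Rightarrow> qfun) \<Rightarrow> complex" where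
  "qtrace_op c \<mu> \<nu> T = qtrace (THE b. represents c \<mu> \<nu> b T)"

definition action_functional :: "int \<Rightarrow> real \<Rightarrow> real \<Rightarrow> qfun \<Rightarrow> complex" where
  "action_functional c \<mu> \<nu> P = - qtrace_op c \<mu> \<nu> (psi2 c (- \<mu>) (- \<nu>) qunit P P)"

end

theory Submission
  imports Defs
begin

text \<open>
  An element \<open>a\<close> of the algebra acts pointwise in \<open>(x, y)\<close>, by a bounded matrix on \<open>\<ell>\<^sup>2(\<int>)\<close>. For
  smooth \<open>P\<close>, the derivative \<open>\<delta>\<^sub>j P\<close> belongs to the algebra as the norm limit of difference quotients of
  the Heisenberg action. In each degree \<open>p\<close>, the vector \<open>P \<Phi>\<close> is the limit of finite sums of products of
  smooth functions with Sobolev functions; by the Leibniz rule for the covariant derivatives, these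
  converge in \<open>L\<^sup>2\<close> together with their weak derivatives and traces. Hence \<open>P\<close> preserves the
  domain of the Dirac operator, and the commutator is \<open>i \<Sum>\<^sub>j \<delta>\<^sub>j P \<otimes> \<sigma>\<^sub>j\<close>; since the domain
  is dense, it has no other bounded extension. From \<open>Tr (\<sigma>\<^sub>i \<sigma>\<^sub>j) = 2 \<delta>\<^sub>i\<^sub>j\<close> one gets the symbol
  \<open>- 2 \<Sum>\<^sub>j (\<delta>\<^sub>j P)\<^sup>2\<close> of \<open>\<psi>\<^sub>2\<close>, which is unique because the elements of the algebra are continuous and
  quasi-periodic.
\<close>

section \<open>Bounded matrices on square summable sequences\<close>

text \<open>The sum over the degrees q of an element of the algebra is a Fourier series and need not
  converge in norm. What the norm does control is each row of the matrix over a point, in l2 and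
  uniformly in the point. Truncations to |q| \<le> n therefore converge in L2 in a fixed degree p,
  dominated by the bound of the row times the norm of the fibre of the vector. Square summability
  over p cannot come from the truncations. It is read off from the commutator relation, whose
  right-hand side contains only bounded operators applied to vectors of the Hilbert space. So the
  multiplier in \<open>hdelta\<close> for \<open>HX\<close>, which grows quadratically in p, needs
  no uniform estimate: for fixed p it is bounded on the square, and over all p a phase compensates
  it. The boundary values do need a uniform estimate: a trace inequality with constants independent
  of p bounds them by \<Phi> and its x-derivative. Vectors are functions and operators act on
  representatives, so most identities between operators hold only up to null sets.\<close>

definition l2_bound :: "(int \<Rightarrow> complex) \<Rightarrow> real \<Rightarrow> bool" where
  "l2_bound \<xi> c \<longleftrightarrow> (\<forall>F. finite F \<longrightarrow> L2_set (\<lambda>r. cmod (\<xi> r)) F \<le> c)"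

text \<open>Only finite blocks are tested, so the condition makes sense before any infinite sum is
  known to converge; \<open>matrix_bound_apply\<close> extends it to all square summable
  vectors.\<close>

definition matrix_bound :: "(int \<Rightarrow> int \<Rightarrow> complex) \<Rightarrow> real \<Rightarrow> bool" where
  "matrix_bound A C \<longleftrightarrow> 0 \<le> C \<and> (\<forall>F S \<xi>. finite F \<longrightarrow> finite S \<longrightarrow>
     L2_set (\<lambda>p. cmod (\<Sum>s\<in>S. A p s * \<xi> s)) F \<le> C * L2_set (\<lambda>s. cmod (\<xi> s)) S)"

lemma l2_bound_nonneg: "l2_bound \<xi> c \<Longrightarrow> 0 \<le> c"
  using L2_set_nonneg order_trans unfolding l2_bound_def by (metis finite.emptyI)

lemma L2_set_mono_set:
  assumes "finite T" "S \<subseteq> T" shows "L2_set f S \<le> L2_set f T"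
  unfolding L2_set_def using assms by (intro real_sqrt_le_mono sum_mono2) auto

lemma L2_set_reindex: "inj_on h S \<Longrightarrow> L2_set f (h ` S) = L2_set (\<lambda>x. f (h x)) S"
  unfolding L2_set_def by (simp add: sum.reindex)

lemma l2_bound_reindex:
  assumes "l2_bound \<xi> c" "inj h" shows "l2_bound (\<lambda>r. \<xi> (h r)) c"
  unfolding l2_bound_def
proof (intro allI impI)
  fix F :: "int set" assume F: "finite F"
  have "L2_set (\<lambda>r. cmod (\<xi> (h r))) F = L2_set (\<lambda>r. cmod (\<xi> r)) (h ` F)"
    using assms(2) by (subst L2_set_reindex) (auto intro: inj_on_subset)
  then show "L2_set (\<lambda>r. cmod (\<xi> (h r))) F \<le> c"
    using assms(1) F unfolding l2_bound_def by simp
qed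

text \<open>Cauchy-Schwarz on finite sets bounds the absolute partial sums by \<open>c * d\<close>
  independently of the set. The third part is kept because it later dominates truncated
  sums.\<close>

lemma l2_bound_summable:
  assumes "l2_bound a c" "l2_bound b d"
  shows "(\<lambda>s. norm (a s * b s)) summable_on UNIV" and "norm (\<Sum>\<^sub>\<infinity>s. a s * b s) \<le> c * d"
    and "finite F \<Longrightarrow> (\<Sum>s\<in>F. norm (a s * b s)) \<le> c * d"
proof -
  have fin: "(\<Sum>s\<in>F. norm (a s * b s)) \<le> c * d" if "finite F" for F
  proof -
    have "(\<Sum>s\<in>F. norm (a s * b s)) = (\<Sum>s\<in>F. \<bar>cmod (a s)\<bar> * \<bar>cmod (b s)\<bar>)"
      by (simp add: norm_mult)
    also have "\<dots> \<le> L2_set (\<lambda>s. cmod (a s)) F * L2_set (\<lambda>s. cmod (b s)) F"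
      by (rule L2_set_mult_ineq)
    also have "\<dots> \<le> c * d"
      using assms that l2_bound_nonneg[OF assms(1)] unfolding l2_bound_def by (intro mult_mono) auto
    finally show ?thesis .
  qed
  then show "finite F \<Longrightarrow> (\<Sum>s\<in>F. norm (a s * b s)) \<le> c * d" .
  show s: "(\<lambda>s. norm (a s * b s)) summable_on UNIV"
    using fin by (intro nonneg_bdd_above_summable_on bdd_aboveI[of _ "c * d"]) auto
  have "norm (\<Sum>\<^sub>\<infinity>s. a s * b s) \<le> (\<Sum>\<^sub>\<infinity>s. norm (a s * b s))"
    by (rule norm_infsum_bound[OF s])
  also have "\<dots> \<le> c * d"
    using fin s by (intro infsum_le_finite_sums) auto
  finally show "norm (\<Sum>\<^sub>\<infinity>s. a s * b s) \<le> c * d" .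
qed

lemma l2_bound_has_sum:
  assumes "l2_bound a c" "l2_bound b d"
  shows "((\<lambda>s. a s * b s) has_sum (\<Sum>\<^sub>\<infinity>s. a s * b s)) UNIV"
  using l2_bound_summable(1)[OF assms] by (simp add: abs_summable_summable)

lemma L2_set_singleton: "L2_set f {p} = \<bar>f p\<bar>"
  by (simp add: L2_set_def)

lemma L2_set_sq: "(L2_set f S)\<^sup>2 = (\<Sum>s\<in>S. (f s)\<^sup>2)"
  unfolding L2_set_def by (simp add: sum_nonneg)

lemma l2_bound_iff_sq: "l2_bound \<xi> c \<longleftrightarrow> 0 \<le> c \<and> (\<forall>F. finite F \<longrightarrow> (\<Sum>r\<in>F. (cmod (\<xi> r))\<^sup>2) \<le> c\<^sup>2)"
proof -
  have "L2_set (\<lambda>r. cmod (\<xi> r)) F \<le> c \<longleftrightarrow> (\<Sum>r\<in>F. (cmod (\<xi> r))\<^sup>2) \<le> c\<^sup>2" if "0 \<le> c" for F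
    using that abs_le_square_iff[of "L2_set (\<lambda>r. cmod (\<xi> r)) F" c] by (simp add: L2_set_sq)
  then show ?thesis using l2_bound_nonneg[of \<xi> c] unfolding l2_bound_def by auto
qed

text \<open>Smallness is claimed for every S beyond S0, not for S0 alone, which is the form needed
  for limits along finite sets.\<close>

lemma l2_bound_tail:
  assumes "l2_bound \<xi> c" "0 < \<epsilon>"
  obtains S0 where "finite S0" "\<And>S. S0 \<subseteq> S \<Longrightarrow> l2_bound (\<lambda>s. if s \<in> S then 0 else \<xi> s) \<epsilon>"
proof -
  let ?f = "\<lambda>s. (cmod (\<xi> s))\<^sup>2"
  have fin: "(\<Sum>r\<in>F. ?f r) \<le> c\<^sup>2" if "finite F" for F
    using assms(1) that by (simp add: l2_bound_iff_sq)
  have sm: "?f summable_on UNIV"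
    using fin by (intro nonneg_bdd_above_summable_on bdd_aboveI[of _ "c\<^sup>2"]) auto
  then obtain S0 where S0: "finite S0" "dist (sum ?f S0) (infsum ?f UNIV) \<le> \<epsilon>\<^sup>2"
    using infsum_finite_approximation[OF sm, of "\<epsilon>\<^sup>2"] assms(2) by auto
  have "l2_bound (\<lambda>s. if s \<in> S then 0 else \<xi> s) \<epsilon>" if "S0 \<subseteq> S" for S
    unfolding l2_bound_iff_sq
  proof (intro conjI allI impI)
    fix F :: "int set" assume F: "finite F"
    have "(\<Sum>r\<in>F. (cmod (if r \<in> S then 0 else \<xi> r))\<^sup>2) = (\<Sum>r\<in>F - S. ?f r)"
      using F by (intro sum.mono_neutral_cong_right) auto
    also have "\<dots> \<le> (\<Sum>r\<in>F - S0. ?f r)"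
      using F that by (intro sum_mono2) auto
    also have "\<dots> = (\<Sum>r\<in>(F - S0) \<union> S0. ?f r) - sum ?f S0"
      using F S0 by (subst sum.union_disjoint) auto
    also have "\<dots> \<le> infsum ?f UNIV - sum ?f S0"
      using F S0 by (intro diff_right_mono finite_sum_le_infsum sm) auto
    also have "\<dots> \<le> \<epsilon>\<^sup>2" using S0(2) by (simp add: dist_real_def)
    finally show "(\<Sum>r\<in>F. (cmod (if r \<in> S then 0 else \<xi> r))\<^sup>2) \<le> \<epsilon>\<^sup>2" .
  qed (use assms in auto)
  then show thesis using S0 that by blast
qed

lemma matrix_bound_nonneg: "matrix_bound A C \<Longrightarrow> 0 \<le> C"
  by (simp add: matrix_bound_def)

lemma matrix_boundD:
  "matrix_bound A C \<Longrightarrow> finite F \<Longrightarrow> finite S \<Longrightarrow>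
     L2_set (\<lambda>p. cmod (\<Sum>s\<in>S. A p s * \<xi> s)) F \<le> C * L2_set (\<lambda>s. cmod (\<xi> s)) S"
  by (simp add: matrix_bound_def)

lemma matrix_bound_col: 
  assumes "matrix_bound A C" shows "l2_bound (\<lambda>p. A p s) C"
  unfolding l2_bound_def using matrix_boundD[OF assms, of _ "{s}" "\<lambda>_. 1"] by simp

text \<open>Testing the bound on the conjugate of a row turns column sums into row sums.\<close>

lemma matrix_bound_row: 
  assumes "matrix_bound A C" shows "l2_bound (A p) C"
  unfolding l2_bound_def
proof (intro allI impI)
  fix S :: "int set" assume S: "finite S"
  let ?n = "L2_set (\<lambda>r. cmod (A p r)) S"
  have "(\<Sum>s\<in>S. A p s * cnj (A p s)) = of_real (?n\<^sup>2)"
    unfolding L2_set_sq of_real_sum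
    by (intro sum.cong refl) (simp add: complex_norm_square[symmetric])
  then have "cmod (\<Sum>s\<in>S. A p s * cnj (A p s)) = ?n\<^sup>2"
    by (simp only: norm_of_real) simp
  then have "?n\<^sup>2 = L2_set (\<lambda>p. cmod (\<Sum>s\<in>S. A p s * cnj (A p s))) {p}"
    by (simp only: L2_set_singleton abs_power2)
  also have "\<dots> \<le> C * ?n"
    using matrix_boundD[OF assms _ S, of "{p}" "\<lambda>s. cnj (A p s)"] by simp
  finally have "?n * ?n \<le> C * ?n" by (simp add: power2_eq_square)
  then show "?n \<le> C"
    using matrix_bound_nonneg[OF assms] L2_set_nonneg[of "\<lambda>r. cmod (A p r)" S]
    by (cases "?n = 0") (auto dest: mult_right_le_imp_le)
qed

lemma matrix_bound_entry: "matrix_bound A C \<Longrightarrow> cmod (A p s) \<le> C"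
  using matrix_bound_row[of A C p, unfolded l2_bound_def, rule_format, of "{s}"] by simp

lemma matrix_bound_has_sum:
  assumes "matrix_bound A C" "l2_bound \<xi> c"
  shows "((\<lambda>s. A p s * \<xi> s) has_sum (\<Sum>\<^sub>\<infinity>s. A p s * \<xi> s)) UNIV"
  using l2_bound_has_sum[OF matrix_bound_row[OF assms(1)] assms(2)] .

text \<open>On finitely many rows the norm is a continuous function of the row sums, so the bound
  for finite sets of columns survives the limit.\<close>

lemma matrix_bound_apply:
  assumes "matrix_bound A C" "l2_bound \<xi> c"
  shows "l2_bound (\<lambda>p. \<Sum>\<^sub>\<infinity>s. A p s * \<xi> s) (C * c)"
  unfolding l2_bound_def
proof (intro allI impI)
  fix F :: "int set" assume F: "finite F"
  have lim: "((\<lambda>S. \<Sum>s\<in>S. A p s * \<xi> s) \<longlongrightarrow> (\<Sum>\<^sub>\<infinity>s. A p s * \<xi> s)) (finite_subsets_at_top UNIV)" for p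
    using matrix_bound_has_sum[OF assms] unfolding has_sum_def .
  have "((\<lambda>S. L2_set (\<lambda>p. cmod (\<Sum>s\<in>S. A p s * \<xi> s)) F) \<longlongrightarrow>
      L2_set (\<lambda>p. cmod (\<Sum>\<^sub>\<infinity>s. A p s * \<xi> s)) F) (finite_subsets_at_top UNIV)"
    unfolding L2_set_def by (intro tendsto_intros lim)
  moreover have "\<forall>\<^sub>F S in finite_subsets_at_top UNIV. L2_set (\<lambda>p. cmod (\<Sum>s\<in>S. A p s * \<xi> s)) F \<le> C * c"
  proof (rule eventually_finite_subsets_at_top_weakI)
    fix S :: "int set" assume S: "finite S"
    have "L2_set (\<lambda>p. cmod (\<Sum>s\<in>S. A p s * \<xi> s)) F \<le> C * L2_set (\<lambda>s. cmod (\<xi> s)) S"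
      using matrix_boundD[OF assms(1) F S] .
    also have "\<dots> \<le> C * c"
      using assms S matrix_bound_nonneg unfolding l2_bound_def by (intro mult_left_mono) auto
    finally show "L2_set (\<lambda>p. cmod (\<Sum>s\<in>S. A p s * \<xi> s)) F \<le> C * c" .
  qed
  ultimately show "L2_set (\<lambda>p. cmod (\<Sum>\<^sub>\<infinity>s. A p s * \<xi> s)) F \<le> C * c"
    by (rule tendsto_upperbound) simp
qed

lemma l2_bound_finite:
  assumes "finite S" shows "l2_bound (\<lambda>s. if s \<in> S then \<xi> s else 0) (L2_set (\<lambda>s. cmod (\<xi> s)) S)"
  unfolding l2_bound_def
proof (intro allI impI)
  fix F :: "int set" assume F: "finite F"
  have "L2_set (\<lambda>r. cmod (if r \<in> S then \<xi> r else 0)) F = L2_set (\<lambda>s. cmod (\<xi> s)) (F \<inter> S)"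
    unfolding L2_set_def using F by (intro arg_cong[where f=sqrt] sum.mono_neutral_cong_right) auto
  also have "\<dots> \<le> L2_set (\<lambda>s. cmod (\<xi> s)) S"
    using assms by (intro L2_set_mono_set) auto
  finally show "L2_set (\<lambda>r. cmod (if r \<in> S then \<xi> r else 0)) F \<le> L2_set (\<lambda>s. cmod (\<xi> s)) S" .
qed

lemma matrix_bound_assoc_finite:
  assumes "matrix_bound A C" "matrix_bound B D" "finite S"
  shows "(\<Sum>s\<in>S. (\<Sum>\<^sub>\<infinity>r. A p r * B r s) * \<xi> s) = (\<Sum>\<^sub>\<infinity>r. A p r * (\<Sum>s\<in>S. B r s * \<xi> s))"
proof -
  have sm: "(\<lambda>r. A p r * B r s) summable_on UNIV" for s
    using l2_bound_summable(1)[OF matrix_bound_row[OF assms(1)] matrix_bound_col[OF assms(2)]]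
    by (rule abs_summable_summable)
  have "(\<Sum>s\<in>S. (\<Sum>\<^sub>\<infinity>r. A p r * B r s) * \<xi> s) = (\<Sum>s\<in>S. (\<Sum>\<^sub>\<infinity>r. A p r * B r s * \<xi> s))"
    by (simp add: infsum_cmult_left')
  also have "\<dots> = (\<Sum>\<^sub>\<infinity>r. \<Sum>s\<in>S. A p r * B r s * \<xi> s)"
    using assms(3)
  proof (induction S)
    case (insert t S)
    have "(\<lambda>r. \<Sum>s\<in>S. A p r * B r s * \<xi> s) summable_on UNIV"
      using insert(1) by (induction S) (auto intro!: summable_on_add summable_on_cmult_left sm)
    then show ?case
      using insert by (simp add: infsum_add summable_on_cmult_left sm)
  qed simp
  finally show ?thesis by (simp add: sum_distrib_left mult.assoc)
qed

text \<open>The double series need not converge absolutely, so sums cannot simply be exchanged. The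
  vector is split into a finite part, where \<open>matrix_bound_assoc_finite\<close> applies, and a
  tail of norm at most \<epsilon>, which contributes at most
  \<open>C * D * \<epsilon>\<close>.\<close>

lemma matrix_bound_assoc:
  assumes "matrix_bound A C" "matrix_bound B D" "l2_bound \<xi> c"
  shows "((\<lambda>s. (\<Sum>\<^sub>\<infinity>r. A p r * B r s) * \<xi> s) has_sum (\<Sum>\<^sub>\<infinity>r. A p r * (\<Sum>\<^sub>\<infinity>s. B r s * \<xi> s))) UNIV"
    (is "(_ has_sum ?R) _")
  unfolding has_sum_def tendsto_iff eventually_finite_subsets_at_top
proof (intro allI impI)
  fix e :: real assume e: "0 < e"
  \<comment> \<open>The summand 1 keeps the denominator positive when C or D is 0; the factor 2
    leaves e / 2, hence a strict inequality.\<close>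
  define \<epsilon> where "\<epsilon> = e / (2 * (C * D + 1))"
  have pos: "C * D + 1 > 0" using matrix_bound_nonneg[OF assms(1)] matrix_bound_nonneg[OF assms(2)]
    by (simp add: add_nonneg_pos)
  then have \<epsilon>: "0 < \<epsilon>" using e by (simp add: \<epsilon>_def)
  obtain S0 where S0: "finite S0" "\<And>S. S0 \<subseteq> S \<Longrightarrow> l2_bound (\<lambda>s. if s \<in> S then 0 else \<xi> s) \<epsilon>"
    using l2_bound_tail[OF assms(3) \<epsilon>] by blast
  show "\<exists>X. finite X \<and> X \<subseteq> UNIV \<and> (\<forall>Y. finite Y \<and> X \<subseteq> Y \<and> Y \<subseteq> UNIV \<longrightarrow>
      dist (\<Sum>s\<in>Y. (\<Sum>\<^sub>\<infinity>r. A p r * B r s) * \<xi> s) ?R < e)"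
  proof (intro exI[of _ S0] conjI allI impI; (elim conjE)?)
    fix S assume S: "finite S" "S0 \<subseteq> S"
    let ?\<eta> = "\<lambda>s. if s \<in> S then 0 else \<xi> s"
    let ?\<zeta> = "\<lambda>s. if s \<in> S then \<xi> s else 0"
    have B\<eta>: "l2_bound (\<lambda>r. \<Sum>\<^sub>\<infinity>s. B r s * ?\<eta> s) (D * \<epsilon>)"
      by (rule matrix_bound_apply[OF assms(2) S0(2)[OF S(2)]])
    have B\<zeta>: "l2_bound (\<lambda>r. \<Sum>\<^sub>\<infinity>s. B r s * ?\<zeta> s) (D * L2_set (\<lambda>s. cmod (\<xi> s)) S)"
      by (rule matrix_bound_apply[OF assms(2) l2_bound_finite[OF S(1)]])
    have \<zeta>: "(\<Sum>\<^sub>\<infinity>s. B r s * ?\<zeta> s) = (\<Sum>s\<in>S. B r s * \<xi> s)" for r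
    proof -
      have "(\<Sum>\<^sub>\<infinity>s. B r s * ?\<zeta> s) = (\<Sum>\<^sub>\<infinity>s\<in>S. B r s * \<xi> s)"
        by (rule infsum_cong_neutral) auto
      then show ?thesis using S by simp
    qed
    have split: "(\<Sum>\<^sub>\<infinity>s. B r s * \<xi> s) = (\<Sum>\<^sub>\<infinity>s. B r s * ?\<zeta> s) + (\<Sum>\<^sub>\<infinity>s. B r s * ?\<eta> s)" for r
    proof -
      have "(\<Sum>\<^sub>\<infinity>s. B r s * \<xi> s) = (\<Sum>\<^sub>\<infinity>s. B r s * ?\<zeta> s + B r s * ?\<eta> s)"
        by (intro infsum_cong) auto
      also have "\<dots> = (\<Sum>\<^sub>\<infinity>s. B r s * ?\<zeta> s) + (\<Sum>\<^sub>\<infinity>s. B r s * ?\<eta> s)"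
        using matrix_bound_has_sum[OF assms(2) l2_bound_finite[OF S(1)], of r] 
          matrix_bound_has_sum[OF assms(2) S0(2)[OF S(2)], of r]
        by (intro infsum_add) (auto simp: summable_on_def)
      finally show ?thesis .
    qed
    have "?R = (\<Sum>\<^sub>\<infinity>r. A p r * (\<Sum>\<^sub>\<infinity>s. B r s * ?\<zeta> s) + A p r * (\<Sum>\<^sub>\<infinity>s. B r s * ?\<eta> s))"
      unfolding split by (simp add: distrib_left)
    also have "\<dots> = (\<Sum>\<^sub>\<infinity>r. A p r * (\<Sum>\<^sub>\<infinity>s. B r s * ?\<zeta> s)) + (\<Sum>\<^sub>\<infinity>r. A p r * (\<Sum>\<^sub>\<infinity>s. B r s * ?\<eta> s))"
      using matrix_bound_has_sum[OF assms(1) B\<zeta>, of p] matrix_bound_has_sum[OF assms(1) B\<eta>, of p]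
      by (intro infsum_add) (auto simp: summable_on_def)
    also have "(\<Sum>\<^sub>\<infinity>r. A p r * (\<Sum>\<^sub>\<infinity>s. B r s * ?\<zeta> s)) = (\<Sum>s\<in>S. (\<Sum>\<^sub>\<infinity>r. A p r * B r s) * \<xi> s)"
      unfolding \<zeta> by (rule matrix_bound_assoc_finite[OF assms(1,2) S(1), symmetric])
    finally have "dist (\<Sum>s\<in>S. (\<Sum>\<^sub>\<infinity>r. A p r * B r s) * \<xi> s) ?R = cmod (\<Sum>\<^sub>\<infinity>r. A p r * (\<Sum>\<^sub>\<infinity>s. B r s * ?\<eta> s))"
      by (simp add: dist_norm)
    also have "\<dots> \<le> C * (D * \<epsilon>)"
      by (rule l2_bound_summable(2)[OF matrix_bound_row[OF assms(1)] B\<eta>])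
    also have "\<dots> < e"
    proof -
      have "C * D * \<epsilon> \<le> (C * D + 1) * \<epsilon>" using \<epsilon> by (intro mult_right_mono) auto
      also have "\<dots> = e / 2" using pos unfolding \<epsilon>_def by (simp only: times_divide_eq_right) (simp add: divide_simps)
      finally show ?thesis using e by (simp add: mult.assoc)
    qed
    finally show "dist (\<Sum>s\<in>S. (\<Sum>\<^sub>\<infinity>r. A p r * B r s) * \<xi> s) ?R < e" .
  qed (use S0 in auto)
qed

lemma matrix_bound_prod:
  assumes "matrix_bound A C" "matrix_bound B D"
  shows "matrix_bound (\<lambda>p s. \<Sum>\<^sub>\<infinity>r. A p r * B r s) (C * D)"
  unfolding matrix_bound_def
proof (intro conjI allI impI)
  fix F S :: "int set" and \<xi> assume F: "finite F" and S: "finite S"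
  have *: "l2_bound (\<lambda>r. \<Sum>s\<in>S. B r s * \<xi> s) (D * L2_set (\<lambda>s. cmod (\<xi> s)) S)"
    unfolding l2_bound_def using matrix_boundD[OF assms(2) _ S] by blast
  show "L2_set (\<lambda>p. cmod (\<Sum>s\<in>S. (\<Sum>\<^sub>\<infinity>r. A p r * B r s) * \<xi> s)) F \<le> C * D * L2_set (\<lambda>s. cmod (\<xi> s)) S"
    unfolding matrix_bound_assoc_finite[OF assms S] using matrix_bound_apply[OF assms(1) *] F 
    unfolding l2_bound_def by (simp add: mult.assoc)
qed (use assms matrix_bound_nonneg in auto)

section \<open>Operations on bounded matrices\<close>

lemma matrix_bound_add:
  assumes "matrix_bound A C" "matrix_bound B D"
  shows "matrix_bound (\<lambda>p s. A p s + B p s) (C + D)"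
  unfolding matrix_bound_def
proof (intro conjI allI impI)
  fix F S :: "int set" and \<xi> assume F: "finite F" and S: "finite S"
  have "L2_set (\<lambda>p. cmod (\<Sum>s\<in>S. (A p s + B p s) * \<xi> s)) F
      \<le> L2_set (\<lambda>p. cmod (\<Sum>s\<in>S. A p s * \<xi> s) + cmod (\<Sum>s\<in>S. B p s * \<xi> s)) F"
    by (intro L2_set_mono) (auto simp: distrib_right sum.distrib norm_triangle_ineq)
  also have "\<dots> \<le> L2_set (\<lambda>p. cmod (\<Sum>s\<in>S. A p s * \<xi> s)) F + L2_set (\<lambda>p. cmod (\<Sum>s\<in>S. B p s * \<xi> s)) F"
    by (rule L2_set_triangle_ineq)
  also have "\<dots> \<le> C * L2_set (\<lambda>s. cmod (\<xi> s)) S + D * L2_set (\<lambda>s. cmod (\<xi> s)) S"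
    by (intro add_mono matrix_boundD assms F S)
  finally show "L2_set (\<lambda>p. cmod (\<Sum>s\<in>S. (A p s + B p s) * \<xi> s)) F \<le> (C + D) * L2_set (\<lambda>s. cmod (\<xi> s)) S"
    by (simp add: distrib_right)
qed (use assms matrix_bound_nonneg in auto)

lemma matrix_bound_scale:
  assumes "matrix_bound A C" 
  shows "matrix_bound (\<lambda>p s. k * A p s) (cmod k * C)"
  unfolding matrix_bound_def
proof (intro conjI allI impI)
  fix F S :: "int set" and \<xi> assume F: "finite F" and S: "finite S"
  have "L2_set (\<lambda>p. cmod (\<Sum>s\<in>S. k * A p s * \<xi> s)) F = L2_set (\<lambda>p. cmod k * cmod (\<Sum>s\<in>S. A p s * \<xi> s)) F"
    by (simp add: mult.assoc norm_mult flip: sum_distrib_left)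
  also have "\<dots> = cmod k * L2_set (\<lambda>p. cmod (\<Sum>s\<in>S. A p s * \<xi> s)) F"
    by (simp add: L2_set_right_distrib)
  also have "\<dots> \<le> cmod k * (C * L2_set (\<lambda>s. cmod (\<xi> s)) S)"
    by (intro mult_left_mono matrix_boundD assms F S) auto
  finally show "L2_set (\<lambda>p. cmod (\<Sum>s\<in>S. k * A p s * \<xi> s)) F \<le> cmod k * C * L2_set (\<lambda>s. cmod (\<xi> s)) S"
    by (simp add: mult.assoc)
qed (use assms matrix_bound_nonneg in auto)

lemma matrix_bound_mono: "matrix_bound A C \<Longrightarrow> C \<le> D \<Longrightarrow> matrix_bound A D"
  unfolding matrix_bound_def using mult_right_mono[OF _ L2_set_nonneg] order_trans by meson

text \<open>Diagonal unitaries on both sides do not change the norm. The Heisenberg action takes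
  this form in \<open>qhm_bound_heis_act\<close>.\<close>

lemma matrix_bound_unimodular:
  assumes "matrix_bound A C" "\<And>p. cmod (u p) = 1" "\<And>p. cmod (v p) = 1"
  shows "matrix_bound (\<lambda>p s. u p * A p s * v s) C"
  unfolding matrix_bound_def
proof (intro conjI allI impI)
  fix F S :: "int set" and \<xi> assume F: "finite F" and S: "finite S"
  have "L2_set (\<lambda>p. cmod (\<Sum>s\<in>S. u p * A p s * v s * \<xi> s)) F = 
     L2_set (\<lambda>p. cmod (\<Sum>s\<in>S. A p s * (v s * \<xi> s))) F"
    by (simp add: mult.assoc norm_mult assms flip: sum_distrib_left)
  also have "\<dots> \<le> C * L2_set (\<lambda>s. cmod (v s * \<xi> s)) S"
    by (intro matrix_boundD assms F S)
  finally show "L2_set (\<lambda>p. cmod (\<Sum>s\<in>S. u p * A p s * v s * \<xi> s)) F \<le> C * L2_set (\<lambda>s. cmod (\<xi> s)) S"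
    by (simp add: norm_mult assms)
qed (use assms matrix_bound_nonneg in auto)

text \<open>A single shifted diagonal is the contribution of one degree q. An element of
  \<open>D0\<close> is a finite sum of these.\<close>

lemma matrix_bound_diagonal:
  assumes "0 \<le> B" "\<And>p. cmod (f p) \<le> B" 
  shows "matrix_bound (\<lambda>p s. if p - s = q then f p else 0) B"
  unfolding matrix_bound_def
proof (intro conjI allI impI)
  fix F S :: "int set" and \<xi> assume F: "finite F" and S: "finite S"
  have eq: "(\<Sum>s\<in>S. (if p - s = q then f p else 0) * \<xi> s) = (if p - q \<in> S then f p * \<xi> (p - q) else 0)" for p
  proof -
    have "(\<Sum>s\<in>S. (if p - s = q then f p else 0) * \<xi> s) = (\<Sum>s\<in>S. if s = p - q then f p * \<xi> s else 0)"
      by (intro sum.cong) auto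
    then show ?thesis using S by simp
  qed
  have "L2_set (\<lambda>p. cmod (\<Sum>s\<in>S. (if p - s = q then f p else 0) * \<xi> s)) F
      \<le> L2_set (\<lambda>p. B * cmod (if p - q \<in> S then \<xi> (p - q) else 0)) F"
    unfolding eq using assms by (intro L2_set_mono) (auto simp: norm_mult mult_right_mono)
  also have "\<dots> = B * L2_set (\<lambda>p. cmod (if p - q \<in> S then \<xi> (p - q) else 0)) F"
    using assms by (simp add: L2_set_right_distrib)
  also have "\<dots> \<le> B * L2_set (\<lambda>s. cmod (\<xi> s)) S"
    using l2_bound_reindex[OF l2_bound_finite[OF S], of "\<lambda>p. p - q" \<xi>] F assms(1)
    by (intro mult_left_mono) (auto simp: l2_bound_def inj_def)
  finally show "L2_set (\<lambda>p. cmod (\<Sum>s\<in>S. (if p - s = q then f p else 0) * \<xi> s)) F \<le> B * L2_set (\<lambda>s. cmod (\<xi> s)) S" .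
qed (use assms in auto)

section \<open>The algebra as bounded matrices\<close>

lemma ee_add: "ee (s + t) = ee s * ee t"
  unfolding ee_def by (simp add: exp_add[symmetric] algebra_simps)

lemma cmod_ee [simp]: "cmod (ee t) = 1"
  unfolding ee_def by simp

lemma ee_of_int [simp]: "ee (of_int n) = 1"
  unfolding ee_def
  using exp_integer_2pi[of "of_int n"] by (simp add: mult_ac)

lemma ee_0 [simp]: "ee 0 = 1"
  by (simp add: ee_def)

lemma cnj_ee: "cnj (ee t) = ee (- t)"
  unfolding ee_def by (simp add: exp_cnj)

lemma ee_uminus_mult [simp]: "ee (- t) * ee t = 1" "ee t * ee (- t) = 1"
  by (simp_all flip: ee_add)

lemma continuous_ee [continuous_intros]: "continuous_on S f \<Longrightarrow> continuous_on S (\<lambda>x. ee (f x))"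
  unfolding ee_def by (intro continuous_intros)

text \<open>Along \<open>int_decode\<close> the integral over the integers becomes a series, so
  bounding it amounts to bounding finite sums. Estimates over all degrees go through this
  form.\<close>

lemma nn_integral_count_space_int_le_iff:
  fixes f :: "int \<Rightarrow> ennreal"
  shows "(\<integral>\<^sup>+p. f p \<partial>count_space UNIV) \<le> K \<longleftrightarrow> (\<forall>F. finite F \<longrightarrow> sum f F \<le> K)"
proof
  assume *: "(\<integral>\<^sup>+p. f p \<partial>count_space UNIV) \<le> K"
  show "\<forall>F. finite F \<longrightarrow> sum f F \<le> K"
  proof (intro allI impI)
    fix F :: "int set" assume F: "finite F"
    have "sum f F = (\<integral>\<^sup>+p. f p \<partial>count_space F)"
      using F by (simp add: nn_integral_count_space_finite)
    also have "\<dots> = (\<integral>\<^sup>+p. f p * indicator F p \<partial>count_space UNIV)"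
      by (subst nn_integral_count_space_indicator) auto
    also have "\<dots> \<le> (\<integral>\<^sup>+p. f p \<partial>count_space UNIV)"
      by (intro nn_integral_mono) (auto simp: indicator_def)
    finally show "sum f F \<le> K" using * by simp
  qed
next
  assume *: "\<forall>F. finite F \<longrightarrow> sum f F \<le> K"
  have "(\<integral>\<^sup>+p. f p \<partial>count_space UNIV) = (\<integral>\<^sup>+n. f (int_decode n) \<partial>count_space UNIV)"
    using nn_integral_bij_count_space[OF bij_int_decode, of f] by simp
  also have "\<dots> = (\<Sum>n. f (int_decode n))"
    by (rule nn_integral_count_space_nat)
  also have "\<dots> \<le> K"
  proof (intro suminf_le_const)
    fix n
    have "(\<Sum>i<n. f (int_decode i)) = sum f (int_decode ` {..<n})"
      by (subst sum.reindex) (auto simp: inj_int_decode)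
    then show "(\<Sum>i<n. f (int_decode i)) \<le> K" using * by simp
  qed auto
  finally show "(\<integral>\<^sup>+p. f p \<partial>count_space UNIV) \<le> K" .
qed

lemma l2_int_le_iff:
  assumes "0 \<le> c" shows "l2_int \<xi> \<le> ennreal (c\<^sup>2) \<longleftrightarrow> l2_bound \<xi> c"
  unfolding l2_int_def nn_integral_count_space_int_le_iff l2_bound_iff_sq
  using assms by (simp add: sum_nonneg)

text \<open>With columns s = p - q the convolution in \<open>regular_rep\<close> becomes a matrix
  applied to a sequence, and \<open>qmult\<close> becomes the matrix product over one and the same
  base point.\<close>

definition qmat :: "real \<Rightarrow> real \<Rightarrow> qfun \<Rightarrow> real \<Rightarrow> real \<Rightarrow> int \<Rightarrow> int \<Rightarrow> complex" where
  "qmat \<mu> \<nu> \<Phi> x y p s = \<Phi> (x + 2 * of_int p * \<mu>) (y + 2 * of_int p * \<nu>) (p - s)"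

text \<open>A real substitute for \<open>qnorm\<close>, which is an infimum in the extended reals. A
  bound C gives \<open>qnorm\<close> at most C, and a strict inequality for \<open>qnorm\<close>
  gives back a bound below the same number; limits need no more.\<close>

definition qhm_bound :: "real \<Rightarrow> real \<Rightarrow> qfun \<Rightarrow> real \<Rightarrow> bool" where
  "qhm_bound \<mu> \<nu> \<Phi> C \<longleftrightarrow> (\<forall>x y. matrix_bound (qmat \<mu> \<nu> \<Phi> x y) C)"

lemma regular_rep_eq: "regular_rep \<mu> \<nu> \<Phi> x y \<xi> p = (\<Sum>\<^sub>\<infinity>s. qmat \<mu> \<nu> \<Phi> x y p s * \<xi> s)"
  unfolding regular_rep_def qmat_def
  by (rule infsum_reindex_bij_witness[where i = "\<lambda>s. p - s" and j = "\<lambda>q. p - q"]) auto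

lemma qhm_bound_nonneg: "qhm_bound \<mu> \<nu> \<Phi> C \<Longrightarrow> 0 \<le> C"
  unfolding qhm_bound_def using matrix_bound_nonneg by blast

lemma infsum_restrict:
  fixes f g :: "int \<Rightarrow> complex"
  assumes "finite S" shows "(\<Sum>\<^sub>\<infinity>s. f s * (if s \<in> S then g s else 0)) = (\<Sum>s\<in>S. f s * g s)"
proof -
  have "(\<Sum>\<^sub>\<infinity>s. f s * (if s \<in> S then g s else 0)) = (\<Sum>\<^sub>\<infinity>s\<in>S. f s * g s)"
    by (rule infsum_cong_neutral) auto
  then show ?thesis using assms by simp
qed

lemma qnorm_less:
  assumes "qnorm \<mu> \<nu> \<Phi> < e"
  obtains C where "qhm_bound \<mu> \<nu> \<Phi> C" "ennreal C < e"
proof -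
  obtain K where K: "K < e" and b: "\<And>x y \<xi>. finite {r. \<xi> r \<noteq> 0} \<Longrightarrow>
     l2_int (regular_rep \<mu> \<nu> \<Phi> x y \<xi>) \<le> K\<^sup>2 * l2_int \<xi>"
    using assms unfolding qnorm_def Inf_less_iff by auto
  have "K < \<infinity>" using K by (simp add: less_top order_less_le_trans[OF _ top_greatest])
  then obtain C where C: "K = ennreal C" "0 \<le> C" by (cases K) auto
  have "matrix_bound (qmat \<mu> \<nu> \<Phi> x y) C" for x y
    unfolding matrix_bound_def
  proof (intro conjI allI impI C)
    fix F S :: "int set" and \<xi> :: "int \<Rightarrow> complex" assume F: "finite F" and S: "finite S"
    let ?\<xi> = "\<lambda>s. if s \<in> S then \<xi> s else 0"
    let ?L = "L2_set (\<lambda>s. cmod (\<xi> s)) S"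
    have "l2_int (regular_rep \<mu> \<nu> \<Phi> x y ?\<xi>) \<le> K\<^sup>2 * l2_int ?\<xi>"
      using S by (intro b finite_subset[OF _ S]) auto
    also have "\<dots> \<le> K\<^sup>2 * ennreal (?L\<^sup>2)"
      using l2_bound_finite[OF S, of \<xi>] by (intro mult_left_mono) (auto simp: l2_int_le_iff)
    also have "\<dots> = ennreal ((C * ?L)\<^sup>2)"
      using C by (simp add: power_mult_distrib ennreal_mult ennreal_power)
    finally have "l2_bound (regular_rep \<mu> \<nu> \<Phi> x y ?\<xi>) (C * ?L)"
      using C by (subst (asm) l2_int_le_iff) auto
    then show "L2_set (\<lambda>p. cmod (\<Sum>s\<in>S. qmat \<mu> \<nu> \<Phi> x y p s * \<xi> s)) F \<le> C * ?L"
      using F unfolding regular_rep_eq infsum_restrict[OF S] l2_bound_def by simp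
  qed
  then show thesis using that K C by (auto simp: qhm_bound_def)
qed

lemma qnorm_le:
  assumes "qhm_bound \<mu> \<nu> \<Phi> C" shows "qnorm \<mu> \<nu> \<Phi> \<le> ennreal C"
  unfolding qnorm_def
proof (intro Inf_lower CollectI allI impI)
  fix x y and \<xi> :: "int \<Rightarrow> complex" assume fin: "finite {r. \<xi> r \<noteq> 0}"
  let ?S = "{r. \<xi> r \<noteq> 0}"
  let ?L = "L2_set (\<lambda>s. cmod (\<xi> s)) ?S"
  have C: "0 \<le> C" using assms by (rule qhm_bound_nonneg)
  have \<xi>: "\<xi> = (\<lambda>s. if s \<in> ?S then \<xi> s else 0)" by auto
  have "l2_bound \<xi> ?L" using l2_bound_finite[OF fin, of \<xi>] by (simp only: \<xi>[symmetric])
  then have "l2_bound (regular_rep \<mu> \<nu> \<Phi> x y \<xi>) (C * ?L)"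
    unfolding regular_rep_eq using assms by (intro matrix_bound_apply) (auto simp: qhm_bound_def)
  then have "l2_int (regular_rep \<mu> \<nu> \<Phi> x y \<xi>) \<le> ennreal ((C * ?L)\<^sup>2)"
    using C by (subst l2_int_le_iff) auto
  also have "\<dots> = (ennreal C)\<^sup>2 * ennreal (?L\<^sup>2)"
    using C by (simp add: power_mult_distrib ennreal_mult ennreal_power)
  also have "ennreal (?L\<^sup>2) \<le> l2_int \<xi>"
    unfolding L2_set_sq l2_int_def
    using nn_integral_count_space_int_le_iff[THEN iffD1, OF order_refl, rule_format, OF fin, 
        of "\<lambda>p. ennreal ((cmod (\<xi> p))\<^sup>2)"] by (simp add: sum_ennreal)
  finally show "l2_int (regular_rep \<mu> \<nu> \<Phi> x y \<xi>) \<le> (ennreal C)\<^sup>2 * l2_int \<xi>"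
    by (simp add: mult_left_mono)
qed

text \<open>The coefficient of degree q at a point is the matrix entry in row 0 and column -q over
  that point. Hence convergence in norm implies uniform convergence of each coefficient
  function.\<close>

lemma qhm_bound_entry: "qhm_bound \<mu> \<nu> \<Phi> C \<Longrightarrow> cmod (\<Phi> x y q) \<le> C"
  using matrix_bound_entry[of "qmat \<mu> \<nu> \<Phi> x y" C 0 "- q"] unfolding qhm_bound_def qmat_def by simp

lemma qhm_bound_add: "qhm_bound \<mu> \<nu> \<Phi> C \<Longrightarrow> qhm_bound \<mu> \<nu> \<Psi> D \<Longrightarrow> qhm_bound \<mu> \<nu> (\<lambda>x y p. \<Phi> x y p + \<Psi> x y p) (C + D)"
  unfolding qhm_bound_def using matrix_bound_add unfolding qmat_def by blast

lemma qhm_bound_0: 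
  assumes "0 \<le> e" shows "qhm_bound \<mu> \<nu> (\<lambda>x y p. 0) e"
proof -
  have "qmat \<mu> \<nu> (\<lambda>x y p. 0) x y = (\<lambda>p s. 0)" for x y by (intro ext) (simp add: qmat_def)
  moreover have "matrix_bound (\<lambda>p s. 0) e" using assms unfolding matrix_bound_def by (simp add: L2_set_def sum_nonneg)
  ultimately show ?thesis by (simp add: qhm_bound_def)
qed

lemma qhm_bound_scale: "qhm_bound \<mu> \<nu> \<Phi> C \<Longrightarrow> qhm_bound \<mu> \<nu> (\<lambda>x y p. k * \<Phi> x y p) (cmod k * C)"
  unfolding qhm_bound_def using matrix_bound_scale unfolding qmat_def by blast

lemma qhm_bound_diff: 
  assumes "qhm_bound \<mu> \<nu> \<Phi> C" "qhm_bound \<mu> \<nu> \<Psi> D" shows "qhm_bound \<mu> \<nu> (\<lambda>x y p. \<Phi> x y p - \<Psi> x y p) (C + D)"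
  using qhm_bound_add[OF assms(1) qhm_bound_scale[OF assms(2), of "-1"]] by simp

lemma qhm_bound_mono: "qhm_bound \<mu> \<nu> \<Phi> C \<Longrightarrow> C \<le> D \<Longrightarrow> qhm_bound \<mu> \<nu> \<Phi> D"
  unfolding qhm_bound_def using matrix_bound_mono by blast

text \<open>The first two statements concern row 0, the last one column -p with the row index
  negated. Row and column are exactly the two factors in the series of \<open>qmult\<close>, which
  therefore converges absolutely.\<close>

lemma qhm_bound_l2_bound:
  assumes "qhm_bound \<mu> \<nu> \<Phi> C"
  shows qhm_bound_row: "l2_bound (\<lambda>q. \<Phi> x y q) C"
    and qhm_bound_row': "l2_bound (\<lambda>q. \<Phi> x y (p - q)) C"
    and qhm_bound_col: "l2_bound (\<lambda>q. \<Phi> (x - 2 * of_int q * \<mu>) (y - 2 * of_int q * \<nu>) (p - q)) C"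
proof -
  have "l2_bound (qmat \<mu> \<nu> \<Phi> x y 0) C" using assms by (intro matrix_bound_row) (auto simp: qhm_bound_def)
  from l2_bound_reindex[OF this, of uminus] show *: "l2_bound (\<lambda>q. \<Phi> x y q) C" 
    by (simp add: qmat_def)
  show "l2_bound (\<lambda>q. \<Phi> x y (p - q)) C"
    using l2_bound_reindex[OF *, of "\<lambda>q. p - q"] by (simp add: inj_def)
  have "l2_bound (\<lambda>r. qmat \<mu> \<nu> \<Phi> x y r (- p)) C" using assms by (intro matrix_bound_col) (auto simp: qhm_bound_def)
  from l2_bound_reindex[OF this, of uminus]
  show "l2_bound (\<lambda>q. \<Phi> (x - 2 * of_int q * \<mu>) (y - 2 * of_int q * \<nu>) (p - q)) C"
    by (simp add: qmat_def)
qed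

lemma qmult_has_sum:
  assumes "qhm_bound \<mu> \<nu> \<Phi> C" "qhm_bound \<mu> \<nu> \<Psi> D"
  shows "((\<lambda>q. \<Phi> x y q * \<Psi> (x - 2 * of_int q * \<mu>) (y - 2 * of_int q * \<nu>) (p - q))
    has_sum qmult \<mu> \<nu> \<Phi> \<Psi> x y p) UNIV"
  unfolding qmult_def by (rule l2_bound_has_sum[OF qhm_bound_row[OF assms(1)] qhm_bound_col[OF assms(2)]])

lemma qmat_qmult: 
  "qmat \<mu> \<nu> (qmult \<mu> \<nu> \<Phi> \<Psi>) x y p s = (\<Sum>\<^sub>\<infinity>r. qmat \<mu> \<nu> \<Phi> x y p r * qmat \<mu> \<nu> \<Psi> x y r s)"
  unfolding qmat_def qmult_def
  by (rule infsum_reindex_bij_witness[where i = "\<lambda>s. p - s" and j = "\<lambda>q. p - q"]) 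
     (auto simp: algebra_simps)

lemma qhm_bound_qmult: 
  assumes "qhm_bound \<mu> \<nu> \<Phi> C" "qhm_bound \<mu> \<nu> \<Psi> D" shows "qhm_bound \<mu> \<nu> (qmult \<mu> \<nu> \<Phi> \<Psi>) (C * D)"
proof -
  have "qmat \<mu> \<nu> (qmult \<mu> \<nu> \<Phi> \<Psi>) x y = (\<lambda>p s. \<Sum>\<^sub>\<infinity>r. qmat \<mu> \<nu> \<Phi> x y p r * qmat \<mu> \<nu> \<Psi> x y r s)" for x y
    by (intro ext) (rule qmat_qmult)
  then show ?thesis using assms unfolding qhm_bound_def by (auto intro: matrix_bound_prod)
qed

section \<open>The dense subalgebra and its norm closure\<close>

lemma D0D:
  assumes "\<Phi> \<in> D0 c \<mu> \<nu>"
  shows "continuous_on UNIV (\<lambda>z. \<Phi> (fst z) (snd z) p)" "\<Phi> x (y + 1) p = \<Phi> x y p"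
    "finite {p. \<exists>x y. \<Phi> x y p \<noteq> 0}"
    "cnj (ee (of_int (c * k * p) * (y - of_int p * \<nu>))) * \<Phi> (x + of_int k) y p = \<Phi> x y p"
  using assms unfolding D0_def by blast+

lemma D0I:
  assumes "\<And>p. continuous_on UNIV (\<lambda>z. \<Phi> (fst z) (snd z) p)" "\<And>x y p. \<Phi> x (y + 1) p = \<Phi> x y p"
    "\<exists>B. \<forall>x y p. cmod (\<Phi> x y p) \<le> B" "finite {p. \<exists>x y. \<Phi> x y p \<noteq> 0}"
    "\<And>k x y p. cnj (ee (of_int (c * k * p) * (y - of_int p * \<nu>))) * \<Phi> (x + of_int k) y p = \<Phi> x y p"
  shows "\<Phi> \<in> D0 c \<mu> \<nu>"
  using assms unfolding D0_def by blast

text \<open>Induction over the finitely many degrees: each one is a shifted diagonal bounded by the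
  supremum B, and the bounds add up.\<close>

lemma D0_bounded:
  assumes "\<Phi> \<in> D0 c \<mu> \<nu>" obtains C where "qhm_bound \<mu> \<nu> \<Phi> C"
proof -
  define S where "S = {p. \<exists>x y. \<Phi> x y p \<noteq> 0}"
  have S: "finite S" using assms by (simp add: D0_def S_def)
  obtain B where B: "\<And>x y p. cmod (\<Phi> x y p) \<le> B" using assms by (auto simp: D0_def)
  have B0: "0 \<le> B" using B[of 0 0 0] norm_ge_zero order_trans by blast
  have "\<exists>C. qhm_bound \<mu> \<nu> (\<lambda>x y p. if p \<in> T then \<Phi> x y p else 0) C" if "finite T" for T
    using that
  proof induction
    case empty
    show ?case using qhm_bound_0[of 0] by auto
  next
    case (insert q T)
    then obtain C where C: "qhm_bound \<mu> \<nu> (\<lambda>x y p. if p \<in> T then \<Phi> x y p else 0) C" by blast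
    have "qhm_bound \<mu> \<nu> (\<lambda>x y p. if p = q then \<Phi> x y p else 0) B"
      unfolding qhm_bound_def qmat_def
    proof (intro allI)
      fix x y
      have "matrix_bound (\<lambda>p s. if p - s = q then \<Phi> (x + 2 * of_int p * \<mu>) (y + 2 * of_int p * \<nu>) q else 0) B"
        by (rule matrix_bound_diagonal[OF B0 B])
      then show "matrix_bound (\<lambda>p s. if p - s = q then \<Phi> (x + 2 * of_int p * \<mu>) (y + 2 * of_int p * \<nu>) (p - s) else 0) B"
        by (rule back_subst[where P = "\<lambda>M. matrix_bound M B"]) (intro ext, auto)
    qed
    from qhm_bound_add[OF this C]
    have "qhm_bound \<mu> \<nu> (\<lambda>x y p. if p \<in> insert q T then \<Phi> x y p else 0) (B + C)"
      using insert(2) by (elim back_subst[where P = "\<lambda>M. qhm_bound \<mu> \<nu> M (B + C)"]) (intro ext, auto)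
    then show ?case by blast
  qed
  from this[OF S] obtain C where "qhm_bound \<mu> \<nu> (\<lambda>x y p. if p \<in> S then \<Phi> x y p else 0) C" by blast
  moreover have "(\<lambda>x y p. if p \<in> S then \<Phi> x y p else 0) = \<Phi>" by (intro ext) (auto simp: S_def)
  ultimately show thesis using that by simp
qed

lemma qhm_bound_bounded: "qhm_bound \<mu> \<nu> \<Phi> C \<Longrightarrow> \<exists>B. \<forall>x y p. cmod (\<Phi> x y p) \<le> B"
  by (intro exI allI) (rule qhm_bound_entry)

lemma qhm_iff: "\<Phi> \<in> qhm c \<mu> \<nu> \<longleftrightarrow> (\<forall>e>0. \<exists>\<Psi>\<in>D0 c \<mu> \<nu>. qhm_bound \<mu> \<nu> (\<lambda>x y p. \<Phi> x y p - \<Psi> x y p) e)"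
proof
  assume L: "\<Phi> \<in> qhm c \<mu> \<nu>"
  show "\<forall>e>0. \<exists>\<Psi>\<in>D0 c \<mu> \<nu>. qhm_bound \<mu> \<nu> (\<lambda>x y p. \<Phi> x y p - \<Psi> x y p) e"
  proof (intro allI impI)
    fix e :: real assume "0 < e"
    then have "0 < ennreal e" by simp
    then obtain \<Psi> where "\<Psi> \<in> D0 c \<mu> \<nu>" "qnorm \<mu> \<nu> (\<lambda>x y p. \<Phi> x y p - \<Psi> x y p) < ennreal e"
      using L unfolding qhm_def by blast
    moreover obtain C where C: "qhm_bound \<mu> \<nu> (\<lambda>x y p. \<Phi> x y p - \<Psi> x y p) C" "ennreal C < ennreal e"
      using qnorm_less[OF calculation(2)] .
    moreover have "C \<le> e" using C qhm_bound_nonneg[OF C(1)] by (simp add: ennreal_less_iff)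
    from qhm_bound_mono[OF C(1) this] have "qhm_bound \<mu> \<nu> (\<lambda>x y p. \<Phi> x y p - \<Psi> x y p) e" .
    ultimately show "\<exists>\<Psi>\<in>D0 c \<mu> \<nu>. qhm_bound \<mu> \<nu> (\<lambda>x y p. \<Phi> x y p - \<Psi> x y p) e" by blast
  qed
next
  assume R: "\<forall>e>0. \<exists>\<Psi>\<in>D0 c \<mu> \<nu>. qhm_bound \<mu> \<nu> (\<lambda>x y p. \<Phi> x y p - \<Psi> x y p) e"
  show "\<Phi> \<in> qhm c \<mu> \<nu>"
    unfolding qhm_def
  proof (intro CollectI allI impI)
    fix \<epsilon> :: ennreal assume "0 < \<epsilon>"
    obtain e :: real where "0 < e" "ennreal e < \<epsilon>"
    proof (cases \<epsilon>)
      case (real r)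
      with \<open>0 < \<epsilon>\<close> have "0 < r / 2" "ennreal (r / 2) < \<epsilon>" by (auto simp: ennreal_less_iff)
      then show thesis using that by blast
    qed (use that[of 1] in auto)
    with R obtain \<Psi> where "\<Psi> \<in> D0 c \<mu> \<nu>" "qhm_bound \<mu> \<nu> (\<lambda>x y p. \<Phi> x y p - \<Psi> x y p) e" by blast
    then show "\<exists>\<Psi>\<in>D0 c \<mu> \<nu>. qnorm \<mu> \<nu> (\<lambda>x y p. \<Phi> x y p - \<Psi> x y p) < \<epsilon>"
      using qnorm_le \<open>ennreal e < \<epsilon>\<close> order_le_less_trans by blast
  qed
qed

lemma D0_qhm: 
  assumes "\<Phi> \<in> D0 c \<mu> \<nu>" shows "\<Phi> \<in> qhm c \<mu> \<nu>"
  unfolding qhm_iff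
proof (intro allI impI bexI[OF _ assms])
  fix e :: real assume e: "0 < e"
  then show "qhm_bound \<mu> \<nu> (\<lambda>x y p. \<Phi> x y p - \<Phi> x y p) e" using qhm_bound_0[of e] by simp
qed

lemma qhm_bounded:
  assumes "\<Phi> \<in> qhm c \<mu> \<nu>" obtains C where "qhm_bound \<mu> \<nu> \<Phi> C"
proof -
  obtain \<Psi> where \<Psi>: "\<Psi> \<in> D0 c \<mu> \<nu>" "qhm_bound \<mu> \<nu> (\<lambda>x y p. \<Phi> x y p - \<Psi> x y p) 1"
    using assms[unfolded qhm_iff, rule_format, OF zero_less_one] by blast
  obtain C where "qhm_bound \<mu> \<nu> \<Psi> C" using D0_bounded[OF \<Psi>(1)] .
  from qhm_bound_add[OF \<Psi>(2) this] show thesis using that by simp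
qed

lemma qhm_closed:
  assumes "\<And>e. e > 0 \<Longrightarrow> \<exists>\<Psi>\<in>qhm c \<mu> \<nu>. qhm_bound \<mu> \<nu> (\<lambda>x y p. \<Phi> x y p - \<Psi> x y p) e"
  shows "\<Phi> \<in> qhm c \<mu> \<nu>"
  unfolding qhm_iff
proof (intro allI impI)
  fix e :: real assume "0 < e"
  then obtain \<Psi> where \<Psi>: "\<Psi> \<in> qhm c \<mu> \<nu>" "qhm_bound \<mu> \<nu> (\<lambda>x y p. \<Phi> x y p - \<Psi> x y p) (e/2)"
    using assms half_gt_zero by blast
  then obtain \<Theta> where \<Theta>: "\<Theta> \<in> D0 c \<mu> \<nu>" "qhm_bound \<mu> \<nu> (\<lambda>x y p. \<Psi> x y p - \<Theta> x y p) (e/2)"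
    unfolding qhm_iff using half_gt_zero[OF \<open>0 < e\<close>] by blast
  have "qhm_bound \<mu> \<nu> (\<lambda>x y p. \<Phi> x y p - \<Theta> x y p) e"
    using qhm_bound_add[OF \<Psi>(2) \<Theta>(2)] by simp
  then show "\<exists>\<Psi>\<in>D0 c \<mu> \<nu>. qhm_bound \<mu> \<nu> (\<lambda>x y p. \<Phi> x y p - \<Psi> x y p) e" using \<Theta> by blast
qed

lemma D0_add: 
  assumes "\<Phi> \<in> D0 c \<mu> \<nu>" "\<Psi> \<in> D0 c \<mu> \<nu>" shows "(\<lambda>x y p. \<Phi> x y p + \<Psi> x y p) \<in> D0 c \<mu> \<nu>"
proof (rule D0I)
  obtain C D where "qhm_bound \<mu> \<nu> \<Phi> C" "qhm_bound \<mu> \<nu> \<Psi> D"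
    by (rule D0_bounded[OF assms(1)], rule D0_bounded[OF assms(2)])
  from qhm_bound_bounded[OF qhm_bound_add[OF this]] show "\<exists>B. \<forall>x y p. cmod (\<Phi> x y p + \<Psi> x y p) \<le> B" .
  have "{p. \<exists>x y. \<Phi> x y p + \<Psi> x y p \<noteq> 0} \<subseteq> {p. \<exists>x y. \<Phi> x y p \<noteq> 0} \<union> {p. \<exists>x y. \<Psi> x y p \<noteq> 0}"
    by auto (metis add.left_neutral)
  then show "finite {p. \<exists>x y. \<Phi> x y p + \<Psi> x y p \<noteq> 0}"
    by (rule finite_subset) (simp add: D0D(3)[OF assms(1)] D0D(3)[OF assms(2)])
qed (simp_all only: distrib_left D0D[OF assms(1)] D0D[OF assms(2)] continuous_on_add)

lemma D0_scale: 
  assumes "\<Phi> \<in> D0 c \<mu> \<nu>" shows "(\<lambda>x y p. k * \<Phi> x y p) \<in> D0 c \<mu> \<nu>"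
proof (rule D0I)
  obtain C where "qhm_bound \<mu> \<nu> \<Phi> C" by (rule D0_bounded[OF assms(1)])
  from qhm_bound_bounded[OF qhm_bound_scale[OF this]] show "\<exists>B. \<forall>x y p. cmod (k * \<Phi> x y p) \<le> B" .
  show "finite {p. \<exists>x y. k * \<Phi> x y p \<noteq> 0}"
    by (rule finite_subset[OF _ D0D(3)[OF assms]]) auto
qed (simp_all only: mult.left_commute[of _ k] D0D[OF assms(1)] continuous_on_mult_left)

lemma qhm_add: 
  assumes "\<Phi> \<in> qhm c \<mu> \<nu>" "\<Psi> \<in> qhm c \<mu> \<nu>" shows "(\<lambda>x y p. \<Phi> x y p + \<Psi> x y p) \<in> qhm c \<mu> \<nu>"
  unfolding qhm_iff
proof (intro allI impI)
  fix e :: real assume "0 < e"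
  then have e: "0 < e / 2" by simp
  obtain \<Phi>' where \<Phi>': "\<Phi>' \<in> D0 c \<mu> \<nu>" "qhm_bound \<mu> \<nu> (\<lambda>x y p. \<Phi> x y p - \<Phi>' x y p) (e/2)"
    using assms(1) e unfolding qhm_iff by blast
  obtain \<Psi>' where \<Psi>': "\<Psi>' \<in> D0 c \<mu> \<nu>" "qhm_bound \<mu> \<nu> (\<lambda>x y p. \<Psi> x y p - \<Psi>' x y p) (e/2)"
    using assms(2) e unfolding qhm_iff by blast
  have "qhm_bound \<mu> \<nu> (\<lambda>x y p. \<Phi> x y p + \<Psi> x y p - (\<Phi>' x y p + \<Psi>' x y p)) e"
    using qhm_bound_add[OF \<Phi>'(2) \<Psi>'(2)] by (simp add: algebra_simps)
  then show "\<exists>\<Theta>\<in>D0 c \<mu> \<nu>. qhm_bound \<mu> \<nu> (\<lambda>x y p. \<Phi> x y p + \<Psi> x y p - \<Theta> x y p) e"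
    by (intro bexI[OF _ D0_add[OF \<Phi>'(1) \<Psi>'(1)]])
qed

lemma qhm_scale: 
  assumes "\<Phi> \<in> qhm c \<mu> \<nu>" shows "(\<lambda>x y p. k * \<Phi> x y p) \<in> qhm c \<mu> \<nu>"
  unfolding qhm_iff
proof (intro allI impI)
  fix e :: real assume "0 < e"
  then have e: "0 < e / (cmod k + 1)" by (simp add: add_nonneg_pos)
  obtain \<Phi>' where \<Phi>': "\<Phi>' \<in> D0 c \<mu> \<nu>" "qhm_bound \<mu> \<nu> (\<lambda>x y p. \<Phi> x y p - \<Phi>' x y p) (e / (cmod k + 1))"
    using assms(1) e unfolding qhm_iff by blast
  have "cmod k * (e / (cmod k + 1)) \<le> (cmod k + 1) * (e / (cmod k + 1))"
    using e by (intro mult_right_mono) auto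
  also have "\<dots> = e" by (simp add: add_nonneg_eq_0_iff)
  finally have "qhm_bound \<mu> \<nu> (\<lambda>x y p. k * \<Phi> x y p - k * \<Phi>' x y p) e"
    using qhm_bound_mono[OF qhm_bound_scale[OF \<Phi>'(2), of k]] by (simp add: right_diff_distrib)
  then show "\<exists>\<Theta>\<in>D0 c \<mu> \<nu>. qhm_bound \<mu> \<nu> (\<lambda>x y p. k * \<Phi> x y p - \<Theta> x y p) e"
    by (intro bexI[OF _ D0_scale[OF \<Phi>'(1)]])
qed

lemma D0_qmult: 
  assumes "\<Phi> \<in> D0 c \<mu> \<nu>" "\<Psi> \<in> D0 c \<mu> \<nu>" shows "qmult \<mu> \<nu> \<Phi> \<Psi> \<in> D0 c \<mu> \<nu>"
proof (rule D0I)
  obtain C D where "qhm_bound \<mu> \<nu> \<Phi> C" "qhm_bound \<mu> \<nu> \<Psi> D"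
    by (rule D0_bounded[OF assms(1)], rule D0_bounded[OF assms(2)])
  from qhm_bound_bounded[OF qhm_bound_qmult[OF this]]
  show "\<exists>B. \<forall>x y p. cmod (qmult \<mu> \<nu> \<Phi> \<Psi> x y p) \<le> B" .
  let ?S = "{p. \<exists>x y. \<Phi> x y p \<noteq> 0}" and ?T = "{p. \<exists>x y. \<Psi> x y p \<noteq> 0}"
  note S = D0D(3)[OF assms(1)] and T = D0D(3)[OF assms(2)]
  have eq: "qmult \<mu> \<nu> \<Phi> \<Psi> x y p =
      (\<Sum>q\<in>?S. \<Phi> x y q * \<Psi> (x - 2 * of_int q * \<mu>) (y - 2 * of_int q * \<nu>) (p - q))" for x y p
  proof -
    have "qmult \<mu> \<nu> \<Phi> \<Psi> x y p =
       (\<Sum>\<^sub>\<infinity>q\<in>?S. \<Phi> x y q * \<Psi> (x - 2 * of_int q * \<mu>) (y - 2 * of_int q * \<nu>) (p - q))"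
      unfolding qmult_def by (rule infsum_cong_neutral) auto
    then show ?thesis using S by simp
  qed
  have "continuous_on UNIV (\<lambda>z. \<Psi> (fst z - a) (snd z - b) p)" for a b p
  proof -
    note D0D(1)[OF assms(2), of p]
    from this have "continuous_on UNIV (\<lambda>z. (\<lambda>z. \<Psi> (fst z) (snd z) p) (fst z - a, snd z - b))"
      by (rule continuous_on_compose2) (auto intro!: continuous_intros)
    then show ?thesis by simp
  qed
  then show "continuous_on UNIV (\<lambda>z. qmult \<mu> \<nu> \<Phi> \<Psi> (fst z) (snd z) p)" for p
    unfolding eq by (intro continuous_intros D0D(1)[OF assms(1)])
  have "{p. \<exists>x y. qmult \<mu> \<nu> \<Phi> \<Psi> x y p \<noteq> 0} \<subseteq> (\<lambda>(a, b). a + b) ` (?S \<times> ?T)"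
  proof
    fix p assume "p \<in> {p. \<exists>x y. qmult \<mu> \<nu> \<Phi> \<Psi> x y p \<noteq> 0}"
    then obtain x y where "qmult \<mu> \<nu> \<Phi> \<Psi> x y p \<noteq> 0" by blast
    then obtain q where q: "q \<in> ?S" 
      and "\<Phi> x y q * \<Psi> (x - 2 * of_int q * \<mu>) (y - 2 * of_int q * \<nu>) (p - q) \<noteq> 0"
      unfolding eq by (rule sum.not_neutral_contains_not_neutral)
    then have "\<Psi> (x - 2 * of_int q * \<mu>) (y - 2 * of_int q * \<nu>) (p - q) \<noteq> 0" by simp
    then have "p - q \<in> ?T" by blast
    with q have "(q, p - q) \<in> ?S \<times> ?T" by blast
    then show "p \<in> (\<lambda>(a, b). a + b) ` (?S \<times> ?T)" by (rule rev_image_eqI) simp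
  qed
  then show "finite {p. \<exists>x y. qmult \<mu> \<nu> \<Phi> \<Psi> x y p \<noteq> 0}"
    by (rule finite_subset) (intro finite_imageI finite_cartesian_product S T)
  have shift: "\<Psi> (x + of_int k) y p = ee (of_int (c * k * p) * (y - of_int p * \<nu>)) * \<Psi> x y p"
    if "\<Psi> \<in> D0 c \<mu> \<nu>" for \<Psi> k x y p
  proof -
    have "\<Psi> x y p = cnj (ee (of_int (c * k * p) * (y - of_int p * \<nu>))) * \<Psi> (x + of_int k) y p"
      by (simp only: D0D(4)[OF that])
    then show ?thesis by (simp only: cnj_ee mult.assoc[symmetric] ee_uminus_mult mult_1_left)
  qed
  show "cnj (ee (of_int (c * k * p) * (y - of_int p * \<nu>))) * qmult \<mu> \<nu> \<Phi> \<Psi> (x + of_int k) y p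
      = qmult \<mu> \<nu> \<Phi> \<Psi> x y p" for k x y p
    unfolding eq sum_distrib_left
  proof (intro sum.cong refl)
    fix q
    let ?x = "x - 2 * of_int q * \<mu>" and ?y = "y - 2 * of_int q * \<nu>"
    have "\<Psi> (x + of_int k - 2 * of_int q * \<mu>) ?y (p - q) 
        = ee (of_int (c * k * (p - q)) * (?y - of_int (p - q) * \<nu>)) * \<Psi> ?x ?y (p - q)"
      using shift[OF assms(2), of ?x k ?y "p - q"] by (simp add: algebra_simps)
    \<comment> \<open>The phases compose because q^2 + 2 q (p - q) + (p - q)^2 = p^2; the middle
      term is produced by the shift of y by 2 q \<nu> in the product.\<close>
    moreover have "ee (- (of_int (c * k * p) * (y - of_int p * \<nu>))) * (ee (of_int (c * k * q) * (y - of_int q * \<nu>))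
        * ee (of_int (c * k * (p - q)) * (?y - of_int (p - q) * \<nu>))) = 1"
      unfolding ee_add[symmetric] by (simp add: algebra_simps)
    ultimately show "cnj (ee (of_int (c * k * p) * (y - of_int p * \<nu>))) * (\<Phi> (x + of_int k) y q *
       \<Psi> (x + of_int k - 2 * of_int q * \<mu>) ?y (p - q)) = \<Phi> x y q * \<Psi> ?x ?y (p - q)"
      by (simp only: shift[OF assms(1)] cnj_ee) (simp only: mult_ac, simp add: mult_ac)
  qed
  show "qmult \<mu> \<nu> \<Phi> \<Psi> x (y + 1) p = qmult \<mu> \<nu> \<Phi> \<Psi> x y p" for x y p
    unfolding eq diff_add_eq[symmetric] D0D(2)[OF assms(1)] D0D(2)[OF assms(2)] ..
qed

text \<open>The identity a b - a' b' = a (b - b') + (a - a') b', proved on the level of convergent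
  sums, since \<open>qmult\<close> is bilinear only where its series converge.\<close>

lemma qmult_diff:
  assumes "qhm_bound \<mu> \<nu> \<Phi> C" "qhm_bound \<mu> \<nu> \<Psi> D" "qhm_bound \<mu> \<nu> \<Phi>' C'" "qhm_bound \<mu> \<nu> \<Psi>' D'"
  shows "qmult \<mu> \<nu> \<Phi> \<Psi> x y p - qmult \<mu> \<nu> \<Phi>' \<Psi>' x y p =
    qmult \<mu> \<nu> \<Phi> (\<lambda>x y p. \<Psi> x y p - \<Psi>' x y p) x y p + qmult \<mu> \<nu> (\<lambda>x y p. \<Phi> x y p - \<Phi>' x y p) \<Psi>' x y p"
proof -
  have "((\<lambda>q. (\<Phi> x y q * \<Psi> (x - 2 * of_int q * \<mu>) (y - 2 * of_int q * \<nu>) (p - q))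
     + - (\<Phi>' x y q * \<Psi>' (x - 2 * of_int q * \<mu>) (y - 2 * of_int q * \<nu>) (p - q)))
      has_sum (qmult \<mu> \<nu> \<Phi> \<Psi> x y p + - qmult \<mu> \<nu> \<Phi>' \<Psi>' x y p)) UNIV"
    using qmult_has_sum[OF assms(1,2)] qmult_has_sum[OF assms(3,4)]
    by (intro has_sum_add) (auto simp: has_sum_uminus)
  moreover have "((\<lambda>q. (\<Phi> x y q * (\<Psi> (x - 2 * of_int q * \<mu>) (y - 2 * of_int q * \<nu>) (p - q)
       - \<Psi>' (x - 2 * of_int q * \<mu>) (y - 2 * of_int q * \<nu>) (p - q)))
     + ((\<Phi> x y q - \<Phi>' x y q) * \<Psi>' (x - 2 * of_int q * \<mu>) (y - 2 * of_int q * \<nu>) (p - q)))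
      has_sum (qmult \<mu> \<nu> \<Phi> (\<lambda>x y p. \<Psi> x y p - \<Psi>' x y p) x y p + qmult \<mu> \<nu> (\<lambda>x y p. \<Phi> x y p - \<Phi>' x y p) \<Psi>' x y p)) UNIV"
    using qmult_has_sum[OF assms(1) qhm_bound_diff[OF assms(2,4)]] qmult_has_sum[OF qhm_bound_diff[OF assms(1,3)] assms(4)]
    by (intro has_sum_add)
  ultimately show ?thesis
    by (simp add: right_diff_distrib left_diff_distrib) (metis (no_types, lifting) has_sum_unique)
qed

lemma qhm_qmult: 
  assumes "\<Phi> \<in> qhm c \<mu> \<nu>" "\<Psi> \<in> qhm c \<mu> \<nu>" shows "qmult \<mu> \<nu> \<Phi> \<Psi> \<in> qhm c \<mu> \<nu>"
proof (rule qhm_closed)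
  fix e :: real assume e: "0 < e"
  obtain C where C: "qhm_bound \<mu> \<nu> \<Phi> C" using qhm_bounded[OF assms(1)] .
  obtain D where D: "qhm_bound \<mu> \<nu> \<Psi> D" using qhm_bounded[OF assms(2)] .
  have nn: "0 \<le> C" "0 \<le> D" using C D qhm_bound_nonneg by auto
  \<comment> \<open>By d \<le> 1 the approximation of \<Psi> has a bound at most D + 1, so the total
    error is at most d (C + D + 1), hence at most e.\<close>
  define d where "d = min 1 (e / (C + D + 1))"
  have d: "0 < d" "d \<le> 1" "d \<le> e / (C + D + 1)" using e nn by (auto simp: d_def)
  obtain \<Phi>' where \<Phi>': "\<Phi>' \<in> D0 c \<mu> \<nu>" "qhm_bound \<mu> \<nu> (\<lambda>x y p. \<Phi> x y p - \<Phi>' x y p) d"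
    using assms(1) d unfolding qhm_iff by blast
  obtain \<Psi>' where \<Psi>': "\<Psi>' \<in> D0 c \<mu> \<nu>" "qhm_bound \<mu> \<nu> (\<lambda>x y p. \<Psi> x y p - \<Psi>' x y p) d"
    using assms(2) d unfolding qhm_iff by blast
  obtain C' where C': "qhm_bound \<mu> \<nu> \<Phi>' C'" using D0_bounded[OF \<Phi>'(1)] .
  have D': "qhm_bound \<mu> \<nu> \<Psi>' (D + d)" using qhm_bound_diff[OF D \<Psi>'(2)] by simp
  have "C * d + d * (D + d) \<le> d * (C + D + 1)"
    using d by (simp add: algebra_simps)
  also have "\<dots> \<le> e" using d(3) nn by (simp add: pos_le_divide_eq add_nonneg_pos)
  finally have "C * d + d * (D + d) \<le> e" .
  then have "qhm_bound \<mu> \<nu> (\<lambda>x y p. qmult \<mu> \<nu> \<Phi> \<Psi> x y p - qmult \<mu> \<nu> \<Phi>' \<Psi>' x y p) e"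
    unfolding qmult_diff[OF C D C' D']
    by (intro qhm_bound_mono[OF qhm_bound_add[OF qhm_bound_qmult[OF C \<Psi>'(2)] qhm_bound_qmult[OF \<Phi>'(2) D']]])
  then show "\<exists>\<Psi>''\<in>qhm c \<mu> \<nu>. qhm_bound \<mu> \<nu> (\<lambda>x y p. qmult \<mu> \<nu> \<Phi> \<Psi> x y p - \<Psi>'' x y p) e"
    using D0_qhm[OF D0_qmult[OF \<Phi>'(1) \<Psi>'(1)]] by blast
qed

text \<open>The form in which identities pass from \<open>D0\<close> to the closure: both sides are
  approximated within e, by \<open>qhm_bound_entry\<close>.\<close>

lemma eq_if_close:
  fixes a b :: complex assumes "\<And>e. e > 0 \<Longrightarrow> cmod (a - b) \<le> 2 * e" shows "a = b"
proof (rule ccontr)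
  assume "a \<noteq> b"
  then show False using assms[of "cmod (a - b) / 4"] by simp
qed

lemma qhm_continuous:
  assumes "\<Phi> \<in> qhm c \<mu> \<nu>" shows "continuous_on UNIV (\<lambda>z. \<Phi> (fst z) (snd z) p)"
proof -
  have "\<forall>n. \<exists>\<Psi>. \<Psi> \<in> D0 c \<mu> \<nu> \<and> qhm_bound \<mu> \<nu> (\<lambda>x y p. \<Phi> x y p - \<Psi> x y p) (1 / Suc n)"
  proof
    fix n
    have "0 < 1 / real (Suc n)" by simp
    with assms show "\<exists>\<Psi>. \<Psi> \<in> D0 c \<mu> \<nu> \<and> qhm_bound \<mu> \<nu> (\<lambda>x y p. \<Phi> x y p - \<Psi> x y p) (1 / Suc n)"
      unfolding qhm_iff by blast
  qed
  from choice[OF this] obtain \<Psi>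
    where "\<forall>n. \<Psi> n \<in> D0 c \<mu> \<nu> \<and> qhm_bound \<mu> \<nu> (\<lambda>x y p. \<Phi> x y p - \<Psi> n x y p) (1 / Suc n)" ..
  then have \<Psi>: "\<And>n. \<Psi> n \<in> D0 c \<mu> \<nu>" "\<And>n. qhm_bound \<mu> \<nu> (\<lambda>x y p. \<Phi> x y p - \<Psi> n x y p) (1 / Suc n)"
    by blast+
  have "uniform_limit UNIV (\<lambda>n z. \<Psi> n (fst z) (snd z) p) (\<lambda>z. \<Phi> (fst z) (snd z) p) sequentially"
    unfolding uniform_limit_iff
  proof (intro allI impI)
    fix e :: real assume "0 < e"
    then have "\<forall>\<^sub>F n in sequentially. 1 / real (Suc n) < e"
      using order_tendstoD(2)[OF LIMSEQ_Suc[OF lim_1_over_n]] by blast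
    then show "\<forall>\<^sub>F n in sequentially. \<forall>z\<in>UNIV. dist (\<Psi> n (fst z) (snd z) p) (\<Phi> (fst z) (snd z) p) < e"
    proof eventually_elim
      case (elim n)
      show ?case
      proof
        fix z
        show "dist (\<Psi> n (fst z) (snd z) p) (\<Phi> (fst z) (snd z) p) < e"
          unfolding dist_norm norm_minus_commute[of "\<Psi> n _ _ _"]
          by (rule order_le_less_trans[OF qhm_bound_entry[OF \<Psi>(2)] elim])
      qed
    qed
  qed
  then show ?thesis
    by (rule uniform_limit_theorem[rotated]) (auto intro: always_eventually D0D(1)[OF \<Psi>(1)])
qed

lemma qhm_periodic:
  assumes "\<Phi> \<in> qhm c \<mu> \<nu>" shows "\<Phi> x (y + 1) p = \<Phi> x y p"
proof (rule eq_if_close)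
  fix e :: real assume "0 < e"
  then obtain \<Psi> where \<Psi>: "\<Psi> \<in> D0 c \<mu> \<nu>" "qhm_bound \<mu> \<nu> (\<lambda>x y p. \<Phi> x y p - \<Psi> x y p) e"
    using assms unfolding qhm_iff by blast
  note D0D(2)[OF \<Psi>(1), of x y p]
  then have "\<Phi> x (y + 1) p - \<Phi> x y p = (\<Phi> x (y + 1) p - \<Psi> x (y + 1) p) - (\<Phi> x y p - \<Psi> x y p)" by simp
  also have "cmod \<dots> \<le> e + e"
    by (rule order_trans[OF norm_triangle_ineq4]) (intro add_mono qhm_bound_entry[OF \<Psi>(2)])
  finally show "cmod (\<Phi> x (y + 1) p - \<Phi> x y p) \<le> 2 * e" by simp
qed

lemma qhm_shift:
  assumes "\<Phi> \<in> qhm c \<mu> \<nu>" 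
  shows "\<Phi> (x + of_int k) y p = ee (of_int (c * k * p) * (y - of_int p * \<nu>)) * \<Phi> x y p"
proof (rule eq_if_close)
  fix e :: real assume "0 < e"
  then obtain \<Psi> where \<Psi>: "\<Psi> \<in> D0 c \<mu> \<nu>" "qhm_bound \<mu> \<nu> (\<lambda>x y p. \<Phi> x y p - \<Psi> x y p) e"
    using assms unfolding qhm_iff by blast
  let ?u = "ee (of_int (c * k * p) * (y - of_int p * \<nu>))"
  have "\<Psi> x y p = cnj ?u * \<Psi> (x + of_int k) y p" by (simp only: D0D(4)[OF \<Psi>(1)])
  then have *: "\<Psi> (x + of_int k) y p = ?u * \<Psi> x y p"
    by (simp only: cnj_ee mult.assoc[symmetric] ee_uminus_mult mult_1_left)
  have "\<Phi> (x + of_int k) y p - ?u * \<Phi> x y p = 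
      (\<Phi> (x + of_int k) y p - \<Psi> (x + of_int k) y p) - ?u * (\<Phi> x y p - \<Psi> x y p)" 
    using * by (simp add: algebra_simps)
  also have "cmod \<dots> \<le> e + e"
    by (rule order_trans[OF norm_triangle_ineq4]) 
       (simp only: norm_mult cmod_ee mult_1_left, intro add_mono qhm_bound_entry[OF \<Psi>(2)])
  finally show "cmod (\<Phi> (x + of_int k) y p - ?u * \<Phi> x y p) \<le> 2 * e" by simp
qed

text \<open>The phase of degree p - q over the point shifted by p splits as a factor in p times its
  conjugate in q, since (p - q) (2 p - (p - q)) = p^2 - q^2. The action thus conjugates the matrix
  by a diagonal unitary and moves the base point.\<close>

lemma qhm_bound_heis_act:
  assumes "qhm_bound \<mu> \<nu> \<Phi> C" shows "qhm_bound \<mu> \<nu> (heis_act c \<mu> (r, s, t) \<Phi>) C"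
  unfolding qhm_bound_def
proof (intro allI)
  fix x y
  define u where "u p = ee (of_int p * (t + of_int c * s * (x - r)) + of_int c * s * \<mu> * of_int p * of_int p)" for p :: int
  define v where "v p = ee (- (of_int p * (t + of_int c * s * (x - r)) + of_int c * s * \<mu> * of_int p * of_int p))" for p :: int
  have "matrix_bound (\<lambda>p q. u p * qmat \<mu> \<nu> \<Phi> (x - r) (y - s) p q * v q) C"
    using assms by (intro matrix_bound_unimodular) (auto simp: qhm_bound_def u_def v_def)
  moreover have "qmat \<mu> \<nu> (heis_act c \<mu> (r, s, t) \<Phi>) x y = (\<lambda>p q. u p * qmat \<mu> \<nu> \<Phi> (x - r) (y - s) p q * v q)"
  proof (intro ext)
    fix p q
    have "ee (of_int (p - q) * (t + of_int c * s * (x + 2 * of_int p * \<mu> - r - of_int (p - q) * \<mu>))) = u p * v q"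
      unfolding u_def v_def ee_add[symmetric] by (simp add: algebra_simps)
    then show "qmat \<mu> \<nu> (heis_act c \<mu> (r, s, t) \<Phi>) x y p q = u p * qmat \<mu> \<nu> \<Phi> (x - r) (y - s) p q * v q"
      unfolding qmat_def heis_act_def by (simp add: algebra_simps)
  qed
  ultimately show "matrix_bound (qmat \<mu> \<nu> (heis_act c \<mu> (r, s, t) \<Phi>) x y) C" by simp
qed

lemma D0_heis_act:
  assumes "\<Phi> \<in> D0 c \<mu> \<nu>" shows "heis_act c \<mu> (r, s, t) \<Phi> \<in> D0 c \<mu> \<nu>"
proof (rule D0I)
  obtain C where "qhm_bound \<mu> \<nu> \<Phi> C" by (rule D0_bounded[OF assms(1)])
  from qhm_bound_bounded[OF qhm_bound_heis_act[OF this]]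
  show "\<exists>B. \<forall>x y p. cmod (heis_act c \<mu> (r, s, t) \<Phi> x y p) \<le> B" .
  fix p
  have "continuous_on UNIV (\<lambda>z. (\<lambda>z. \<Phi> (fst z) (snd z) p) (fst z - r, snd z - s))"
    by (rule continuous_on_compose2[OF D0D(1)[OF assms]]) (auto intro!: continuous_intros)
  then have "continuous_on UNIV (\<lambda>z. \<Phi> (fst z - r) (snd z - s) p)" by simp
  then show "continuous_on UNIV (\<lambda>z. heis_act c \<mu> (r, s, t) \<Phi> (fst z) (snd z) p)"
    unfolding heis_act_def case_prod_conv by (intro continuous_intros)
next
  show "finite {p. \<exists>x y. heis_act c \<mu> (r, s, t) \<Phi> x y p \<noteq> 0}"
    by (rule finite_subset[OF _ D0D(3)[OF assms]]) (auto simp: heis_act_def)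
  show "heis_act c \<mu> (r, s, t) \<Phi> x (y + 1) p = heis_act c \<mu> (r, s, t) \<Phi> x y p" for x y p
    unfolding heis_act_def case_prod_conv diff_add_eq[symmetric] D0D(2)[OF assms] ..
  show "cnj (ee (of_int (c * k * p) * (y - of_int p * \<nu>))) * heis_act c \<mu> (r, s, t) \<Phi> (x + of_int k) y p
    = heis_act c \<mu> (r, s, t) \<Phi> x y p" for k x y p
  proof -
    let ?a = "of_int (c * k * p) * (y - of_int p * \<nu>)"
    let ?b = "of_int (c * k * p) * (y - s - of_int p * \<nu>)"
    have "\<Phi> (x - r) (y - s) p = cnj (ee ?b) * \<Phi> (x - r + of_int k) (y - s) p"
      by (simp only: D0D(4)[OF assms])
    then have "\<Phi> (x + of_int k - r) (y - s) p = ee ?b * \<Phi> (x - r) (y - s) p"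
      by (simp only: cnj_ee mult.assoc[symmetric] ee_uminus_mult diff_add_eq mult_1_left)
    \<comment> \<open>Translating y by s changes the phase of quasi-periodicity by - c k p s. The
      phase of the action, evaluated at x + k, contributes exactly c k p s.\<close>
    moreover have "ee (- ?a) * (ee (of_int p * (t + of_int c * s * (x + of_int k - r - of_int p * \<mu>))) * ee ?b)
        = ee (of_int p * (t + of_int c * s * (x - r - of_int p * \<mu>)))"
      unfolding ee_add[symmetric] by (simp add: algebra_simps)
    ultimately show ?thesis
      unfolding heis_act_def by (simp only: case_prod_conv cnj_ee mult.assoc[symmetric])
  qed
qed

lemma qhm_heis_act:
  assumes "\<Phi> \<in> qhm c \<mu> \<nu>" shows "heis_act c \<mu> (r, s, t) \<Phi> \<in> qhm c \<mu> \<nu>"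
  unfolding qhm_iff
proof (intro allI impI)
  fix e :: real assume "0 < e"
  then obtain \<Psi> where \<Psi>: "\<Psi> \<in> D0 c \<mu> \<nu>" "qhm_bound \<mu> \<nu> (\<lambda>x y p. \<Phi> x y p - \<Psi> x y p) e"
    using assms unfolding qhm_iff by blast
  have "qhm_bound \<mu> \<nu> (\<lambda>x y p. heis_act c \<mu> (r, s, t) \<Phi> x y p - heis_act c \<mu> (r, s, t) \<Psi> x y p) e"
    using qhm_bound_heis_act[OF \<Psi>(2), of c r s t] by (simp add: heis_act_def right_diff_distrib)
  then show "\<exists>\<Psi>\<in>D0 c \<mu> \<nu>. qhm_bound \<mu> \<nu> (\<lambda>x y p. heis_act c \<mu> (r, s, t) \<Phi> x y p - \<Psi> x y p) e"
    using D0_heis_act[OF \<Psi>(1)] by blast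
qed

section \<open>Smooth functions on the plane\<close>

definition plane_smooth :: "(real \<Rightarrow> real \<Rightarrow> complex) \<Rightarrow> bool" where
  "plane_smooth f \<longleftrightarrow> (\<forall>k. plane_Ck k f)"

lemma plane_Ck_SucI:
  assumes "\<And>x y. ((\<lambda>s. f s y) has_vector_derivative fx x y) (at x)"
    "\<And>x y. ((\<lambda>s. f x s) has_vector_derivative fy x y) (at y)" "plane_Ck k fx" "plane_Ck k fy"
  shows "plane_Ck (Suc k) f"
  unfolding plane_Ck.simps using assms by (intro exI[of _ fx] exI[of _ fy]) auto

lemma plane_Ck_SucD:
  assumes "plane_Ck (Suc k) f"
  shows "((\<lambda>s. f s y) has_vector_derivative pdx f x y) (at x)"
    "((\<lambda>s. f x s) has_vector_derivative pdy f x y) (at y)" "plane_Ck k (pdx f)" "plane_Ck k (pdy f)"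
proof -
  obtain fx fy where f: "\<And>x y. ((\<lambda>s. f s y) has_vector_derivative fx x y) (at x)"
    "\<And>x y. ((\<lambda>s. f x s) has_vector_derivative fy x y) (at y)" "plane_Ck k fx" "plane_Ck k fy"
    using assms by auto
  have "pdx f = fx" "pdy f = fy"
    unfolding pdx_def pdy_def using f by (auto intro!: ext vector_derivative_at)
  then show "((\<lambda>s. f s y) has_vector_derivative pdx f x y) (at x)"
    "((\<lambda>s. f x s) has_vector_derivative pdy f x y) (at y)" "plane_Ck k (pdx f)" "plane_Ck k (pdy f)"
    using f by auto
qed

lemma pdx_eq: "(\<And>x y. ((\<lambda>s. f s y) has_vector_derivative fx x y) (at x)) \<Longrightarrow> pdx f = fx"
  unfolding pdx_def by (auto intro!: ext vector_derivative_at)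

lemma pdy_eq: "(\<And>x y. ((\<lambda>s. f x s) has_vector_derivative fy x y) (at y)) \<Longrightarrow> pdy f = fy"
  unfolding pdy_def by (auto intro!: ext vector_derivative_at)

lemma plane_smoothD:
  assumes "plane_smooth f"
  shows "((\<lambda>s. f s y) has_vector_derivative pdx f x y) (at x)"
    "((\<lambda>s. f x s) has_vector_derivative pdy f x y) (at y)" 
    "plane_smooth (pdx f)" "plane_smooth (pdy f)"
    "continuous_on UNIV (\<lambda>z. f (fst z) (snd z))"
  using assms plane_Ck_SucD[of _ f] plane_Ck.simps(1)[of f] unfolding plane_smooth_def by blast+

lemma plane_Ck_add: 
  "plane_Ck k f \<Longrightarrow> plane_Ck k g \<Longrightarrow> plane_Ck k (\<lambda>x y. f x y + g x y)"
proof (induction k arbitrary: f g)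
  case 0
  then show ?case by (simp add: continuous_on_add)
next
  case (Suc k)
  note f = plane_Ck_SucD[OF Suc.prems(1)] and g = plane_Ck_SucD[OF Suc.prems(2)]
  show ?case
    by (rule plane_Ck_SucI[of _ "\<lambda>x y. pdx f x y + pdx g x y" "\<lambda>x y. pdy f x y + pdy g x y"])
       (intro has_vector_derivative_add f g Suc.IH)+
qed

lemma plane_Ck_const: "plane_Ck k (\<lambda>x y. a)"
proof (induction k arbitrary: a)
  case (Suc k)
  show ?case by (rule plane_Ck_SucI[of _ "\<lambda>x y. 0" "\<lambda>x y. 0"]) (auto intro: Suc)
qed simp

lemma plane_Ck_uminus: "plane_Ck k f \<Longrightarrow> plane_Ck k (\<lambda>x y. - f x y)"
proof (induction k arbitrary: f)
  case 0
  then show ?case by (simp add: continuous_on_minus)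
next
  case (Suc k)
  note f = plane_Ck_SucD[OF Suc.prems]
  show ?case
    by (rule plane_Ck_SucI[of _ "\<lambda>x y. - pdx f x y" "\<lambda>x y. - pdy f x y"])
       (intro has_vector_derivative_minus f Suc.IH)+
qed

text \<open>All orders up to k are assumed because \<open>plane_Ck\<close> of order k records
  continuity of the derivatives of order k only; the lower orders, which the product rule also
  involves, would have to be derived.\<close>

lemma plane_Ck_mult: 
  "(\<And>j. j \<le> k \<Longrightarrow> plane_Ck j f) \<Longrightarrow> (\<And>j. j \<le> k \<Longrightarrow> plane_Ck j g) \<Longrightarrow> plane_Ck k (\<lambda>x y. f x y * g x y)"
proof (induction k arbitrary: f g)
  case 0
  from "0.prems"(1)[of 0] "0.prems"(2)[of 0] show ?case by (simp add: continuous_on_mult)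
next
  case (Suc k)
  note f = plane_Ck_SucD(1,2)[OF Suc.prems(1)[of "Suc k", OF order_refl]] 
  note g = plane_Ck_SucD(1,2)[OF Suc.prems(2)[of "Suc k", OF order_refl]]
  have f': "plane_Ck j (pdx f)" "plane_Ck j (pdy f)" "plane_Ck j (pdx g)" "plane_Ck j (pdy g)" if "j \<le> k" for j
    using that Suc.prems[of "Suc j"] plane_Ck_SucD(3,4)[of j f] plane_Ck_SucD(3,4)[of j g] by auto
  have fg: "plane_Ck j f" "plane_Ck j g" if "j \<le> k" for j
    using that Suc.prems[of j] by auto
  show ?case
    by (rule plane_Ck_SucI[of _ "\<lambda>x y. f x y * pdx g x y + pdx f x y * g x y" 
            "\<lambda>x y. f x y * pdy g x y + pdy f x y * g x y"])
       (rule has_vector_derivative_mult[OF f(1) g(1)] has_vector_derivative_mult[OF f(2) g(2)] 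
         plane_Ck_add[OF Suc.IH Suc.IH]; intro f' fg; assumption)+
qed

lemma plane_smooth_const: "plane_smooth (\<lambda>x y. a)"
  by (simp add: plane_smooth_def plane_Ck_const)

lemma plane_smooth_add: "plane_smooth f \<Longrightarrow> plane_smooth g \<Longrightarrow> plane_smooth (\<lambda>x y. f x y + g x y)"
  by (simp add: plane_smooth_def plane_Ck_add)

lemma plane_smooth_mult: "plane_smooth f \<Longrightarrow> plane_smooth g \<Longrightarrow> plane_smooth (\<lambda>x y. f x y * g x y)"
  by (simp add: plane_smooth_def plane_Ck_mult)

lemma plane_smooth_diff: "plane_smooth f \<Longrightarrow> plane_smooth g \<Longrightarrow> plane_smooth (\<lambda>x y. f x y - g x y)"
  using plane_smooth_add[OF _ plane_smooth_mult[OF plane_smooth_const[of "-1"]], of f g] by simp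

lemma plane_smooth_fst: "plane_smooth (\<lambda>x y. of_real x)"
  unfolding plane_smooth_def
proof
  fix k show "plane_Ck k (\<lambda>x y. of_real x)"
  proof (cases k)
    case (Suc j)
    have "((\<lambda>x. complex_of_real x) has_vector_derivative of_real 1) (at x)" for x
      by (rule has_vector_derivative_of_real) (auto intro!: derivative_eq_intros)
    then show ?thesis unfolding Suc
      by (intro plane_Ck_SucI[of _ "\<lambda>x y. 1" "\<lambda>x y. 0"]) (auto intro: plane_Ck_const)
  qed (auto intro!: continuous_intros)
qed

lemma plane_smooth_snd: "plane_smooth (\<lambda>x y. of_real y)"
  unfolding plane_smooth_def
proof
  fix k show "plane_Ck k (\<lambda>x y. of_real y)"
  proof (cases k)
    case (Suc j)
    have "((\<lambda>x. complex_of_real x) has_vector_derivative of_real 1) (at x)" for x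
      by (rule has_vector_derivative_of_real) (auto intro!: derivative_eq_intros)
    then show ?thesis unfolding Suc
      by (intro plane_Ck_SucI[of _ "\<lambda>x y. 0" "\<lambda>x y. 1"]) (auto intro: plane_Ck_const)
  qed (auto intro!: continuous_intros)
qed

text \<open>H is a family of functions of one variable whose derivatives are combinations of two of
  its members. Higher chain rules are then replaced by an induction over the order. The family is
  \<open>{ee}\<close> for exponentials and all of \<open>bump\<close> for cutoffs.\<close>

lemma plane_Ck_compose:
  fixes g :: "real \<Rightarrow> real \<Rightarrow> real" and H :: "(real \<Rightarrow> complex) set"
  assumes H: "\<And>h. h \<in> H \<Longrightarrow> \<exists>h1\<in>H. \<exists>h2\<in>H. \<exists>a b. \<forall>t. (h has_vector_derivative a * h1 t + b * h2 t) (at t)"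
    and g: "plane_smooth (\<lambda>x y. of_real (g x y))"
  shows "h \<in> H \<Longrightarrow> plane_Ck k (\<lambda>x y. h (g x y))"
proof (induction k arbitrary: h rule: less_induct)
  case (less k)
  let ?G = "\<lambda>x y. complex_of_real (g x y)"
  obtain h1 h2 a b where h: "h1 \<in> H" "h2 \<in> H" "\<And>t. (h has_vector_derivative a * h1 t + b * h2 t) (at t)"
    using H[OF less.prems] by blast
  show ?case
  proof (cases k)
    case 0
    have "continuous_on UNIV h"
      using h(3) by (auto simp: continuous_on_eq_continuous_at intro: has_vector_derivative_continuous)
    moreover have "continuous_on UNIV (\<lambda>z. Re (?G (fst z) (snd z)))"
      by (intro continuous_on_Re plane_smoothD(5)[OF g])
    ultimately show ?thesis unfolding 0 by (auto intro: continuous_on_compose2)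
  next
    case (Suc j)
    note G = plane_smoothD[OF g]
    \<comment> \<open>A real function viewed in the complex numbers has a real derivative, so
      scaling by its real part in the chain rule is the same as multiplying by the complex
      derivative.\<close>
    have real: "Re z *\<^sub>R w = z * w" if "((\<lambda>t. complex_of_real (u t)) has_vector_derivative z) (at t0)" for u t0 z w
    proof -
      have "((\<lambda>t. Im (complex_of_real (u t))) has_vector_derivative Im z) (at t0)"
        by (rule bounded_linear.has_vector_derivative[OF bounded_linear_Im that])
      then have "Im z = 0" using vector_derivative_unique_at[OF _ has_vector_derivative_const[of 0]] by auto
      then show ?thesis by (simp add: complex_eq_iff)
    qed
    have dx: "((\<lambda>s. g s y) has_vector_derivative Re (pdx ?G x y)) (at x)" for x y
      using bounded_linear.has_vector_derivative[OF bounded_linear_Re G(1)] by simp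
    have dy: "((\<lambda>s. g x s) has_vector_derivative Re (pdy ?G x y)) (at y)" for x y
      using bounded_linear.has_vector_derivative[OF bounded_linear_Re G(2)] by simp
    have ck: "plane_Ck j (\<lambda>x y. a * h1 (g x y) + b * h2 (g x y))"
      "plane_Ck i (\<lambda>x y. a * h1 (g x y) + b * h2 (g x y))" if "i \<le> j" for i
      using that Suc h by (intro plane_Ck_add plane_Ck_mult plane_Ck_const less.IH; simp)+
    show ?thesis unfolding Suc
    proof (rule plane_Ck_SucI)
      fix x y
      show "((\<lambda>s. h (g s y)) has_vector_derivative pdx ?G x y * (a * h1 (g x y) + b * h2 (g x y))) (at x)"
        using vector_diff_chain_at[OF dx h(3), of y x] unfolding real[OF G(1)] by (simp add: o_def)
      show "((\<lambda>s. h (g x s)) has_vector_derivative pdy ?G x y * (a * h1 (g x y) + b * h2 (g x y))) (at y)"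
        using vector_diff_chain_at[OF dy h(3), of x y] unfolding real[OF G(2)] by (simp add: o_def)
    next
      show "plane_Ck j (\<lambda>x y. pdx ?G x y * (a * h1 (g x y) + b * h2 (g x y)))"
        by (rule plane_Ck_mult) (use G(3) ck in \<open>auto simp: plane_smooth_def\<close>)
      show "plane_Ck j (\<lambda>x y. pdy ?G x y * (a * h1 (g x y) + b * h2 (g x y)))"
        by (rule plane_Ck_mult) (use G(4) ck in \<open>auto simp: plane_smooth_def\<close>)
    qed
  qed
qed

lemma has_vector_derivative_ee: "(ee has_vector_derivative 2 * of_real pi * \<i> * ee t) (at t)"
  unfolding ee_def by (rule has_vector_derivative_real_field) (auto intro!: derivative_eq_intros)

lemma plane_smooth_ee:
  assumes "plane_smooth (\<lambda>x y. of_real (g x y))" shows "plane_smooth (\<lambda>x y. ee (g x y))"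
  unfolding plane_smooth_def
proof
  fix k show "plane_Ck k (\<lambda>x y. ee (g x y))"
  proof (rule plane_Ck_compose[OF _ assms, of "{ee}"])
    fix h assume "h \<in> {ee}"
    then have "\<forall>t. (h has_vector_derivative 2 * of_real pi * \<i> * ee t + 0 * ee t) (at t)"
      by (simp add: has_vector_derivative_ee)
    then show "\<exists>h1\<in>{ee}. \<exists>h2\<in>{ee}. \<exists>a b. \<forall>t. (h has_vector_derivative a * h1 t + b * h2 t) (at t)"
      by blast
  qed simp
qed

text \<open>The classical flat function exp(-1/t), multiplied by powers of 1/t so that the family is
  closed under differentiation up to linear combinations.\<close>

definition bump :: "nat \<Rightarrow> real \<Rightarrow> real" where
  "bump k t = (if t > 0 then (1 / t) ^ k * exp (- (1 / t)) else 0)"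

lemma bump_tendsto_0: "(bump k \<longlongrightarrow> 0) (at 0)"
proof -
  have "((\<lambda>u. u ^ k / exp u) \<longlongrightarrow> 0) (at_top :: real filter)"
    by (rule tendsto_power_div_exp_0)
  from filterlim_compose[OF this filterlim_inverse_at_top_right]
  have "((\<lambda>t. (inverse t) ^ k / exp (inverse t)) \<longlongrightarrow> 0) (at_right (0::real))" .
  then have "(bump k \<longlongrightarrow> 0) (at_right 0)"
    by (rule Lim_transform_eventually)
       (auto simp: bump_def eventually_at_filter exp_minus field_simps)
  moreover have "(bump k \<longlongrightarrow> 0) (at_left 0)"
    by (rule Lim_transform_eventually[OF tendsto_const])
       (auto simp: bump_def eventually_at_filter)
  ultimately show ?thesis by (simp add: filterlim_split_at)
qed

lemma bump_derivative: 
  "(bump k has_real_derivative (bump (k + 2) t - of_nat k * bump (k + 1) t)) (at t)"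
proof -
  consider "t > 0" | "t < 0" | "t = 0" by linarith
  then show ?thesis
  proof cases
    case 1
    have "((\<lambda>t. (1 / t) ^ k * exp (- (1 / t))) has_real_derivative 
       (bump (k + 2) t - of_nat k * bump (k + 1) t)) (at t)"
    proof -
      have u: "((\<lambda>t. 1 / t) has_real_derivative - ((1 / t)\<^sup>2)) (at t)"
        using 1 by (auto intro!: derivative_eq_intros simp: power2_eq_square)
      have e: "((\<lambda>t. exp (- (1 / t))) has_real_derivative exp (- (1 / t)) * (1 / t)\<^sup>2) (at t)"
        using DERIV_chain2[OF DERIV_exp DERIV_minus[OF u]] by simp
      have eq: "of_nat k * (- (w\<^sup>2) * w ^ (k - Suc 0)) * E + E * w\<^sup>2 * w ^ k
          = w ^ (k + 2) * E - of_nat k * (w ^ (k + 1) * E)" for w E :: real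
        by (cases k) (auto simp: algebra_simps power2_eq_square)
      show ?thesis
        using DERIV_mult[OF DERIV_power[OF u, of k] e] 1 unfolding eq by (simp add: bump_def)
    qed
    then show ?thesis
      by (rule has_field_derivative_transform_within_open[OF _ open_greaterThan[of 0]])
         (use 1 in \<open>auto simp: bump_def\<close>)
  next
    case 2
    have "((\<lambda>t. 0) has_real_derivative (bump (k + 2) t - of_nat k * bump (k + 1) t)) (at t)"
      using 2 by (simp add: bump_def)
    then show ?thesis
      by (rule has_field_derivative_transform_within_open[OF _ open_lessThan[of 0]])
         (use 2 in \<open>auto simp: bump_def\<close>)
  next
    case 3
    \<comment> \<open>At 0 the difference quotient of \<open>bump k\<close> is itself
      \<open>bump (k + 1)\<close>, on both sides of 0, and so tends to 0.\<close>
    have "((\<lambda>h. (bump k (0 + h) - bump k 0) / h) \<longlongrightarrow> 0) (at 0)"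
    proof (rule Lim_transform_eventually[OF bump_tendsto_0[of "k + 1"]])
      show "\<forall>\<^sub>F x in at 0. bump (k + 1) x = (bump k (0 + x) - bump k 0) / x"
        by (auto simp: bump_def eventually_at_filter)
    qed
    then show ?thesis unfolding 3 DERIV_def by (simp add: bump_def)
  qed
qed

lemma plane_smooth_bump:
  assumes "plane_smooth (\<lambda>x y. of_real (g x y))" shows "plane_smooth (\<lambda>x y. of_real (bump k (g x y)))"
  unfolding plane_smooth_def
proof
  fix n
  let ?H = "range (\<lambda>k t. complex_of_real (bump k t))"
  have "plane_Ck n (\<lambda>x y. (\<lambda>t. complex_of_real (bump k t)) (g x y))"
  proof (rule plane_Ck_compose[OF _ assms, of ?H])
    fix h assume "h \<in> ?H"
    then obtain k where h: "h = (\<lambda>t. complex_of_real (bump k t))" by blast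
    have "(h has_vector_derivative (1 * of_real (bump (k + 2) t) + (- of_nat k) * of_real (bump (k + 1) t))) (at t)" for t
      using has_vector_derivative_of_real[OF bump_derivative[of k t]] by (simp add: h)
    then show "\<exists>h1\<in>?H. \<exists>h2\<in>?H. \<exists>a b. \<forall>t. (h has_vector_derivative a * h1 t + b * h2 t) (at t)"
      by (intro bexI[of _ "\<lambda>t. complex_of_real (bump (k + 2) t)"] 
            bexI[of _ "\<lambda>t. complex_of_real (bump (k + 1) t)"] exI[of _ 1] exI[of _ "- of_nat k"] allI) auto
  qed auto
  then show "plane_Ck n (\<lambda>x y. complex_of_real (bump k (g x y)))" .
qed

lemma bump_nonneg: "0 \<le> bump k t" by (simp add: bump_def)

lemma bump0_le_1: "bump 0 t \<le> 1" by (simp add: bump_def)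

text \<open>Rescaled bumps are smooth functions with values in [0,1] that converge pointwise to the
  indicator of the positive half-line.\<close>

lemma bump0_tendsto: "(\<lambda>n. bump 0 (real n * t)) \<longlonglongrightarrow> (if t > 0 then 1 else 0)"
proof (cases "t > 0")
  case True
  have "(\<lambda>n. exp (- ((1 / t) * (1 / real n)))) \<longlonglongrightarrow> exp (- ((1 / t) * 0))"
    by (intro tendsto_intros lim_1_over_n)
  then have "(\<lambda>n. exp (- ((1 / t) * (1 / real n)))) \<longlonglongrightarrow> 1" by simp
  then have "(\<lambda>n. bump 0 (real n * t)) \<longlonglongrightarrow> 1"
    by (rule Lim_transform_eventually)
       (use True in \<open>auto simp: bump_def eventually_sequentially mult.commute intro!: exI[of _ 1]\<close>)
  then show ?thesis using True by simp
next
  case False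
  then have "bump 0 (real n * t) = 0" for n
    by (auto simp: bump_def zero_less_mult_iff)
  then show ?thesis using False by simp
qed

section \<open>Smooth functions and test functions on the cylinder\<close>

lemma smooth_cyl_iff: "f \<in> smooth_cyl \<longleftrightarrow> plane_smooth f \<and> (\<forall>x y. f x (y + 1) = f x y)"
  by (simp add: smooth_cyl_def plane_smooth_def)

lemma smooth_cyl_mult: 
  "f \<in> smooth_cyl \<Longrightarrow> g \<in> smooth_cyl \<Longrightarrow> (\<lambda>x y. f x y * g x y) \<in> smooth_cyl"
  by (simp add: smooth_cyl_iff plane_smooth_mult)

lemma smooth_cyl_add: 
  "f \<in> smooth_cyl \<Longrightarrow> g \<in> smooth_cyl \<Longrightarrow> (\<lambda>x y. f x y + g x y) \<in> smooth_cyl"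
  by (simp add: smooth_cyl_iff plane_smooth_add)

lemma periodic_deriv: 
  fixes u :: "real \<Rightarrow> complex"
  assumes "\<And>y. (u has_vector_derivative u' y) (at y)" "\<And>y. u (y + 1) = u y" shows "u' (y + 1) = u' y"
proof -
  have "((\<lambda>s. u (s + 1)) has_vector_derivative u' (y + 1)) (at y)"
    using vector_diff_chain_at[of "\<lambda>s. s + 1" 1 y u "u' (y + 1)"] assms(1)
    by (simp add: o_def has_vector_derivative_add_const)
  then have "(u has_vector_derivative u' (y + 1)) (at y)" by (simp add: assms(2))
  then show ?thesis using assms(1) vector_derivative_unique_at by blast
qed

lemma smooth_cyl_pd:
  assumes "f \<in> smooth_cyl" shows "pdx f \<in> smooth_cyl" "pdy f \<in> smooth_cyl"
proof -
  have f: "plane_smooth f" and per: "\<And>x y. f x (y + 1) = f x y" using assms by (auto simp: smooth_cyl_iff)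
  have "pdx f x (y + 1) = pdx f x y" for x y by (simp add: pdx_def per)
  moreover have "pdy f x (y + 1) = pdy f x y" for x y
    using periodic_deriv[of "f x" "pdy f x"] plane_smoothD(2)[OF f] per by blast
  ultimately show "pdx f \<in> smooth_cyl" "pdy f \<in> smooth_cyl"
    using plane_smoothD(3,4)[OF f] by (auto simp: smooth_cyl_iff)
qed

lemma pdx_mult:
  assumes "plane_smooth f" "plane_smooth g"
  shows "pdx (\<lambda>x y. f x y * g x y) = (\<lambda>x y. f x y * pdx g x y + pdx f x y * g x y)"
  by (rule pdx_eq) (rule has_vector_derivative_mult[OF plane_smoothD(1)[OF assms(1)] plane_smoothD(1)[OF assms(2)]])

lemma pdy_mult:
  assumes "plane_smooth f" "plane_smooth g"
  shows "pdy (\<lambda>x y. f x y * g x y) = (\<lambda>x y. f x y * pdy g x y + pdy f x y * g x y)"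
  by (rule pdy_eq) (rule has_vector_derivative_mult[OF plane_smoothD(2)[OF assms(1)] plane_smoothD(2)[OF assms(2)]])

lemma test_cyl_mult: 
  assumes "f \<in> smooth_cyl" "\<phi> \<in> test_cyl" shows "(\<lambda>x y. f x y * \<phi> x y) \<in> test_cyl"
  using assms smooth_cyl_mult[of f \<phi>] unfolding test_cyl_def by fastforce

lemma test_cyl_pd:
  assumes "\<phi> \<in> test_cyl" shows "pdx \<phi> \<in> test_cyl" "pdy \<phi> \<in> test_cyl"
proof -
  obtain a b where ab: "0 < a" "b < 1" "\<And>x y. \<phi> x y \<noteq> 0 \<Longrightarrow> a \<le> x \<and> x \<le> b" and s: "\<phi> \<in> smooth_cyl"
    using assms by (auto simp: test_cyl_def)
  have y: "pdy \<phi> x y = 0" if "\<not> (a \<le> x \<and> x \<le> b)" for x y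
  proof -
    have "\<phi> x = (\<lambda>s. 0)" using ab(3) that by blast
    then show ?thesis by (simp add: pdy_def)
  qed
  have x: "pdx \<phi> x y = 0" if "\<not> (a \<le> x \<and> x \<le> b)" for x y
  proof -
    have "((\<lambda>s. \<phi> s y) has_vector_derivative 0) (at x)"
    proof (rule has_vector_derivative_transform_within_open[OF has_vector_derivative_const[of 0]])
      show "open (- {a..b})" by (simp add: open_Compl)
      show "x \<in> - {a..b}" using that by simp
      show "\<And>s. s \<in> - {a..b} \<Longrightarrow> 0 = \<phi> s y" using ab(3) by fastforce
    qed
    then show ?thesis unfolding pdx_def by (rule vector_derivative_at)
  qed
  show "pdx \<phi> \<in> test_cyl" "pdy \<phi> \<in> test_cyl"
    unfolding test_cyl_def using ab(1,2) x y smooth_cyl_pd[OF s] by blast+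
qed

section \<open>Smooth elements of the algebra\<close>

lemma qnorm_tendsto_pointwise:
  assumes "((\<lambda>t. qnorm \<mu> \<nu> (\<lambda>x y p. H t x y p - G x y p)) \<longlongrightarrow> 0) F"
  shows "((\<lambda>t. H t x y p) \<longlongrightarrow> G x y p) F"
  unfolding tendsto_iff
proof (intro allI impI)
  fix e :: real assume "0 < e"
  then have "\<forall>\<^sub>F t in F. qnorm \<mu> \<nu> (\<lambda>x y p. H t x y p - G x y p) < ennreal e"
    using order_tendstoD(2)[OF assms, of "ennreal e"] by simp
  then show "\<forall>\<^sub>F t in F. dist (H t x y p) (G x y p) < e"
  proof eventually_elim
    case (elim t)
    obtain C where "qhm_bound \<mu> \<nu> (\<lambda>x y p. H t x y p - G x y p) C" "ennreal C < ennreal e"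
      using qnorm_less[OF elim] .
    then show ?case using qhm_bound_entry[of \<mu> \<nu> "\<lambda>x y p. H t x y p - G x y p" C x y p] qhm_bound_nonneg
      by (fastforce simp: dist_norm ennreal_less_iff)
  qed
qed

text \<open>Norm derivatives are in particular derivatives of each coefficient. The minus signs
  anticipate that the action translates the arguments by (-r, -s), so that the orbit of P, read at
  the origin, shows P at (u, v).\<close>

lemma norm_Ck_plane_Ck:
  "norm_Ck \<mu> \<nu> k F \<Longrightarrow> plane_Ck k (\<lambda>u v. F (- u, - v, 0) x y p)"
proof (induction k arbitrary: F)
  case 0
  have "continuous_on UNIV (\<lambda>h. F h x y p)"
    unfolding continuous_on_eq_continuous_at[OF open_UNIV] isCont_def
  proof
    fix h :: "real \<times> real \<times> real"
    have "((\<lambda>h'. qnorm \<mu> \<nu> (\<lambda>x y p. F h' x y p - F h x y p)) \<longlongrightarrow> 0) (at h)" 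
      using 0 unfolding norm_Ck.simps by blast
    then show "((\<lambda>h. F h x y p) \<longlongrightarrow> F h x y p) (at h)" by (rule qnorm_tendsto_pointwise)
  qed
  then have "continuous_on UNIV (\<lambda>z::real \<times> real. F (- fst z, - snd z, 0) x y p)"
    by (rule continuous_on_compose2) (auto intro!: continuous_intros)
  then show ?case by simp
next
  case (Suc k)
  have "(1, 0, 0) \<in> (Basis :: (real \<times> real \<times> real) set)" "(0, 1, 0) \<in> (Basis :: (real \<times> real \<times> real) set)"
    by (auto simp: Basis_prod_def zero_prod_def)
  then obtain G1 G2 
    where G1: "\<And>h. ((\<lambda>t. qnorm \<mu> \<nu> (\<lambda>x y p. (F (h + t *\<^sub>R (1, 0, 0)) x y p - F h x y p) / of_real t - G1 h x y p)) \<longlongrightarrow> 0) (at 0)"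
      "norm_Ck \<mu> \<nu> k G1"
    and G2: "\<And>h. ((\<lambda>t. qnorm \<mu> \<nu> (\<lambda>x y p. (F (h + t *\<^sub>R (0, 1, 0)) x y p - F h x y p) / of_real t - G2 h x y p)) \<longlongrightarrow> 0) (at 0)"
      "norm_Ck \<mu> \<nu> k G2"
    using Suc.prems unfolding norm_Ck.simps by blast
  have lim: "((\<lambda>s. f (- s)) has_vector_derivative - D) (at u)" 
    if "((\<lambda>t. (f (- u + t) - f (- u)) / of_real t) \<longlongrightarrow> D) (at 0)" for f :: "real \<Rightarrow> complex" and D u
  proof -
    have "((\<lambda>t. norm ((f (- u + t) - f (- u)) / of_real t - D)) \<longlongrightarrow> 0) (at 0)"
      by (intro tendsto_norm_zero LIM_zero that)
    then have "((\<lambda>t. norm (f (- u + t) - f (- u) - t *\<^sub>R D) / norm t) \<longlongrightarrow> 0) (at 0)"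
    proof (rule Lim_transform_eventually)
      have "norm ((f (- u + t) - f (- u)) / of_real t - D) = norm (f (- u + t) - f (- u) - t *\<^sub>R D) / norm t"
        if "t \<noteq> 0" for t
      proof -
        have "(f (- u + t) - f (- u)) / of_real t - D = (f (- u + t) - f (- u) - t *\<^sub>R D) / of_real t"
          using that by (simp add: diff_divide_distrib scaleR_conv_of_real)
        then show ?thesis by (simp add: norm_divide)
      qed
      then show "\<forall>\<^sub>F t in at 0. norm ((f (- u + t) - f (- u)) / of_real t - D) = 
          norm (f (- u + t) - f (- u) - t *\<^sub>R D) / norm t"
        by (simp add: eventually_at_filter)
    qed
    then have "(f has_vector_derivative D) (at (- u))"
      unfolding has_vector_derivative_def has_derivative_at
      by (simp add: bounded_linear_scaleR_left)
    moreover have "(uminus has_vector_derivative - 1) (at u)"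
      by (rule has_vector_derivative_minus[OF has_vector_derivative_id])
    ultimately show ?thesis
      using vector_diff_chain_at[of uminus "- 1" u f D] by (simp add: o_def)
  qed
  have neg: "plane_Ck k (\<lambda>u v. - G (- u, - v, 0) x y p)" if "norm_Ck \<mu> \<nu> k G" for G
    by (rule plane_Ck_uminus[OF Suc.IH[OF that]])
  show ?case
  proof (rule plane_Ck_SucI)
    fix u v
    show "((\<lambda>s. F (- s, - v, 0) x y p) has_vector_derivative - G1 (- u, - v, 0) x y p) (at u)"
      using qnorm_tendsto_pointwise[OF G1(1)[of "(- u, - v, 0)"], of x y p]
      by (intro lim) simp
    show "((\<lambda>s. F (- u, - s, 0) x y p) has_vector_derivative - G2 (- u, - v, 0) x y p) (at v)"
      using qnorm_tendsto_pointwise[OF G2(1)[of "(- u, - v, 0)"], of x y p]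
      by (intro lim) simp
  qed (use neg G1(2) G2(2) in auto)
qed

text \<open>Up to a smooth phase, the value of P at (u, v) is the value at the origin of P moved by
  (-u, -v, 0). Smoothness along the group is therefore smoothness in the plane.\<close>

lemma smooth_qhm_plane_smooth:
  assumes "P \<in> smooth_qhm c \<mu> \<nu>" shows "plane_smooth (\<lambda>x y. P x y p)"
proof -
  have F: "plane_smooth (\<lambda>u v. heis_act c \<mu> (- u, - v, 0) P 0 0 p)"
    using assms norm_Ck_plane_Ck[of \<mu> \<nu> _ "\<lambda>h. heis_act c \<mu> h P"]
    by (simp add: smooth_qhm_def plane_smooth_def)
  have "P u v p = ee (of_int p * of_int c * v * (u - of_int p * \<mu>)) * heis_act c \<mu> (- u, - v, 0) P 0 0 p" for u v
    unfolding heis_act_def by (simp add: mult.assoc[symmetric] ee_add[symmetric])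
  moreover have "plane_smooth (\<lambda>u v. of_real (of_int p * of_int c * v * (u - of_int p * \<mu>)))"
    unfolding of_real_mult of_real_diff
    by (intro plane_smooth_mult plane_smooth_diff plane_smooth_const plane_smooth_fst plane_smooth_snd)
  ultimately show ?thesis
    using plane_smooth_mult[OF plane_smooth_ee F] by simp
qed

lemma heis_act_0: "heis_act c \<mu> 0 P = P"
  by (intro ext) (simp add: heis_act_def zero_prod_def)

text \<open>\<open>norm_Ck\<close> provides a norm derivative G without placing it in the algebra.
  Pointwise limits are unique, so G at 0 is D; then D is a norm limit of difference quotients, which
  lie in the algebra because the action preserves it.\<close>

lemma smooth_qhm_derivative:
  assumes P: "P \<in> smooth_qhm c \<mu> \<nu>" and b: "b \<in> Basis"
    and D: "\<And>x y p. ((\<lambda>t. heis_act c \<mu> (t *\<^sub>R b) P x y p) has_vector_derivative D x y p) (at 0)"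
  shows "D \<in> qhm c \<mu> \<nu>"
proof -
  have "norm_Ck \<mu> \<nu> (Suc 0) (\<lambda>h. heis_act c \<mu> h P)" using P unfolding smooth_qhm_def by blast
  then obtain G where "\<And>h. ((\<lambda>t. qnorm \<mu> \<nu> (\<lambda>x y p. (heis_act c \<mu> (h + t *\<^sub>R b) P x y p - heis_act c \<mu> h P x y p)
      / of_real t - G h x y p)) \<longlongrightarrow> 0) (at 0)"
    using b unfolding norm_Ck.simps by blast
  from this[of 0] have G: "((\<lambda>t. qnorm \<mu> \<nu> (\<lambda>x y p. (heis_act c \<mu> (t *\<^sub>R b) P x y p - P x y p)
      / of_real t - G 0 x y p)) \<longlongrightarrow> 0) (at 0)"
    by (simp add: heis_act_0)
  have "G 0 x y p = D x y p" for x y p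
  proof (rule tendsto_unique[OF _ qnorm_tendsto_pointwise[OF G, of x y p]])
    let ?f = "\<lambda>t. heis_act c \<mu> (t *\<^sub>R b) P x y p"
    have "((\<lambda>t. norm (?f t - P x y p - t *\<^sub>R D x y p) / norm t) \<longlongrightarrow> 0) (at 0)"
      using D[of x y p] by (simp add: has_vector_derivative_def has_derivative_at heis_act_0)
    then have "((\<lambda>t. norm ((?f t - P x y p) / of_real t - D x y p)) \<longlongrightarrow> 0) (at 0)"
    proof (rule Lim_transform_eventually)
      have "norm (?f t - P x y p - t *\<^sub>R D x y p) / norm t = norm ((?f t - P x y p) / of_real t - D x y p)"
        if "t \<noteq> 0" for t
      proof -
        have "(?f t - P x y p) / of_real t - D x y p = (?f t - P x y p - t *\<^sub>R D x y p) / of_real t"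
          using that by (simp add: diff_divide_distrib scaleR_conv_of_real)
        then show ?thesis by (simp add: norm_divide)
      qed
      then show "\<forall>\<^sub>F t in at 0. norm (?f t - P x y p - t *\<^sub>R D x y p) / norm t = 
          norm ((?f t - P x y p) / of_real t - D x y p)"
        by (simp add: eventually_at_filter)
    qed
    then show "((\<lambda>t. (?f t - P x y p) / of_real t) \<longlongrightarrow> D x y p) (at 0)"
      by (rule LIM_zero_cancel[OF tendsto_norm_zero_cancel])
  qed simp
  then have GD: "G 0 = D" by (intro ext)
  show ?thesis
  proof (rule qhm_closed)
    fix e :: real assume "0 < e"
    then have "\<forall>\<^sub>F t in at 0. qnorm \<mu> \<nu> (\<lambda>x y p. (heis_act c \<mu> (t *\<^sub>R b) P x y p - P x y p)
      / of_real t - D x y p) < ennreal e"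
      by (intro order_tendstoD(2)[OF G[unfolded GD]]) simp
    from eventually_happens'[OF at_neq_bot this] obtain t 
      where "qnorm \<mu> \<nu> (\<lambda>x y p. (heis_act c \<mu> (t *\<^sub>R b) P x y p - P x y p)
        / of_real t - D x y p) < ennreal e" ..
    from qnorm_less[OF this] obtain C 
      where C: "qhm_bound \<mu> \<nu> (\<lambda>x y p. (heis_act c \<mu> (t *\<^sub>R b) P x y p - P x y p) / of_real t - D x y p) C" 
        "ennreal C < ennreal e" .
    let ?\<Psi> = "\<lambda>x y p. inverse (of_real t) * (heis_act c \<mu> (t *\<^sub>R b) P x y p + (- 1) * P x y p)"
    obtain r s u where tb: "t *\<^sub>R b = (r, s, u)" by (cases "t *\<^sub>R b") auto
    have "P \<in> qhm c \<mu> \<nu>" using P by (simp add: smooth_qhm_def)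
    then have "?\<Psi> \<in> qhm c \<mu> \<nu>"
      unfolding tb by (intro qhm_scale qhm_add qhm_heis_act)
    moreover have "C \<le> e" using C qhm_bound_nonneg[OF C(1)] by (simp add: ennreal_less_iff)
    then have "qhm_bound \<mu> \<nu> (\<lambda>x y p. - 1 * ((heis_act c \<mu> (t *\<^sub>R b) P x y p - P x y p) / of_real t - D x y p)) e"
      using qhm_bound_mono[OF qhm_bound_scale[OF C(1), of "-1"]] by simp
    then have "qhm_bound \<mu> \<nu> (\<lambda>x y p. D x y p - ?\<Psi> x y p) e"
      by (rule back_subst[where P = "\<lambda>M. qhm_bound \<mu> \<nu> M e"])
         (intro ext, simp add: divide_inverse mult.commute)
    ultimately show "\<exists>\<Psi>\<in>qhm c \<mu> \<nu>. qhm_bound \<mu> \<nu> (\<lambda>x y p. D x y p - \<Psi> x y p) e"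
      by (intro bexI[of _ ?\<Psi>])
  qed
qed

lemma has_vector_derivative_ee_mult: 
  "((\<lambda>t. ee (a * t)) has_vector_derivative 2 * of_real pi * \<i> * of_real a * ee (a * t)) (at t)"
proof -
  have "((\<lambda>t. a * t) has_vector_derivative a) (at t)"
    by (auto simp flip: has_real_derivative_iff_has_vector_derivative intro!: derivative_eq_intros)
  from vector_diff_chain_at[OF this has_vector_derivative_ee] show ?thesis
    by (simp add: o_def scaleR_conv_of_real mult_ac)
qed

lemma has_vector_derivative_reflect:
  fixes f :: "real \<Rightarrow> complex"
  assumes "(f has_vector_derivative D) (at x)"
  shows "((\<lambda>t. f (x - t)) has_vector_derivative - D) (at 0)"
proof -
  have "((\<lambda>t. x - t) has_vector_derivative - 1) (at 0)"
    by (auto simp flip: has_real_derivative_iff_has_vector_derivative intro!: derivative_eq_intros)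
  from vector_diff_chain_at[OF this, of f D] assms show ?thesis by (simp add: o_def)
qed

lemma smooth_qhm_qdelta:
  assumes P: "P \<in> smooth_qhm c \<mu> \<nu>" shows "qdelta c \<mu> j P \<in> qhm c \<mu> \<nu>"
proof (cases j)
  case HX
  show ?thesis
  proof (rule smooth_qhm_derivative[OF P, of "(0, 1, 0)"])
    fix x y p
    have "((\<lambda>t. ee (of_int p * of_int c * (x - of_int p * \<mu>) * t) * P x (y - t) p) has_vector_derivative
       ee (of_int p * of_int c * (x - of_int p * \<mu>) * 0) * - pdy (\<lambda>x y. P x y p) x y + 
       2 * of_real pi * \<i> * of_real (of_int p * of_int c * (x - of_int p * \<mu>))
         * ee (of_int p * of_int c * (x - of_int p * \<mu>) * 0) * P x (y - 0) p) (at 0)"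
      by (rule has_vector_derivative_mult[OF has_vector_derivative_ee_mult 
          has_vector_derivative_reflect[OF plane_smoothD(2)[OF smooth_qhm_plane_smooth[OF P]]]])
    then show "((\<lambda>t. heis_act c \<mu> (t *\<^sub>R (0, 1, 0)) P x y p) has_vector_derivative qdelta c \<mu> j P x y p) (at 0)"
      by (simp add: HX heis_act_def pdy_def mult_ac)
  qed (auto simp: Basis_prod_def zero_prod_def)
next
  case HY
  show ?thesis
  proof (rule smooth_qhm_derivative[OF P, of "(1, 0, 0)"])
    fix x y p
    show "((\<lambda>t. heis_act c \<mu> (t *\<^sub>R (1, 0, 0)) P x y p) has_vector_derivative qdelta c \<mu> j P x y p) (at 0)"
      using has_vector_derivative_reflect[OF plane_smoothD(1)[OF smooth_qhm_plane_smooth[OF P, of p]], of x y]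
      by (simp add: HY heis_act_def pdx_def)
  qed (auto simp: Basis_prod_def zero_prod_def)
next
  case HZ
  show ?thesis
  proof (rule smooth_qhm_derivative[OF P, of "(0, 0, 1)"])
    fix x y p
    show "((\<lambda>t. heis_act c \<mu> (t *\<^sub>R (0, 0, 1)) P x y p) has_vector_derivative qdelta c \<mu> j P x y p) (at 0)"
      using has_vector_derivative_mult_left[OF has_vector_derivative_ee_mult[of "of_int p" 0], of "P x y p"]
      by (simp add: HZ heis_act_def)
  qed (auto simp: Basis_prod_def zero_prod_def)
qed

section \<open>Square integrable functions\<close>

definition norm_sq :: "'a measure \<Rightarrow> ('a \<Rightarrow> complex) \<Rightarrow> ennreal" where
  "norm_sq M f = (\<integral>\<^sup>+z. ennreal ((cmod (f z))\<^sup>2) \<partial>M)"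

definition L2 :: "'a measure \<Rightarrow> ('a \<Rightarrow> complex) set" where
  "L2 M = {f. f \<in> borel_measurable M \<and> norm_sq M f < \<infinity>}"

lemma L2D: "f \<in> L2 M \<Longrightarrow> f \<in> borel_measurable M" "f \<in> L2 M \<Longrightarrow> norm_sq M f < \<infinity>"
  by (auto simp: L2_def)

lemma norm_sq_mono: "AE z in M. cmod (f z) \<le> cmod (g z) \<Longrightarrow> norm_sq M f \<le> norm_sq M g"
  unfolding norm_sq_def by (intro nn_integral_mono_AE) (auto intro!: ennreal_leI power_mono)

lemma norm_sq_cong: "AE z in M. f z = g z \<Longrightarrow> norm_sq M f = norm_sq M g"
  unfolding norm_sq_def by (intro nn_integral_cong_AE) auto

text \<open>Squared norms are used throughout, with this inequality in the role of the triangle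
  inequality. The factors 2 are harmless, as only finiteness, convergence and boundedness are at
  stake.\<close>

lemma cmod_add_sq: "(cmod (a + b))\<^sup>2 \<le> 2 * (cmod a)\<^sup>2 + 2 * (cmod b)\<^sup>2"
proof -
  have "(cmod (a + b))\<^sup>2 \<le> (cmod a + cmod b)\<^sup>2"
    by (intro power_mono norm_triangle_ineq) auto
  also have "\<dots> \<le> 2 * (cmod a)\<^sup>2 + 2 * (cmod b)\<^sup>2"
    using zero_le_power2[of "cmod a - cmod b"] by (simp add: power2_eq_square algebra_simps)
  finally show ?thesis .
qed

lemma norm_sq_add:
  assumes "f \<in> borel_measurable M" "g \<in> borel_measurable M"
  shows "norm_sq M (\<lambda>z. f z + g z) \<le> 2 * norm_sq M f + 2 * norm_sq M g"
proof -
  have [measurable]: "f \<in> borel_measurable M" "g \<in> borel_measurable M" by fact+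
  have "norm_sq M (\<lambda>z. f z + g z) \<le> (\<integral>\<^sup>+z. 2 * ennreal ((cmod (f z))\<^sup>2) + 2 * ennreal ((cmod (g z))\<^sup>2) \<partial>M)"
    unfolding norm_sq_def
  proof (rule nn_integral_mono)
    fix z
    have "ennreal ((cmod (f z + g z))\<^sup>2) \<le> ennreal (2 * (cmod (f z))\<^sup>2 + 2 * (cmod (g z))\<^sup>2)"
      by (intro ennreal_leI cmod_add_sq)
    then show "ennreal ((cmod (f z + g z))\<^sup>2) \<le> 2 * ennreal ((cmod (f z))\<^sup>2) + 2 * ennreal ((cmod (g z))\<^sup>2)"
      by (simp add: ennreal_mult)
  qed
  also have "\<dots> = 2 * norm_sq M f + 2 * norm_sq M g"
    unfolding norm_sq_def by (subst nn_integral_add) (auto simp: nn_integral_cmult)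
  finally show ?thesis .
qed

lemma norm_sq_mult_le:
  assumes "f \<in> borel_measurable M" "\<And>z. z \<in> space M \<Longrightarrow> cmod (a z) \<le> B" "0 \<le> B"
  shows "norm_sq M (\<lambda>z. a z * f z) \<le> ennreal (B\<^sup>2) * norm_sq M f"
proof -
  have [measurable]: "f \<in> borel_measurable M" by fact+
  have "norm_sq M (\<lambda>z. a z * f z) \<le> (\<integral>\<^sup>+z. ennreal (B\<^sup>2) * ennreal ((cmod (f z))\<^sup>2) \<partial>M)"
    unfolding norm_sq_def
  proof (rule nn_integral_mono)
    fix z assume "z \<in> space M"
    then have "(cmod (a z * f z))\<^sup>2 \<le> B\<^sup>2 * (cmod (f z))\<^sup>2"
      unfolding norm_mult power_mult_distrib using assms by (intro mult_right_mono power_mono) auto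
    then show "ennreal ((cmod (a z * f z))\<^sup>2) \<le> ennreal (B\<^sup>2) * ennreal ((cmod (f z))\<^sup>2)"
      by (simp add: ennreal_mult[symmetric] ennreal_leI)
  qed
  also have "\<dots> = ennreal (B\<^sup>2) * norm_sq M f"
    unfolding norm_sq_def by (simp add: nn_integral_cmult)
  finally show ?thesis .
qed

lemma norm_sq_cmult: "f \<in> borel_measurable M \<Longrightarrow> norm_sq M (\<lambda>z. k * f z) = ennreal ((cmod k)\<^sup>2) * norm_sq M f"
  unfolding norm_sq_def by (subst nn_integral_cmult[symmetric]) 
    (auto simp: norm_mult power_mult_distrib ennreal_mult intro!: nn_integral_cong)

lemma norm_sq_uminus: "norm_sq M (\<lambda>z. - f z) = norm_sq M f"
  unfolding norm_sq_def by simp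

lemma norm_sq_minus_commute: "norm_sq M (\<lambda>z. f z - g z) = norm_sq M (\<lambda>z. g z - f z)"
  unfolding norm_sq_def by (simp add: norm_minus_commute)

lemma norm_sq_triangle:
  assumes "f \<in> borel_measurable M" "g \<in> borel_measurable M" "h \<in> borel_measurable M"
  shows "norm_sq M (\<lambda>z. f z - h z) \<le> 2 * norm_sq M (\<lambda>z. f z - g z) + 2 * norm_sq M (\<lambda>z. g z - h z)"
  using norm_sq_add[of "\<lambda>z. f z - g z" M "\<lambda>z. g z - h z"] assms by simp

lemma ennreal_two_less_top: "a < \<infinity> \<Longrightarrow> b < \<infinity> \<Longrightarrow> 2 * a + 2 * b < (\<infinity>::ennreal)"
  by (simp add: ennreal_mult_less_top)

lemma L2_add: 
  assumes "f \<in> L2 M" "g \<in> L2 M" shows "(\<lambda>z. f z + g z) \<in> L2 M"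
proof -
  have "norm_sq M (\<lambda>z. f z + g z) < \<infinity>"
    using order_le_less_trans[OF norm_sq_add ennreal_two_less_top] assms by (auto simp: L2_def)
  then show ?thesis using assms by (auto simp: L2_def)
qed

lemma L2_mult:
  assumes "f \<in> L2 M" "a \<in> borel_measurable M" "\<And>z. z \<in> space M \<Longrightarrow> cmod (a z) \<le> B"
  shows "(\<lambda>z. a z * f z) \<in> L2 M"
proof -
  have "norm_sq M (\<lambda>z. a z * f z) \<le> ennreal ((max B 0)\<^sup>2) * norm_sq M f"
    using assms by (intro norm_sq_mult_le) (auto simp: L2_def le_max_iff_disj)
  also have "\<dots> < \<infinity>" using assms by (auto simp: L2_def ennreal_mult_less_top)
  finally show ?thesis using assms by (auto simp: L2_def)
qed

lemma L2_cmult: "f \<in> L2 M \<Longrightarrow> (\<lambda>z. k * f z) \<in> L2 M"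
  by (rule L2_mult[of _ _ _ "cmod k"]) auto

lemma L2_diff: "f \<in> L2 M \<Longrightarrow> g \<in> L2 M \<Longrightarrow> (\<lambda>z. f z - g z) \<in> L2 M"
  using L2_add[OF _ L2_cmult[of g M "-1"], of f] by simp

lemma L2_0: "(\<lambda>z. 0) \<in> L2 M"
  by (simp add: L2_def norm_sq_def)

lemma L2_sum: "(\<And>i. i \<in> I \<Longrightarrow> f i \<in> L2 M) \<Longrightarrow> (\<lambda>z. \<Sum>i\<in>I. f i z) \<in> L2 M"
  by (induction I rule: infinite_finite_induct) (auto intro!: L2_add simp: L2_0)

lemma L2_cnj: "f \<in> L2 M \<Longrightarrow> (\<lambda>z. cnj (f z)) \<in> L2 M"
proof -
  assume f: "f \<in> L2 M"
  have "cnj \<in> borel_measurable borel"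
    by (intro borel_measurable_continuous_onI continuous_intros)
  from measurable_compose[OF L2D(1)[OF f] this] f show ?thesis by (simp add: L2_def norm_sq_def)
qed

lemma L2_prod_norm:
  assumes "f \<in> L2 M" "g \<in> L2 M"
  shows "(\<integral>\<^sup>+z. ennreal (cmod (f z * g z)) \<partial>M)\<^sup>2 \<le> norm_sq M f * norm_sq M g"
proof -
  have [measurable]: "f \<in> borel_measurable M" "g \<in> borel_measurable M" using assms by (auto simp: L2_def)
  show ?thesis
    using Cauchy_Schwarz_nn_integral[of "\<lambda>z. ennreal (cmod (f z))" M "\<lambda>z. ennreal (cmod (g z))"]
    unfolding norm_sq_def by (simp add: norm_mult ennreal_mult ennreal_power)
qed

lemma L2_integrable:
  assumes "f \<in> L2 M" "g \<in> L2 M" shows "integrable M (\<lambda>z. f z * g z)"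
proof (rule integrableI_bounded)
  have "(\<integral>\<^sup>+z. ennreal (cmod (f z * g z)) \<partial>M)\<^sup>2 < \<infinity>"
    using L2_prod_norm[OF assms] assms 
    by (intro order_le_less_trans[OF L2_prod_norm[OF assms]]) (auto simp: L2_def ennreal_mult_less_top)
  then show "(\<integral>\<^sup>+z. ennreal (cmod (f z * g z)) \<partial>M) < \<infinity>"
    by (simp add: power_less_top_ennreal)
qed (use assms in \<open>auto simp: L2_def\<close>)

lemma L2_integral_tendsto:
  assumes f: "f \<in> L2 M" and fn: "\<And>n. F n \<in> L2 M" and g: "g \<in> L2 M" 
    and lim: "(\<lambda>n. norm_sq M (\<lambda>z. F n z - f z)) \<longlonglongrightarrow> 0"
  shows "(\<lambda>n. LINT z|M. F n z * g z) \<longlonglongrightarrow> (LINT z|M. f z * g z)"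
proof -
  obtain G where G: "norm_sq M g = ennreal G" "0 \<le> G" using g by (cases "norm_sq M g") (auto simp: L2_def)
  have "(\<lambda>n. norm_sq M (\<lambda>z. F n z - f z) * ennreal G) \<longlonglongrightarrow> 0 * ennreal G"
    unfolding mult.commute[of _ "ennreal G"] by (intro ennreal_tendsto_cmult lim) auto
  then have lim2: "(\<lambda>n. norm_sq M (\<lambda>z. F n z - f z) * norm_sq M g) \<longlonglongrightarrow> 0" using G by simp
  have le: "ennreal ((cmod ((LINT z|M. F n z * g z) - (LINT z|M. f z * g z)))\<^sup>2) \<le> norm_sq M (\<lambda>z. F n z - f z) * norm_sq M g" for n
  proof -
    have "(LINT z|M. F n z * g z) - (LINT z|M. f z * g z) = (LINT z|M. (F n z - f z) * g z)"
      by (subst Bochner_Integration.integral_diff[symmetric]) 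
         (auto intro!: L2_integrable f fn g simp: left_diff_distrib)
    moreover have "ennreal (cmod (LINT z|M. (F n z - f z) * g z)) \<le> (\<integral>\<^sup>+z. ennreal (cmod ((F n z - f z) * g z)) \<partial>M)"
      by (intro integral_norm_bound_ennreal L2_integrable L2_diff f fn g)
    ultimately have "(ennreal (cmod ((LINT z|M. F n z * g z) - (LINT z|M. f z * g z))))\<^sup>2 
      \<le> (\<integral>\<^sup>+z. ennreal (cmod ((F n z - f z) * g z)) \<partial>M)\<^sup>2"
      by (simp add: power_mono)
    also have "\<dots> \<le> norm_sq M (\<lambda>z. F n z - f z) * norm_sq M g"
      by (intro L2_prod_norm L2_diff f fn g)
    finally show ?thesis by (simp add: ennreal_power)
  qed
  have "(\<lambda>n. ennreal ((cmod ((LINT z|M. F n z * g z) - (LINT z|M. f z * g z)))\<^sup>2)) \<longlonglongrightarrow> 0"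
    by (rule tendsto_sandwich[OF _ _ tendsto_const lim2]) (auto intro: le always_eventually)
  then have "(\<lambda>n. (cmod ((LINT z|M. F n z * g z) - (LINT z|M. f z * g z)))\<^sup>2) \<longlonglongrightarrow> 0"
    by (simp flip: ennreal_0)
  then have "(\<lambda>n. sqrt ((cmod ((LINT z|M. F n z * g z) - (LINT z|M. f z * g z)))\<^sup>2)) \<longlonglongrightarrow> sqrt 0"
    by (rule tendsto_real_sqrt)
  then show ?thesis by (simp add: tendsto_norm_zero_iff LIM_zero_iff)
qed

text \<open>The limit inherits the bound w, so the squared difference is dominated by 4 w^2, which
  is integrable.\<close>

lemma norm_sq_dominated:
  assumes f: "f \<in> borel_measurable M" and fn: "\<And>n. F n \<in> borel_measurable M"
    and w: "w \<in> borel_measurable M" "(\<integral>\<^sup>+z. ennreal ((w z)\<^sup>2) \<partial>M) < \<infinity>"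
    and bd: "\<And>n. AE z in M. cmod (F n z) \<le> w z"
    and lim: "AE z in M. (\<lambda>n. F n z) \<longlonglongrightarrow> f z"
  shows "(\<lambda>n. norm_sq M (\<lambda>z. F n z - f z)) \<longlonglongrightarrow> 0"
proof -
  have bd': "AE z in M. \<forall>n. cmod (F n z) \<le> w z" by (intro AE_all_countable[THEN iffD2] allI bd)
  note [measurable] = f fn w(1)
  have "(\<lambda>n. \<integral>\<^sup>+z. ennreal (norm (0 - (cmod (F n z - f z))\<^sup>2)) \<partial>M) \<longlonglongrightarrow> 0"
  proof (rule nn_integral_dominated_convergence_norm)
    show "(\<integral>\<^sup>+z. ennreal (4 * (w z)\<^sup>2) \<partial>M) < \<infinity>"
      using w by (simp add: ennreal_mult nn_integral_cmult ennreal_mult_less_top)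
    show "AE z in M. norm ((cmod (F n z - f z))\<^sup>2) \<le> 4 * (w z)\<^sup>2" for n
      using bd' lim
    proof eventually_elim
      case (elim z)
      have "cmod (f z) \<le> w z"
        by (rule tendsto_upperbound[OF tendsto_norm[OF elim(2)]]) (use elim(1) in auto)
      then have "cmod (F n z - f z) \<le> 2 * w z"
        using elim(1) norm_triangle_ineq4[of "F n z" "f z"] by (smt (verit))
      then have "(cmod (F n z - f z))\<^sup>2 \<le> (2 * w z)\<^sup>2" by (intro power_mono) auto
      then show ?case by (simp add: power_mult_distrib)
    qed
    show "AE z in M. (\<lambda>n. (cmod (F n z - f z))\<^sup>2) \<longlonglongrightarrow> 0"
      using lim
    proof eventually_elim
      case (elim z)
      have "(\<lambda>n. (cmod (F n z - f z))\<^sup>2) \<longlonglongrightarrow> 0\<^sup>2"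
        by (intro tendsto_power tendsto_norm_zero LIM_zero elim)
      then show ?case by simp
    qed
  qed measurable
  then show ?thesis by (simp add: norm_sq_def)
qed

lemma norm_sq_eq_0:
  assumes "f \<in> borel_measurable M" "norm_sq M f = 0" shows "AE z in M. f z = 0"
proof -
  have [measurable]: "f \<in> borel_measurable M" by fact
  have "AE z in M. ennreal ((cmod (f z))\<^sup>2) = 0"
    using assms(2) unfolding norm_sq_def by (subst (asm) nn_integral_0_iff_AE) auto
  then show ?thesis by eventually_elim simp
qed

section \<open>Test functions are dense\<close>

abbreviation Sq :: "(real \<times> real) measure" where
  "Sq \<equiv> lebesgue_on unit_square"

lemma unit_square_cbox: "unit_square = cbox (0, 0) (1, 1)"
  by (auto simp: cbox_Pair_eq)

lemma unit_square_lebesgue [simp, measurable]: "unit_square \<in> sets lebesgue"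
  unfolding unit_square_cbox by simp

lemma emeasure_Sq: "emeasure Sq unit_square = 1"
proof -
  have "unit_square \<in> sets lborel" by (simp add: unit_square_cbox)
  then have "emeasure Sq unit_square = emeasure lborel unit_square"
    by (subst emeasure_restrict_space) simp_all
  also have "\<dots> = emeasure lborel (cbox (0, 0) (1, 1) :: (real \<times> real) set)"
    by (simp only: unit_square_cbox)
  also have "\<dots> = (\<Prod>b\<in>Basis. ((1, 1) - (0, 0)) \<bullet> (b :: real \<times> real))"
    by (rule emeasure_lborel_cbox) (auto simp: Basis_prod_def)
  also have "\<dots> = 1" by (auto simp: Basis_prod_def intro!: prod.neutral)
  finally show ?thesis by simp
qed

lemma finite_measure_Sq: "finite_measure Sq"
  by (rule finite_measureI) (simp add: emeasure_Sq)

lemma L2_bounded: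
  assumes "finite_measure M" "f \<in> borel_measurable M" "\<And>z. z \<in> space M \<Longrightarrow> cmod (f z) \<le> B"
  shows "f \<in> L2 M"
proof -
  have "(\<lambda>z. 1) \<in> L2 M"
    using finite_measure.emeasure_finite[OF assms(1)] by (simp add: L2_def norm_sq_def less_top)
  from L2_mult[OF this assms(2,3)] show ?thesis by simp
qed

lemma continuous_measurable:
  fixes f :: "'a::euclidean_space \<Rightarrow> complex"
  assumes "continuous_on UNIV f" shows "f \<in> borel_measurable (lebesgue_on S)"
  using assms by (intro measurable_restrict_space1 measurable_completion)
    (simp add: borel_measurable_continuous_onI)

lemma continuous_L2:
  fixes f :: "'a::euclidean_space \<Rightarrow> complex"
  assumes "continuous_on UNIV f" shows "f \<in> L2 (lebesgue_on (cbox a b))"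
proof -
  have "bounded (f ` cbox a b)"
    by (intro compact_imp_bounded compact_continuous_image continuous_on_subset[OF assms]) auto
  then obtain B where "\<And>z. z \<in> cbox a b \<Longrightarrow> cmod (f z) \<le> B"
    by (auto simp: bounded_iff)
  moreover have "finite_measure (lebesgue_on (cbox a b))"
    by (rule finite_measureI) (auto simp: emeasure_restrict_space emeasure_lborel_cbox_eq)
  ultimately show ?thesis
    using L2_bounded[of "lebesgue_on (cbox a b)" f B] continuous_measurable[OF assms] by simp
qed

lemma plane_smooth_L2: "plane_smooth f \<Longrightarrow> (\<lambda>z. f (fst z) (snd z)) \<in> L2 Sq"
  unfolding unit_square_cbox by (rule continuous_L2[OF plane_smoothD(5)])

lemma L2_cyl_iff: "f \<in> L2_cyl \<longleftrightarrow> (\<lambda>z. f (fst z) (snd z)) \<in> L2 Sq"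
  by (simp add: L2_cyl_def L2_def l2_square_def norm_sq_def)

lemma l2_square_norm_sq: "l2_square f = norm_sq Sq (\<lambda>z. f (fst z) (snd z))"
  by (simp add: l2_square_def norm_sq_def)

lemma test_cyl_smooth: "\<phi> \<in> test_cyl \<Longrightarrow> \<phi> \<in> smooth_cyl" "\<phi> \<in> test_cyl \<Longrightarrow> plane_smooth \<phi>"
  by (auto simp: test_cyl_def smooth_cyl_iff)

lemma test_cyl_add: 
  assumes "\<phi> \<in> test_cyl" "\<psi> \<in> test_cyl" shows "(\<lambda>x y. \<phi> x y + \<psi> x y) \<in> test_cyl"
proof -
  obtain a b where 1: "0 < a" "b < 1" "\<And>x y. \<phi> x y \<noteq> 0 \<Longrightarrow> a \<le> x \<and> x \<le> b"
    using assms(1) by (auto simp: test_cyl_def)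
  obtain a' b' where 2: "0 < a'" "b' < 1" "\<And>x y. \<psi> x y \<noteq> 0 \<Longrightarrow> a' \<le> x \<and> x \<le> b'"
    using assms(2) by (auto simp: test_cyl_def)
  have "min a a' \<le> x \<and> x \<le> max b b'" if "\<phi> x y + \<psi> x y \<noteq> 0" for x y
    using that 1(3)[of x y] 2(3)[of x y] by (cases "\<phi> x y = 0") auto
  moreover have "0 < min a a'" "max b b' < 1" using 1 2 by auto
  moreover have "(\<lambda>x y. \<phi> x y + \<psi> x y) \<in> smooth_cyl"
    using assms by (intro smooth_cyl_add test_cyl_smooth)
  ultimately show ?thesis unfolding test_cyl_def by blast
qed

lemma test_cyl_cmult: "\<phi> \<in> test_cyl \<Longrightarrow> (\<lambda>x y. k * \<phi> x y) \<in> test_cyl"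
  by (rule test_cyl_mult) (auto simp: smooth_cyl_iff plane_smooth_const)

text \<open>The closure of the test functions in L2 of the square. It is shown to be everything by
  climbing from open boxes to Borel sets, Lebesgue sets and simple functions.\<close>

definition test_closure :: "(real \<times> real \<Rightarrow> complex) set" where
  "test_closure = {f \<in> L2 Sq. \<forall>e>0. \<exists>\<phi>\<in>test_cyl. norm_sq Sq (\<lambda>z. f z - \<phi> (fst z) (snd z)) < ennreal e}"

lemma test_closure_limit:
  assumes f: "f \<in> L2 Sq" and F: "\<And>n. F n \<in> test_closure" 
    and lim: "(\<lambda>n. norm_sq Sq (\<lambda>z. F n z - f z)) \<longlonglongrightarrow> 0"
  shows "f \<in> test_closure"
  unfolding test_closure_def
proof (intro CollectI conjI f allI impI)
  fix e :: real assume e: "0 < e"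
  then have "\<forall>\<^sub>F n in sequentially. norm_sq Sq (\<lambda>z. F n z - f z) < ennreal (e/8)"
    using order_tendstoD(2)[OF lim, of "ennreal (e/8)"] by simp
  then obtain n where n: "norm_sq Sq (\<lambda>z. f z - F n z) < ennreal (e/8)"
    unfolding norm_sq_minus_commute[of _ f] using eventually_happens'[OF sequentially_bot] by fastforce
  \<comment> \<open>Two errors below e/8, each doubled by the squared triangle inequality, make e/2
    and leave room for a strict inequality.\<close>
  have "0 < e/8" using e by simp
  then obtain \<phi> where \<phi>: "\<phi> \<in> test_cyl" "norm_sq Sq (\<lambda>z. F n z - \<phi> (fst z) (snd z)) < ennreal (e/8)"
    using F[of n] unfolding test_closure_def by blast
  have "norm_sq Sq (\<lambda>z. f z - \<phi> (fst z) (snd z)) 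
    \<le> 2 * norm_sq Sq (\<lambda>z. f z - F n z) + 2 * norm_sq Sq (\<lambda>z. F n z - \<phi> (fst z) (snd z))"
    using F[of n] f \<phi>(1) 
    by (intro norm_sq_triangle L2D plane_smooth_L2 test_cyl_smooth) (auto simp: test_closure_def)
  also have "\<dots> \<le> 2 * ennreal (e/8) + 2 * ennreal (e/8)"
    using n \<phi>(2) by (intro add_mono mult_left_mono) auto
  also have "\<dots> = ennreal (e/2)"
    using e by (simp only: mult_2) (simp add: ennreal_plus[symmetric] del: ennreal_plus)
  also have "\<dots> < ennreal e" using e by (simp add: ennreal_less_iff)
  finally show "\<exists>\<phi>\<in>test_cyl. norm_sq Sq (\<lambda>z. f z - \<phi> (fst z) (snd z)) < ennreal e" using \<phi>(1) by blast
qed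

lemma test_closure_test: 
  assumes "\<phi> \<in> test_cyl" shows "(\<lambda>z. \<phi> (fst z) (snd z)) \<in> test_closure"
  unfolding test_closure_def using assms
  by (auto simp: norm_sq_def intro!: plane_smooth_L2 test_cyl_smooth bexI[of _ \<phi>])

text \<open>A constant sequence converges in L2 to every function that agrees with it almost
  everywhere.\<close>

lemma test_closure_cong:
  assumes "f \<in> test_closure" "g \<in> L2 Sq" "AE z in Sq. f z = g z" shows "g \<in> test_closure"
proof (rule test_closure_limit[OF assms(2), of "\<lambda>n. f"])
  have "norm_sq Sq (\<lambda>z. f z - g z) = norm_sq Sq (\<lambda>z. 0)"
    by (rule norm_sq_cong) (use assms(3) in auto)
  then show "(\<lambda>n. norm_sq Sq (\<lambda>z. f z - g z)) \<longlonglongrightarrow> 0" by (simp add: norm_sq_def)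
qed (rule assms)

lemma test_closure_seq:
  assumes "f \<in> test_closure"
  obtains \<phi> where "\<And>n. \<phi> n \<in> test_cyl" "(\<lambda>n. norm_sq Sq (\<lambda>z. \<phi> n (fst z) (snd z) - f z)) \<longlonglongrightarrow> 0"
proof -
  have "\<forall>n. \<exists>\<phi>. \<phi> \<in> test_cyl \<and> norm_sq Sq (\<lambda>z. f z - \<phi> (fst z) (snd z)) < ennreal (1 / Suc n)"
  proof
    fix n have "0 < 1 / real (Suc n)" by simp
    then show "\<exists>\<phi>. \<phi> \<in> test_cyl \<and> norm_sq Sq (\<lambda>z. f z - \<phi> (fst z) (snd z)) < ennreal (1 / Suc n)"
      using assms unfolding test_closure_def by blast
  qed
  from choice[OF this] obtain \<phi> 
    where \<phi>: "\<forall>n. \<phi> n \<in> test_cyl \<and> norm_sq Sq (\<lambda>z. f z - \<phi> n (fst z) (snd z)) < ennreal (1 / Suc n)" ..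
  have l: "(\<lambda>n. ennreal (1 / Suc n)) \<longlonglongrightarrow> 0"
    using LIMSEQ_Suc[OF lim_1_over_n[where 'a=real]] by (simp flip: ennreal_0)
  have "(\<lambda>n. norm_sq Sq (\<lambda>z. \<phi> n (fst z) (snd z) - f z)) \<longlonglongrightarrow> 0"
    by (rule tendsto_sandwich[OF _ _ tendsto_const l])
       (use \<phi> in \<open>auto simp: norm_sq_minus_commute[of _ _ f] intro!: always_eventually less_imp_le\<close>)
  then show thesis using that \<phi> by blast
qed

lemma test_closure_add:
  assumes "f \<in> test_closure" "g \<in> test_closure" shows "(\<lambda>z. f z + g z) \<in> test_closure"
proof -
  obtain \<phi> where \<phi>: "\<And>n. \<phi> n \<in> test_cyl" "(\<lambda>n. norm_sq Sq (\<lambda>z. \<phi> n (fst z) (snd z) - f z)) \<longlonglongrightarrow> 0"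
    using test_closure_seq[OF assms(1)] by blast
  obtain \<psi> where \<psi>: "\<And>n. \<psi> n \<in> test_cyl" "(\<lambda>n. norm_sq Sq (\<lambda>z. \<psi> n (fst z) (snd z) - g z)) \<longlonglongrightarrow> 0"
    using test_closure_seq[OF assms(2)] by blast
  have L2: "f \<in> L2 Sq" "g \<in> L2 Sq" using assms by (auto simp: test_closure_def)
  have meas: "(\<lambda>z. \<phi> n (fst z) (snd z)) \<in> borel_measurable Sq" "(\<lambda>z. \<psi> n (fst z) (snd z)) \<in> borel_measurable Sq" for n
    by (intro L2D plane_smooth_L2 test_cyl_smooth \<phi> \<psi>)+
  have "(\<lambda>n. 2 * norm_sq Sq (\<lambda>z. \<phi> n (fst z) (snd z) - f z) + 2 * norm_sq Sq (\<lambda>z. \<psi> n (fst z) (snd z) - g z)) \<longlonglongrightarrow> 2 * 0 + 2 * 0"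
    by (intro tendsto_add ennreal_tendsto_cmult \<phi> \<psi>) auto
  then have l: "(\<lambda>n. 2 * norm_sq Sq (\<lambda>z. \<phi> n (fst z) (snd z) - f z) + 2 * norm_sq Sq (\<lambda>z. \<psi> n (fst z) (snd z) - g z)) \<longlonglongrightarrow> 0"
    by simp
  show ?thesis
  proof (rule test_closure_limit[OF L2_add[OF L2] test_closure_test[OF test_cyl_add[OF \<phi>(1) \<psi>(1)]]])
    have "norm_sq Sq (\<lambda>z. \<phi> n (fst z) (snd z) + \<psi> n (fst z) (snd z) - (f z + g z)) 
      \<le> 2 * norm_sq Sq (\<lambda>z. \<phi> n (fst z) (snd z) - f z) + 2 * norm_sq Sq (\<lambda>z. \<psi> n (fst z) (snd z) - g z)" for n
      using norm_sq_add[OF borel_measurable_diff[OF meas(1) L2D(1)[OF L2(1)]] borel_measurable_diff[OF meas(2) L2D(1)[OF L2(2)]], of n n]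
      by (simp add: add_diff_add)
    then show "(\<lambda>n. norm_sq Sq (\<lambda>z. \<phi> n (fst z) (snd z) + \<psi> n (fst z) (snd z) - (f z + g z))) \<longlonglongrightarrow> 0"
      by (intro tendsto_sandwich[OF _ _ tendsto_const l] always_eventually) auto
  qed
qed

lemma test_closure_cmult:
  assumes "f \<in> test_closure" shows "(\<lambda>z. k * f z) \<in> test_closure"
proof -
  obtain \<phi> where \<phi>: "\<And>n. \<phi> n \<in> test_cyl" "(\<lambda>n. norm_sq Sq (\<lambda>z. \<phi> n (fst z) (snd z) - f z)) \<longlonglongrightarrow> 0"
    using test_closure_seq[OF assms(1)] by blast
  have L2: "f \<in> L2 Sq" using assms by (auto simp: test_closure_def)
  have meas: "(\<lambda>z. \<phi> n (fst z) (snd z)) \<in> borel_measurable Sq" for n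
    by (intro L2D plane_smooth_L2 test_cyl_smooth \<phi>)+
  have "(\<lambda>n. ennreal ((cmod k)\<^sup>2) * norm_sq Sq (\<lambda>z. \<phi> n (fst z) (snd z) - f z)) \<longlonglongrightarrow> ennreal ((cmod k)\<^sup>2) * 0"
    by (intro ennreal_tendsto_cmult \<phi>) auto
  then have l: "(\<lambda>n. ennreal ((cmod k)\<^sup>2) * norm_sq Sq (\<lambda>z. \<phi> n (fst z) (snd z) - f z)) \<longlonglongrightarrow> 0"
    by simp
  show ?thesis
  proof (rule test_closure_limit[OF L2_cmult[OF L2] test_closure_test[OF test_cyl_cmult[OF \<phi>(1)]]])
    have "norm_sq Sq (\<lambda>z. k * \<phi> n (fst z) (snd z) - k * f z) 
      = ennreal ((cmod k)\<^sup>2) * norm_sq Sq (\<lambda>z. \<phi> n (fst z) (snd z) - f z)" for n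
      using norm_sq_cmult[of "\<lambda>z. \<phi> n (fst z) (snd z) - f z" Sq k, OF borel_measurable_diff[OF meas L2D(1)[OF L2]]]
      by (simp add: right_diff_distrib)
    then show "(\<lambda>n. norm_sq Sq (\<lambda>z. k * \<phi> n (fst z) (snd z) - k * f z)) \<longlonglongrightarrow> 0"
      using l by simp
  qed
qed

lemma test_closure_sum:
  "finite I \<Longrightarrow> (\<And>i. i \<in> I \<Longrightarrow> f i \<in> test_closure) \<Longrightarrow> (\<lambda>z. \<Sum>i\<in>I. f i z) \<in> test_closure"
proof (induction I rule: finite_induct)
  case empty
  have "(\<lambda>x y. 0) \<in> test_cyl" 
    by (auto simp: test_cyl_def smooth_cyl_iff plane_smooth_const intro!: exI[of _ "1/2"])
  from test_closure_test[OF this] show ?case by simp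
qed (auto intro: test_closure_add)

lemma test_closure_bounded_limit:
  assumes f: "f \<in> borel_measurable Sq" and F: "\<And>n. F n \<in> test_closure"
    and lim: "AE z in Sq. (\<lambda>n. F n z) \<longlonglongrightarrow> f z" and bd: "\<And>n z. z \<in> unit_square \<Longrightarrow> cmod (F n z) \<le> B"
    and fb: "\<And>z. z \<in> unit_square \<Longrightarrow> cmod (f z) \<le> B"
  shows "f \<in> test_closure"
proof (rule test_closure_limit[OF L2_bounded[OF finite_measure_Sq f] F])
  show "(\<lambda>n. norm_sq Sq (\<lambda>z. F n z - f z)) \<longlonglongrightarrow> 0"
  proof (rule norm_sq_dominated[OF f _ _ _ _ lim, of "\<lambda>z. B"])
    show "F n \<in> borel_measurable Sq" for n using F by (auto simp: test_closure_def L2_def)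
    show "(\<integral>\<^sup>+z. ennreal (B\<^sup>2) \<partial>Sq) < \<infinity>" 
      by (simp add: emeasure_Sq)
    show "AE z in Sq. cmod (F n z) \<le> B" for n using bd by (auto intro!: AE_I2)
  qed auto
qed (use fb in auto)

text \<open>Because of the shift by 1 the cutoff vanishes until n t exceeds 1. This keeps the
  support of the x-cutoffs away from the edges of the cylinder, even for boxes that touch
  them.\<close>

lemma bump_shift_tendsto: "(\<lambda>n. bump 0 (real n * t - 1)) \<longlonglongrightarrow> (if t > 0 then 1 else 0)"
proof (cases "t > 0")
  case True
  have lim: "filterlim (\<lambda>n. -1 + t * real n) at_top sequentially"
    by (intro filterlim_tendsto_add_at_top[OF tendsto_const] 
          filterlim_tendsto_pos_mult_at_top[OF tendsto_const True] filterlim_real_sequentially)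
  have "((\<lambda>s. exp (- inverse s)) \<longlongrightarrow> exp (- 0)) (at_top :: real filter)"
    by (intro tendsto_intros tendsto_inverse_0_at_top filterlim_ident)
  from filterlim_compose[OF this lim] have "(\<lambda>n. exp (- inverse (-1 + t * real n))) \<longlonglongrightarrow> 1" by simp
  moreover have "\<forall>\<^sub>F n in sequentially. exp (- inverse (-1 + t * real n)) = bump 0 (real n * t - 1)"
    using filterlim_at_top_dense[THEN iffD1, OF lim, rule_format, of 0]
    by eventually_elim (simp add: bump_def inverse_eq_divide mult.commute)
  ultimately have "(\<lambda>n. bump 0 (real n * t - 1)) \<longlonglongrightarrow> 1" by (rule Lim_transform_eventually)
  then show ?thesis using True by simp
next
  case False
  then have "real n * t \<le> 0" for n by (simp add: mult_nonneg_nonpos)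
  then have "bump 0 (real n * t - 1) = 0" for n
    by (smt (verit) bump_def)
  then show ?thesis using False by simp
qed

text \<open>Test functions are 1-periodic in \<open>y\<close>, hence their cutoff in \<open>y\<close> is a function of a cosine.\<close>

definition arc :: "real \<Rightarrow> real \<Rightarrow> real \<Rightarrow> real" where
  "arc c d y = cos (2 * pi * y - pi * (c + d)) - cos (pi * (d - c))"

text \<open>With \<theta> = \<pi> |2 y - (c + d)| the condition c < y < d reads \<theta> < \<pi> (d
  - c), and the cosine decreases on [0, \<pi>]. If \<theta> exceeds \<pi>, the reflected angle 2
  \<pi> - \<theta> is used; it is still at least \<pi> (d - c), because y lies in [0,1].\<close>

lemma arc_pos_iff:
  assumes "0 \<le> c" "c < d" "d \<le> 1" "0 \<le> y" "y \<le> 1"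
  shows "arc c d y > 0 \<longleftrightarrow> c < y \<and> y < d"
proof -
  define \<theta> where "\<theta> = \<bar>2 * pi * y - pi * (c + d)\<bar>"
  have \<theta>: "arc c d y = cos \<theta> - cos (pi * (d - c))" by (simp add: arc_def \<theta>_def)
  have L: "0 \<le> pi * (d - c)" "pi * (d - c) \<le> pi" using assms by (auto intro: mult_left_le)
  have \<theta>': "\<theta> = pi * \<bar>2 * y - (c + d)\<bar>"
    unfolding \<theta>_def by (simp add: abs_mult[symmetric] right_diff_distrib mult_ac flip: abs_mult_pos)
       (simp add: abs_mult right_diff_distrib[symmetric] mult.assoc)
  show ?thesis
  proof (cases "c < y \<and> y < d")
    case True
    then have "\<bar>2 * y - (c + d)\<bar> < d - c" by linarith
    then have "\<theta> < pi * (d - c)" unfolding \<theta>' by simp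
    then have "cos (pi * (d - c)) < cos \<theta>" using L by (intro cos_monotone_0_pi) (auto simp: \<theta>_def)
    then show ?thesis using True \<theta> by simp
  next
    case False
    then have 1: "d - c \<le> \<bar>2 * y - (c + d)\<bar>" "\<bar>2 * y - (c + d)\<bar> \<le> 2 - (d - c)" using assms by auto
    have "cos \<theta> \<le> cos (pi * (d - c))"
    proof (cases "\<theta> \<le> pi")
      case True
      have "pi * (d - c) \<le> \<theta>" unfolding \<theta>' using 1 by simp
      then show ?thesis using L True by (intro cos_monotone_0_pi_le) auto
    next
      case False
      have "\<theta> \<le> pi * (2 - (d - c))" unfolding \<theta>' using 1(2) by (intro mult_left_mono) auto
      then have "pi * (d - c) \<le> 2 * pi - \<theta>" by (simp add: algebra_simps)
      then have "cos (2 * pi - \<theta>) \<le> cos (pi * (d - c))" using L False by (intro cos_monotone_0_pi_le) auto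
      then show ?thesis by (simp add: cos_diff)
    qed
    then show ?thesis using False \<theta> by simp
  qed
qed

lemma plane_smooth_cos:
  assumes "plane_smooth (\<lambda>x y. of_real (g x y))" shows "plane_smooth (\<lambda>x y. of_real (cos (g x y)))"
proof -
  have "complex_of_real (cos t) = (1/2) * ee (t / (2 * pi)) + (1/2) * ee (- (t / (2 * pi)))" for t
  proof -
    have "ee (t / (2 * pi)) = exp (\<i> * of_real t)" "ee (- (t / (2 * pi))) = exp (- (\<i> * of_real t))"
      by (simp_all add: ee_def mult_ac)
    then show ?thesis by (simp add: cos_of_real[symmetric] cos_exp_eq add_divide_distrib)
  qed
  moreover have "plane_smooth (\<lambda>x y. of_real (g x y / (2 * pi)))" "plane_smooth (\<lambda>x y. of_real (- (g x y / (2 * pi))))"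
    using plane_smooth_mult[OF plane_smooth_const[of "of_real (1 / (2 * pi))"] assms]
      plane_smooth_mult[OF plane_smooth_const[of "of_real (- 1 / (2 * pi))"] assms] by simp_all
  ultimately show ?thesis
    by (simp only:) (intro plane_smooth_add plane_smooth_mult plane_smooth_const plane_smooth_ee)
qed

lemma borel_indicator_measurable:
  assumes "A \<in> sets borel" shows "(indicator A :: real \<times> real \<Rightarrow> complex) \<in> borel_measurable Sq"
  using assms by (intro measurable_restrict_space1 measurable_completion) simp

lemma box_test_closure:
  assumes "0 \<le> a" "a < b" "b \<le> 1" "0 \<le> c" "c < d" "d \<le> 1"
  shows "(\<lambda>z. indicator ({a<..<b} \<times> {c<..<d}) z) \<in> test_closure"
proof -
  define X1 where "X1 n x y = complex_of_real (bump 0 (real n * (x - a) - 1))" for n and x y :: real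
  define X2 where "X2 n x y = complex_of_real (bump 0 (real n * (b - x) - 1))" for n and x y :: real
  define Y where "Y n x y = complex_of_real (bump 0 (real n * arc c d y))" for n and x y :: real
  define F where "F n x y = X1 n x y * X2 n x y * Y n x y" for n x y
  have "plane_smooth (X1 n)" for n unfolding X1_def
    by (rule plane_smooth_bump, unfold of_real_mult of_real_diff,
        intro plane_smooth_diff plane_smooth_mult plane_smooth_const plane_smooth_fst)
  moreover have "plane_smooth (X2 n)" for n unfolding X2_def
    by (rule plane_smooth_bump, unfold of_real_mult of_real_diff,
        intro plane_smooth_diff plane_smooth_mult plane_smooth_const plane_smooth_fst)
  moreover have "plane_smooth (Y n)" for n unfolding Y_def arc_def
    by (rule plane_smooth_bump, unfold of_real_mult of_real_diff,
        intro plane_smooth_diff plane_smooth_mult plane_smooth_const plane_smooth_cos,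
        unfold of_real_mult of_real_diff,
        intro plane_smooth_diff plane_smooth_mult plane_smooth_const plane_smooth_snd)
  ultimately have sm: "plane_smooth (F n)" for n unfolding F_def by (intro plane_smooth_mult)
  have per: "F n x (y + 1) = F n x y" for n x y
  proof -
    have "2 * pi * (y + 1) - pi * (c + d) = (2 * pi * y - pi * (c + d)) + 2 * pi" by (simp add: algebra_simps)
    then have "arc c d (y + 1) = arc c d y" unfolding arc_def by (simp only: cos_periodic)
    then show ?thesis by (simp add: F_def X1_def X2_def Y_def)
  qed
  have bd: "cmod (F n x y) \<le> 1" for n x y
    unfolding F_def X1_def X2_def Y_def norm_mult
    by (intro mult_le_one mult_nonneg_nonneg) (auto simp: bump_nonneg bump0_le_1)
  have lim: "(\<lambda>n. F n (fst z) (snd z)) \<longlonglongrightarrow> indicator ({a<..<b} \<times> {c<..<d}) z" if "z \<in> unit_square" for z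
  proof -
    have "(\<lambda>n. F n (fst z) (snd z)) \<longlonglongrightarrow> of_real (if fst z - a > 0 then 1 else 0) * 
        of_real (if b - fst z > 0 then 1 else 0) * of_real (if arc c d (snd z) > 0 then 1 else 0)"
      unfolding F_def X1_def X2_def Y_def
      by (intro tendsto_mult tendsto_of_real bump_shift_tendsto bump0_tendsto)
    also have "of_real (if fst z - a > 0 then 1 else 0) * 
        of_real (if b - fst z > 0 then 1 else 0) * of_real (if arc c d (snd z) > 0 then 1 else 0)
        = (indicator ({a<..<b} \<times> {c<..<d}) z :: complex)"
      using that arc_pos_iff[of c d "snd z"] assms by (cases z) (auto simp: indicator_def)
    finally show ?thesis .
  qed
  have supp: "a + 1 / real n \<le> x \<and> x \<le> b - 1 / real n" if "F n x y \<noteq> 0" for n x y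
  proof -
    have p: "real n * (x - a) > 1" "real n * (b - x) > 1"
      using that by (auto simp: F_def X1_def X2_def bump_def split: if_splits)
    then have "n > 0" by (cases n) auto
    with p show ?thesis by (simp add: field_simps)
  qed
  have test: "F n \<in> test_cyl" if "n > 0" for n
    unfolding test_cyl_def smooth_cyl_iff
  proof (intro CollectI conjI allI sm per exI)
    show "0 < a + 1 / real n" "b - 1 / real n < 1" using assms that by (auto simp: add_nonneg_pos)
       (smt (verit) divide_pos_pos of_nat_0_less_iff)
    show "F n x y \<noteq> 0 \<longrightarrow> a + 1 / real n \<le> x \<and> x \<le> b - 1 / real n" for x y using supp by blast
  qed
  show ?thesis
  \<comment> \<open>The sequence starts at index 1: at index 0 the division by zero makes the inner
    bounds equal to a and b, which may lie on the edges.\<close>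
  proof (rule test_closure_bounded_limit[of _ "\<lambda>n z. F (Suc n) (fst z) (snd z)" 1])
    show "(indicator ({a<..<b} \<times> {c<..<d}) :: _ \<Rightarrow> complex) \<in> borel_measurable Sq"
      by (intro borel_indicator_measurable borel_open open_Times) auto
    show "(\<lambda>z. F (Suc n) (fst z) (snd z)) \<in> test_closure" for n by (intro test_closure_test test) simp
    show "AE z in Sq. (\<lambda>n. F (Suc n) (fst z) (snd z)) \<longlonglongrightarrow> indicator ({a<..<b} \<times> {c<..<d}) z"
      using lim by (auto intro!: AE_I2 LIMSEQ_Suc)
  qed (auto simp: bd indicator_def)
qed

lemma box_Pair_real: "box (a, c) (b, d) = {a<..<b} \<times> {c<..<(d::real)}" for a b :: real
  by (auto simp: box_def Basis_prod_def)

lemma AE_Sq_interior: "AE z in Sq. 0 < fst z \<and> fst z < 1 \<and> 0 < snd z \<and> snd z < 1"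
proof -
  have "cbox (0, 0) (1, 1) - box (0, 0) (1, 1) \<in> null_sets (lebesgue :: (real \<times> real) measure)"
    using negligible_frontier_interval[of "(0, 0)" "(1, 1) :: real \<times> real"] by (simp add: negligible_iff_null_sets)
  then have "AE z in lebesgue. z \<notin> cbox (0, 0) (1, 1) - box (0, 0) ((1, 1) :: real \<times> real)"
    by (rule AE_not_in)
  then show ?thesis
    by (subst AE_restrict_space_iff) (auto simp: box_Pair_real unit_square_cbox elim!: eventually_mono)
qed

lemma indicator_L2: "A \<in> sets borel \<Longrightarrow> (\<lambda>z. indicator A z) \<in> L2 Sq"
  by (rule L2_bounded[OF finite_measure_Sq borel_indicator_measurable, of _ 1]) (auto simp: indicator_def)

text \<open>A Dynkin argument: open boxes form a generator stable under intersection, and the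
  closure admits complements and, by bounded convergence, countable disjoint unions.\<close>

lemma borel_test_closure:
  assumes "A \<in> sets borel" shows "(\<lambda>z::real \<times> real. indicator A z) \<in> test_closure"
proof -
  let ?G = "range (\<lambda>(a, b). box a b :: (real \<times> real) set)"
  have bs: "sets borel = sigma_sets UNIV ?G" by (subst borel_eq_box) simp
  have stable: "Int_stable ?G" by (auto simp: Int_stable_def box_Int_box)
  have one: "(\<lambda>z. 1) \<in> test_closure"
  proof (rule test_closure_cong[OF box_test_closure[of 0 1 0 1]])
    show "(\<lambda>z. 1) \<in> L2 Sq" by (rule L2_bounded[OF finite_measure_Sq, of _ 1]) auto
    show "AE z in Sq. indicator ({0<..<1} \<times> {0<..<1}) z = (1::complex)"
      using AE_Sq_interior by eventually_elim (auto simp: indicator_def mem_Times_iff)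
  qed auto
  have zero: "(\<lambda>z. 0) \<in> test_closure" using test_closure_cmult[OF one, of 0] by simp
  have sub: "?G \<subseteq> Pow UNIV" by simp
  from stable sub assms[unfolded bs] show ?thesis
  proof (induction rule: sigma_sets_induct_disjoint)
    case (basic A)
    then obtain a c b d where A: "A = {a<..<b} \<times> {c<..<d}" by (auto simp: box_Pair_real)
    have bor: "A \<in> sets borel" unfolding A by (intro borel_open open_Times) auto
    \<comment> \<open>The box is clipped to the square. On the open square, hence almost everywhere,
      the indicator does not change.\<close>
    let ?a = "max a 0" and ?b = "min b 1" and ?c = "max c 0" and ?d = "min d 1"
    show ?case
    proof (cases "?a < ?b \<and> ?c < ?d")
      case True
      show ?thesis
      proof (rule test_closure_cong[OF box_test_closure[of ?a ?b ?c ?d] indicator_L2[OF bor]])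
        show "AE z in Sq. indicator ({?a<..<?b} \<times> {?c<..<?d}) z = (indicator A z :: complex)"
          using AE_Sq_interior by eventually_elim (auto simp: indicator_def A)
      qed (use True in auto)
    next
      case False
      show ?thesis
      proof (rule test_closure_cong[OF zero indicator_L2[OF bor]])
        show "AE z in Sq. 0 = (indicator A z :: complex)"
          using AE_Sq_interior by eventually_elim (use False in \<open>auto simp: indicator_def A\<close>)
      qed
    qed
  next
    case empty
    then show ?case using zero by simp
  next
    case (compl A)
    have "(\<lambda>z. 1 + (-1) * indicator A z) \<in> test_closure"
      by (intro test_closure_add one test_closure_cmult compl)
    moreover have "(\<lambda>z. 1 + (-1) * indicator A z) = (\<lambda>z. indicator (UNIV - A) z :: complex)"
      by (auto simp: indicator_def)
    ultimately show ?case by simp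
  next
    case (union A)
    have bor: "A i \<in> sets borel" for i using union(2) bs by auto
    show ?case
    proof (rule test_closure_bounded_limit[of _ "\<lambda>n z. \<Sum>i<n. indicator (A i) z" 1])
      show "(\<lambda>z. indicator (\<Union>i. A i) z :: complex) \<in> borel_measurable Sq"
        using bor by (intro borel_indicator_measurable) auto
      have eq: "(\<Sum>i<n. indicator (A i) z) = (indicator (\<Union>i<n. A i) z :: complex)" for n z
        using union(1) by (subst indicator_UN_disjoint) (auto simp: disjoint_family_on_def)
      show "(\<lambda>z. \<Sum>i<n. indicator (A i) z) \<in> test_closure" for n
        by (intro test_closure_sum union) auto
      show "AE z in Sq. (\<lambda>n. \<Sum>i<n. indicator (A i) z) \<longlonglongrightarrow> (indicator (\<Union>i. A i) z :: complex)"
        unfolding eq by (intro AE_I2 LIMSEQ_indicator_UN)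
      show "cmod (\<Sum>i<n. indicator (A i) z) \<le> 1" for n z unfolding eq by (auto simp: indicator_def)
    qed (auto simp: indicator_def)
  qed
qed

text \<open>A Lebesgue set is a Borel set up to a null set, and \<open>test_closure\<close> does not
  see null sets.\<close>

lemma set_test_closure:
  assumes "A \<in> sets Sq" shows "(\<lambda>z. indicator A z) \<in> test_closure"
proof -
  have A: "A \<in> sets lebesgue" "A \<subseteq> unit_square" 
    using assms by (auto simp: sets_restrict_space_iff)
  obtain S N N' where S: "A = S \<union> N" "N \<subseteq> N'" "N' \<in> null_sets lborel" "S \<in> sets lborel"
    using sets_completionE[OF A(1)] .
  have "N' \<in> null_sets lebesgue" using S(3) by (rule null_sets_completionI)
  then have "AE z in lebesgue. z \<notin> N'" by (rule AE_not_in)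
  then have N': "AE z in Sq. z \<notin> N'" by (subst AE_restrict_space_iff) (auto elim: eventually_mono)
  show ?thesis
  proof (rule test_closure_cong)
    show "(\<lambda>z. indicator S z) \<in> test_closure" using S(4) by (intro borel_test_closure) simp
    show "(\<lambda>z. indicator A z) \<in> L2 Sq"
      using assms by (intro L2_bounded[OF finite_measure_Sq, of _ 1]) (auto simp: indicator_def)
    show "AE z in Sq. indicator S z = (indicator A z :: complex)"
      using N' by eventually_elim (use S(1,2) in \<open>auto simp: indicator_def\<close>)
  qed
qed

text \<open>A measurable f is a pointwise limit of simple functions bounded by 2 |f|, so dominated
  convergence gives convergence in L2; a simple function is a finite combination of
  indicators.\<close>

lemma L2_Sq_test_closure:
  assumes "f \<in> L2 Sq" shows "f \<in> test_closure"
proof -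
  obtain F where F: "\<And>i. simple_function Sq (F i)" "\<And>z. z \<in> space Sq \<Longrightarrow> (\<lambda>i. F i z) \<longlonglongrightarrow> f z"
    "\<And>i z. z \<in> space Sq \<Longrightarrow> dist (F i z) 0 \<le> 2 * dist (f z) 0"
    using borel_measurable_implies_sequence_metric[OF L2D(1)[OF assms], of 0] by blast
  have clos: "F i \<in> test_closure" for i
  proof (rule test_closure_cong)
    show "(\<lambda>z. \<Sum>v\<in>F i ` unit_square. v * indicator (F i -` {v} \<inter> unit_square) z) \<in> test_closure"
    proof (intro test_closure_sum test_closure_cmult set_test_closure)
      show "finite (F i ` unit_square)" using simple_functionD(1)[OF F(1)[of i]] by simp
      show "F i -` {v} \<inter> unit_square \<in> sets Sq" for v
        using simple_functionD(2)[OF F(1)[of i], of "{v}"] by simp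
    qed
    have "(\<lambda>z. 2 * f z) \<in> L2 Sq" by (rule L2_cmult[OF assms])
    moreover have "norm_sq Sq (F i) \<le> norm_sq Sq (\<lambda>z. 2 * f z)"
      using F(3)[of _ i] by (intro norm_sq_mono AE_I2) (auto simp: norm_mult)
    ultimately show "F i \<in> L2 Sq" 
      using borel_measurable_simple_function[OF F(1)[of i]] by (auto simp: L2_def)
    show "AE z in Sq. (\<Sum>v\<in>F i ` unit_square. v * indicator (F i -` {v} \<inter> unit_square) z) = F i z"
    proof (rule AE_I2)
      fix z assume "z \<in> space Sq"
      then have z: "z \<in> unit_square" by simp
      have fin: "finite (F i ` unit_square)" using simple_functionD(1)[OF F(1)[of i]] by simp
      have "(\<Sum>v\<in>F i ` unit_square. v * indicator (F i -` {v} \<inter> unit_square) z)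
         = (\<Sum>v\<in>F i ` unit_square. if v = F i z then v else 0)"
        using z by (intro sum.cong) (auto simp: indicator_def)
      also have "\<dots> = F i z" using fin z by simp
      finally show "(\<Sum>v\<in>F i ` unit_square. v * indicator (F i -` {v} \<inter> unit_square) z) = F i z" .
    qed
  qed
  show ?thesis
  proof (rule test_closure_limit[OF assms clos])
    show "(\<lambda>n. norm_sq Sq (\<lambda>z. F n z - f z)) \<longlonglongrightarrow> 0"
    proof (rule norm_sq_dominated[of _ _ _ "\<lambda>z. cmod (2 * f z)"])
      show "(\<integral>\<^sup>+z. ennreal ((cmod (2 * f z))\<^sup>2) \<partial>Sq) < \<infinity>"
        using L2D(2)[OF L2_cmult[OF assms, of 2]] by (simp add: norm_sq_def)
      show "AE z in Sq. cmod (F n z) \<le> cmod (2 * f z)" for n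
        using F(3)[of _ n] by (intro AE_I2) (auto simp: norm_mult)
      show "AE z in Sq. (\<lambda>n. F n z) \<longlonglongrightarrow> f z" using F(2) by (intro AE_I2) auto
      show "f \<in> borel_measurable Sq" "F n \<in> borel_measurable Sq" for n
        using assms clos[of n] by (auto simp: test_closure_def L2_def)
      then show "(\<lambda>z. cmod (2 * f z)) \<in> borel_measurable Sq" by measurable
    qed
  qed
qed

text \<open>Approximating the conjugate of h by test functions turns orthogonality into the
  vanishing of the integral of |h|^2.\<close>

lemma test_orthogonal_imp_0:
  assumes h: "h \<in> L2 Sq" and orth: "\<And>\<phi>. \<phi> \<in> test_cyl \<Longrightarrow> (LINT z|Sq. \<phi> (fst z) (snd z) * h z) = 0"
  shows "AE z in Sq. h z = 0"
proof -
  have "(\<lambda>z. cnj (h z)) \<in> test_closure" by (rule L2_Sq_test_closure[OF L2_cnj[OF h]])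
  then obtain \<phi> where \<phi>: "\<And>n. \<phi> n \<in> test_cyl" "(\<lambda>n. norm_sq Sq (\<lambda>z. \<phi> n (fst z) (snd z) - cnj (h z))) \<longlonglongrightarrow> 0"
    using test_closure_seq by blast
  have "(\<lambda>n. LINT z|Sq. \<phi> n (fst z) (snd z) * h z) \<longlonglongrightarrow> (LINT z|Sq. cnj (h z) * h z)"
    by (rule L2_integral_tendsto[OF L2_cnj[OF h] _ h \<phi>(2)]) (intro plane_smooth_L2 test_cyl_smooth \<phi>)
  then have "(LINT z|Sq. cnj (h z) * h z) = 0"
    by (simp add: orth[OF \<phi>(1)] LIMSEQ_const_iff)
  moreover have eq: "cnj (h z) * h z = of_real ((cmod (h z))\<^sup>2)" for z
    by (metis complex_norm_square mult.commute)
  ultimately have 0: "(LINT z|Sq. (cmod (h z))\<^sup>2) = 0" 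
    unfolding eq by (simp only: integral_complex_of_real of_real_eq_0_iff)
  have "integrable Sq (\<lambda>z. cnj (h z) * h z)" by (rule L2_integrable[OF L2_cnj[OF h] h])
  then have "integrable Sq (\<lambda>z. (cmod (h z))\<^sup>2)" 
    unfolding eq by (simp only: complex_of_real_integrable_eq)
  from integral_nonneg_eq_0_iff_AE[OF this] 0 have "AE z in Sq. (cmod (h z))\<^sup>2 = 0" by simp
  then show ?thesis by eventually_elim simp
qed

section \<open>Weak derivatives\<close>

abbreviation unc :: "(real \<Rightarrow> real \<Rightarrow> complex) \<Rightarrow> real \<times> real \<Rightarrow> complex" where
  "unc f \<equiv> \<lambda>z. f (fst z) (snd z)"

lemma LINT_Sq_continuous:
  fixes h :: "real \<times> real \<Rightarrow> 'b::euclidean_space"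
  assumes "continuous_on UNIV h"
  shows "(LINT z|Sq. h z) = integral {0..1} (\<lambda>y. integral {0..1} (\<lambda>x. h (x, y)))"
    and "(LINT z|Sq. h z) = integral {0..1} (\<lambda>x. integral {0..1} (\<lambda>y. h (x, y)))"
    and "integrable Sq h"
proof -
  have c: "continuous_on (cbox (0, 0) (1, 1)) h" using assms continuous_on_subset by blast
  show i: "integrable Sq h"
    unfolding unit_square_cbox by (rule continuous_imp_integrable[OF c])
  have "(LINT z|Sq. h z) = integral unit_square h"
    by (rule lebesgue_integral_eq_integral[OF i]) simp
  also have "\<dots> = integral (cbox 0 1) (\<lambda>x. integral (cbox 0 1) (\<lambda>y. h (x, y)))"
    unfolding unit_square_cbox by (rule integral_prod_continuous[OF c])
  finally show 1: "(LINT z|Sq. h z) = integral {0..1} (\<lambda>x. integral {0..1} (\<lambda>y. h (x, y)))" by simp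
  show "(LINT z|Sq. h z) = integral {0..1} (\<lambda>y. integral {0..1} (\<lambda>x. h (x, y)))"
    unfolding 1 using integral_swap_continuous[of 0 0 1 1 "\<lambda>x y. h (x, y)"] c by simp
qed

lemma integral_pd:
  assumes "plane_smooth f"
  shows "integral {0..1} (\<lambda>x. pdx f x y) = f 1 y - f 0 y" "integral {0..1} (\<lambda>y. pdy f x y) = f x 1 - f x 0"
  using plane_smoothD(1,2)[OF assms]
  by (intro integral_unique fundamental_theorem_of_calculus; auto intro: has_vector_derivative_at_within)+

text \<open>The x-derivative integrates to boundary values that vanish because the support stays
  away from the edges; the y-derivative integrates to 0 by periodicity. This is where the gluing of
  the circle enters.\<close>

lemma LINT_pd_test:
  assumes "\<phi> \<in> test_cyl" "pd \<in> {pdx, pdy}"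
  shows "(LINT z|Sq. unc (pd \<phi>) z) = 0"
proof -
  have s: "plane_smooth \<phi>" using assms by (intro test_cyl_smooth)
  have 0: "\<phi> 0 y = 0" "\<phi> 1 y = 0" for y using assms(1) by (fastforce simp: test_cyl_def)+
  have per: "\<phi> x 1 = \<phi> x 0" for x 
  proof -
    have "\<phi> x (0 + 1) = \<phi> x 0" using test_cyl_smooth(1)[OF assms(1)] unfolding smooth_cyl_iff by blast
    then show ?thesis by simp
  qed
  have "(LINT z|Sq. unc (pdx \<phi>) z) = 0"
    by (subst LINT_Sq_continuous(1)) (simp_all add: plane_smoothD[OF plane_smoothD(3)[OF s]] integral_pd[OF s] 0)
  moreover have "(LINT z|Sq. unc (pdy \<phi>) z) = 0"
    by (subst LINT_Sq_continuous(2)) (simp_all add: plane_smoothD[OF plane_smoothD(4)[OF s]] integral_pd[OF s] per)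
  ultimately show ?thesis using assms(2) by auto
qed

text \<open>The classical derivative \<open>pd\<close> is a parameter, always \<open>pdx\<close> or
  \<open>pdy\<close>, so that each rule for weak derivatives is proved once for both
  directions.\<close>

definition weak_deriv :: "((real \<Rightarrow> real \<Rightarrow> complex) \<Rightarrow> real \<Rightarrow> real \<Rightarrow> complex) \<Rightarrow> 
    (real \<Rightarrow> real \<Rightarrow> complex) \<Rightarrow> (real \<Rightarrow> real \<Rightarrow> complex) \<Rightarrow> bool" where
  "weak_deriv pd f g \<longleftrightarrow> g \<in> L2_cyl \<and> (\<forall>\<phi>\<in>test_cyl. (LINT z|Sq. unc f z * unc (pd \<phi>) z) = - (LINT z|Sq. unc g z * unc \<phi> z))"

lemma weak_dx_iff: "is_weak_dx f g \<longleftrightarrow> weak_deriv pdx f g"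
  by (simp add: is_weak_dx_def weak_deriv_def)

lemma weak_dy_iff: "is_weak_dy f g \<longleftrightarrow> weak_deriv pdy f g"
  by (simp add: is_weak_dy_def weak_deriv_def)

lemma pd_test: "\<phi> \<in> test_cyl \<Longrightarrow> pd \<in> {pdx, pdy} \<Longrightarrow> pd \<phi> \<in> test_cyl"
  using test_cyl_pd by auto

lemma pd_smooth: "f \<in> smooth_cyl \<Longrightarrow> pd \<in> {pdx, pdy} \<Longrightarrow> pd f \<in> smooth_cyl"
  using smooth_cyl_pd by auto

lemma pd_mult: "plane_smooth f \<Longrightarrow> plane_smooth g \<Longrightarrow> pd \<in> {pdx, pdy} \<Longrightarrow> 
   pd (\<lambda>x y. f x y * g x y) = (\<lambda>x y. f x y * pd g x y + pd f x y * g x y)"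
  using pdx_mult pdy_mult by auto

lemma smooth_L2: "f \<in> smooth_cyl \<Longrightarrow> unc f \<in> L2 Sq" "f \<in> test_cyl \<Longrightarrow> unc f \<in> L2 Sq"
  by (simp_all add: plane_smooth_L2 smooth_cyl_iff test_cyl_smooth(2))

lemma smooth_bounded:
  assumes "plane_smooth f" 
  shows "\<exists>B>0. \<forall>z\<in>unit_square. cmod (unc f z) \<le> B"
proof -
  have "bounded (unc f ` unit_square)" unfolding unit_square_cbox
    by (intro compact_imp_bounded compact_continuous_image continuous_on_subset[OF plane_smoothD(5)[OF assms]]) auto
  then obtain B where "0 < B" "\<forall>w\<in>unc f ` unit_square. cmod w \<le> B" unfolding bounded_pos by blast
  then show ?thesis by blast
qed

lemma smooth_mult_L2: 
  assumes "plane_smooth a" "f \<in> L2 Sq" shows "(\<lambda>z. unc a z * f z) \<in> L2 Sq"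
proof -
  obtain B where "\<forall>z\<in>unit_square. cmod (unc a z) \<le> B" using smooth_bounded[OF assms(1)] by blast
  then show ?thesis by (intro L2_mult[OF assms(2) L2D(1)[OF plane_smooth_L2[OF assms(1)]], of B]) auto
qed

lemma weakD: "weak_deriv pd f g \<Longrightarrow> unc g \<in> L2 Sq"
  "weak_deriv pd f g \<Longrightarrow> \<phi> \<in> test_cyl \<Longrightarrow> (LINT z|Sq. unc f z * unc (pd \<phi>) z) = - (LINT z|Sq. unc g z * unc \<phi> z)"
  by (auto simp: weak_deriv_def L2_cyl_iff)

text \<open>The product of a smooth periodic factor and a test function is again a test function.
  Inserting it into the definition for f and expanding its classical derivative gives the Leibniz
  rule.\<close>

lemma weak_mult:
  assumes pd: "pd \<in> {pdx, pdy}" and a: "a \<in> smooth_cyl" and f: "unc f \<in> L2 Sq" and w: "weak_deriv pd f g"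
  shows "weak_deriv pd (\<lambda>x y. a x y * f x y) (\<lambda>x y. a x y * g x y + pd a x y * f x y)"
proof -
  note g = weakD(1)[OF w]
  have sa: "plane_smooth a" "plane_smooth (pd a)" using a pd_smooth[OF a pd] by (auto simp: smooth_cyl_iff)
  note L = smooth_mult_L2[OF sa(1)] smooth_mult_L2[OF sa(2)]
  have in_L2: "unc (\<lambda>x y. a x y * g x y + pd a x y * f x y) \<in> L2 Sq"
    by (intro L2_add L f g)
  moreover have "(LINT z|Sq. unc (\<lambda>x y. a x y * f x y) z * unc (pd \<phi>) z) =
     - (LINT z|Sq. unc (\<lambda>x y. a x y * g x y + pd a x y * f x y) z * unc \<phi> z)" if \<phi>: "\<phi> \<in> test_cyl" for \<phi>
  proof -
    note \<phi>L = smooth_L2(2)[OF \<phi>] smooth_L2(2)[OF pd_test[OF \<phi> pd]]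
    have a\<phi>: "(\<lambda>x y. a x y * \<phi> x y) \<in> test_cyl" by (rule test_cyl_mult[OF a \<phi>])
    have "(LINT z|Sq. unc f z * unc (pd (\<lambda>x y. a x y * \<phi> x y)) z) = - (LINT z|Sq. unc g z * unc (\<lambda>x y. a x y * \<phi> x y) z)"
      by (rule weakD(2)[OF w a\<phi>])
    also have "(LINT z|Sq. unc f z * unc (pd (\<lambda>x y. a x y * \<phi> x y)) z) = 
      (LINT z|Sq. (unc a z * unc f z) * unc (pd \<phi>) z + (unc (pd a) z * unc f z) * unc \<phi> z)"
      unfolding pd_mult[OF sa(1) test_cyl_smooth(2)[OF \<phi>] pd] by (simp add: algebra_simps)
    also have "\<dots> = (LINT z|Sq. (unc a z * unc f z) * unc (pd \<phi>) z) + (LINT z|Sq. (unc (pd a) z * unc f z) * unc \<phi> z)"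
      by (intro Bochner_Integration.integral_add L2_integrable L f \<phi>L)
    finally have "(LINT z|Sq. (unc a z * unc f z) * unc (pd \<phi>) z) = 
       - ((LINT z|Sq. (unc a z * unc g z) * unc \<phi> z) + (LINT z|Sq. (unc (pd a) z * unc f z) * unc \<phi> z))"
      by (simp add: algebra_simps)
    also have "(LINT z|Sq. (unc a z * unc g z) * unc \<phi> z) + (LINT z|Sq. (unc (pd a) z * unc f z) * unc \<phi> z)
      = (LINT z|Sq. (unc a z * unc g z) * unc \<phi> z + (unc (pd a) z * unc f z) * unc \<phi> z)"
      by (intro Bochner_Integration.integral_add[symmetric] L2_integrable L f g \<phi>L)
    finally show ?thesis by (simp add: algebra_simps)
  qed
  ultimately show ?thesis unfolding weak_deriv_def L2_cyl_iff by blast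
qed

text \<open>The Leibniz rule for f times the constant 1. Integration by parts is thereby reduced to
  the vanishing of the integral of \<open>pd \<phi>\<close>.\<close>

lemma weak_smooth:
  assumes pd: "pd \<in> {pdx, pdy}" and f: "f \<in> smooth_cyl" shows "weak_deriv pd f (pd f)"
proof -
  have "weak_deriv pd (\<lambda>x y. 1) (\<lambda>x y. 0)"
    using LINT_pd_test[OF _ pd] by (auto simp: weak_deriv_def L2_cyl_iff L2_0)
  moreover have "(\<lambda>z. 1) \<in> L2 Sq" by (rule L2_bounded[OF finite_measure_Sq, of _ 1]) auto
  ultimately show ?thesis using weak_mult[OF pd f, of "\<lambda>x y. 1" "\<lambda>x y. 0"] by simp
qed

lemma weak_add:
  assumes pd: "pd \<in> {pdx, pdy}" and f: "unc f \<in> L2 Sq" "unc f' \<in> L2 Sq" and w: "weak_deriv pd f g" "weak_deriv pd f' g'"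
  shows "weak_deriv pd (\<lambda>x y. f x y + f' x y) (\<lambda>x y. g x y + g' x y)"
proof -
  note g = weakD(1)[OF w(1)] weakD(1)[OF w(2)]
  have "(LINT z|Sq. (unc f z + unc f' z) * unc (pd \<phi>) z) = - (LINT z|Sq. (unc g z + unc g' z) * unc \<phi> z)"
    if \<phi>: "\<phi> \<in> test_cyl" for \<phi>
  proof -
    note \<phi>L = smooth_L2(2)[OF \<phi>] smooth_L2(2)[OF pd_test[OF \<phi> pd]]
    have "(LINT z|Sq. (unc f z + unc f' z) * unc (pd \<phi>) z) = 
       (LINT z|Sq. unc f z * unc (pd \<phi>) z) + (LINT z|Sq. unc f' z * unc (pd \<phi>) z)"
      unfolding distrib_right by (intro Bochner_Integration.integral_add L2_integrable f \<phi>L)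
    moreover have "(LINT z|Sq. (unc g z + unc g' z) * unc \<phi> z) = 
       (LINT z|Sq. unc g z * unc \<phi> z) + (LINT z|Sq. unc g' z * unc \<phi> z)"
      unfolding distrib_right by (intro Bochner_Integration.integral_add L2_integrable g \<phi>L)
    ultimately show ?thesis by (simp add: weakD(2)[OF w(1) \<phi>] weakD(2)[OF w(2) \<phi>])
  qed
  then show ?thesis using L2_add[OF g] by (auto simp: weak_deriv_def L2_cyl_iff)
qed

lemma weak_sum:
  assumes pd: "pd \<in> {pdx, pdy}" and f: "\<And>i. i \<in> I \<Longrightarrow> unc (f i) \<in> L2 Sq" and w: "\<And>i. i \<in> I \<Longrightarrow> weak_deriv pd (f i) (g i)"
  shows "weak_deriv pd (\<lambda>x y. \<Sum>i\<in>I. f i x y) (\<lambda>x y. \<Sum>i\<in>I. g i x y)"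
  using f w
proof (induction I rule: infinite_finite_induct)
  case (insert i I)
  have "unc (\<lambda>x y. \<Sum>i\<in>I. f i x y) \<in> L2 Sq" using insert by (intro L2_sum) auto
  with insert show ?case by (simp add: weak_add[OF pd])
qed (auto simp: weak_deriv_def L2_cyl_iff L2_0)

text \<open>Both sides of the defining identity are continuous in L2 for a fixed test function, so
  the graph of the weak derivative is closed.\<close>

lemma weak_limit:
  assumes pd: "pd \<in> {pdx, pdy}" and f: "unc f \<in> L2 Sq" "unc g \<in> L2 Sq" 
    and F: "\<And>n. unc (F n) \<in> L2 Sq" "\<And>n. weak_deriv pd (F n) (G n)"
    and lim: "(\<lambda>n. norm_sq Sq (\<lambda>z. unc (F n) z - unc f z)) \<longlonglongrightarrow> 0" "(\<lambda>n. norm_sq Sq (\<lambda>z. unc (G n) z - unc g z)) \<longlonglongrightarrow> 0"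
  shows "weak_deriv pd f g"
  unfolding weak_deriv_def L2_cyl_iff
proof (intro conjI ballI f)
  fix \<phi> assume \<phi>: "\<phi> \<in> test_cyl"
  have "(\<lambda>n. LINT z|Sq. unc (F n) z * unc (pd \<phi>) z) \<longlonglongrightarrow> (LINT z|Sq. unc f z * unc (pd \<phi>) z)"
    by (rule L2_integral_tendsto[OF f(1) F(1) smooth_L2(2)[OF pd_test[OF \<phi> pd]] lim(1)])
  moreover have "(\<lambda>n. - (LINT z|Sq. unc (G n) z * unc \<phi> z)) \<longlonglongrightarrow> - (LINT z|Sq. unc g z * unc \<phi> z)"
    by (rule tendsto_minus[OF L2_integral_tendsto[OF f(2) weakD(1)[OF F(2)] smooth_L2(2)[OF \<phi>] lim(2)]])
  then have "(\<lambda>n. LINT z|Sq. unc (F n) z * unc (pd \<phi>) z) \<longlonglongrightarrow> - (LINT z|Sq. unc g z * unc \<phi> z)"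
    by (simp add: weakD(2)[OF F(2) \<phi>])
  ultimately show "(LINT z|Sq. unc f z * unc (pd \<phi>) z) = - (LINT z|Sq. unc g z * unc \<phi> z)"
    by (rule LIMSEQ_unique)
qed

text \<open>The difference of two candidates is orthogonal to all test functions, which are
  dense.\<close>

lemma weak_unique:
  assumes w: "weak_deriv pd f g" "weak_deriv pd f g'"
  shows "AE z in Sq. unc g z = unc g' z"
proof -
  note g = weakD(1)[OF w(1)] weakD(1)[OF w(2)]
  have "AE z in Sq. unc g z - unc g' z = 0"
  proof (rule test_orthogonal_imp_0[OF L2_diff[OF g]])
    fix \<phi> assume \<phi>: "\<phi> \<in> test_cyl"
    have "(LINT z|Sq. \<phi> (fst z) (snd z) * (unc g z - unc g' z)) = 
       (LINT z|Sq. unc g z * unc \<phi> z) - (LINT z|Sq. unc g' z * unc \<phi> z)"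
      by (subst Bochner_Integration.integral_diff[symmetric]) 
         (auto intro!: L2_integrable g smooth_L2 \<phi> simp: algebra_simps)
    also have "\<dots> = 0" using weakD(2)[OF w(1) \<phi>] weakD(2)[OF w(2) \<phi>] by simp
    finally show "(LINT z|Sq. \<phi> (fst z) (snd z) * (unc g z - unc g' z)) = 0" .
  qed
  then show ?thesis by eventually_elim simp
qed

text \<open>The choice in \<open>weak_dx\<close> is meaningful as soon as one weak derivative
  exists; uniqueness then identifies it almost everywhere with any explicit candidate.\<close>

lemma weak_dx_some: "weak_deriv pdx f g \<Longrightarrow> weak_deriv pdx f (weak_dx f)"
  unfolding weak_dx_def weak_dx_iff by (rule someI[of "weak_deriv pdx f" g])

lemma weak_dy_some: "weak_deriv pdy f g \<Longrightarrow> weak_deriv pdy f (weak_dy f)"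
  unfolding weak_dy_def weak_dy_iff by (rule someI[of "weak_deriv pdy f" g])

lemma weak_dx_AE: "weak_deriv pdx f g \<Longrightarrow> AE z in Sq. unc (weak_dx f) z = unc g z"
  using weak_unique weak_dx_some by blast

lemma weak_dy_AE: "weak_deriv pdy f g \<Longrightarrow> AE z in Sq. unc (weak_dy f) z = unc g z"
  using weak_unique weak_dy_some by blast

lemma H1_cylI: "unc f \<in> L2 Sq \<Longrightarrow> weak_deriv pdx f g \<Longrightarrow> weak_deriv pdy f h \<Longrightarrow> f \<in> H1_cyl"
  by (auto simp: H1_cyl_def L2_cyl_iff weak_dx_iff weak_dy_iff)

lemma H1_cylD: 
  assumes "f \<in> H1_cyl" shows "unc f \<in> L2 Sq" "weak_deriv pdx f (weak_dx f)" "weak_deriv pdy f (weak_dy f)"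
  using assms weak_dx_some weak_dy_some by (auto simp: H1_cyl_def L2_cyl_iff weak_dx_iff weak_dy_iff)

section \<open>Traces\<close>

abbreviation Ci :: "real measure" where "Ci \<equiv> lebesgue_on {0..1}"

lemma norm_sq_Sq_smooth:
  assumes "plane_smooth f"
  shows "norm_sq Sq (unc f) = ennreal (integral {0..1} (\<lambda>y. integral {0..1} (\<lambda>x. (cmod (f x y))\<^sup>2)))"
proof -
  have c: "continuous_on UNIV (\<lambda>z. (cmod (unc f z))\<^sup>2)"
    by (intro continuous_intros plane_smoothD(5)[OF assms])
  show ?thesis unfolding norm_sq_def
    by (subst nn_integral_eq_integral[OF LINT_Sq_continuous(3)[OF c]]) 
       (auto simp: LINT_Sq_continuous(1)[OF c])
qed

lemma norm_sq_Ci_continuous: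
  assumes "continuous_on UNIV f"
  shows "norm_sq Ci f = ennreal (integral {0..1} (\<lambda>y. (cmod (f y))\<^sup>2))"
proof -
  have c: "continuous_on (cbox 0 1) (\<lambda>z. (cmod (f z))\<^sup>2)"
    by (intro continuous_intros continuous_on_subset[OF assms]) auto
  have i: "integrable Ci (\<lambda>z. (cmod (f z))\<^sup>2)"
    using continuous_imp_integrable[OF c] by simp
  show ?thesis unfolding norm_sq_def
    by (subst nn_integral_eq_integral[OF i]) (auto simp: lebesgue_integral_eq_integral[OF i])
qed

text \<open>Integrate the derivative of \<open>x \<bar>f\<bar>\<^sup>2\<close> over \<open>x\<close>.\<close>

lemma smooth_trace_le:
  assumes "plane_smooth f"
  shows "norm_sq Ci (f 1) \<le> 2 * norm_sq Sq (unc f) + norm_sq Sq (unc (pdx f))"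
proof -
  note f = plane_smoothD[OF assms] and f' = plane_smoothD[OF plane_smoothD(3)[OF assms]]
  have cx: "continuous_on UNIV (\<lambda>x. f x y)" "continuous_on UNIV (\<lambda>x. pdx f x y)" for y
    using continuous_on_Pair[OF continuous_on_id continuous_on_const, of UNIV y] continuous_on_compose2[OF f(5), of UNIV "\<lambda>x. (x, y)"] 
      continuous_on_compose2[OF f'(5), of UNIV "\<lambda>x. (x, y)"] by (auto intro!: continuous_intros)
  have pt: "(cmod (f 1 y))\<^sup>2 \<le> 2 * integral {0..1} (\<lambda>x. (cmod (f x y))\<^sup>2) + integral {0..1} (\<lambda>x. (cmod (pdx f x y))\<^sup>2)" for y
  proof -
    let ?d = "\<lambda>x. (cmod (f x y))\<^sup>2 + x * (2 * Re (cnj (f x y) * pdx f x y))"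
    have sq: "(cmod w)\<^sup>2 = Re w * Re w + Im w * Im w" for w by (simp only: cmod_power2) (simp only: power2_eq_square)
    have "((\<lambda>x. x * (cmod (f x y))\<^sup>2) has_real_derivative ?d x) (at x)" for x
    proof -
      have RI: "((\<lambda>x. Re (f x y)) has_real_derivative Re (pdx f x y)) (at x)"
        "((\<lambda>x. Im (f x y)) has_real_derivative Im (pdx f x y)) (at x)"
        using bounded_linear.has_vector_derivative[OF bounded_linear_Re f(1)]
          bounded_linear.has_vector_derivative[OF bounded_linear_Im f(1)]
        by (simp_all add: has_real_derivative_iff_has_vector_derivative)
      show ?thesis unfolding sq
        by (rule DERIV_cong[OF DERIV_mult[OF DERIV_ident DERIV_add[OF DERIV_mult[OF RI(1) RI(1)] DERIV_mult[OF RI(2) RI(2)]]]])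
           (simp add: algebra_simps)
    qed
    then have "(?d has_integral (1 * (cmod (f 1 y))\<^sup>2 - 0 * (cmod (f 0 y))\<^sup>2)) {0..1}"
      by (intro fundamental_theorem_of_calculus)
         (auto simp flip: has_real_derivative_iff_has_vector_derivative intro: has_field_derivative_at_within)
    then have "(cmod (f 1 y))\<^sup>2 = integral {0..1} ?d" by (simp add: integral_unique)
    also have "\<dots> \<le> integral {0..1} (\<lambda>x. 2 * (cmod (f x y))\<^sup>2 + (cmod (pdx f x y))\<^sup>2)"
    proof (rule integral_le)
      show "?d integrable_on {0..1}" "(\<lambda>x. 2 * (cmod (f x y))\<^sup>2 + (cmod (pdx f x y))\<^sup>2) integrable_on {0..1}"
        by (intro integrable_continuous_interval continuous_intros continuous_on_subset[OF cx(1)] continuous_on_subset[OF cx(2)]; simp)+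
      fix x :: real assume x: "x \<in> {0..1}"
      have "x * (2 * Re (cnj (f x y) * pdx f x y)) \<le> x * ((cmod (f x y))\<^sup>2 + (cmod (pdx f x y))\<^sup>2)"
      proof (intro mult_left_mono)
        show "2 * Re (cnj (f x y) * pdx f x y) \<le> (cmod (f x y))\<^sup>2 + (cmod (pdx f x y))\<^sup>2"
          using zero_le_power2[of "Re (f x y) - Re (pdx f x y)"] zero_le_power2[of "Im (f x y) - Im (pdx f x y)"]
          unfolding sq by (simp add: power2_eq_square algebra_simps)
      qed (use x in auto)
      also have "\<dots> \<le> 1 * ((cmod (f x y))\<^sup>2 + (cmod (pdx f x y))\<^sup>2)" using x by (intro mult_right_mono) auto
      finally show "?d x \<le> 2 * (cmod (f x y))\<^sup>2 + (cmod (pdx f x y))\<^sup>2" by simp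
    qed
    also have "\<dots> = 2 * integral {0..1} (\<lambda>x. (cmod (f x y))\<^sup>2) + integral {0..1} (\<lambda>x. (cmod (pdx f x y))\<^sup>2)"
      by (subst Henstock_Kurzweil_Integration.integral_add)
         (auto intro!: integrable_continuous_interval continuous_intros continuous_on_subset[OF cx(1)] continuous_on_subset[OF cx(2)])
    finally show ?thesis .
  qed
  have cy: "continuous_on {0..1} (\<lambda>y. integral {0..1} (\<lambda>x. (cmod (g x y))\<^sup>2))" if "plane_smooth g" for g
  proof -
    have "continuous_on (cbox 0 1 \<times> cbox 0 1) (\<lambda>z::real \<times> real. (snd z, fst z))" by (intro continuous_intros)
    from continuous_on_compose2[OF plane_smoothD(5)[OF that] this]
    have "continuous_on (cbox 0 1 \<times> cbox 0 1) (\<lambda>z. g (snd z) (fst z))" by simp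
    then have "continuous_on (cbox 0 1 \<times> cbox 0 1) (\<lambda>(y::real, x). (cmod (g x y))\<^sup>2)"
      unfolding case_prod_beta by (intro continuous_intros)
    from integral_continuous_on_param[OF this] show ?thesis by simp
  qed
  note c1 = cy[OF assms] and c2 = cy[OF f(3)]
  have c3: "continuous_on UNIV (f 1)"
    using continuous_on_compose2[OF f(5), of UNIV "\<lambda>y. (1, y)"] 
      continuous_on_Pair[OF continuous_on_const continuous_on_id, of UNIV 1] by auto
  \<comment> \<open>An integral that does not exist is 0 by convention, so nonnegativity holds for
    arbitrary g.\<close>
  have in0: "0 \<le> integral {0..1} (\<lambda>x. (cmod (g x y))\<^sup>2)" for g and y :: real
    by (cases "(\<lambda>x. (cmod (g x y))\<^sup>2) integrable_on {0..1}")
       (simp_all add: Henstock_Kurzweil_Integration.integral_nonneg not_integrable_integral)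
  have out0: "0 \<le> integral {0..1} (\<lambda>y::real. integral {0..1} (\<lambda>x. (cmod (g x y))\<^sup>2))" for g
    by (cases "(\<lambda>y. integral {0..1} (\<lambda>x. (cmod (g x y))\<^sup>2)) integrable_on {0..1}")
       (simp_all add: Henstock_Kurzweil_Integration.integral_nonneg not_integrable_integral in0)
  have "integral {0..1} (\<lambda>y. (cmod (f 1 y))\<^sup>2) \<le> integral {0..1} (\<lambda>y. 2 * integral {0..1} (\<lambda>x. (cmod (f x y))\<^sup>2)
      + integral {0..1} (\<lambda>x. (cmod (pdx f x y))\<^sup>2))"
    by (intro integral_le integrable_continuous_interval continuous_intros c1 c2 continuous_on_subset[OF c3] pt) auto
  also have "\<dots> = 2 * integral {0..1} (\<lambda>y. integral {0..1} (\<lambda>x. (cmod (f x y))\<^sup>2)) + 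
      integral {0..1} (\<lambda>y. integral {0..1} (\<lambda>x. (cmod (pdx f x y))\<^sup>2))"
    by (subst Henstock_Kurzweil_Integration.integral_add)
       (auto intro!: integrable_continuous_interval continuous_intros c1 c2)
  finally have "ennreal (integral {0..1} (\<lambda>y. (cmod (f 1 y))\<^sup>2)) \<le> 
     ennreal (2 * integral {0..1} (\<lambda>y. integral {0..1} (\<lambda>x. (cmod (f x y))\<^sup>2)) + 
      integral {0..1} (\<lambda>y. integral {0..1} (\<lambda>x. (cmod (pdx f x y))\<^sup>2)))" by (rule ennreal_leI)
  also have "\<dots> = 2 * ennreal (integral {0..1} (\<lambda>y. integral {0..1} (\<lambda>x. (cmod (f x y))\<^sup>2))) + 
      ennreal (integral {0..1} (\<lambda>y. integral {0..1} (\<lambda>x. (cmod (pdx f x y))\<^sup>2)))"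
    using out0[of f] out0[of "pdx f"] by (simp add: ennreal_mult')
  finally show ?thesis
    by (simp add: norm_sq_Sq_smooth[OF assms] norm_sq_Sq_smooth[OF f(3)] norm_sq_Ci_continuous[OF c3])
qed

text \<open>
  The closure of the set of all \<open>(F, \<partial>\<^sub>x F, \<partial>\<^sub>y F, F x0)\<close> with \<open>F\<close> smooth. In contrast to
  \<open>has_sobolev_trace\<close>, no choice of weak derivatives is involved.
\<close>

definition tdist where
  "tdist f fx fy x0 g F = norm_sq Sq (\<lambda>z. unc F z - unc f z) + norm_sq Sq (\<lambda>z. unc (pdx F) z - unc fx z)
     + norm_sq Sq (\<lambda>z. unc (pdy F) z - unc fy z) + norm_sq Ci (\<lambda>y. F x0 y - g y)"

definition sobolev_graph where
  "sobolev_graph f fx fy x0 g \<longleftrightarrow> unc f \<in> L2 Sq \<and> unc fx \<in> L2 Sq \<and> unc fy \<in> L2 Sq \<and> g \<in> borel_measurable Ci \<and>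
     (\<forall>e>0. \<exists>F\<in>smooth_cyl. tdist f fx fy x0 g F < ennreal e)"

lemma sobolev_graphD:
  assumes "sobolev_graph f fx fy x0 g"
  shows "unc f \<in> L2 Sq" "unc fx \<in> L2 Sq" "unc fy \<in> L2 Sq" "g \<in> borel_measurable Ci"
    "e > 0 \<Longrightarrow> \<exists>F\<in>smooth_cyl. tdist f fx fy x0 g F < ennreal e"
  using assms by (auto simp: sobolev_graph_def)

lemma has_trace_iff:
  assumes "f \<in> H1_cyl"
  shows "has_sobolev_trace f x0 g \<longleftrightarrow> sobolev_graph f (weak_dx f) (weak_dy f) x0 g"
proof
  note f = H1_cylD(1)[OF assms] weakD(1)[OF H1_cylD(2)[OF assms]] weakD(1)[OF H1_cylD(3)[OF assms]]
  assume "has_sobolev_trace f x0 g"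
  then obtain F where g: "g \<in> borel_measurable Ci" and F: "\<And>n. F n \<in> smooth_cyl"
    and l: "(\<lambda>n. norm_sq Sq (\<lambda>z. unc (F n) z - unc f z)) \<longlonglongrightarrow> 0"
        "(\<lambda>n. norm_sq Sq (\<lambda>z. unc (pdx (F n)) z - unc (weak_dx f) z)) \<longlonglongrightarrow> 0"
        "(\<lambda>n. norm_sq Sq (\<lambda>z. unc (pdy (F n)) z - unc (weak_dy f) z)) \<longlonglongrightarrow> 0"
        "(\<lambda>n. norm_sq Ci (\<lambda>y. F n x0 y - g y)) \<longlonglongrightarrow> 0"
    unfolding has_sobolev_trace_def l2_square_norm_sq norm_sq_def by blast
  have lim: "(\<lambda>n. tdist f (weak_dx f) (weak_dy f) x0 g (F n)) \<longlonglongrightarrow> 0 + 0 + 0 + 0"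
    unfolding tdist_def by (intro tendsto_add l)
  have "\<exists>F\<in>smooth_cyl. tdist f (weak_dx f) (weak_dy f) x0 g F < ennreal e" if "e > 0" for e
  proof -
    have "\<forall>\<^sub>F n in sequentially. tdist f (weak_dx f) (weak_dy f) x0 g (F n) < ennreal e"
      using order_tendstoD(2)[OF lim, of "ennreal e"] that by simp
    from eventually_happens'[OF sequentially_bot this] show ?thesis using F by blast
  qed
  then show "sobolev_graph f (weak_dx f) (weak_dy f) x0 g" using f g by (auto simp: sobolev_graph_def)
next
  assume h: "sobolev_graph f (weak_dx f) (weak_dy f) x0 g"
  have "\<forall>n. \<exists>F. F \<in> smooth_cyl \<and> tdist f (weak_dx f) (weak_dy f) x0 g F < ennreal (1 / Suc n)"
  proof
    fix n have "0 < 1 / real (Suc n)" by simp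
    from sobolev_graphD(5)[OF h this] show "\<exists>F. F \<in> smooth_cyl \<and> tdist f (weak_dx f) (weak_dy f) x0 g F < ennreal (1 / Suc n)"
      by blast
  qed
  from choice[OF this] obtain F where F: "\<forall>n. F n \<in> smooth_cyl \<and> tdist f (weak_dx f) (weak_dy f) x0 g (F n) < ennreal (1 / Suc n)" ..
  have l: "(\<lambda>n. ennreal (1 / Suc n)) \<longlonglongrightarrow> 0"
    using LIMSEQ_Suc[OF lim_1_over_n[where 'a=real]] by (simp flip: ennreal_0)
  have sq: "u \<longlonglongrightarrow> 0" if "\<And>n. u n \<le> tdist f (weak_dx f) (weak_dy f) x0 g (F n)" for u :: "nat \<Rightarrow> ennreal"
  proof (rule tendsto_sandwich[OF _ _ tendsto_const l])
    show "\<forall>\<^sub>F n in sequentially. u n \<le> ennreal (1 / real (Suc n))"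
      using that F by (intro always_eventually allI) (meson less_imp_le order_trans)
  qed simp
  have "(\<lambda>n. norm_sq Sq (\<lambda>z. unc (F n) z - unc f z)) \<longlonglongrightarrow> 0"
        "(\<lambda>n. norm_sq Sq (\<lambda>z. unc (pdx (F n)) z - unc (weak_dx f) z)) \<longlonglongrightarrow> 0"
        "(\<lambda>n. norm_sq Sq (\<lambda>z. unc (pdy (F n)) z - unc (weak_dy f) z)) \<longlonglongrightarrow> 0"
        "(\<lambda>n. norm_sq Ci (\<lambda>y. F n x0 y - g y)) \<longlonglongrightarrow> 0"
    by (rule sq, simp add: tdist_def add.assoc add_increasing add_increasing2)+
  then show "has_sobolev_trace f x0 g"
    unfolding has_sobolev_trace_def l2_square_norm_sq norm_sq_def using F sobolev_graphD(4)[OF h] by blast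
qed

lemma sobolev_graph_smooth:
  assumes "F \<in> smooth_cyl" shows "sobolev_graph F (pdx F) (pdy F) x0 (F x0)"
proof -
  have s: "plane_smooth F" "plane_smooth (pdx F)" "plane_smooth (pdy F)" 
    using assms smooth_cyl_pd by (auto simp: smooth_cyl_iff)
  have "continuous_on UNIV (F x0)"
    using continuous_on_compose2[OF plane_smoothD(5)[OF s(1)], of UNIV "\<lambda>y. (x0, y)"] 
      continuous_on_Pair[OF continuous_on_const continuous_on_id, of UNIV x0] by auto
  then have "F x0 \<in> borel_measurable Ci" by (rule continuous_measurable)
  moreover have "tdist F (pdx F) (pdy F) x0 (F x0) F = 0" by (simp add: tdist_def norm_sq_def)
  ultimately show ?thesis using assms by (auto simp: sobolev_graph_def intro!: plane_smooth_L2 s bexI[of _ F])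
qed

lemma smooth_section_measurable:
  "F \<in> smooth_cyl \<Longrightarrow> F x0 \<in> borel_measurable Ci"
  using sobolev_graph_smooth sobolev_graphD(4) by blast

lemma smooth_meas: 
  "F \<in> smooth_cyl \<Longrightarrow> unc F \<in> borel_measurable Sq"
  "F \<in> smooth_cyl \<Longrightarrow> unc (pdx F) \<in> borel_measurable Sq" "F \<in> smooth_cyl \<Longrightarrow> unc (pdy F) \<in> borel_measurable Sq"
  using L2D(1)[OF smooth_L2(1)] smooth_cyl_pd by blast+

text \<open>A relation defined as a closure is closed. All four components have to converge along
  one and the same sequence, since the smooth approximant must serve them all at once.\<close>

lemma sobolev_graph_limit:
  assumes L: "unc f \<in> L2 Sq" "unc fx \<in> L2 Sq" "unc fy \<in> L2 Sq" "g \<in> borel_measurable Ci"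
    and h: "\<And>n. sobolev_graph (f' n) (fx' n) (fy' n) x0 (g' n)"
    and l: "(\<lambda>n. norm_sq Sq (\<lambda>z. unc (f' n) z - unc f z)) \<longlonglongrightarrow> 0" "(\<lambda>n. norm_sq Sq (\<lambda>z. unc (fx' n) z - unc fx z)) \<longlonglongrightarrow> 0"
      "(\<lambda>n. norm_sq Sq (\<lambda>z. unc (fy' n) z - unc fy z)) \<longlonglongrightarrow> 0" "(\<lambda>n. norm_sq Ci (\<lambda>y. g' n y - g y)) \<longlonglongrightarrow> 0"
  shows "sobolev_graph f fx fy x0 g"
  unfolding sobolev_graph_def
proof (intro conjI L allI impI)
  fix e :: real assume e: "0 < e"
  let ?d = "\<lambda>n. norm_sq Sq (\<lambda>z. unc (f' n) z - unc f z) + norm_sq Sq (\<lambda>z. unc (fx' n) z - unc fx z) + 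
     norm_sq Sq (\<lambda>z. unc (fy' n) z - unc fy z) + norm_sq Ci (\<lambda>y. g' n y - g y)"
  have "?d \<longlonglongrightarrow> 0 + 0 + 0 + 0" by (intro tendsto_add l)
  then have "\<forall>\<^sub>F n in sequentially. ?d n < ennreal (e/8)"
    using order_tendstoD(2)[of ?d _ _ "ennreal (e/8)"] e by simp
  from eventually_happens'[OF sequentially_bot this] obtain n where n: "?d n < ennreal (e/8)" ..
  have "0 < e/8" using e by simp
  from sobolev_graphD(5)[OF h[of n] this] obtain F where F: "F \<in> smooth_cyl" "tdist (f' n) (fx' n) (fy' n) x0 (g' n) F < ennreal (e/8)" ..
  note m = smooth_meas[OF F(1)] smooth_section_measurable[OF F(1)] 
    L2D(1)[OF sobolev_graphD(1)[OF h]] L2D(1)[OF sobolev_graphD(2)[OF h]] L2D(1)[OF sobolev_graphD(3)[OF h]] sobolev_graphD(4)[OF h]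
    L(4) L2D(1)[OF L(1)] L2D(1)[OF L(2)] L2D(1)[OF L(3)]
  have "tdist f fx fy x0 g F \<le> 
     (2 * norm_sq Sq (\<lambda>z. unc F z - unc (f' n) z) + 2 * norm_sq Sq (\<lambda>z. unc (f' n) z - unc f z)) +
     (2 * norm_sq Sq (\<lambda>z. unc (pdx F) z - unc (fx' n) z) + 2 * norm_sq Sq (\<lambda>z. unc (fx' n) z - unc fx z)) +
     (2 * norm_sq Sq (\<lambda>z. unc (pdy F) z - unc (fy' n) z) + 2 * norm_sq Sq (\<lambda>z. unc (fy' n) z - unc fy z)) +
     (2 * norm_sq Ci (\<lambda>y. F x0 y - g' n y) + 2 * norm_sq Ci (\<lambda>y. g' n y - g y))"
    unfolding tdist_def by (intro add_mono norm_sq_triangle m)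
  also have "\<dots> = 2 * tdist (f' n) (fx' n) (fy' n) x0 (g' n) F + 2 * ?d n"
    unfolding tdist_def distrib_left by (simp only: add_ac)
  also have "\<dots> \<le> 2 * ennreal (e/8) + 2 * ennreal (e/8)"
    using n F(2) by (intro add_mono mult_left_mono less_imp_le) auto
  also have "\<dots> = ennreal (e/2)"
    using e by (simp only: mult_2) (simp add: ennreal_plus[symmetric] del: ennreal_plus)
  also have "\<dots> < ennreal e" using e by (simp add: ennreal_less_iff)
  finally show "\<exists>F\<in>smooth_cyl. tdist f fx fy x0 g F < ennreal e" using F(1) by blast
qed

lemma norm_sq_diff_eq_0: 
  assumes "AE z in M. u z = v z" shows "norm_sq M (\<lambda>z. u z - v z) = 0"
proof -
  have "norm_sq M (\<lambda>z. u z - v z) = norm_sq M (\<lambda>z. 0)" by (rule norm_sq_cong) (use assms in auto)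
  then show ?thesis by (simp add: norm_sq_def)
qed

lemma sobolev_graph_cong:
  assumes h: "sobolev_graph f' fx' fy' x0 g'" 
    and L: "unc f \<in> L2 Sq" "unc fx \<in> L2 Sq" "unc fy \<in> L2 Sq" "g \<in> borel_measurable Ci"
    and ae: "AE z in Sq. unc f' z = unc f z" "AE z in Sq. unc fx' z = unc fx z" "AE z in Sq. unc fy' z = unc fy z"
      "AE y in Ci. g' y = g y"
  shows "sobolev_graph f fx fy x0 g"
proof (rule sobolev_graph_limit[OF L h])
  show "(\<lambda>n. norm_sq Sq (\<lambda>z. unc f' z - unc f z)) \<longlonglongrightarrow> 0" "(\<lambda>n. norm_sq Sq (\<lambda>z. unc fx' z - unc fx z)) \<longlonglongrightarrow> 0"
    "(\<lambda>n. norm_sq Sq (\<lambda>z. unc fy' z - unc fy z)) \<longlonglongrightarrow> 0" "(\<lambda>n. norm_sq Ci (\<lambda>y. g' y - g y)) \<longlonglongrightarrow> 0"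
    by (simp_all add: norm_sq_diff_eq_0 ae)
qed

lemma sobolev_graph_add:
  assumes h: "sobolev_graph f fx fy x0 g" "sobolev_graph f' fx' fy' x0 g'"
  shows "sobolev_graph (\<lambda>x y. f x y + f' x y) (\<lambda>x y. fx x y + fx' x y) (\<lambda>x y. fy x y + fy' x y) x0 (\<lambda>y. g y + g' y)"
  unfolding sobolev_graph_def
proof (intro conjI allI impI)
  fix e :: real assume e: "0 < e"
  then have e8: "0 < e/8" by simp
  obtain F where F: "F \<in> smooth_cyl" "tdist f fx fy x0 g F < ennreal (e/8)" using sobolev_graphD(5)[OF h(1) e8] ..
  obtain F' where F': "F' \<in> smooth_cyl" "tdist f' fx' fy' x0 g' F' < ennreal (e/8)" using sobolev_graphD(5)[OF h(2) e8] ..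
  let ?F = "\<lambda>x y. F x y + F' x y"
  have s: "plane_smooth F" "plane_smooth F'" using F(1) F'(1) by (auto simp: smooth_cyl_iff)
  have pd: "pdx ?F = (\<lambda>x y. pdx F x y + pdx F' x y)" "pdy ?F = (\<lambda>x y. pdy F x y + pdy F' x y)"
    by (rule pdx_eq pdy_eq, intro has_vector_derivative_add plane_smoothD s)+
  note m = smooth_meas[OF F(1)] smooth_section_measurable[OF F(1)] smooth_meas[OF F'(1)] smooth_section_measurable[OF F'(1)] 
    L2D(1)[OF sobolev_graphD(1)[OF h(1)]] L2D(1)[OF sobolev_graphD(2)[OF h(1)]] L2D(1)[OF sobolev_graphD(3)[OF h(1)]] sobolev_graphD(4)[OF h(1)]
    L2D(1)[OF sobolev_graphD(1)[OF h(2)]] L2D(1)[OF sobolev_graphD(2)[OF h(2)]] L2D(1)[OF sobolev_graphD(3)[OF h(2)]] sobolev_graphD(4)[OF h(2)]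
  have "tdist (\<lambda>x y. f x y + f' x y) (\<lambda>x y. fx x y + fx' x y) (\<lambda>x y. fy x y + fy' x y) x0 (\<lambda>y. g y + g' y) ?F \<le> 
     (2 * norm_sq Sq (\<lambda>z. unc F z - unc f z) + 2 * norm_sq Sq (\<lambda>z. unc F' z - unc f' z)) +
     (2 * norm_sq Sq (\<lambda>z. unc (pdx F) z - unc fx z) + 2 * norm_sq Sq (\<lambda>z. unc (pdx F') z - unc fx' z)) +
     (2 * norm_sq Sq (\<lambda>z. unc (pdy F) z - unc fy z) + 2 * norm_sq Sq (\<lambda>z. unc (pdy F') z - unc fy' z)) +
     (2 * norm_sq Ci (\<lambda>y. F x0 y - g y) + 2 * norm_sq Ci (\<lambda>y. F' x0 y - g' y))"
    unfolding tdist_def pd add_diff_add by (intro add_mono norm_sq_add borel_measurable_diff m)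
  also have "\<dots> = 2 * tdist f fx fy x0 g F + 2 * tdist f' fx' fy' x0 g' F'"
    unfolding tdist_def distrib_left by (simp only: add_ac)
  also have "\<dots> \<le> 2 * ennreal (e/8) + 2 * ennreal (e/8)"
    using F(2) F'(2) by (intro add_mono mult_left_mono less_imp_le) auto
  also have "\<dots> = ennreal (e/2)"
    using e by (simp only: mult_2) (simp add: ennreal_plus[symmetric] del: ennreal_plus)
  also have "\<dots> < ennreal e" using e by (simp add: ennreal_less_iff)
  finally show "\<exists>F\<in>smooth_cyl. tdist (\<lambda>x y. f x y + f' x y) (\<lambda>x y. fx x y + fx' x y) (\<lambda>x y. fy x y + fy' x y) x0 (\<lambda>y. g y + g' y) F < ennreal e" 
    using smooth_cyl_add[OF F(1) F'(1)] by blast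
qed (intro L2_add borel_measurable_add sobolev_graphD(1,2,3,4)[OF h(1)] sobolev_graphD(1,2,3,4)[OF h(2)])+

lemma sobolev_graph_zero: "sobolev_graph (\<lambda>x y. 0) (\<lambda>x y. 0) (\<lambda>x y. 0) x0 (\<lambda>y. 0)"
proof -
  have "(\<lambda>x y. 0) \<in> smooth_cyl" by (simp add: smooth_cyl_iff plane_smooth_const)
  moreover have "pdx (\<lambda>x y. 0) = (\<lambda>x y. 0)" "pdy (\<lambda>x y. 0) = (\<lambda>x y. 0)" by (auto intro!: pdx_eq pdy_eq)
  ultimately show ?thesis using sobolev_graph_smooth[of "\<lambda>x y. 0" x0] by simp
qed

lemma sobolev_graph_sum:
  assumes "\<And>i. i \<in> I \<Longrightarrow> sobolev_graph (f i) (fx i) (fy i) x0 (g i)"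
  shows "sobolev_graph (\<lambda>x y. \<Sum>i\<in>I. f i x y) (\<lambda>x y. \<Sum>i\<in>I. fx i x y) (\<lambda>x y. \<Sum>i\<in>I. fy i x y) x0 (\<lambda>y. \<Sum>i\<in>I. g i y)"
  using assms by (induction I rule: infinite_finite_induct) (simp_all add: sobolev_graph_zero sobolev_graph_add)

lemma sobolev_graph_mult:
  assumes a: "a \<in> smooth_cyl" and h: "sobolev_graph f fx fy x0 g" and x0: "x0 \<in> {0..1}"
  shows "sobolev_graph (\<lambda>x y. a x y * f x y) (\<lambda>x y. a x y * fx x y + pdx a x y * f x y)
     (\<lambda>x y. a x y * fy x y + pdy a x y * f x y) x0 (\<lambda>y. a x0 y * g y)"
  unfolding sobolev_graph_def
proof (intro conjI allI impI)
  have s: "plane_smooth a" "plane_smooth (pdx a)" "plane_smooth (pdy a)" 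
    using a smooth_cyl_pd by (auto simp: smooth_cyl_iff)
  note hL = sobolev_graphD(1,2,3)[OF h]
  show "(\<lambda>z. a (fst z) (snd z) * f (fst z) (snd z)) \<in> L2 Sq"
    "(\<lambda>z. a (fst z) (snd z) * fx (fst z) (snd z) + pdx a (fst z) (snd z) * f (fst z) (snd z)) \<in> L2 Sq"
    "(\<lambda>z. a (fst z) (snd z) * fy (fst z) (snd z) + pdy a (fst z) (snd z) * f (fst z) (snd z)) \<in> L2 Sq"
    by (intro L2_add smooth_mult_L2[OF s(1)] smooth_mult_L2[OF s(2)] smooth_mult_L2[OF s(3)] hL)+
  show "(\<lambda>y. a x0 y * g y) \<in> borel_measurable Ci"
    by (intro borel_measurable_times smooth_section_measurable[OF a] sobolev_graphD(4)[OF h])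
  obtain B1 B2 B3 where B: "\<forall>z\<in>unit_square. cmod (unc a z) \<le> B1" "\<forall>z\<in>unit_square. cmod (unc (pdx a) z) \<le> B2"
     "\<forall>z\<in>unit_square. cmod (unc (pdy a) z) \<le> B3" "B1 > 0" "B2 > 0" "B3 > 0"
    using smooth_bounded[OF s(1)] smooth_bounded[OF s(2)] smooth_bounded[OF s(3)] by blast
  define B where "B = B1 + B2 + B3"
  have Bb: "cmod (unc a z) \<le> B" "cmod (unc (pdx a) z) \<le> B" "cmod (unc (pdy a) z) \<le> B" if "z \<in> unit_square" for z
    using B(1)[rule_format, OF that] B(2)[rule_format, OF that] B(3)[rule_format, OF that] B(4-6)
    unfolding B_def by linarith+
  have B0: "0 < B" using B(4-6) by (simp add: B_def)
  define K where "K = ennreal (B\<^sup>2)"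
  fix e :: real assume e: "0 < e"
  \<comment> \<open>The estimate below loses a factor 5 B^2; the 5 = 1 + 2 + 2 counts the error of f
    itself and its appearances in both product rules. This value of d leaves 5 e / 12, which is
    below e.\<close>
  define d where "d = e / (12 * B\<^sup>2)"
  have d: "0 < d" using e B0 by (simp add: d_def)
  obtain F where F: "F \<in> smooth_cyl" "tdist f fx fy x0 g F < ennreal d" using sobolev_graphD(5)[OF h d] ..
  have sF: "plane_smooth F" using F(1) by (simp add: smooth_cyl_iff)
  note m = smooth_meas[OF F(1)] smooth_section_measurable[OF F(1)] smooth_meas[OF a]
    L2D(1)[OF sobolev_graphD(1)[OF h]] L2D(1)[OF sobolev_graphD(2)[OF h]] L2D(1)[OF sobolev_graphD(3)[OF h]] sobolev_graphD(4)[OF h]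
  have n1: "norm_sq Sq (\<lambda>z. unc u z * w z) \<le> K * norm_sq Sq w" 
    if "w \<in> borel_measurable Sq" "u \<in> {a, pdx a, pdy a}" for w u
    unfolding K_def using that Bb B0 by (intro norm_sq_mult_le) auto
  let ?u = "norm_sq Sq (\<lambda>z. unc F z - unc f z)" and ?v = "norm_sq Sq (\<lambda>z. unc (pdx F) z - unc fx z)"
    and ?w = "norm_sq Sq (\<lambda>z. unc (pdy F) z - unc fy z)" and ?t = "norm_sq Ci (\<lambda>y. F x0 y - g y)"
  have 1: "norm_sq Sq (\<lambda>z. a (fst z) (snd z) * F (fst z) (snd z) - a (fst z) (snd z) * f (fst z) (snd z)) \<le> K * ?u"
    unfolding right_diff_distrib[symmetric] by (intro n1 borel_measurable_diff m) simp
  have aux: "norm_sq Sq (\<lambda>z. a (fst z) (snd z) * p z + b (fst z) (snd z) * F (fst z) (snd z) - 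
      (a (fst z) (snd z) * q z + b (fst z) (snd z) * f (fst z) (snd z))) \<le> 2 * (K * norm_sq Sq (\<lambda>z. p z - q z)) + 2 * (K * ?u)"
    if p: "p \<in> borel_measurable Sq" "q \<in> borel_measurable Sq" and b: "b \<in> {pdx a, pdy a}" for p q b
  proof -
    have mb: "unc b \<in> borel_measurable Sq" using b m by auto
    have "norm_sq Sq (\<lambda>z. a (fst z) (snd z) * p z + b (fst z) (snd z) * F (fst z) (snd z) - 
      (a (fst z) (snd z) * q z + b (fst z) (snd z) * f (fst z) (snd z))) = 
       norm_sq Sq (\<lambda>z. unc a z * (p z - q z) + unc b z * (unc F z - unc f z))"
      by (simp add: algebra_simps)
    also have "\<dots> \<le> 2 * norm_sq Sq (\<lambda>z. unc a z * (p z - q z)) + 2 * norm_sq Sq (\<lambda>z. unc b z * (unc F z - unc f z))"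
      by (intro norm_sq_add borel_measurable_times borel_measurable_diff m p mb)
    also have "\<dots> \<le> 2 * (K * norm_sq Sq (\<lambda>z. p z - q z)) + 2 * (K * ?u)"
      by (intro add_mono mult_left_mono n1 borel_measurable_diff m p) (use b in auto)
    finally show ?thesis .
  qed
  \<comment> \<open>The bound B is known on the square only; the section at \<open>x0\<close> lies
    in it because \<open>x0\<close> is between 0 and 1.\<close>
  have 4: "norm_sq Ci (\<lambda>y. a x0 y * F x0 y - a x0 y * g y) \<le> K * ?t"
    unfolding right_diff_distrib[symmetric] K_def using Bb(1)[of "(x0, _)"] x0 B0
    by (intro norm_sq_mult_le borel_measurable_diff m) auto
  have "tdist (\<lambda>x y. a x y * f x y) (\<lambda>x y. a x y * fx x y + pdx a x y * f x y)
     (\<lambda>x y. a x y * fy x y + pdy a x y * f x y) x0 (\<lambda>y. a x0 y * g y) (\<lambda>x y. a x y * F x y)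
     \<le> K * ?u + (2 * (K * ?v) + 2 * (K * ?u)) + (2 * (K * ?w) + 2 * (K * ?u)) + K * ?t"
    unfolding tdist_def pdx_mult[OF s(1) sF] pdy_mult[OF s(1) sF]
    by (intro add_mono 1 aux 4 m) auto
  also have "\<dots> \<le> 5 * (K * ?u) + 5 * (K * ?v) + 5 * (K * ?w) + 5 * (K * ?t)"
  proof -
    have "K * ?u + (2 * (K * ?v) + 2 * (K * ?u)) + (2 * (K * ?w) + 2 * (K * ?u)) + K * ?t
      = (1 + 2 + 2) * (K * ?u) + 2 * (K * ?v) + 2 * (K * ?w) + 1 * (K * ?t)"
      by (simp only: distrib_right mult_1_left add_ac)
    also have "\<dots> \<le> 5 * (K * ?u) + 5 * (K * ?v) + 5 * (K * ?w) + 5 * (K * ?t)"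
      by (intro add_mono mult_right_mono) auto
    finally show ?thesis .
  qed
  also have "\<dots> = 5 * K * tdist f fx fy x0 g F"
    unfolding tdist_def distrib_left by (simp only: mult.assoc add_ac)
  also have "\<dots> \<le> 5 * K * ennreal d" by (intro mult_left_mono less_imp_le[OF F(2)]) simp
  also have "\<dots> = ennreal (5 * B\<^sup>2 * d)"
    using d by (simp add: K_def ennreal_mult)
  also have "\<dots> < ennreal e"
    using e B0 by (intro ennreal_lessI) (auto simp: d_def)
  finally show "\<exists>F\<in>smooth_cyl. tdist (\<lambda>x y. a x y * f x y) (\<lambda>x y. a x y * fx x y + pdx a x y * f x y)
     (\<lambda>x y. a x y * fy x y + pdy a x y * f x y) x0 (\<lambda>y. a x0 y * g y) F < ennreal e"
    using smooth_cyl_mult[OF a F(1)] by blast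
qed

text \<open>The trace inequality for smooth functions survives approximation. Moving from g to the
  approximant and from there back to f and fx doubles the constants, which gives 8 and 4, and leaves
  the error 8 + 4 + 2 = 14 times e / 14. In \<open>G_trace\<close> it makes the boundary values of
  all degrees jointly square summable.\<close>

lemma sobolev_graph_trace_le:
  assumes h: "sobolev_graph f fx fy 1 g"
  shows "norm_sq Ci g \<le> 8 * norm_sq Sq (unc f) + 4 * norm_sq Sq (unc fx)"
proof (rule ennreal_le_epsilon)
  fix e :: real assume "0 < e"
  then have e: "0 < e / 14" by simp
  obtain F where F: "F \<in> smooth_cyl" "tdist f fx fy 1 g F < ennreal (e/14)" using sobolev_graphD(5)[OF h e] ..
  have sF: "plane_smooth F" using F(1) by (simp add: smooth_cyl_iff)
  note m = smooth_meas[OF F(1)] smooth_section_measurable[OF F(1)]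
    L2D(1)[OF sobolev_graphD(1)[OF h]] L2D(1)[OF sobolev_graphD(2)[OF h]] L2D(1)[OF sobolev_graphD(3)[OF h]] sobolev_graphD(4)[OF h]
  have le: "norm_sq Sq (\<lambda>z. unc F z - unc f z) \<le> ennreal (e/14)" "norm_sq Sq (\<lambda>z. unc (pdx F) z - unc fx z) \<le> ennreal (e/14)"
     "norm_sq Ci (\<lambda>y. F 1 y - g y) \<le> ennreal (e/14)"
    by (rule order_trans[OF _ less_imp_le[OF F(2)]], simp add: tdist_def add.assoc add_increasing add_increasing2)+
  have tri: "norm_sq M v \<le> 2 * norm_sq M u + 2 * norm_sq M (\<lambda>z. u z - v z)" if "u \<in> borel_measurable M" "v \<in> borel_measurable M" for M :: "'c measure" and u v
    using norm_sq_add[of u M "\<lambda>z. v z - u z"] that by (simp add: norm_sq_minus_commute[of M v u])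
  have "norm_sq Ci g \<le> 2 * norm_sq Ci (F 1) + 2 * norm_sq Ci (\<lambda>y. F 1 y - g y)" by (intro tri m)
  also have "\<dots> \<le> 2 * (2 * norm_sq Sq (unc F) + norm_sq Sq (unc (pdx F))) + 2 * ennreal (e/14)"
    by (intro add_mono mult_left_mono smooth_trace_le sF le) auto
  also have "\<dots> \<le> 2 * (2 * (2 * norm_sq Sq (unc f) + 2 * ennreal (e/14)) + (2 * norm_sq Sq (unc fx) + 2 * ennreal (e/14))) + 2 * ennreal (e/14)"
  proof -
    have "norm_sq Sq (unc F) \<le> 2 * norm_sq Sq (unc f) + 2 * norm_sq Sq (\<lambda>z. unc f z - unc F z)" by (intro tri m)
    also have "\<dots> \<le> 2 * norm_sq Sq (unc f) + 2 * ennreal (e/14)"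
      unfolding norm_sq_minus_commute[of _ "unc f"] by (intro add_mono mult_left_mono le order_refl) auto
    finally have 1: "norm_sq Sq (unc F) \<le> 2 * norm_sq Sq (unc f) + 2 * ennreal (e/14)" .
    have "norm_sq Sq (unc (pdx F)) \<le> 2 * norm_sq Sq (unc fx) + 2 * norm_sq Sq (\<lambda>z. unc fx z - unc (pdx F) z)" by (intro tri m)
    also have "\<dots> \<le> 2 * norm_sq Sq (unc fx) + 2 * ennreal (e/14)"
      unfolding norm_sq_minus_commute[of _ "unc fx"] by (intro add_mono mult_left_mono le order_refl) auto
    finally have 2: "norm_sq Sq (unc (pdx F)) \<le> 2 * norm_sq Sq (unc fx) + 2 * ennreal (e/14)" .
    show ?thesis by (intro add_mono mult_left_mono 1 2 order_refl) auto
  qed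
  also have "\<dots> = 8 * norm_sq Sq (unc f) + 4 * norm_sq Sq (unc fx) + (8 * ennreal (e/14) + (4 * ennreal (e/14) + 2 * ennreal (e/14)))"
    by (simp add: algebra_simps)
  also have "8 * ennreal (e/14) + (4 * ennreal (e/14) + 2 * ennreal (e/14)) = (8 + (4 + 2)) * ennreal (e/14)"
    by (simp only: distrib_right)
  also have "(8 + (4 + 2)) * ennreal (e/14) = ennreal 14 * ennreal (e/14)" by simp
  also have "\<dots> = ennreal (14 * (e/14))" using e by (subst ennreal_mult) auto
  also have "14 * (e/14) = e" by simp
  finally show "norm_sq Ci g \<le> 8 * norm_sq Sq (unc f) + 4 * norm_sq Sq (unc fx) + ennreal e" .
qed

section \<open>Fields of square summable sequences\<close>

text \<open>Lebesgue measure is complete, so null sets do not affect measurability. Infinite sums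
  over the degrees are controlled only where the fibre is square summable, that is, almost
  everywhere.\<close>

lemma lebesgue_on_measurable_AE:
  fixes f g :: "'a::euclidean_space \<Rightarrow> complex"
  assumes S: "S \<in> sets lebesgue" and g: "g \<in> borel_measurable (lebesgue_on S)" and ae: "AE z in lebesgue_on S. g z = f z"
  shows "f \<in> borel_measurable (lebesgue_on S)"
proof -
  have "(\<lambda>z. if z \<in> S then g z else 0) \<in> borel_measurable lebesgue"
    using g by (simp add: borel_measurable_if[OF S])
  moreover have "AE z in lebesgue. (if z \<in> S then g z else 0) = (if z \<in> S then f z else 0)"
    using ae S by (subst (asm) AE_restrict_space_iff) (auto elim!: eventually_mono)
  ultimately have "(\<lambda>z. if z \<in> S then f z else 0) \<in> borel_measurable lebesgue" by (rule borel_measurable_AE)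
  then show ?thesis by (simp add: borel_measurable_if[OF S])
qed

lemma lebesgue_on_measurable_limit:
  fixes f :: "'a::euclidean_space \<Rightarrow> complex"
  assumes S: "S \<in> sets lebesgue" and F: "\<And>n. F n \<in> borel_measurable (lebesgue_on S)"
    and lim: "AE z in lebesgue_on S. (\<lambda>n. F n z) \<longlonglongrightarrow> f z"
  shows "f \<in> borel_measurable (lebesgue_on S)"
proof (rule lebesgue_on_measurable_AE[OF S])
  show "(\<lambda>z. lim (\<lambda>n. F n z)) \<in> borel_measurable (lebesgue_on S)"
    by (rule borel_measurable_lim_metric[OF F])
  show "AE z in lebesgue_on S. lim (\<lambda>n. F n z) = f z"
    using lim by eventually_elim (rule limI)
qed

lemma l2_int_suminf: "l2_int \<xi> = (\<Sum>n. ennreal ((cmod (\<xi> (int_decode n)))\<^sup>2))"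
  unfolding l2_int_def
  using nn_integral_bij_count_space[OF bij_int_decode, of "\<lambda>p. ennreal ((cmod (\<xi> p))\<^sup>2)"]
  by (simp add: nn_integral_count_space_nat)

text \<open>The space of square integrable l2-valued functions, seen fibrewise. By
  \<open>nn_integral_l2_int\<close> its norm can equally be summed over the degrees. It is used on
  the square for vectors and on the circle for their boundary values.\<close>

definition fields :: "'a measure \<Rightarrow> ('a \<Rightarrow> int \<Rightarrow> complex) set" where
  "fields M = {\<xi>. (\<forall>q. (\<lambda>z. \<xi> z q) \<in> borel_measurable M) \<and> (\<integral>\<^sup>+z. l2_int (\<xi> z) \<partial>M) < \<infinity>}"

lemma l2_int_measurable: 
  assumes "\<And>q. (\<lambda>z. \<xi> z q) \<in> borel_measurable M" shows "(\<lambda>z. l2_int (\<xi> z)) \<in> borel_measurable M"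
proof -
  note [measurable] = assms
  show ?thesis unfolding l2_int_suminf by measurable
qed

lemma nn_integral_l2_int:
  assumes "\<And>q. (\<lambda>z. \<xi> z q) \<in> borel_measurable M"
  shows "(\<integral>\<^sup>+z. l2_int (\<xi> z) \<partial>M) = (\<integral>\<^sup>+q. norm_sq M (\<lambda>z. \<xi> z q) \<partial>count_space UNIV)"
proof -
  note [measurable] = assms
  have "(\<integral>\<^sup>+z. l2_int (\<xi> z) \<partial>M) = (\<Sum>n. norm_sq M (\<lambda>z. \<xi> z (int_decode n)))"
    unfolding l2_int_suminf norm_sq_def by (subst nn_integral_suminf) auto
  also have "\<dots> = (\<integral>\<^sup>+q. norm_sq M (\<lambda>z. \<xi> z q) \<partial>count_space UNIV)"
    using nn_integral_bij_count_space[OF bij_int_decode, of "\<lambda>q. norm_sq M (\<lambda>z. \<xi> z q)"]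
    by (simp add: nn_integral_count_space_nat)
  finally show ?thesis .
qed

lemma fields_component:
  assumes "\<xi> \<in> fields M" shows "(\<lambda>z. \<xi> z q) \<in> L2 M"
proof -
  have m: "\<And>q. (\<lambda>z. \<xi> z q) \<in> borel_measurable M" using assms by (simp add: fields_def)
  have "norm_sq M (\<lambda>z. \<xi> z q) \<le> (\<integral>\<^sup>+q. norm_sq M (\<lambda>z. \<xi> z q) \<partial>count_space UNIV)"
    using nn_integral_count_space_int_le_iff[THEN iffD1, OF order_refl, rule_format, of "{q}" "\<lambda>q. norm_sq M (\<lambda>z. \<xi> z q)"] by simp
  also have "\<dots> < \<infinity>" using assms nn_integral_l2_int[OF m] by (simp add: fields_def)
  finally show ?thesis using m by (simp add: L2_def)
qed

lemma fieldsI: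
  assumes "\<And>q. (\<lambda>z. \<xi> z q) \<in> borel_measurable M" "(\<integral>\<^sup>+q. norm_sq M (\<lambda>z. \<xi> z q) \<partial>count_space UNIV) < \<infinity>"
  shows "\<xi> \<in> fields M"
  using assms nn_integral_l2_int[OF assms(1)] by (simp add: fields_def)

lemma l2_int_less_top: "l2_int \<xi> < \<infinity> \<Longrightarrow> l2_bound \<xi> (sqrt (enn2real (l2_int \<xi>)))"
  using l2_int_le_iff[of "sqrt (enn2real (l2_int \<xi>))" \<xi>] by simp

lemma fields_AE:
  assumes "\<xi> \<in> fields M" shows "AE z in M. l2_bound (\<xi> z) (sqrt (enn2real (l2_int (\<xi> z))))"
proof -
  have "AE z in M. l2_int (\<xi> z) \<noteq> \<infinity>"
    using assms by (intro nn_integral_noteq_infinite l2_int_measurable) (auto simp: fields_def)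
  then show ?thesis by eventually_elim (simp add: l2_int_less_top less_top)
qed

lemma l2_int_reindex:
  assumes "bij h" shows "l2_int (\<lambda>q. \<xi> (h q)) = l2_int \<xi>"
  unfolding l2_int_def using nn_integral_bij_count_space[OF assms, of "\<lambda>p. ennreal ((cmod (\<xi> p))\<^sup>2)"] by simp

lemma fields_reindex:
  assumes "\<xi> \<in> fields M" "bij h" shows "(\<lambda>z q. \<xi> z (h q)) \<in> fields M"
  using assms by (simp add: fields_def l2_int_reindex)

text \<open>Replaces the net of finite sets of degrees by a sequence, for which dominated
  convergence and measurability of limits are available.\<close>

lemma symmetric_intervals: 
  "filterlim (\<lambda>n. {- int n..int n}) (finite_subsets_at_top UNIV) sequentially"
  unfolding filterlim_finite_subsets_at_top
proof (intro allI impI)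
  fix X :: "int set" assume "finite X \<and> X \<subseteq> UNIV"
  then have X: "finite X" by simp
  define N where "N = nat (Max (insert 0 (abs ` X)))"
  have "\<bar>x\<bar> \<le> int N" if "x \<in> X" for x using X that by (simp add: N_def Max_ge_iff)
  then have sub: "X \<subseteq> {- int n..int n}" if "N \<le> n" for n using that by fastforce
  show "\<forall>\<^sub>F n in sequentially. finite {- int n..int n} \<and> X \<subseteq> {- int n..int n} \<and> {- int n..int n} \<subseteq> UNIV"
    using sub by (auto simp: eventually_sequentially intro!: exI[of _ N])
qed

lemma has_sum_symmetric:
  "(f has_sum s) UNIV \<Longrightarrow> (\<lambda>n. \<Sum>q\<in>{- int n..int n}. f q) \<longlonglongrightarrow> s"
  unfolding has_sum_def by (rule filterlim_compose[OF _ symmetric_intervals])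

text \<open>Cauchy-Schwarz in each fibre bounds all truncations by C times the l2 norm of the fibre
  of \<eta>. This is square integrable over S, so dominated convergence applies although there is no
  convergence in operator norm.\<close>

lemma row_sum:
  fixes r \<eta> :: "'a::euclidean_space \<Rightarrow> int \<Rightarrow> complex"
  assumes S: "S \<in> sets lebesgue" and r: "\<And>q. (\<lambda>z. r z q) \<in> borel_measurable (lebesgue_on S)" 
    and b: "\<And>z. z \<in> S \<Longrightarrow> l2_bound (r z) C" and \<eta>: "\<eta> \<in> fields (lebesgue_on S)"
  shows row_sum_AE: "AE z in lebesgue_on S. ((\<lambda>q. r z q * \<eta> z q) has_sum (\<Sum>\<^sub>\<infinity>q. r z q * \<eta> z q)) UNIV"
    and row_sum_measurable: "(\<lambda>z. \<Sum>\<^sub>\<infinity>q. r z q * \<eta> z q) \<in> borel_measurable (lebesgue_on S)"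
    and row_sum_limit: "(\<lambda>n. norm_sq (lebesgue_on S) (\<lambda>z. (\<Sum>q\<in>{- int n..int n}. r z q * \<eta> z q) - (\<Sum>\<^sub>\<infinity>q. r z q * \<eta> z q))) \<longlonglongrightarrow> 0"
proof -
  let ?M = "lebesgue_on S"
  \<comment> \<open>Where the fibre norm is infinite, \<open>enn2real\<close> returns 0; this
    happens on a null set only, and the domination is claimed almost everywhere.\<close>
  let ?w = "\<lambda>z. C * sqrt (enn2real (l2_int (\<eta> z)))"
  have m: "\<And>q. (\<lambda>z. \<eta> z q) \<in> borel_measurable ?M" using \<eta> by (simp add: fields_def)
  note ae = fields_AE[OF \<eta>]
  have sp: "AE z in ?M. z \<in> S" by (rule AE_I2) simp
  show hs: "AE z in ?M. ((\<lambda>q. r z q * \<eta> z q) has_sum (\<Sum>\<^sub>\<infinity>q. r z q * \<eta> z q)) UNIV"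
    using ae sp by eventually_elim (rule l2_bound_has_sum[OF b])
  have lim: "AE z in ?M. (\<lambda>n. \<Sum>q\<in>{- int n..int n}. r z q * \<eta> z q) \<longlonglongrightarrow> (\<Sum>\<^sub>\<infinity>q. r z q * \<eta> z q)"
    using hs by eventually_elim (rule has_sum_symmetric)
  have pm: "(\<lambda>z. \<Sum>q\<in>{- int n..int n}. r z q * \<eta> z q) \<in> borel_measurable ?M" for n
    by (intro borel_measurable_sum borel_measurable_times r m)
  show sm: "(\<lambda>z. \<Sum>\<^sub>\<infinity>q. r z q * \<eta> z q) \<in> borel_measurable ?M"
    by (rule lebesgue_on_measurable_limit[OF S pm lim])
  note [measurable] = l2_int_measurable[OF m]
  have wm: "?w \<in> borel_measurable ?M" by measurable
  show "(\<lambda>n. norm_sq ?M (\<lambda>z. (\<Sum>q\<in>{- int n..int n}. r z q * \<eta> z q) - (\<Sum>\<^sub>\<infinity>q. r z q * \<eta> z q))) \<longlonglongrightarrow> 0"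
  proof (rule norm_sq_dominated[OF sm pm wm _ _ lim])
    have "(\<integral>\<^sup>+z. ennreal ((?w z)\<^sup>2) \<partial>?M) \<le> (\<integral>\<^sup>+z. ennreal (C\<^sup>2) * l2_int (\<eta> z) \<partial>?M)"
    proof (rule nn_integral_mono)
      fix z
      have "ennreal ((?w z)\<^sup>2) = ennreal (C\<^sup>2) * ennreal (enn2real (l2_int (\<eta> z)))"
        by (simp add: power_mult_distrib ennreal_mult)
      also have "\<dots> \<le> ennreal (C\<^sup>2) * l2_int (\<eta> z)" by (intro mult_left_mono) (simp_all add: ennreal_enn2real_if)
      finally show "ennreal ((?w z)\<^sup>2) \<le> ennreal (C\<^sup>2) * l2_int (\<eta> z)" .
    qed
    also have "\<dots> = ennreal (C\<^sup>2) * (\<integral>\<^sup>+z. l2_int (\<eta> z) \<partial>?M)" by (simp add: nn_integral_cmult)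
    also have "\<dots> < \<infinity>" using \<eta> by (simp add: fields_def ennreal_mult_less_top)
    finally show "(\<integral>\<^sup>+z. ennreal ((?w z)\<^sup>2) \<partial>?M) < \<infinity>" .
    show "AE z in ?M. cmod (\<Sum>q\<in>{- int n..int n}. r z q * \<eta> z q) \<le> ?w z" for n
      using ae sp
    proof eventually_elim
      case (elim z)
      have "cmod (\<Sum>q\<in>{- int n..int n}. r z q * \<eta> z q) \<le> (\<Sum>q\<in>{- int n..int n}. cmod (r z q * \<eta> z q))" by (rule norm_sum)
      also have "\<dots> \<le> ?w z" by (rule l2_bound_summable(3)[OF b[OF elim(2)] elim(1)]) simp
      finally show ?case .
    qed
  qed
qed

section \<open>The representation\<close>

abbreviation fld :: "qfun \<Rightarrow> real \<times> real \<Rightarrow> int \<Rightarrow> complex" where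
  "fld \<xi> \<equiv> \<lambda>z. \<xi> (fst z) (snd z)"

lemma hnorm2_eq:
  assumes "\<And>p. (\<lambda>z. fld \<xi> z p) \<in> borel_measurable Sq"
  shows "hnorm2 \<xi> = (\<integral>\<^sup>+z. l2_int (fld \<xi> z) \<partial>Sq)"
  unfolding hnorm2_def l2_square_norm_sq nn_integral_l2_int[OF assms] ..

lemma hilb_iff: "\<xi> \<in> hilb \<longleftrightarrow> fld \<xi> \<in> fields Sq"
proof
  assume "\<xi> \<in> hilb"
  then have "\<And>p. (\<lambda>z. fld \<xi> z p) \<in> borel_measurable Sq" "hnorm2 \<xi> < \<infinity>"
    by (auto simp: hilb_def L2_cyl_iff L2_def)
  then show "fld \<xi> \<in> fields Sq" by (simp add: fields_def hnorm2_eq)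
next
  assume *: "fld \<xi> \<in> fields Sq"
  then have "\<And>p. (\<lambda>z. fld \<xi> z p) \<in> borel_measurable Sq" by (simp add: fields_def)
  with * show "\<xi> \<in> hilb" using fields_component[OF *] by (simp add: hilb_def L2_cyl_iff hnorm2_eq fields_def)
qed

lemma hilbD:
  assumes "\<xi> \<in> hilb"
  shows "(\<lambda>z. fld \<xi> z p) \<in> L2 Sq" "(\<lambda>z. fld \<xi> z p) \<in> borel_measurable Sq" 
    "hnorm2 \<xi> = (\<integral>\<^sup>+z. l2_int (fld \<xi> z) \<partial>Sq)" "hnorm2 \<xi> < \<infinity>"
    "AE z in Sq. l2_bound (fld \<xi> z) (sqrt (enn2real (l2_int (fld \<xi> z))))"
proof -
  have f: "fld \<xi> \<in> fields Sq" using assms by (simp add: hilb_iff)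
  show "(\<lambda>z. fld \<xi> z p) \<in> L2 Sq" using fields_component[OF f] .
  show m: "(\<lambda>z. fld \<xi> z p) \<in> borel_measurable Sq" for p using f by (simp add: fields_def)
  show "hnorm2 \<xi> = (\<integral>\<^sup>+z. l2_int (fld \<xi> z) \<partial>Sq)" by (rule hnorm2_eq[OF m])
  then show "hnorm2 \<xi> < \<infinity>" using f by (simp add: fields_def)
  show "AE z in Sq. l2_bound (fld \<xi> z) (sqrt (enn2real (l2_int (fld \<xi> z))))" by (rule fields_AE[OF f])
qed

lemma heq_iff: "heq \<xi> \<eta> \<longleftrightarrow> (AE z in Sq. \<forall>p. fld \<xi> z p = fld \<eta> z p)"
  unfolding heq_def by (simp add: AE_all_countable)

lemma heqD: "heq \<xi> \<eta> \<Longrightarrow> AE z in Sq. \<forall>p. fld \<xi> z p = fld \<eta> z p"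
  by (simp add: heq_iff)

lemma heq_refl: "heq \<xi> \<xi>" by (simp add: heq_def)

lemma heq_sym: "heq \<xi> \<eta> \<Longrightarrow> heq \<eta> \<xi>" 
  unfolding heq_iff by (elim eventually_mono) simp

lemma heq_trans: 
  assumes "heq \<xi> \<eta>" "heq \<eta> \<zeta>" shows "heq \<xi> \<zeta>"
  unfolding heq_iff using heqD[OF assms(1)] heqD[OF assms(2)] by eventually_elim simp

lemma hilb_heq:
  assumes "\<xi> \<in> hilb" "heq \<xi> \<eta>" shows "\<eta> \<in> hilb"
proof -
  note ae = heqD[OF assms(2)]
  have m: "(\<lambda>z. fld \<eta> z p) \<in> borel_measurable Sq" for p
    using ae by (intro lebesgue_on_measurable_AE[OF unit_square_lebesgue hilbD(2)[OF assms(1)]]) (elim eventually_mono, simp)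
  have "(\<integral>\<^sup>+z. l2_int (fld \<eta> z) \<partial>Sq) = (\<integral>\<^sup>+z. l2_int (fld \<xi> z) \<partial>Sq)"
    by (rule nn_integral_cong_AE) (use ae in \<open>elim eventually_mono, simp add: l2_int_def\<close>)
  then show ?thesis using m hilbD(3,4)[OF assms(1)] by (simp add: hilb_iff fields_def)
qed

lemma norm_sq_hnorm2: "hnorm2 \<xi> = (\<integral>\<^sup>+p. norm_sq Sq (\<lambda>z. fld \<xi> z p) \<partial>count_space UNIV)"
  by (simp add: hnorm2_def l2_square_norm_sq)

lemma hnorm2_heq: "heq \<xi> \<eta> \<Longrightarrow> hnorm2 \<xi> = hnorm2 \<eta>"
  unfolding norm_sq_hnorm2 heq_def by (intro nn_integral_cong norm_sq_cong) blast

lemma hnorm2_add: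
  assumes "\<xi> \<in> hilb" "\<eta> \<in> hilb"
  shows "hnorm2 (\<lambda>x y p. \<xi> x y p + \<eta> x y p) \<le> 2 * hnorm2 \<xi> + 2 * hnorm2 \<eta>"
proof -
  have "hnorm2 (\<lambda>x y p. \<xi> x y p + \<eta> x y p) \<le> 
     (\<integral>\<^sup>+p. 2 * norm_sq Sq (\<lambda>z. fld \<xi> z p) + 2 * norm_sq Sq (\<lambda>z. fld \<eta> z p) \<partial>count_space UNIV)"
    unfolding norm_sq_hnorm2 by (intro nn_integral_mono norm_sq_add hilbD(2) assms)
  also have "\<dots> = 2 * hnorm2 \<xi> + 2 * hnorm2 \<eta>"
    unfolding norm_sq_hnorm2 by (subst nn_integral_add) (auto simp: nn_integral_cmult)
  finally show ?thesis .
qed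

lemma hnorm2_mult:
  assumes "\<xi> \<in> hilb" "0 \<le> B" "\<And>z p. z \<in> unit_square \<Longrightarrow> cmod (fld m z p) \<le> B"
  shows "hnorm2 (\<lambda>x y p. m x y p * \<xi> x y p) \<le> ennreal (B\<^sup>2) * hnorm2 \<xi>"
proof -
  have "hnorm2 (\<lambda>x y p. m x y p * \<xi> x y p) \<le> (\<integral>\<^sup>+p. ennreal (B\<^sup>2) * norm_sq Sq (\<lambda>z. fld \<xi> z p) \<partial>count_space UNIV)"
    unfolding norm_sq_hnorm2 by (intro nn_integral_mono norm_sq_mult_le hilbD(2) assms) (use assms in auto)
  also have "\<dots> = ennreal (B\<^sup>2) * hnorm2 \<xi>" unfolding norm_sq_hnorm2 by (simp add: nn_integral_cmult)
  finally show ?thesis .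
qed

lemma hilbI: 
  assumes "\<And>p. (\<lambda>z. fld \<xi> z p) \<in> borel_measurable Sq" "hnorm2 \<xi> < \<infinity>" shows "\<xi> \<in> hilb"
  using assms by (simp add: hilb_iff fields_def hnorm2_eq)

lemma hilb_add: 
  assumes "\<xi> \<in> hilb" "\<eta> \<in> hilb" shows "(\<lambda>x y p. \<xi> x y p + \<eta> x y p) \<in> hilb"
proof (rule hilbI)
  show "hnorm2 (\<lambda>x y p. \<xi> x y p + \<eta> x y p) < \<infinity>"
    by (rule order_le_less_trans[OF hnorm2_add[OF assms] ennreal_two_less_top[OF hilbD(4)[OF assms(1)] hilbD(4)[OF assms(2)]]])
qed (intro borel_measurable_add hilbD(2) assms)

lemma hilb_mult: 
  assumes "\<xi> \<in> hilb" "\<And>z p. z \<in> unit_square \<Longrightarrow> cmod (fld m z p) \<le> B" "\<And>p. (\<lambda>z. fld m z p) \<in> borel_measurable Sq"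
  shows "(\<lambda>x y p. m x y p * \<xi> x y p) \<in> hilb"
proof (rule hilbI)
  have "cmod (fld m (0, 0) 0) \<le> B" by (rule assms(2)) simp
  then have "0 \<le> B" using norm_ge_zero order_trans by blast
  from order_le_less_trans[OF hnorm2_mult[of \<xi> B m, OF assms(1) this assms(2)]]
  show "hnorm2 (\<lambda>x y p. m x y p * \<xi> x y p) < \<infinity>"
    using hilbD(4)[OF assms(1)] by (simp add: ennreal_mult_less_top)
qed (intro borel_measurable_times hilbD(2) assms)

lemma hilb_cmult: "\<xi> \<in> hilb \<Longrightarrow> (\<lambda>x y p. k * \<xi> x y p) \<in> hilb"
  by (rule hilb_mult[of _ "\<lambda>x y p. k" "cmod k"]) auto

lemma hilb_0: "(\<lambda>x y p. 0) \<in> hilb"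
  by (rule hilbI) (simp_all add: hnorm2_def l2_square_def)

lemma hilb_sum: "(\<And>i. i \<in> I \<Longrightarrow> f i \<in> hilb) \<Longrightarrow> (\<lambda>x y p. \<Sum>i\<in>I. f i x y p) \<in> hilb"
  by (induction I rule: infinite_finite_induct) (auto intro!: hilb_add hilb_0)

lemma hilb_uminus: "\<xi> \<in> hilb \<Longrightarrow> (\<lambda>x y p. - \<xi> x y p) \<in> hilb"
  using hilb_cmult[of \<xi> "-1"] by simp

lemma hilb_diff: "\<xi> \<in> hilb \<Longrightarrow> \<eta> \<in> hilb \<Longrightarrow> (\<lambda>x y p. \<xi> x y p - \<eta> x y p) \<in> hilb"
  using hilb_add[OF _ hilb_uminus, of \<xi> \<eta>] by simp

section \<open>The representation through fibre matrices\<close>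

lemma rep_eq: 
  "rep (- \<mu>) (- \<nu>) a \<xi> x y p = (\<Sum>\<^sub>\<infinity>q. a (x + 2 * of_int p * \<mu>) (y + 2 * of_int p * \<nu>) q * \<xi> x y (p - q))"
  by (simp add: rep_def)

text \<open>With the opposite signs of the parameters, the representation acts over each point of
  the square by the matrix \<open>qmat\<close> of the regular representation at this point.\<close>

lemma rep_qmat: "rep (- \<mu>) (- \<nu>) a \<xi> x y p = (\<Sum>\<^sub>\<infinity>s. qmat \<mu> \<nu> a x y p s * \<xi> x y s)"
  unfolding regular_rep_eq[symmetric] by (simp add: rep_def regular_rep_def)

lemma continuous_shift:
  assumes "continuous_on UNIV (unc f)" shows "continuous_on UNIV (\<lambda>z. f (fst z + a) (snd z + b))"
proof -
  have "continuous_on UNIV (\<lambda>z::real\<times>real. (fst z + a, snd z + b))" by (intro continuous_intros)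
  from continuous_on_compose2[OF assms this] show ?thesis by simp
qed

lemma qhm_shift_measurable:
  assumes "a \<in> qhm c \<mu> \<nu>"
  shows "(\<lambda>z. a (fst z + u) (snd z + v) q) \<in> borel_measurable Sq"
  using continuous_measurable[OF continuous_shift[OF qhm_continuous[OF assms]]] .

text \<open>The matrix bound C holds on almost every fibre with the same constant, so it integrates
  over the square.\<close>

lemma rep_hilb_aux:
  assumes a: "a \<in> qhm c \<mu> \<nu>" and C: "qhm_bound \<mu> \<nu> a C" and \<xi>: "\<xi> \<in> hilb"
  shows "rep (- \<mu>) (- \<nu>) a \<xi> \<in> hilb" "hnorm2 (rep (- \<mu>) (- \<nu>) a \<xi>) \<le> ennreal (C\<^sup>2) * hnorm2 \<xi>"
proof -
  have f: "fld \<xi> \<in> fields Sq" using \<xi> by (simp add: hilb_iff)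
  have m: "(\<lambda>z. fld (rep (- \<mu>) (- \<nu>) a \<xi>) z p) \<in> borel_measurable Sq" for p
    unfolding rep_eq
  proof (rule row_sum_measurable[OF unit_square_lebesgue qhm_shift_measurable[OF a]])
    show "l2_bound (a (fst z + 2 * of_int p * \<mu>) (snd z + 2 * of_int p * \<nu>)) C" for z by (rule qhm_bound_row[OF C])
    have "bij (\<lambda>q. p - q)" by (rule bij_betw_byWitness[of _ "\<lambda>q. p - q"]) auto
    from fields_reindex[OF f this] show "(\<lambda>z q. fld \<xi> z (p - q)) \<in> fields Sq" .
  qed
  have m\<xi>: "\<And>p. (\<lambda>z. fld \<xi> z p) \<in> borel_measurable Sq" by (rule hilbD(2)[OF \<xi>])
  have "hnorm2 (rep (- \<mu>) (- \<nu>) a \<xi>) = (\<integral>\<^sup>+z. l2_int (fld (rep (- \<mu>) (- \<nu>) a \<xi>) z) \<partial>Sq)"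
    by (rule hnorm2_eq[OF m])
  also have "\<dots> \<le> (\<integral>\<^sup>+z. ennreal (C\<^sup>2) * l2_int (fld \<xi> z) \<partial>Sq)"
  proof (rule nn_integral_mono_AE)
    show "AE z in Sq. l2_int (fld (rep (- \<mu>) (- \<nu>) a \<xi>) z) \<le> ennreal (C\<^sup>2) * l2_int (fld \<xi> z)"
      using hilbD(5)[OF \<xi>]
    proof eventually_elim
      case (elim z)
      let ?d = "sqrt (enn2real (l2_int (fld \<xi> z)))"
      have "matrix_bound (qmat \<mu> \<nu> a (fst z) (snd z)) C" using C by (simp add: qhm_bound_def)
      from matrix_bound_apply[OF this elim] have "l2_bound (fld (rep (- \<mu>) (- \<nu>) a \<xi>) z) (C * ?d)" 
        by (simp add: rep_qmat[abs_def])
      then have "l2_int (fld (rep (- \<mu>) (- \<nu>) a \<xi>) z) \<le> ennreal ((C * ?d)\<^sup>2)"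
        using l2_int_le_iff[of "C * ?d"] qhm_bound_nonneg[OF C] by simp
      also have "\<dots> = ennreal (C\<^sup>2) * ennreal (enn2real (l2_int (fld \<xi> z)))"
        by (simp add: power_mult_distrib ennreal_mult)
      also have "\<dots> \<le> ennreal (C\<^sup>2) * l2_int (fld \<xi> z)" by (intro mult_left_mono) (simp_all add: ennreal_enn2real_if)
      finally show ?case .
    qed
  qed
  also have "\<dots> = ennreal (C\<^sup>2) * hnorm2 \<xi>"
    unfolding hnorm2_eq[OF m\<xi>] by (rule nn_integral_cmult[OF l2_int_measurable[OF m\<xi>]])
  finally show le: "hnorm2 (rep (- \<mu>) (- \<nu>) a \<xi>) \<le> ennreal (C\<^sup>2) * hnorm2 \<xi>" .
  also have "\<dots> < \<infinity>" using hilbD(4)[OF \<xi>] by (simp add: ennreal_mult_less_top)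
  finally show "rep (- \<mu>) (- \<nu>) a \<xi> \<in> hilb" by (rule hilbI[OF m])
qed

lemma rep_hilb:
  assumes "a \<in> qhm c \<mu> \<nu>" "\<xi> \<in> hilb" shows "rep (- \<mu>) (- \<nu>) a \<xi> \<in> hilb"
proof -
  obtain C where "qhm_bound \<mu> \<nu> a C" using qhm_bounded[OF assms(1)] .
  from rep_hilb_aux(1)[OF assms(1) this assms(2)] show ?thesis .
qed

lemma rep_cong: "heq \<xi> \<eta> \<Longrightarrow> heq (rep \<mu> \<nu> a \<xi>) (rep \<mu> \<nu> a \<eta>)"
  unfolding heq_iff by (elim eventually_mono) (simp add: rep_def)

lemma rep_has_sum_AE:
  assumes "a \<in> qhm c \<mu> \<nu>" "\<xi> \<in> hilb"
  shows "AE z in Sq. \<forall>p. ((\<lambda>s. qmat \<mu> \<nu> a (fst z) (snd z) p s * fld \<xi> z s) has_sum fld (rep (- \<mu>) (- \<nu>) a \<xi>) z p) UNIV"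
proof -
  obtain C where C: "qhm_bound \<mu> \<nu> a C" using qhm_bounded[OF assms(1)] .
  show ?thesis
    using hilbD(5)[OF assms(2)]
  proof eventually_elim
    case (elim z)
    have "matrix_bound (qmat \<mu> \<nu> a (fst z) (snd z)) C" using C by (simp add: qhm_bound_def)
    from matrix_bound_has_sum[OF this elim] show ?case unfolding rep_qmat by blast
  qed
qed

text \<open>Linearity holds only almost everywhere: on fibres that are not square summable the sums
  may diverge, and a divergent sum is 0 by convention.\<close>

lemma rep_lincomb:
  assumes "a \<in> qhm c \<mu> \<nu>" "\<xi> \<in> hilb" "\<eta> \<in> hilb"
  shows "heq (rep (- \<mu>) (- \<nu>) a (\<lambda>x y p. k * \<xi> x y p + l * \<eta> x y p))
    (\<lambda>x y p. k * rep (- \<mu>) (- \<nu>) a \<xi> x y p + l * rep (- \<mu>) (- \<nu>) a \<eta> x y p)"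
  unfolding heq_iff using rep_has_sum_AE[OF assms(1,2)] rep_has_sum_AE[OF assms(1,3)]
proof eventually_elim
  case (elim z)
  show ?case
  proof
    fix p
    let ?A = "qmat \<mu> \<nu> a (fst z) (snd z) p"
    have "((\<lambda>s. k * (?A s * fld \<xi> z s) + l * (?A s * fld \<eta> z s)) has_sum 
       (k * fld (rep (- \<mu>) (- \<nu>) a \<xi>) z p + l * fld (rep (- \<mu>) (- \<nu>) a \<eta>) z p)) UNIV"
      using elim by (intro has_sum_add has_sum_cmult_right) auto
    then have "(\<Sum>\<^sub>\<infinity>s. k * (?A s * fld \<xi> z s) + l * (?A s * fld \<eta> z s)) = 
       k * fld (rep (- \<mu>) (- \<nu>) a \<xi>) z p + l * fld (rep (- \<mu>) (- \<nu>) a \<eta>) z p" by (rule infsumI)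
    then show "fld (rep (- \<mu>) (- \<nu>) a (\<lambda>x y p. k * \<xi> x y p + l * \<eta> x y p)) z p = 
      k * fld (rep (- \<mu>) (- \<nu>) a \<xi>) z p + l * fld (rep (- \<mu>) (- \<nu>) a \<eta>) z p"
      by (subst rep_qmat) (simp add: algebra_simps)
  qed
qed

lemma rep_uminus: "rep \<mu> \<nu> a (\<lambda>x y p. - \<xi> x y p) = (\<lambda>x y p. - rep \<mu> \<nu> a \<xi> x y p)"
  by (intro ext) (simp add: rep_def infsum_uminus)

lemma rep_lincomb_left:
  assumes "a \<in> qhm c \<mu> \<nu>" "b \<in> qhm c \<mu> \<nu>" "\<xi> \<in> hilb"
  shows "heq (rep (- \<mu>) (- \<nu>) (\<lambda>x y p. k * a x y p + l * b x y p) \<xi>)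
    (\<lambda>x y p. k * rep (- \<mu>) (- \<nu>) a \<xi> x y p + l * rep (- \<mu>) (- \<nu>) b \<xi> x y p)"
  unfolding heq_iff using rep_has_sum_AE[OF assms(1,3)] rep_has_sum_AE[OF assms(2,3)]
proof eventually_elim
  case (elim z)
  show ?case
  proof
    fix p
    let ?A = "qmat \<mu> \<nu> a (fst z) (snd z) p" and ?B = "qmat \<mu> \<nu> b (fst z) (snd z) p"
    have "((\<lambda>s. k * (?A s * fld \<xi> z s) + l * (?B s * fld \<xi> z s)) has_sum 
       (k * fld (rep (- \<mu>) (- \<nu>) a \<xi>) z p + l * fld (rep (- \<mu>) (- \<nu>) b \<xi>) z p)) UNIV"
      using elim by (intro has_sum_add has_sum_cmult_right) auto
    then have "(\<Sum>\<^sub>\<infinity>s. k * (?A s * fld \<xi> z s) + l * (?B s * fld \<xi> z s)) = 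
       k * fld (rep (- \<mu>) (- \<nu>) a \<xi>) z p + l * fld (rep (- \<mu>) (- \<nu>) b \<xi>) z p" by (rule infsumI)
    then show "fld (rep (- \<mu>) (- \<nu>) (\<lambda>x y p. k * a x y p + l * b x y p) \<xi>) z p = 
      k * fld (rep (- \<mu>) (- \<nu>) a \<xi>) z p + l * fld (rep (- \<mu>) (- \<nu>) b \<xi>) z p"
      by (subst rep_qmat) (simp add: qmat_def algebra_simps)
  qed
qed

text \<open>On every square summable fibre this is the associativity of two bounded matrices and a
  vector, \<open>matrix_bound_assoc\<close>.\<close>

lemma rep_qmult:
  assumes "a \<in> qhm c \<mu> \<nu>" "b \<in> qhm c \<mu> \<nu>" "\<xi> \<in> hilb"
  shows "heq (rep (- \<mu>) (- \<nu>) a (rep (- \<mu>) (- \<nu>) b \<xi>)) (rep (- \<mu>) (- \<nu>) (qmult \<mu> \<nu> a b) \<xi>)"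
proof -
  obtain C where C: "qhm_bound \<mu> \<nu> a C" using qhm_bounded[OF assms(1)] .
  obtain D where D: "qhm_bound \<mu> \<nu> b D" using qhm_bounded[OF assms(2)] .
  show ?thesis
    unfolding heq_iff using hilbD(5)[OF assms(3)]
  proof eventually_elim
    case (elim z)
    have m: "matrix_bound (qmat \<mu> \<nu> a (fst z) (snd z)) C" "matrix_bound (qmat \<mu> \<nu> b (fst z) (snd z)) D" 
      using C D by (simp_all add: qhm_bound_def)
    show ?case
      unfolding rep_qmat qmat_qmult using infsumI[OF matrix_bound_assoc[OF m elim]] by simp
  qed
qed

lemma rep_qunit: "rep \<mu> \<nu> qunit \<xi> = \<xi>"
proof (intro ext)
  fix x y p
  have "rep \<mu> \<nu> qunit \<xi> x y p = (\<Sum>\<^sub>\<infinity>q\<in>{0}. \<xi> x y (p - q))"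
    unfolding rep_def by (rule infsum_cong_neutral) (auto simp: qunit_def)
  then show "rep \<mu> \<nu> qunit \<xi> x y p = \<xi> x y p" by simp
qed

section \<open>The domain of the Dirac operator\<close>

lemma dirac_dom1D:
  assumes "\<Phi> \<in> dirac_dom1 c (- \<mu>) (- \<nu>)"
  shows "\<Phi> \<in> hilb" "(\<lambda>x y. \<Phi> x y p) \<in> H1_cyl"
    "\<exists>g. has_sobolev_trace (\<lambda>x y. \<Phi> x y p) 1 g \<and>
        has_sobolev_trace (\<lambda>x y. \<Phi> x y p) 0 (\<lambda>y. cnj (ee (of_int (c * p) * (y + of_int p * \<nu>))) * g y)"
    "(\<lambda>x y p. of_int p * \<Phi> x y p) \<in> hilb"
    "(\<lambda>x y p. weak_dy (\<lambda>x y. ee (of_int \<lfloor>of_int c * (of_int p)\<^sup>2 * (- \<mu>)\<rfloor> * y) * \<Phi> x y p) x y) \<in> hilb"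
    "(\<lambda>x y p. weak_dx (\<lambda>x y. \<Phi> x y p) x y) \<in> hilb"
  using assms unfolding dirac_dom1_def by auto

lemma dirac_dom1I:
  assumes "\<Phi> \<in> hilb" "\<And>p. (\<lambda>x y. \<Phi> x y p) \<in> H1_cyl"
    "\<And>p. \<exists>g. has_sobolev_trace (\<lambda>x y. \<Phi> x y p) 1 g \<and>
        has_sobolev_trace (\<lambda>x y. \<Phi> x y p) 0 (\<lambda>y. cnj (ee (of_int (c * p) * (y + of_int p * \<nu>))) * g y)"
    "(\<lambda>x y p. of_int p * \<Phi> x y p) \<in> hilb"
    "(\<lambda>x y p. weak_dy (\<lambda>x y. ee (of_int \<lfloor>of_int c * (of_int p)\<^sup>2 * (- \<mu>)\<rfloor> * y) * \<Phi> x y p) x y) \<in> hilb"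
    "(\<lambda>x y p. weak_dx (\<lambda>x y. \<Phi> x y p) x y) \<in> hilb"
  shows "\<Phi> \<in> dirac_dom1 c (- \<mu>) (- \<nu>)"
  using assms unfolding dirac_dom1_def by auto

lemma ee_int_smooth: 
  "(\<lambda>x y. ee (of_int n * y)) \<in> smooth_cyl"
  "pdx (\<lambda>x y. ee (of_int n * y)) = (\<lambda>x y. 0)"
  "pdy (\<lambda>x y. ee (of_int n * y)) = (\<lambda>x y. 2 * of_real pi * \<i> * of_int n * ee (of_int n * y))"
proof -
  have "ee (of_int n * (y + 1)) = ee (of_int n * y)" for y by (simp add: distrib_left ee_add)
  moreover have "plane_smooth (\<lambda>x y. ee (of_int n * y))"
    by (rule plane_smooth_ee, unfold of_real_mult, intro plane_smooth_mult plane_smooth_const plane_smooth_snd)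
  ultimately show "(\<lambda>x y. ee (of_int n * y)) \<in> smooth_cyl" by (simp add: smooth_cyl_iff)
  show "pdx (\<lambda>x y. ee (of_int n * y)) = (\<lambda>x y. 0)" by (rule pdx_eq) simp
  show "pdy (\<lambda>x y. ee (of_int n * y)) = (\<lambda>x y. 2 * of_real pi * \<i> * of_int n * ee (of_int n * y))"
    using has_vector_derivative_ee_mult[of "of_int n"] by (intro pdy_eq) simp
qed

lemma weak_dy_phase:
  assumes f: "unc f \<in> L2 Sq" and w: "weak_deriv pdy f g"
  shows "AE z in Sq. unc (weak_dy (\<lambda>x y. ee (of_int n * y) * f x y)) z = 
    ee (of_int n * snd z) * (unc g z + 2 * of_real pi * \<i> * of_int n * unc f z)"
proof -
  have "weak_deriv pdy (\<lambda>x y. ee (of_int n * y) * f x y) 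
    (\<lambda>x y. ee (of_int n * y) * g x y + pdy (\<lambda>x y. ee (of_int n * y)) x y * f x y)"
    by (rule weak_mult[OF _ ee_int_smooth(1) f w]) simp
  from weak_dy_AE[OF this[unfolded ee_int_smooth(3)]] show ?thesis
    by eventually_elim (simp add: algebra_simps)
qed

lemma floor_bound: "cmod (of_int \<lfloor>t\<rfloor> - of_real t) \<le> 1"
proof -
  have "cmod (of_int \<lfloor>t\<rfloor> - of_real t) = \<bar>of_int \<lfloor>t\<rfloor> - t\<bar>" 
    using norm_of_real[of "of_int \<lfloor>t\<rfloor> - t", where 'a=complex] by simp
  also have "\<dots> \<le> 1" by linarith
  finally show ?thesis .
qed

text \<open>
  The phase \<open>e(n y)\<close>, with \<open>n\<close> the integral part of \<open>- c p\<^sup>2 \<mu>\<close>, absorbs the quadratic growth in \<open>p\<close>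
  of the multiplier in \<open>hdelta HX\<close>.
\<close>

lemma hdelta_HX_AE:
  assumes f: "unc f \<in> L2 Sq" and w: "weak_deriv pdy f g"
  shows "AE z in Sq. ee (of_int \<lfloor>of_int c * (of_int p)\<^sup>2 * (- \<mu>)\<rfloor> * snd z) * (
     2 * of_real pi * \<i> * of_int c * of_real (fst z) * (of_int p * unc f z) +
     2 * of_real pi * \<i> * (of_int \<lfloor>of_int c * (of_int p)\<^sup>2 * (- \<mu>)\<rfloor> - of_real (of_int c * (of_int p)\<^sup>2 * (- \<mu>))) * unc f z
     - (2 * of_real pi * \<i> * of_int c * of_int p * of_real (fst z - of_int p * (- \<mu>)) * unc f z - unc g z))
     = unc (weak_dy (\<lambda>x y. ee (of_int \<lfloor>of_int c * (of_int p)\<^sup>2 * (- \<mu>)\<rfloor> * y) * f x y)) z"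
  using weak_dy_phase[OF f w, of "\<lfloor>of_int c * (of_int p)\<^sup>2 * (- \<mu>)\<rfloor>"]
  by eventually_elim (simp add: power2_eq_square algebra_simps)

lemma multiplier_hilb:
  assumes "\<xi> \<in> hilb" shows "(\<lambda>x y p. k * of_real x * \<xi> x y p) \<in> hilb"
    "(\<lambda>x y p. k * (of_int \<lfloor>t p\<rfloor> - of_real (t p)) * \<xi> x y p) \<in> hilb"
    "(\<lambda>x y p. ee (of_int (n p) * y) * \<xi> x y p) \<in> hilb" "(\<lambda>x y p. ee (- (of_int (n p) * y)) * \<xi> x y p) \<in> hilb"
proof -
  show "(\<lambda>x y p. k * of_real x * \<xi> x y p) \<in> hilb"
  proof (rule hilb_mult[OF assms, of _ "cmod k"])
    show "cmod (k * of_real (fst z)) \<le> cmod k" if "z \<in> unit_square" for z p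
      using that by (auto simp: norm_mult mult_left_le)
  qed (intro continuous_measurable continuous_intros)
  show "(\<lambda>x y p. k * (of_int \<lfloor>t p\<rfloor> - of_real (t p)) * \<xi> x y p) \<in> hilb"
  proof (rule hilb_mult[OF assms, of _ "cmod k"])
    show "cmod (k * (of_int \<lfloor>t p\<rfloor> - of_real (t p))) \<le> cmod k" if "z \<in> unit_square" for p and z :: "real \<times> real"
      using floor_bound[of "t p"] by (simp add: norm_mult mult_left_le)
  qed simp
  show "(\<lambda>x y p. ee (of_int (n p) * y) * \<xi> x y p) \<in> hilb" "(\<lambda>x y p. ee (- (of_int (n p) * y)) * \<xi> x y p) \<in> hilb"
    by (rule hilb_mult[OF assms, of _ 1], simp, intro continuous_measurable continuous_intros)+
qed

text \<open>For \<open>HX\<close> the phase identity is read backwards: up to a unimodular factor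
  the covariant derivative is the weak derivative of the phased function, corrected by bounded
  multiples of \<Phi> and of p \<Phi>, all of which the domain controls.\<close>

lemma hdelta_hilb:
  assumes \<Phi>: "\<Phi> \<in> dirac_dom1 c (- \<mu>) (- \<nu>)"
  shows "hdelta c (- \<mu>) j \<Phi> \<in> hilb"
proof (cases j)
  case HX
  let ?n = "\<lambda>p::int. \<lfloor>of_int c * (of_int p)\<^sup>2 * (- \<mu>)\<rfloor>"
  let ?t = "\<lambda>p::int. of_int c * (of_int p)\<^sup>2 * (- \<mu>)"
  let ?w = "\<lambda>x y p. weak_dy (\<lambda>x y. ee (of_int (?n p) * y) * \<Phi> x y p) x y"
  let ?\<xi> = "\<lambda>x y p. 2 * of_real pi * \<i> * of_int c * of_real x * (of_int p * \<Phi> x y p) +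
     2 * of_real pi * \<i> * (of_int \<lfloor>?t p\<rfloor> - of_real (?t p)) * \<Phi> x y p
     - ee (- (of_int (?n p) * y)) * ?w x y p"
  have "?\<xi> \<in> hilb"
    by (intro hilb_diff hilb_add multiplier_hilb dirac_dom1D[OF \<Phi>])
  moreover have "heq ?\<xi> (hdelta c (- \<mu>) j \<Phi>)"
    unfolding heq_def
  proof
    fix p
    note H = H1_cylD[OF dirac_dom1D(2)[OF \<Phi>, of p]]
    show "AE z in Sq. fld ?\<xi> z p = fld (hdelta c (- \<mu>) j \<Phi>) z p"
      using hdelta_HX_AE[OF H(1,3), of c p \<mu>]
    proof eventually_elim
      case (elim z)
      show ?case unfolding HX hdelta.simps elim[symmetric] by (simp only: mult.assoc[symmetric] ee_uminus_mult) simp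
    qed
  qed
  ultimately show ?thesis by (rule hilb_heq)
next
  case HY
  show ?thesis unfolding HY hdelta.simps by (intro hilb_uminus dirac_dom1D[OF \<Phi>])
next
  case HZ
  have "(\<lambda>x y p. 2 * of_real pi * \<i> * (of_int p * \<Phi> x y p)) \<in> hilb" by (intro hilb_cmult dirac_dom1D[OF \<Phi>])
  then show ?thesis unfolding HZ hdelta.simps by (simp add: mult.assoc)
qed

section \<open>The representation and the derivations\<close>

lemma has_vector_derivative_shift:
  fixes f :: "real \<Rightarrow> complex"
  assumes "(f has_vector_derivative D) (at (x + a))" shows "((\<lambda>s. f (s + a)) has_vector_derivative D) (at x)"
  using vector_diff_chain_at[of "\<lambda>s. s + a" 1 x f D] assms
  by (simp add: o_def has_vector_derivative_add_const)

lemma plane_Ck_shift: "plane_Ck k f \<Longrightarrow> plane_Ck k (\<lambda>x y. f (x + a) (y + b))"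
proof (induction k arbitrary: f)
  case 0
  then show ?case using continuous_shift[of f a b] by simp
next
  case (Suc k)
  note f = plane_Ck_SucD[OF Suc.prems]
  show ?case
    by (rule plane_Ck_SucI[of _ "\<lambda>x y. pdx f (x + a) (y + b)" "\<lambda>x y. pdy f (x + a) (y + b)"])
       (rule has_vector_derivative_shift[of "\<lambda>s. f s _"] has_vector_derivative_shift[of "f _"] Suc.IH f)+
qed

lemma reflect_fields:
  assumes "\<xi> \<in> fields M" shows "(\<lambda>z q. \<xi> z (p - q)) \<in> fields M"
proof -
  have "bij (\<lambda>q. p - q)" by (rule bij_betw_byWitness[of _ "\<lambda>q. p - q"]) auto
  from fields_reindex[OF assms this] show ?thesis .
qed

lemma norm_sq_add_limit:
  assumes "\<And>n. F n \<in> borel_measurable M" "\<And>n. G n \<in> borel_measurable M" "f \<in> borel_measurable M" "g \<in> borel_measurable M"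
    "(\<lambda>n. norm_sq M (\<lambda>z. F n z - f z)) \<longlonglongrightarrow> 0" "(\<lambda>n. norm_sq M (\<lambda>z. G n z - g z)) \<longlonglongrightarrow> 0"
  shows "(\<lambda>n. norm_sq M (\<lambda>z. F n z + G n z - (f z + g z))) \<longlonglongrightarrow> 0"
proof -
  have "(\<lambda>n. 2 * norm_sq M (\<lambda>z. F n z - f z) + 2 * norm_sq M (\<lambda>z. G n z - g z)) \<longlonglongrightarrow> 2 * 0 + 2 * 0"
    by (intro tendsto_add ennreal_tendsto_cmult assms) auto
  then have l: "(\<lambda>n. 2 * norm_sq M (\<lambda>z. F n z - f z) + 2 * norm_sq M (\<lambda>z. G n z - g z)) \<longlonglongrightarrow> 0" by simp
  show ?thesis
  proof (rule tendsto_sandwich[OF _ _ tendsto_const l])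
    show "\<forall>\<^sub>F n in sequentially. norm_sq M (\<lambda>z. F n z + G n z - (f z + g z)) \<le> 2 * norm_sq M (\<lambda>z. F n z - f z) + 2 * norm_sq M (\<lambda>z. G n z - g z)"
      unfolding add_diff_add by (intro always_eventually allI norm_sq_add borel_measurable_diff assms)
  qed simp
qed

lemma norm_sq_mult_limit:
  assumes "\<And>n. F n \<in> borel_measurable M" "f \<in> borel_measurable M" "\<And>z. z \<in> space M \<Longrightarrow> cmod (m z) \<le> B" "0 \<le> B"
    "(\<lambda>n. norm_sq M (\<lambda>z. F n z - f z)) \<longlonglongrightarrow> 0"
  shows "(\<lambda>n. norm_sq M (\<lambda>z. m z * F n z - m z * f z)) \<longlonglongrightarrow> 0"
proof -
  have "(\<lambda>n. ennreal (B\<^sup>2) * norm_sq M (\<lambda>z. F n z - f z)) \<longlonglongrightarrow> ennreal (B\<^sup>2) * 0"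
    by (intro ennreal_tendsto_cmult assms) auto
  then have l: "(\<lambda>n. ennreal (B\<^sup>2) * norm_sq M (\<lambda>z. F n z - f z)) \<longlonglongrightarrow> 0" by simp
  show ?thesis
  proof (rule tendsto_sandwich[OF _ _ tendsto_const l])
    show "\<forall>\<^sub>F n in sequentially. norm_sq M (\<lambda>z. m z * F n z - m z * f z) \<le> ennreal (B\<^sup>2) * norm_sq M (\<lambda>z. F n z - f z)"
      unfolding right_diff_distrib[symmetric] by (intro always_eventually allI norm_sq_mult_le borel_measurable_diff assms)
  qed simp
qed

context
  fixes c :: int and \<mu> \<nu> :: real and P :: qfun
  assumes P: "P \<in> smooth_qhm c \<mu> \<nu>"
begin

text \<open>The function by which P carries degree p - q into degree p. It is smooth and periodic,
  hence admissible as a factor in the Leibniz rules for weak derivatives and traces.\<close>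

definition coef :: "int \<Rightarrow> int \<Rightarrow> real \<Rightarrow> real \<Rightarrow> complex" where
  "coef p q x y = P (x + 2 * of_int p * \<mu>) (y + 2 * of_int p * \<nu>) q"

lemma P_qhm: "P \<in> qhm c \<mu> \<nu>"
  using P by (simp add: smooth_qhm_def)

lemma coef_smooth: "coef p q \<in> smooth_cyl"
proof -
  have "plane_smooth (\<lambda>x y. P (x + 2 * of_int p * \<mu>) (y + 2 * of_int p * \<nu>) q)"
    using smooth_qhm_plane_smooth[OF P, of q] plane_Ck_shift unfolding plane_smooth_def by blast
  moreover have "P x (y + 1 + a) q = P x (y + a) q" for x y a
    using qhm_periodic[OF P_qhm, of x "y + a" q] by (simp add: add_ac)
  ultimately show ?thesis unfolding coef_def[abs_def] smooth_cyl_iff by blast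
qed

lemma coef_pdx: "pdx (coef p q) x y = - qdelta c \<mu> HY P (x + 2 * of_int p * \<mu>) (y + 2 * of_int p * \<nu>) q"
proof -
  have "pdx (coef p q) = (\<lambda>x y. pdx (\<lambda>x y. P x y q) (x + 2 * of_int p * \<mu>) (y + 2 * of_int p * \<nu>))"
    unfolding coef_def[abs_def]
    by (rule pdx_eq) (rule has_vector_derivative_shift[of "\<lambda>s. P s _ q"], rule plane_smoothD(1)[OF smooth_qhm_plane_smooth[OF P]])
  then show ?thesis by (simp add: pdx_def)
qed

text \<open>The definition of \<open>qdelta\<close> at the shifted point, solved for the derivative;
  the multiplier therefore contains x + 2 p \<mu> in place of x.\<close>

lemma coef_pdy: 
  "pdy (coef p q) x y = 2 * of_real pi * \<i> * of_int c * of_int q * of_real (x + 2 * of_int p * \<mu> - of_int q * \<mu>) * coef p q x y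
     - qdelta c \<mu> HX P (x + 2 * of_int p * \<mu>) (y + 2 * of_int p * \<nu>) q"
proof -
  have "pdy (coef p q) = (\<lambda>x y. pdy (\<lambda>x y. P x y q) (x + 2 * of_int p * \<mu>) (y + 2 * of_int p * \<nu>))"
    unfolding coef_def[abs_def]
    by (rule pdy_eq) (rule has_vector_derivative_shift[of "\<lambda>s. P _ s q"], rule plane_smoothD(2)[OF smooth_qhm_plane_smooth[OF P]])
  then show ?thesis by (simp add: pdy_def coef_def)
qed

text \<open>The exponents satisfy p (y + p \<nu>) = q (y + 2 p \<nu> - q \<nu>) + (p - q) (y + (p -
  q) \<nu>). Thus quasi-periodicity of P in degree q turns the boundary condition of degree p - q
  into the one of degree p.\<close>

lemma coef_boundary:
  "coef p q 0 y * (cnj (ee (of_int (c * (p - q)) * (y + of_int (p - q) * \<nu>))) * t) = 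
   cnj (ee (of_int (c * p) * (y + of_int p * \<nu>))) * (coef p q 1 y * t)"
proof -
  have "coef p q 1 y = ee (of_int (c * 1 * q) * (y + 2 * of_int p * \<nu> - of_int q * \<nu>)) * coef p q 0 y"
    using qhm_shift[OF P_qhm, of "0 + 2 * of_int p * \<mu>" 1 "y + 2 * of_int p * \<nu>" q]
    by (simp add: coef_def add_ac)
  moreover have "ee (- (of_int (c * p) * (y + of_int p * \<nu>))) * ee (of_int (c * 1 * q) * (y + 2 * of_int p * \<nu> - of_int q * \<nu>))
     = ee (- (of_int (c * (p - q)) * (y + of_int (p - q) * \<nu>)))"
    unfolding ee_add[symmetric] by (rule arg_cong[of _ _ ee]) (simp add: algebra_simps)
  ultimately show ?thesis unfolding cnj_ee by (simp add: mult_ac)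
qed

definition rep_part :: "qfun \<Rightarrow> qfun \<Rightarrow> int \<Rightarrow> nat \<Rightarrow> real \<Rightarrow> real \<Rightarrow> complex" where
  "rep_part a \<xi> p n x y = (\<Sum>q\<in>{- int n..int n}. a (x + 2 * of_int p * \<mu>) (y + 2 * of_int p * \<nu>) q * \<xi> x y (p - q))"

lemma rep_part_limit:
  assumes a: "a \<in> qhm c \<mu> \<nu>" and \<xi>: "\<xi> \<in> hilb"
  shows "(\<lambda>n. norm_sq Sq (\<lambda>z. unc (rep_part a \<xi> p n) z - fld (rep (- \<mu>) (- \<nu>) a \<xi>) z p)) \<longlonglongrightarrow> 0"
proof -
  obtain C where C: "qhm_bound \<mu> \<nu> a C" using qhm_bounded[OF a] .
  show ?thesis unfolding rep_part_def rep_eq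
    by (rule row_sum_limit[OF unit_square_lebesgue qhm_shift_measurable[OF a] qhm_bound_row[OF C]])
       (use \<xi> in \<open>auto simp: hilb_iff intro!: reflect_fields\<close>)
qed

lemma rep_part_L2:
  assumes a: "a \<in> qhm c \<mu> \<nu>" and \<xi>: "\<xi> \<in> hilb"
  shows "unc (rep_part a \<xi> p n) \<in> L2 Sq"
proof -
  obtain C where C: "qhm_bound \<mu> \<nu> a C" using qhm_bounded[OF a] .
  show ?thesis unfolding rep_part_def
    by (rule L2_sum) (rule L2_mult[OF hilbD(1)[OF \<xi>] qhm_shift_measurable[OF a] qhm_bound_entry[OF C]])
qed

lemma qdelta_qhm: "qdelta c \<mu> j P \<in> qhm c \<mu> \<nu>"
  by (rule smooth_qhm_qdelta[OF P])

section \<open>The image of a vector of the domain\<close>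

context
  fixes \<Phi> :: qfun
  assumes \<Phi>: "\<Phi> \<in> dirac_dom1 c (- \<mu>) (- \<nu>)"
begin

abbreviation (input) "dom_dx \<equiv> \<lambda>x y p. weak_dx (\<lambda>x y. \<Phi> x y p) x y"
abbreviation (input) "rep_image \<equiv> rep (- \<mu>) (- \<nu>) P \<Phi>"
abbreviation (input) "mult_X p x \<equiv> 2 * of_real pi * \<i> * of_int c * of_int p * of_real (x - of_int p * (- \<mu>))"

lemma \<Phi>_hilb: "\<Phi> \<in> hilb" "dom_dx \<in> hilb" 
  by (rule dirac_dom1D[OF \<Phi>])+

lemma \<Phi>_weak: "weak_deriv pdx (\<lambda>x y. \<Phi> x y p) (\<lambda>x y. dom_dx x y p)" "weak_deriv pdy (\<lambda>x y. \<Phi> x y p) (weak_dy (\<lambda>x y. \<Phi> x y p))"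
  by (rule H1_cylD[OF dirac_dom1D(2)[OF \<Phi>]])+

definition part_x where
  "part_x p n x y = rep_part P dom_dx p n x y - rep_part (qdelta c \<mu> HY P) \<Phi> p n x y"

text \<open>The y-derivative of the truncation, regrouped into covariant derivatives: every part is
  a truncated action of an algebra element on a vector of the Hilbert space, apart from one
  multiplier in degree p, which is bounded on the square.\<close>

definition part_y where
  "part_y p n x y = mult_X p x * rep_part P \<Phi> p n x y - 
     (rep_part P (hdelta c (- \<mu>) HX \<Phi>) p n x y + rep_part (qdelta c \<mu> HX P) \<Phi> p n x y)"

lemma part_x_sum: "part_x p n = (\<lambda>x y. \<Sum>q\<in>{- int n..int n}. coef p q x y * dom_dx x y (p - q) + pdx (coef p q) x y * \<Phi> x y (p - q))"
  unfolding part_x_def rep_part_def coef_pdx sum_subtractf[symmetric]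
  by (intro ext sum.cong refl) (simp add: coef_def del: qdelta.simps)

text \<open>The multipliers match because p (x + p \<mu>) = (p - q) (x + (p - q) \<mu>) + q (x + 2 p
  \<mu> - q \<mu>): the multiplier of degree p at x is the one for \<Phi> in degree p - q plus the
  one for P in degree q at the shifted point.\<close>

lemma part_y_sum: "part_y p n = (\<lambda>x y. \<Sum>q\<in>{- int n..int n}. coef p q x y * weak_dy (\<lambda>x y. \<Phi> x y (p - q)) x y + 
     pdy (coef p q) x y * \<Phi> x y (p - q))"
  unfolding part_y_def rep_part_def coef_pdy sum_distrib_left sum.distrib[symmetric] sum_subtractf[symmetric]
proof (intro ext sum.cong refl)
  fix x y q
  show "mult_X p x * (P (x + 2 * of_int p * \<mu>) (y + 2 * of_int p * \<nu>) q * \<Phi> x y (p - q)) -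
     (P (x + 2 * of_int p * \<mu>) (y + 2 * of_int p * \<nu>) q * hdelta c (- \<mu>) HX \<Phi> x y (p - q) +
      qdelta c \<mu> HX P (x + 2 * of_int p * \<mu>) (y + 2 * of_int p * \<nu>) q * \<Phi> x y (p - q)) =
    coef p q x y * weak_dy (\<lambda>x y. \<Phi> x y (p - q)) x y +
     (2 * of_real pi * \<i> * of_int c * of_int q * of_real (x + 2 * of_int p * \<mu> - of_int q * \<mu>) * coef p q x y
     - qdelta c \<mu> HX P (x + 2 * of_int p * \<mu>) (y + 2 * of_int p * \<nu>) q) * \<Phi> x y (p - q)"
    unfolding coef_def[symmetric] hdelta.simps by (simp add: algebra_simps del: qdelta.simps)
qed

lemma rep_part_weak: "weak_deriv pdx (rep_part P \<Phi> p n) (part_x p n)" "weak_deriv pdy (rep_part P \<Phi> p n) (part_y p n)"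
proof -
  have eq: "rep_part P \<Phi> p n = (\<lambda>x y. \<Sum>q\<in>{- int n..int n}. coef p q x y * \<Phi> x y (p - q))"
    by (intro ext) (simp add: rep_part_def coef_def)
  have L: "unc (\<lambda>x y. coef p q x y * \<Phi> x y (p - q)) \<in> L2 Sq" for q
    using coef_smooth[of p q] by (intro smooth_mult_L2 hilbD(1)[OF \<Phi>_hilb(1)]) (simp add: smooth_cyl_iff)
  show "weak_deriv pdx (rep_part P \<Phi> p n) (part_x p n)" unfolding eq part_x_sum
    by (rule weak_sum[OF _ L weak_mult[OF _ coef_smooth hilbD(1)[OF \<Phi>_hilb(1)] \<Phi>_weak(1)]]) simp_all
  show "weak_deriv pdy (rep_part P \<Phi> p n) (part_y p n)" unfolding eq part_y_sum
    by (rule weak_sum[OF _ L weak_mult[OF _ coef_smooth hilbD(1)[OF \<Phi>_hilb(1)] \<Phi>_weak(2)]]) simp_all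
qed

definition "lim_x = (\<lambda>x y p. rep (- \<mu>) (- \<nu>) P dom_dx x y p - rep (- \<mu>) (- \<nu>) (qdelta c \<mu> HY P) \<Phi> x y p)"

definition "lim_y = (\<lambda>x y p. mult_X p x * rep_image x y p - 
     (rep (- \<mu>) (- \<nu>) P (hdelta c (- \<mu>) HX \<Phi>) x y p + rep (- \<mu>) (- \<nu>) (qdelta c \<mu> HX P) \<Phi> x y p))"

lemma mult_X_bound: "\<exists>B\<ge>0. \<forall>z\<in>unit_square. cmod (mult_X p (fst z)) \<le> B"
proof -
  have "plane_smooth (\<lambda>x y. mult_X p x)" unfolding of_real_diff
    by (intro plane_smooth_mult plane_smooth_diff plane_smooth_const plane_smooth_fst)
  from smooth_bounded[OF this] show ?thesis by (meson less_imp_le)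
qed

lemma mult_X_measurable: "(\<lambda>z. mult_X p (fst z)) \<in> borel_measurable Sq"
  by (intro continuous_measurable continuous_intros)

lemma mult_X_L2:
  assumes "f \<in> L2 Sq" shows "(\<lambda>z. mult_X p (fst z) * f z) \<in> L2 Sq"
proof -
  obtain B where "\<forall>z\<in>unit_square. cmod (mult_X p (fst z)) \<le> B" using mult_X_bound by blast
  then show ?thesis by (intro L2_mult[OF assms mult_X_measurable, of _ B]) auto
qed

lemma G_hilb: "rep_image \<in> hilb" 
  by (rule rep_hilb[OF P_qhm \<Phi>_hilb(1)])

lemma lim_L2: "(\<lambda>z. fld lim_x z p) \<in> L2 Sq" "(\<lambda>z. fld lim_y z p) \<in> L2 Sq"
  unfolding lim_x_def lim_y_def 
  by (rule L2_diff[OF hilbD(1)[OF rep_hilb[OF P_qhm \<Phi>_hilb(2)]] hilbD(1)[OF rep_hilb[OF qdelta_qhm \<Phi>_hilb(1)]]])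
     (rule L2_diff[OF mult_X_L2[OF hilbD(1)[OF G_hilb]] L2_add[OF hilbD(1)[OF rep_hilb[OF P_qhm hdelta_hilb[OF \<Phi>]]]
         hilbD(1)[OF rep_hilb[OF qdelta_qhm \<Phi>_hilb(1)]]]])

lemma part_x_limit: "(\<lambda>n. norm_sq Sq (\<lambda>z. unc (part_x p n) z - fld lim_x z p)) \<longlonglongrightarrow> 0"
proof -
  have "(\<lambda>n. norm_sq Sq (\<lambda>z. unc (rep_part P dom_dx p n) z + - 1 * unc (rep_part (qdelta c \<mu> HY P) \<Phi> p n) z - 
     (fld (rep (- \<mu>) (- \<nu>) P dom_dx) z p + - 1 * fld (rep (- \<mu>) (- \<nu>) (qdelta c \<mu> HY P) \<Phi>) z p))) \<longlonglongrightarrow> 0"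
    by (rule norm_sq_add_limit[OF L2D(1)[OF rep_part_L2[OF P_qhm \<Phi>_hilb(2)]] L2D(1)[OF L2_cmult[OF rep_part_L2[OF qdelta_qhm \<Phi>_hilb(1)]]]
          hilbD(2)[OF rep_hilb[OF P_qhm \<Phi>_hilb(2)]] L2D(1)[OF L2_cmult[OF hilbD(1)[OF rep_hilb[OF qdelta_qhm \<Phi>_hilb(1)]]]]
          rep_part_limit[OF P_qhm \<Phi>_hilb(2)] norm_sq_mult_limit[of _ _ _ _ 1, OF L2D(1)[OF rep_part_L2[OF qdelta_qhm \<Phi>_hilb(1)]]
            hilbD(2)[OF rep_hilb[OF qdelta_qhm \<Phi>_hilb(1)]] _ _ rep_part_limit[OF qdelta_qhm \<Phi>_hilb(1)]]]) auto
  then show ?thesis unfolding part_x_def lim_x_def by simp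
qed

lemma part_y_limit: "(\<lambda>n. norm_sq Sq (\<lambda>z. unc (part_y p n) z - fld lim_y z p)) \<longlonglongrightarrow> 0"
proof -
  obtain B where B: "0 \<le> B" "\<forall>z\<in>unit_square. cmod (mult_X p (fst z)) \<le> B" using mult_X_bound by blast
  have "(\<lambda>n. norm_sq Sq (\<lambda>z. mult_X p (fst z) * unc (rep_part P \<Phi> p n) z + 
       - 1 * (unc (rep_part P (hdelta c (- \<mu>) HX \<Phi>) p n) z + unc (rep_part (qdelta c \<mu> HX P) \<Phi> p n) z) - 
     (mult_X p (fst z) * fld rep_image z p + 
       - 1 * (fld (rep (- \<mu>) (- \<nu>) P (hdelta c (- \<mu>) HX \<Phi>)) z p + fld (rep (- \<mu>) (- \<nu>) (qdelta c \<mu> HX P) \<Phi>) z p)))) \<longlonglongrightarrow> 0"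
  proof (rule norm_sq_add_limit)
    show "(\<lambda>n. norm_sq Sq (\<lambda>z. mult_X p (fst z) * unc (rep_part P \<Phi> p n) z - mult_X p (fst z) * fld rep_image z p)) \<longlonglongrightarrow> 0"
      by (rule norm_sq_mult_limit[OF L2D(1)[OF rep_part_L2[OF P_qhm \<Phi>_hilb(1)]] hilbD(2)[OF G_hilb] _ B(1) 
            rep_part_limit[OF P_qhm \<Phi>_hilb(1)]]) (use B(2) in auto)
    have 1: "(\<lambda>n. norm_sq Sq (\<lambda>z. (unc (rep_part P (hdelta c (- \<mu>) HX \<Phi>) p n) z + unc (rep_part (qdelta c \<mu> HX P) \<Phi> p n) z) - 
       (fld (rep (- \<mu>) (- \<nu>) P (hdelta c (- \<mu>) HX \<Phi>)) z p + fld (rep (- \<mu>) (- \<nu>) (qdelta c \<mu> HX P) \<Phi>) z p))) \<longlonglongrightarrow> 0"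
      by (rule norm_sq_add_limit[OF L2D(1)[OF rep_part_L2[OF P_qhm hdelta_hilb[OF \<Phi>]]] L2D(1)[OF rep_part_L2[OF qdelta_qhm \<Phi>_hilb(1)]]
          hilbD(2)[OF rep_hilb[OF P_qhm hdelta_hilb[OF \<Phi>]]] hilbD(2)[OF rep_hilb[OF qdelta_qhm \<Phi>_hilb(1)]]
          rep_part_limit[OF P_qhm hdelta_hilb[OF \<Phi>]] rep_part_limit[OF qdelta_qhm \<Phi>_hilb(1)]])
    show "(\<lambda>n. norm_sq Sq (\<lambda>z. - 1 * (unc (rep_part P (hdelta c (- \<mu>) HX \<Phi>) p n) z + unc (rep_part (qdelta c \<mu> HX P) \<Phi> p n) z) - 
       - 1 * (fld (rep (- \<mu>) (- \<nu>) P (hdelta c (- \<mu>) HX \<Phi>)) z p + fld (rep (- \<mu>) (- \<nu>) (qdelta c \<mu> HX P) \<Phi>) z p))) \<longlonglongrightarrow> 0"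
      by (rule norm_sq_mult_limit[of _ _ _ _ 1, OF L2D(1)[OF L2_add[OF rep_part_L2[OF P_qhm hdelta_hilb[OF \<Phi>]] rep_part_L2[OF qdelta_qhm \<Phi>_hilb(1)]]]
           L2D(1)[OF L2_add[OF hilbD(1)[OF rep_hilb[OF P_qhm hdelta_hilb[OF \<Phi>]]] hilbD(1)[OF rep_hilb[OF qdelta_qhm \<Phi>_hilb(1)]]]] _ _ 1]) auto
    show "(\<lambda>z. mult_X p (fst z) * unc (rep_part P \<Phi> p n) z) \<in> borel_measurable Sq" for n
      by (rule L2D(1)[OF mult_X_L2[OF rep_part_L2[OF P_qhm \<Phi>_hilb(1)]]])
    show "(\<lambda>z. - 1 * (unc (rep_part P (hdelta c (- \<mu>) HX \<Phi>) p n) z + unc (rep_part (qdelta c \<mu> HX P) \<Phi> p n) z)) \<in> borel_measurable Sq" for n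
      by (rule L2D(1)[OF L2_cmult[OF L2_add[OF rep_part_L2[OF P_qhm hdelta_hilb[OF \<Phi>]] rep_part_L2[OF qdelta_qhm \<Phi>_hilb(1)]]]])
    show "(\<lambda>z. mult_X p (fst z) * fld rep_image z p) \<in> borel_measurable Sq"
      by (rule L2D(1)[OF mult_X_L2[OF hilbD(1)[OF G_hilb]]])
    show "(\<lambda>z. - 1 * (fld (rep (- \<mu>) (- \<nu>) P (hdelta c (- \<mu>) HX \<Phi>)) z p + fld (rep (- \<mu>) (- \<nu>) (qdelta c \<mu> HX P) \<Phi>) z p)) \<in> borel_measurable Sq"
      by (rule L2D(1)[OF L2_cmult[OF L2_add[OF hilbD(1)[OF rep_hilb[OF P_qhm hdelta_hilb[OF \<Phi>]]] hilbD(1)[OF rep_hilb[OF qdelta_qhm \<Phi>_hilb(1)]]]]])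
  qed
  then show ?thesis by (simp only: mult_minus1 add_uminus_conv_diff part_y_def lim_y_def)
qed

lemma G_weak: "weak_deriv pdx (\<lambda>x y. rep_image x y p) (\<lambda>x y. lim_x x y p)" "weak_deriv pdy (\<lambda>x y. rep_image x y p) (\<lambda>x y. lim_y x y p)"
  by (rule weak_limit[OF _ hilbD(1)[OF G_hilb] lim_L2(1) rep_part_L2[OF P_qhm \<Phi>_hilb(1)] rep_part_weak(1)
        rep_part_limit[OF P_qhm \<Phi>_hilb(1)] part_x_limit], simp)
     (rule weak_limit[OF _ hilbD(1)[OF G_hilb] lim_L2(2) rep_part_L2[OF P_qhm \<Phi>_hilb(1)] rep_part_weak(2)
        rep_part_limit[OF P_qhm \<Phi>_hilb(1)] part_y_limit], simp)

text \<open>The commutator relation on the domain. For \<open>HX\<close> and \<open>HY\<close> it is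
  read off from the weak derivatives just computed; for \<open>HZ\<close> no derivative is involved
  and it is the splitting p = s + (p - s) under the sum.\<close>

lemma hdelta_rep:
  "heq (hdelta c (- \<mu>) j rep_image) (\<lambda>x y p. rep (- \<mu>) (- \<nu>) P (hdelta c (- \<mu>) j \<Phi>) x y p + rep (- \<mu>) (- \<nu>) (qdelta c \<mu> j P) \<Phi> x y p)"
proof (cases j)
  case HX
  show ?thesis unfolding heq_def
  proof
    fix p
    show "AE z in Sq. fld (hdelta c (- \<mu>) j rep_image) z p = 
      fld (rep (- \<mu>) (- \<nu>) P (hdelta c (- \<mu>) j \<Phi>)) z p + fld (rep (- \<mu>) (- \<nu>) (qdelta c \<mu> j P) \<Phi>) z p"
      using weak_dy_AE[OF G_weak(2)[of p]]
      by eventually_elim (simp add: HX lim_y_def del: qdelta.simps)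
  qed
next
  case HY
  have "rep (- \<mu>) (- \<nu>) P (hdelta c (- \<mu>) HY \<Phi>) = (\<lambda>x y p. - rep (- \<mu>) (- \<nu>) P dom_dx x y p)"
    unfolding hdelta.simps by (rule rep_uminus)
  note eq = this
  show ?thesis unfolding heq_def HY eq
  proof
    fix p
    show "AE z in Sq. fld (hdelta c (- \<mu>) HY rep_image) z p = 
      - fld (rep (- \<mu>) (- \<nu>) P dom_dx) z p + fld (rep (- \<mu>) (- \<nu>) (qdelta c \<mu> HY P) \<Phi>) z p"
      using weak_dx_AE[OF G_weak(1)[of p]] by eventually_elim (simp add: lim_x_def del: qdelta.simps)
  qed
next
  case HZ
  show ?thesis unfolding heq_iff
    using rep_has_sum_AE[OF P_qhm hdelta_hilb[OF \<Phi>, of HZ]] rep_has_sum_AE[OF qdelta_qhm[of HZ] \<Phi>_hilb(1)]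
  proof eventually_elim
    case (elim z)
    show ?case
    proof
      fix p
      let ?A = "qmat \<mu> \<nu> P (fst z) (snd z) p"
      have "((\<lambda>s. ?A s * fld (hdelta c (- \<mu>) HZ \<Phi>) z s + qmat \<mu> \<nu> (qdelta c \<mu> HZ P) (fst z) (snd z) p s * fld \<Phi> z s)
         has_sum (fld (rep (- \<mu>) (- \<nu>) P (hdelta c (- \<mu>) HZ \<Phi>)) z p + fld (rep (- \<mu>) (- \<nu>) (qdelta c \<mu> HZ P) \<Phi>) z p)) UNIV"
        using elim by (intro has_sum_add) auto
      moreover have "?A s * fld (hdelta c (- \<mu>) HZ \<Phi>) z s + qmat \<mu> \<nu> (qdelta c \<mu> HZ P) (fst z) (snd z) p s * fld \<Phi> z s
        = 2 * of_real pi * \<i> * of_int p * (?A s * fld \<Phi> z s)" for s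
        by (simp add: qmat_def algebra_simps)
      ultimately have "(\<Sum>\<^sub>\<infinity>s. 2 * of_real pi * \<i> * of_int p * (?A s * fld \<Phi> z s)) = 
         fld (rep (- \<mu>) (- \<nu>) P (hdelta c (- \<mu>) HZ \<Phi>)) z p + fld (rep (- \<mu>) (- \<nu>) (qdelta c \<mu> HZ P) \<Phi>) z p"
        by (simp only: infsumI)
      moreover have "fld (hdelta c (- \<mu>) HZ rep_image) z p = (\<Sum>\<^sub>\<infinity>s. 2 * of_real pi * \<i> * of_int p * (?A s * fld \<Phi> z s))"
        unfolding hdelta.simps by (subst rep_qmat) (rule infsum_cmult_right'[symmetric])
      ultimately show "fld (hdelta c (- \<mu>) j rep_image) z p = 
        fld (rep (- \<mu>) (- \<nu>) P (hdelta c (- \<mu>) j \<Phi>)) z p + fld (rep (- \<mu>) (- \<nu>) (qdelta c \<mu> j P) \<Phi>) z p"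
        unfolding HZ by simp
    qed
  qed
qed

text \<open>The right-hand side of the commutator relation applies bounded operators to vectors of
  the Hilbert space. This gives the square summability over p that limits in a fixed degree cannot
  give.\<close>

lemma hdelta_G_hilb: "hdelta c (- \<mu>) j rep_image \<in> hilb"
  by (rule hilb_heq[OF _ heq_sym[OF hdelta_rep]]) 
     (rule hilb_add[OF rep_hilb[OF P_qhm hdelta_hilb[OF \<Phi>]] rep_hilb[OF qdelta_qhm \<Phi>_hilb(1)]])

text \<open>On each edge the boundary values of the truncations are row sums over the boundary
  values of \<Phi>. They converge in L2 of the circle, by \<open>row_sum\<close>, once those
  boundary values form a square integrable field.\<close>

lemma G_trace:
  "\<exists>g. has_sobolev_trace (\<lambda>x y. rep_image x y p) 1 g \<and>
     has_sobolev_trace (\<lambda>x y. rep_image x y p) 0 (\<lambda>y. cnj (ee (of_int (c * p) * (y + of_int p * \<nu>))) * g y)"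
proof -
  let ?e = "\<lambda>p y. cnj (ee (of_int (c * p) * (y + of_int p * \<nu>)))"
  let ?Dy = "\<lambda>p. weak_dy (\<lambda>x y. \<Phi> x y p)"
  from dirac_dom1D(3)[OF \<Phi>] have "\<forall>s. \<exists>g. has_sobolev_trace (\<lambda>x y. \<Phi> x y s) 1 g \<and>
     has_sobolev_trace (\<lambda>x y. \<Phi> x y s) 0 (\<lambda>y. ?e s y * g y)" by blast
  from choice[OF this] obtain g where "\<forall>s. has_sobolev_trace (\<lambda>x y. \<Phi> x y s) 1 (g s) \<and>
     has_sobolev_trace (\<lambda>x y. \<Phi> x y s) 0 (\<lambda>y. ?e s y * g s y)" ..
  then have g: "sobolev_graph (\<lambda>x y. \<Phi> x y s) (\<lambda>x y. dom_dx x y s) (?Dy s) 1 (g s)"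
     "sobolev_graph (\<lambda>x y. \<Phi> x y s) (\<lambda>x y. dom_dx x y s) (?Dy s) 0 (\<lambda>y. ?e s y * g s y)" for s
    using has_trace_iff[OF dirac_dom1D(2)[OF \<Phi>]] by blast+
  have gm: "g s \<in> borel_measurable Ci" for s by (rule sobolev_graphD(4)[OF g(1)])
  \<comment> \<open>The constants of the trace inequality do not depend on the degree, and \<Phi>
    and its x-derivative are both square summable over the degrees.\<close>
  have gf: "(\<lambda>y s. g s y) \<in> fields Ci"
  proof (rule fieldsI[OF gm])
    have "(\<integral>\<^sup>+s. norm_sq Ci (\<lambda>y. g s y) \<partial>count_space UNIV) \<le> (\<integral>\<^sup>+s. 8 * norm_sq Sq (\<lambda>z. fld \<Phi> z s) + 4 * norm_sq Sq (\<lambda>z. fld dom_dx z s) \<partial>count_space UNIV)"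
      by (intro nn_integral_mono sobolev_graph_trace_le[OF g(1)])
    also have "\<dots> = 8 * hnorm2 \<Phi> + 4 * hnorm2 dom_dx"
      unfolding norm_sq_hnorm2 by (subst nn_integral_add) (auto simp: nn_integral_cmult)
    also have "\<dots> < \<infinity>" using hilbD(4)[OF \<Phi>_hilb(1)] hilbD(4)[OF \<Phi>_hilb(2)] by (simp add: ennreal_mult_less_top)
    finally show "(\<integral>\<^sup>+s. norm_sq Ci (\<lambda>y. g s y) \<partial>count_space UNIV) < \<infinity>" .
  qed
  obtain C where C: "qhm_bound \<mu> \<nu> P C" using qhm_bounded[OF P_qhm] .
  define gn where "gn n y = (\<Sum>q\<in>{- int n..int n}. coef p q 1 y * g (p - q) y)" for n y
  define gp where "gp y = (\<Sum>\<^sub>\<infinity>q. coef p q 1 y * g (p - q) y)" for y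
  have I: "{0..1::real} \<in> sets lebesgue" by simp
  have row: "l2_bound (\<lambda>q. coef p q 1 y) C" for y unfolding coef_def by (rule qhm_bound_row[OF C])
  note cm = smooth_section_measurable[OF coef_smooth[of p], of _ 1]
  have gpm: "gp \<in> borel_measurable Ci" 
    unfolding gp_def[abs_def] by (rule row_sum_measurable[OF I cm row reflect_fields[OF gf]])
  have gl: "(\<lambda>n. norm_sq Ci (\<lambda>y. gn n y - gp y)) \<longlonglongrightarrow> 0"
    unfolding gp_def gn_def by (rule row_sum_limit[OF I cm row reflect_fields[OF gf]])
  have gnm: "gn n \<in> borel_measurable Ci" for n
    unfolding gn_def[abs_def] by (intro borel_measurable_sum borel_measurable_times cm gm)
  have eq: "rep_part P \<Phi> p n = (\<lambda>x y. \<Sum>q\<in>{- int n..int n}. coef p q x y * \<Phi> x y (p - q))" for n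
    by (intro ext) (simp add: rep_part_def coef_def)
  have h1: "sobolev_graph (rep_part P \<Phi> p n) (part_x p n) (part_y p n) 1 (gn n)" for n
    unfolding eq part_x_sum part_y_sum gn_def[abs_def]
    by (intro sobolev_graph_sum sobolev_graph_mult coef_smooth g) simp
  have h0: "sobolev_graph (rep_part P \<Phi> p n) (part_x p n) (part_y p n) 0 (\<lambda>y. ?e p y * gn n y)" for n
  proof -
    have "?e p y * gn n y = (\<Sum>q\<in>{- int n..int n}. coef p q 0 y * (?e (p - q) y * g (p - q) y))" for y
      unfolding gn_def sum_distrib_left by (intro sum.cong refl coef_boundary[symmetric])
    then show ?thesis unfolding eq part_x_sum part_y_sum
      by (simp only:) (intro sobolev_graph_sum sobolev_graph_mult coef_smooth g, simp)
  qed
  have em: "?e p \<in> borel_measurable Ci" by (intro continuous_measurable continuous_intros)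
  note L = hilbD(1)[OF G_hilb, of p] lim_L2[of p]
  note l = rep_part_limit[OF P_qhm \<Phi>_hilb(1), of p] part_x_limit[of p] part_y_limit[of p]
  have H1: "sobolev_graph (\<lambda>x y. rep_image x y p) (\<lambda>x y. lim_x x y p) (\<lambda>x y. lim_y x y p) 1 gp"
    by (rule sobolev_graph_limit[OF L gpm h1 l gl])
  have H0: "sobolev_graph (\<lambda>x y. rep_image x y p) (\<lambda>x y. lim_x x y p) (\<lambda>x y. lim_y x y p) 0 (\<lambda>y. ?e p y * gp y)"
    by (rule sobolev_graph_limit[OF L borel_measurable_times[OF em gpm] h0 l norm_sq_mult_limit[OF gnm gpm _ _ gl, of _ 1]]) auto
  have GH: "(\<lambda>x y. rep_image x y p) \<in> H1_cyl" by (rule H1_cylI[OF L(1) G_weak])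
  note wL = weakD(1)[OF H1_cylD(2)[OF GH]] weakD(1)[OF H1_cylD(3)[OF GH]]
  have ae0: "AE z in Sq. fld rep_image z p = fld rep_image z p" by simp
  have ae1: "AE z in Sq. fld lim_x z p = unc (weak_dx (\<lambda>x y. rep_image x y p)) z" 
    using weak_dx_AE[OF G_weak(1)[of p]] by eventually_elim simp
  have ae2: "AE z in Sq. fld lim_y z p = unc (weak_dy (\<lambda>x y. rep_image x y p)) z"
    using weak_dy_AE[OF G_weak(2)[of p]] by eventually_elim simp
  have "has_sobolev_trace (\<lambda>x y. rep_image x y p) 1 gp"
    unfolding has_trace_iff[OF GH] by (rule sobolev_graph_cong[OF H1 L(1) wL gpm ae0 ae1 ae2]) simp
  moreover have "has_sobolev_trace (\<lambda>x y. rep_image x y p) 0 (\<lambda>y. ?e p y * gp y)"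
    unfolding has_trace_iff[OF GH] by (rule sobolev_graph_cong[OF H0 L(1) wL borel_measurable_times[OF em gpm] ae0 ae1 ae2]) simp
  ultimately show ?thesis by blast
qed

text \<open>The conditions over all p are extracted from the three covariant derivatives of the
  image: \<open>HZ\<close> yields the factor p, \<open>HY\<close> the x-derivative, and
  \<open>HX\<close>, together with the factor p, the y-derivative of the phased function.\<close>

lemma rep_dirac_dom1: "rep_image \<in> dirac_dom1 c (- \<mu>) (- \<nu>)"
proof (rule dirac_dom1I[OF G_hilb H1_cylI[OF hilbD(1)[OF G_hilb] G_weak] G_trace])
  have "(\<lambda>x y p. (1 / (2 * of_real pi * \<i>)) * hdelta c (- \<mu>) HZ rep_image x y p) \<in> hilb"
    by (rule hilb_cmult[OF hdelta_G_hilb])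
  then show "(\<lambda>x y p. of_int p * rep_image x y p) \<in> hilb" by (simp add: mult.assoc)
  have "(\<lambda>x y p. - hdelta c (- \<mu>) HY rep_image x y p) \<in> hilb" by (rule hilb_uminus[OF hdelta_G_hilb])
  then show "(\<lambda>x y p. weak_dx (\<lambda>x y. rep_image x y p) x y) \<in> hilb" by simp
  have pG: "(\<lambda>x y p. of_int p * rep_image x y p) \<in> hilb" by fact
  let ?t = "\<lambda>p::int. of_int c * (of_int p)\<^sup>2 * (- \<mu>)"
  let ?\<xi> = "\<lambda>x y p. ee (of_int \<lfloor>?t p\<rfloor> * y) * (2 * of_real pi * \<i> * of_int c * of_real x * (of_int p * rep_image x y p) +
     2 * of_real pi * \<i> * (of_int \<lfloor>?t p\<rfloor> - of_real (?t p)) * rep_image x y p - hdelta c (- \<mu>) HX rep_image x y p)"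
  have "?\<xi> \<in> hilb"
    by (intro multiplier_hilb(3) hilb_diff hilb_add multiplier_hilb(1,2) pG G_hilb hdelta_G_hilb)
  moreover have "heq ?\<xi> (\<lambda>x y p. weak_dy (\<lambda>x y. ee (of_int \<lfloor>?t p\<rfloor> * y) * rep_image x y p) x y)"
    unfolding heq_def hdelta.simps
    by (intro allI hdelta_HX_AE[OF hilbD(1)[OF G_hilb] weak_dy_some[OF G_weak(2)]])
  ultimately show "(\<lambda>x y p. weak_dy (\<lambda>x y. ee (of_int \<lfloor>?t p\<rfloor> * y) * rep_image x y p) x y) \<in> hilb" by (rule hilb_heq)
qed

end

end

section \<open>Density of the domain\<close>

lemma hilb_finite:
  assumes L: "\<And>p. (\<lambda>z. fld \<xi> z p) \<in> L2 Sq" and S: "finite S" "\<And>p. p \<notin> S \<Longrightarrow> AE z in Sq. fld \<xi> z p = 0"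
  shows "\<xi> \<in> hilb"
proof (rule hilbI[OF L2D(1)[OF L]])
  have 0: "norm_sq Sq (\<lambda>z. fld \<xi> z p) = 0" if "p \<notin> S" for p
    using norm_sq_cong[OF S(2)[OF that]] by (simp add: norm_sq_def)
  have "hnorm2 \<xi> \<le> (\<Sum>p\<in>S. norm_sq Sq (\<lambda>z. fld \<xi> z p))"
    unfolding norm_sq_hnorm2 nn_integral_count_space_int_le_iff
  proof (intro allI impI)
    fix F :: "int set" assume F: "finite F"
    have "(\<Sum>p\<in>F. norm_sq Sq (\<lambda>z. fld \<xi> z p)) = (\<Sum>p\<in>F \<inter> S. norm_sq Sq (\<lambda>z. fld \<xi> z p))"
      using F 0 by (intro sum.mono_neutral_right) auto
    also have "\<dots> \<le> (\<Sum>p\<in>S. norm_sq Sq (\<lambda>z. fld \<xi> z p))" using S by (intro sum_mono2) auto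
    finally show "(\<Sum>p\<in>F. norm_sq Sq (\<lambda>z. fld \<xi> z p)) \<le> (\<Sum>p\<in>S. norm_sq Sq (\<lambda>z. fld \<xi> z p))" .
  qed
  also have "\<dots> < \<infinity>" using L2D(2)[OF L] S by (simp add: less_top[symmetric])
  finally show "hnorm2 \<xi> < \<infinity>" .
qed

lemma smooth_H1_cyl: "F \<in> smooth_cyl \<Longrightarrow> F \<in> H1_cyl"
  by (rule H1_cylI[OF smooth_L2(1) weak_smooth weak_smooth]) auto

lemma smooth_weak_pd_AE:
  assumes "F \<in> smooth_cyl"
  shows "AE z in Sq. unc (weak_dx F) z = unc (pdx F) z" "AE z in Sq. unc (weak_dy F) z = unc (pdy F) z"
  by (rule weak_dx_AE[OF weak_smooth[OF _ assms]] weak_dy_AE[OF weak_smooth[OF _ assms]]; simp)+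

lemma smooth_has_trace:
  assumes "F \<in> smooth_cyl" shows "has_sobolev_trace F x0 (F x0)"
proof -
  note H = H1_cylD[OF smooth_H1_cyl[OF assms]]
  have ae1: "AE z in Sq. unc (pdx F) z = unc (weak_dx F) z"
    using smooth_weak_pd_AE(1)[OF assms] by eventually_elim simp
  have ae2: "AE z in Sq. unc (pdy F) z = unc (weak_dy F) z"
    using smooth_weak_pd_AE(2)[OF assms] by eventually_elim simp
  show ?thesis unfolding has_trace_iff[OF smooth_H1_cyl[OF assms]]
    by (rule sobolev_graph_cong[OF sobolev_graph_smooth[OF assms] H(1) weakD(1)[OF H(2)] weakD(1)[OF H(3)] smooth_section_measurable[OF assms] _ ae1 ae2])
       simp_all
qed

text \<open>Test functions vanish near both edges, so both traces are 0 and the quasi-periodic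
  boundary condition holds; finitely many degrees leave nothing to sum.\<close>

lemma test_dirac_dom1:
  assumes \<psi>: "\<And>p. (\<lambda>x y. \<Phi> x y p) \<in> test_cyl" and S: "finite S" "\<And>p x y. p \<notin> S \<Longrightarrow> \<Phi> x y p = 0"
  shows "\<Phi> \<in> dirac_dom1 c (- \<mu>) (- \<nu>)"
proof (rule dirac_dom1I)
  note s = test_cyl_smooth(1)[OF \<psi>]
  show "\<Phi> \<in> hilb" by (rule hilb_finite[OF smooth_L2(1)[OF s] S(1)]) (simp add: S(2))
  show "(\<lambda>x y. \<Phi> x y p) \<in> H1_cyl" for p by (rule smooth_H1_cyl[OF s])
  show "\<exists>g. has_sobolev_trace (\<lambda>x y. \<Phi> x y p) 1 g \<and>
        has_sobolev_trace (\<lambda>x y. \<Phi> x y p) 0 (\<lambda>y. cnj (ee (of_int (c * p) * (y + of_int p * \<nu>))) * g y)" for p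
  proof (intro exI[of _ "\<lambda>y. 0"] conjI)
    have "\<Phi> 1 y p = 0" "\<Phi> 0 y p = 0" for y using \<psi>[of p] by (fastforce simp: test_cyl_def)+
    then show "has_sobolev_trace (\<lambda>x y. \<Phi> x y p) 1 (\<lambda>y. 0)"
      "has_sobolev_trace (\<lambda>x y. \<Phi> x y p) 0 (\<lambda>y. cnj (ee (of_int (c * p) * (y + of_int p * \<nu>))) * 0)"
      using smooth_has_trace[OF s[of p], of 1] smooth_has_trace[OF s[of p], of 0] by simp_all
  qed
  show "(\<lambda>x y p. of_int p * \<Phi> x y p) \<in> hilb"
    by (rule hilb_finite[OF L2_cmult[OF smooth_L2(1)[OF s]] S(1)]) (simp add: S(2))
  show "(\<lambda>x y p. weak_dx (\<lambda>x y. \<Phi> x y p) x y) \<in> hilb"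
  proof (rule hilb_finite[OF weakD(1)[OF H1_cylD(2)[OF smooth_H1_cyl[OF s]]] S(1)])
    fix p assume "p \<notin> S"
    then have "pdx (\<lambda>x y. \<Phi> x y p) = (\<lambda>x y. 0)" by (intro pdx_eq) (simp add: S(2))
    then show "AE z in Sq. unc (weak_dx (\<lambda>x y. \<Phi> x y p)) z = 0" using smooth_weak_pd_AE(1)[OF s[of p]] by simp
  qed
  let ?n = "\<lambda>p. \<lfloor>of_int c * (of_int p)\<^sup>2 * (- \<mu>)\<rfloor>"
  have s': "(\<lambda>x y. ee (of_int (?n p) * y) * \<Phi> x y p) \<in> smooth_cyl" for p
    by (rule smooth_cyl_mult[OF ee_int_smooth(1) s])
  show "(\<lambda>x y p. weak_dy (\<lambda>x y. ee (of_int (?n p) * y) * \<Phi> x y p) x y) \<in> hilb"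
  proof (rule hilb_finite[OF weakD(1)[OF H1_cylD(3)[OF smooth_H1_cyl[OF s']]] S(1)])
    fix p assume "p \<notin> S"
    then have "pdy (\<lambda>x y. ee (of_int (?n p) * y) * \<Phi> x y p) = (\<lambda>x y. 0)" by (intro pdy_eq) (simp add: S(2))
    then show "AE z in Sq. unc (weak_dy (\<lambda>x y. ee (of_int (?n p) * y) * \<Phi> x y p)) z = 0" 
      using smooth_weak_pd_AE(2)[OF s'[of p]] by simp
  qed
qed

text \<open>The tail lemma for scalar sequences, applied to the L2 norms of the components in each
  degree.\<close>

lemma hilb_tail:
  assumes \<xi>: "\<xi> \<in> hilb" and e: "0 < e"
  obtains S where "finite S" "\<And>F. finite F \<Longrightarrow> F \<inter> S = {} \<Longrightarrow> (\<Sum>p\<in>F. norm_sq Sq (\<lambda>z. fld \<xi> z p)) \<le> ennreal (e\<^sup>2)"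
proof -
  define g where "g p = enn2real (norm_sq Sq (\<lambda>z. fld \<xi> z p))" for p
  have ng: "norm_sq Sq (\<lambda>z. fld \<xi> z p) = ennreal (g p)" for p
    using L2D(2)[OF hilbD(1)[OF \<xi>, of p]] by (simp add: g_def less_top)
  have g0: "0 \<le> g p" for p by (simp add: g_def)
  define c where "c = sqrt (enn2real (hnorm2 \<xi>))"
  have "l2_bound (\<lambda>p. of_real (sqrt (g p))) c"
    unfolding l2_bound_iff_sq
  proof (intro conjI allI impI)
    fix F :: "int set" assume F: "finite F"
    have "(\<Sum>p\<in>F. ennreal (g p)) \<le> hnorm2 \<xi>"
      unfolding norm_sq_hnorm2 ng[symmetric] using nn_integral_count_space_int_le_iff[THEN iffD1, OF order_refl, rule_format, OF F] .
    also have "hnorm2 \<xi> = ennreal (enn2real (hnorm2 \<xi>))" using hilbD(4)[OF \<xi>] by (simp add: less_top)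
    finally have "(\<Sum>p\<in>F. g p) \<le> enn2real (hnorm2 \<xi>)" using g0 by simp
    then show "(\<Sum>p\<in>F. (cmod (of_real (sqrt (g p))))\<^sup>2) \<le> c\<^sup>2" using g0 by (simp add: c_def)
  qed (simp add: c_def)
  from l2_bound_tail[OF this e] obtain S where S: "finite S" 
    "\<And>T. S \<subseteq> T \<Longrightarrow> l2_bound (\<lambda>s. if s \<in> T then 0 else complex_of_real (sqrt (g s))) e" by blast
  show thesis
  proof (rule that[OF S(1)])
    fix F :: "int set" assume F: "finite F" "F \<inter> S = {}"
    have "(\<Sum>p\<in>F. g p) = (\<Sum>p\<in>F. (cmod (if p \<in> S then 0 else of_real (sqrt (g p))))\<^sup>2)"
      using F(2) g0 by (intro sum.cong) auto
    also have "\<dots> \<le> e\<^sup>2" using S(2)[OF subset_refl] F(1) by (simp add: l2_bound_iff_sq)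
    finally show "(\<Sum>p\<in>F. norm_sq Sq (\<lambda>z. fld \<xi> z p)) \<le> ennreal (e\<^sup>2)"
      unfolding ng using g0 by (simp add: ennreal_leI)
  qed
qed

lemma dirac_dom1_dense:
  assumes \<xi>: "\<xi> \<in> hilb" and e: "0 < e"
  obtains \<Phi> where "\<Phi> \<in> dirac_dom1 c (- \<mu>) (- \<nu>)" "hnorm2 (\<lambda>x y p. \<xi> x y p - \<Phi> x y p) \<le> ennreal e"
proof -
  \<comment> \<open>\<open>hilb_tail\<close> measures the squared norm by the square of its
    parameter; the tail is allowed e / 2.\<close>
  have "0 < sqrt (e / 2)" using e by simp
  from hilb_tail[OF \<xi> this] obtain S where S: "finite S" 
    "\<And>F. finite F \<Longrightarrow> F \<inter> S = {} \<Longrightarrow> (\<Sum>p\<in>F. norm_sq Sq (\<lambda>z. fld \<xi> z p)) \<le> ennreal ((sqrt (e / 2))\<^sup>2)" by blast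
  \<comment> \<open>The errors of the degrees in S sum to at most e / 2; the summand 1 covers an
    empty S.\<close>
  define d where "d = e / (2 * (real (card S) + 1))"
  have d: "0 < d" using e by (simp add: d_def add_nonneg_pos)
  have "\<forall>p. \<exists>\<phi>. \<phi> \<in> test_cyl \<and> norm_sq Sq (\<lambda>z. fld \<xi> z p - \<phi> (fst z) (snd z)) < ennreal d"
    using L2_Sq_test_closure[OF hilbD(1)[OF \<xi>]] d unfolding test_closure_def by blast
  from choice[OF this] obtain \<phi> where \<phi>: "\<forall>p. \<phi> p \<in> test_cyl \<and> norm_sq Sq (\<lambda>z. fld \<xi> z p - \<phi> p (fst z) (snd z)) < ennreal d" ..
  define \<Phi> where "\<Phi> x y p = (if p \<in> S then \<phi> p x y else 0)" for x y p
  have "(\<lambda>x y. \<Phi> x y p) \<in> test_cyl" for p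
    using \<phi> test_cyl_cmult[of "\<phi> p" 0] by (cases "p \<in> S") (simp_all add: \<Phi>_def)
  then have dom: "\<Phi> \<in> dirac_dom1 c (- \<mu>) (- \<nu>)" 
    by (rule test_dirac_dom1[OF _ S(1)]) (simp add: \<Phi>_def)
  have "hnorm2 (\<lambda>x y p. \<xi> x y p - \<Phi> x y p) \<le> ennreal e"
    unfolding norm_sq_hnorm2 nn_integral_count_space_int_le_iff
  proof (intro allI impI)
    fix F :: "int set" assume F: "finite F"
    let ?h = "\<lambda>p. norm_sq Sq (\<lambda>z. fld (\<lambda>x y p. \<xi> x y p - \<Phi> x y p) z p)"
    have "(\<Sum>p\<in>F. ?h p) = (\<Sum>p\<in>F \<inter> S. ?h p) + (\<Sum>p\<in>F - S. ?h p)"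
      by (subst sum.union_disjoint[symmetric]) (auto simp: F Int_Diff_Un)
    also have "(\<Sum>p\<in>F \<inter> S. ?h p) \<le> (\<Sum>p\<in>F \<inter> S. ennreal d)"
      using \<phi> by (intro sum_mono) (auto simp: \<Phi>_def intro: less_imp_le)
    also have "\<dots> \<le> (\<Sum>p\<in>S. ennreal d)" using S(1) by (intro sum_mono2) auto
    also have "\<dots> = ennreal (real (card S) * d)" using d by (simp add: ennreal_mult ennreal_of_nat_eq_real_of_nat)
    also have "\<dots> \<le> ennreal (e / 2)"
    proof (rule ennreal_leI)
      have "real (card S) * d \<le> (real (card S) + 1) * d" using d by (intro mult_right_mono) auto
      also have "\<dots> = e / 2" by (simp add: d_def divide_simps) (simp add: algebra_simps)?
      finally show "real (card S) * d \<le> e / 2" .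
    qed
    also have "(\<Sum>p\<in>F - S. ?h p) = (\<Sum>p\<in>F - S. norm_sq Sq (\<lambda>z. fld \<xi> z p))"
      by (intro sum.cong refl) (simp add: \<Phi>_def)
    also have "\<dots> \<le> ennreal ((sqrt (e / 2))\<^sup>2)" using F by (intro S(2)) auto
    also have "(sqrt (e / 2))\<^sup>2 = e / 2" using e by simp
    also have "ennreal (e / 2) + ennreal (e / 2) = ennreal e" 
      using e by (simp add: ennreal_plus[symmetric] del: ennreal_plus)
    finally show "(\<Sum>p\<in>F. ?h p) \<le> ennreal e" by (simp add: add_mono)
  qed
  then show thesis using that dom by blast
qed

section \<open>Uniqueness of the commutator\<close>

lemma heq2I: "(\<And>k. heq (F $ k) (G $ k)) \<Longrightarrow> heq2 F G" by (simp add: heq2_def)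

lemma heq2D: "heq2 F G \<Longrightarrow> heq (F $ k) (G $ k)" by (simp add: heq2_def)

lemma lincomb2_nth: "lincomb2 \<alpha> F \<beta> G $ k = (\<lambda>x y p. \<alpha> * (F $ k) x y p + \<beta> * (G $ k) x y p)"
  by (simp add: lincomb2_def)

lemma hilb2_lincomb: "F \<in> hilb2 \<Longrightarrow> G \<in> hilb2 \<Longrightarrow> lincomb2 \<alpha> F \<beta> G \<in> hilb2"
  unfolding hilb2_def by (auto simp: lincomb2_nth intro!: hilb_add hilb_cmult)

lemma dirac_dom_hilb2: "F \<in> dirac_dom c (- \<mu>) (- \<nu>) \<Longrightarrow> F \<in> hilb2"
  unfolding dirac_dom_def hilb2_def using dirac_dom1D(1) by blast

lemma dirac_dom_dense:
  assumes F: "F \<in> hilb2" and e: "0 < e"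
  obtains G where "G \<in> dirac_dom c (- \<mu>) (- \<nu>)" "(\<Sum>k\<in>UNIV. hnorm2 (lincomb2 1 F (- 1) G $ k)) \<le> ennreal e"
proof -
  have e2: "0 < e/2" using e by simp
  have "\<forall>k. \<exists>\<Phi>. \<Phi> \<in> dirac_dom1 c (- \<mu>) (- \<nu>) \<and> hnorm2 (\<lambda>x y p. (F $ k) x y p - \<Phi> x y p) \<le> ennreal (e/2)"
  proof
    fix k
    have "F $ k \<in> hilb" using F by (simp add: hilb2_def)
    from dirac_dom1_dense[OF this e2]
    show "\<exists>\<Phi>. \<Phi> \<in> dirac_dom1 c (- \<mu>) (- \<nu>) \<and> hnorm2 (\<lambda>x y p. (F $ k) x y p - \<Phi> x y p) \<le> ennreal (e/2)" by blast
  qed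
  from choice[OF this] obtain \<Phi> where \<Phi>: "\<forall>k. \<Phi> k \<in> dirac_dom1 c (- \<mu>) (- \<nu>) \<and> 
     hnorm2 (\<lambda>x y p. (F $ k) x y p - \<Phi> k x y p) \<le> ennreal (e/2)" ..
  define G where "G = (\<chi> k. \<Phi> k)"
  have G: "G $ k = \<Phi> k" for k by (simp add: G_def)
  have "(\<Sum>k\<in>UNIV. hnorm2 (lincomb2 1 F (- 1) G $ k)) \<le> (\<Sum>k\<in>(UNIV::2 set). ennreal (e/2))"
    using \<Phi> by (intro sum_mono) (simp add: lincomb2_nth G)
  also have "\<dots> = ennreal e" using e by (simp only: sum_2) (simp add: ennreal_plus[symmetric] del: ennreal_plus)
  finally show thesis using that[of G] \<Phi> by (simp add: dirac_dom_def G)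
qed

text \<open>Two bounded operators with the same values on the dense domain. Linearity and equality
  on the domain hold up to null sets only, so the difference is estimated in norm and found to be
  smaller than every e.\<close>

lemma dirac_commutator_unique:
  assumes T: "is_dirac_commutator c (- \<mu>) (- \<nu>) a T" and T': "is_dirac_commutator c (- \<mu>) (- \<nu>) a T'" 
    and F: "F \<in> hilb2"
  shows "heq2 (T F) (T' F)"
proof (rule heq2I)
  fix k
  have b: "bounded_op2 T" "bounded_op2 T'" using T T' by (auto simp: is_dirac_commutator_def)
  obtain C where C: "\<forall>F\<in>hilb2. (\<Sum>k\<in>UNIV. hnorm2 (T F $ k)) \<le> ennreal C * (\<Sum>k\<in>UNIV. hnorm2 (F $ k))"
    using b(1) unfolding bounded_op2_def by blast
  obtain C' where C': "\<forall>F\<in>hilb2. (\<Sum>k\<in>UNIV. hnorm2 (T' F $ k)) \<le> ennreal C' * (\<Sum>k\<in>UNIV. hnorm2 (F $ k))"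
    using b(2) unfolding bounded_op2_def by blast
  have h: "\<And>F. F \<in> hilb2 \<Longrightarrow> T F \<in> hilb2" "\<And>F. F \<in> hilb2 \<Longrightarrow> T' F \<in> hilb2" using b by (auto simp: bounded_op2_def)
  have hk: "\<And>F k. F \<in> hilb2 \<Longrightarrow> T F $ k \<in> hilb" "\<And>F k. F \<in> hilb2 \<Longrightarrow> T' F $ k \<in> hilb" 
    using h by (auto simp: hilb2_def)
  \<comment> \<open>A common positive constant for both operators; the constants from boundedness
    may be negative, in which case \<open>ennreal\<close> makes them 0.\<close>
  define K where "K = max C 0 + max C' 0 + 1"
  have K: "0 < K" by (simp add: K_def)
  let ?d = "\<lambda>x y p. (T F $ k) x y p - (T' F $ k) x y p"
  have dh: "?d \<in> hilb" by (intro hilb_diff hk F)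
  have "hnorm2 ?d \<le> 0"
  proof (rule ennreal_le_epsilon)
    fix e :: real assume e: "0 < e"
    \<comment> \<open>Each operator contributes at most K times this, that is e / 4, and both
      contributions are doubled.\<close>
    then have "0 < e / (4 * K)" using K by simp
    then obtain G where G: "G \<in> dirac_dom c (- \<mu>) (- \<nu>)" 
      "(\<Sum>k\<in>UNIV. hnorm2 (lincomb2 1 F (- 1) G $ k)) \<le> ennreal (e / (4 * K))"
      using dirac_dom_dense[OF F] by blast
    let ?H = "lincomb2 1 F (- 1) G"
    have G2: "G \<in> hilb2" by (rule dirac_dom_hilb2[OF G(1)])
    have H: "?H \<in> hilb2" by (rule hilb2_lincomb[OF F G2])
    have lin: "heq2 (T ?H) (lincomb2 1 (T F) (- 1) (T G))" "heq2 (T' ?H) (lincomb2 1 (T' F) (- 1) (T' G))"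
      using b F G2 by (auto simp: bounded_op2_def)
    let ?c = "lincomb2 1 (dirac c (- \<mu>) (rep2 (- \<mu>) (- \<nu>) a G)) (- 1) (rep2 (- \<mu>) (- \<nu>) a (dirac c (- \<mu>) G))"
    have "heq2 (T G) ?c" "heq2 (T' G) ?c" using T T' G(1) by (auto simp: is_dirac_commutator_def)
    then have TG: "heq (T G $ k) (T' G $ k)" using heq2D heq_trans heq_sym by blast
    have "heq ?d (\<lambda>x y p. (T ?H $ k) x y p - (T' ?H $ k) x y p)"
      unfolding heq_iff using heqD[OF heq2D[OF lin(1), of k]] heqD[OF heq2D[OF lin(2), of k]] heqD[OF TG]
      by eventually_elim (simp add: lincomb2_nth)
    from hnorm2_heq[OF this] have "hnorm2 ?d = hnorm2 (\<lambda>x y p. (T ?H $ k) x y p + - (T' ?H $ k) x y p)" by simp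
    also have "\<dots> \<le> 2 * hnorm2 (T ?H $ k) + 2 * hnorm2 (\<lambda>x y p. - (T' ?H $ k) x y p)"
      by (intro hnorm2_add hk hilb_uminus H)
    also have "hnorm2 (\<lambda>x y p. - (T' ?H $ k) x y p) = hnorm2 (T' ?H $ k)" by (simp add: norm_sq_hnorm2 norm_sq_uminus)
    also have "2 * hnorm2 (T ?H $ k) + 2 * hnorm2 (T' ?H $ k) \<le> 
       2 * (ennreal K * ennreal (e / (4 * K))) + 2 * (ennreal K * ennreal (e / (4 * K)))"
    proof (intro add_mono mult_left_mono)
      have m: "hnorm2 (f $ k) \<le> (\<Sum>k\<in>UNIV. hnorm2 (f $ k))" for f by (rule member_le_sum) auto
      have "hnorm2 (T ?H $ k) \<le> ennreal C * (\<Sum>k\<in>UNIV. hnorm2 (?H $ k))" 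
        by (rule order_trans[OF m C[rule_format, OF H]])
      also have "\<dots> \<le> ennreal K * ennreal (e / (4 * K))" 
        by (intro mult_mono G(2) ennreal_leI) (auto simp: K_def)
      finally show "hnorm2 (T ?H $ k) \<le> ennreal K * ennreal (e / (4 * K))" .
      have "hnorm2 (T' ?H $ k) \<le> ennreal C' * (\<Sum>k\<in>UNIV. hnorm2 (?H $ k))" 
        by (rule order_trans[OF m C'[rule_format, OF H]])
      also have "\<dots> \<le> ennreal K * ennreal (e / (4 * K))" 
        by (intro mult_mono G(2) ennreal_leI) (auto simp: K_def)
      finally show "hnorm2 (T' ?H $ k) \<le> ennreal K * ennreal (e / (4 * K))" .
    qed auto
    also have "ennreal K * ennreal (e / (4 * K)) = ennreal (e / 4)"
      using K e by (subst ennreal_mult[symmetric]) auto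
    also have "2 * ennreal (e / 4) + 2 * ennreal (e / 4) = ennreal e"
      using e by (simp only: mult_2) (simp add: ennreal_plus[symmetric] del: ennreal_plus)
    finally show "hnorm2 ?d \<le> 0 + ennreal e" by simp
  qed
  then have "hnorm2 ?d = 0" by simp
  then have "norm_sq Sq (\<lambda>z. fld ?d z p) = 0" for p
    using nn_integral_count_space_int_le_iff[of "\<lambda>p. norm_sq Sq (\<lambda>z. fld ?d z p)" 0, THEN iffD1, rule_format, of "{p}"]
    unfolding norm_sq_hnorm2 by simp
  then have "AE z in Sq. fld ?d z p = 0" for p by (intro norm_sq_eq_0 hilbD(2)[OF dh])
  then show "heq (T F $ k) (T' F $ k)" unfolding heq_def by simp
qed

section \<open>Uniqueness of the symbol\<close>

text \<open>The zero set is closed and contains almost every point of the open square, hence the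
  whole open square and its closure.\<close>

lemma continuous_AE_zero:
  fixes h :: "real \<times> real \<Rightarrow> complex"
  assumes c: "continuous_on UNIV h" and ae: "AE z in Sq. h z = 0" and z: "z \<in> unit_square"
  shows "h z = 0"
proof -
  let ?C = "{z. h z = 0}" and ?B = "box (0, 0) (1, 1) :: (real \<times> real) set"
  have cl: "closed ?C" using continuous_closed_preimage_constant[OF c closed_UNIV, of 0] by simp
  have "AE z in lebesgue. z \<in> unit_square \<longrightarrow> h z = 0" using ae by (simp add: AE_restrict_space_iff)
  then have ae': "AE z\<in>?B in lebesgue. z \<in> ?C" 
    by eventually_elim (auto simp: box_Pair_real)
  have "?B \<subseteq> ?C" using mem_closed_if_AE_lebesgue_open[OF open_box cl ae'] by blast
  then have "closure ?B \<subseteq> ?C" using cl by (rule closure_minimal)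
  moreover have "?B \<noteq> {}" by (simp add: box_Pair_real)
  ultimately show ?thesis using z unfolding unit_square_cbox by (subst (asm) closure_box) auto
qed

lemma qhm_periodic_int:
  assumes "\<Phi> \<in> qhm c \<mu> \<nu>" shows "\<Phi> x (y + of_int n) p = \<Phi> x y p"
proof (induction n rule: int_induct[of _ 0])
  case (step1 i)
  then show ?case using qhm_periodic[OF assms, of x "y + of_int i" p] by (simp add: add_ac)
next
  case (step2 i)
  then show ?case using qhm_periodic[OF assms, of x "y + of_int (i - 1)" p] by (simp add: add_ac)
qed simp

text \<open>Applied to the vector that is 1 in degree 0, here \<open>qunit\<close> read as a vector,
  the operator returns the coefficients of b at points shifted by (2 p \<mu>, 2 p \<nu>). Continuity
  gives equality on the shifted square; periodicity in y and quasi-periodicity in x carry it to the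
  plane.\<close>

lemma represents_unique:
  assumes b: "represents c \<mu> \<nu> b T" and b': "represents c \<mu> \<nu> b' T"
  shows "b = b'"
proof (intro ext)
  fix X Y :: real and p :: int
  have q: "b \<in> qhm c \<mu> \<nu>" "b' \<in> qhm c \<mu> \<nu>" using b b' by (auto simp: represents_def)
  let ?\<xi> = "qunit"
  have one: "(\<lambda>z. 1) \<in> L2 Sq" by (rule L2_bounded[OF finite_measure_Sq, of _ 1]) auto
  have "?\<xi> \<in> hilb"
    by (rule hilb_finite[of _ "{0}"]) (auto simp: qunit_def one L2_0)
  then have "heq (rep (- \<mu>) (- \<nu>) b ?\<xi>) (rep (- \<mu>) (- \<nu>) b' ?\<xi>)"
    using b b' heq_trans[OF heq_sym] unfolding represents_def by blast
  moreover have r: "rep (- \<mu>) (- \<nu>) a ?\<xi> x y p = a (x + 2 * of_int p * \<mu>) (y + 2 * of_int p * \<nu>) p" for a x y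
  proof -
    have "rep (- \<mu>) (- \<nu>) a ?\<xi> x y p = (\<Sum>\<^sub>\<infinity>q\<in>{p}. a (x + 2 * of_int p * \<mu>) (y + 2 * of_int p * \<nu>) q)"
      unfolding rep_eq by (rule infsum_cong_neutral) (auto simp: qunit_def)
    then show ?thesis by simp
  qed
  let ?a = "2 * of_int p * \<mu>" and ?b = "2 * of_int p * \<nu>"
  have "AE z in Sq. b (fst z + ?a) (snd z + ?b) p - b' (fst z + ?a) (snd z + ?b) p = 0"
    using calculation unfolding heq_def r[symmetric] by simp
  moreover have "continuous_on UNIV (\<lambda>z. b (fst z + ?a) (snd z + ?b) p - b' (fst z + ?a) (snd z + ?b) p)"
    by (rule continuous_on_diff[OF continuous_shift[OF qhm_continuous[OF q(1)]] continuous_shift[OF qhm_continuous[OF q(2)]]])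
  ultimately have sq: "b (x + ?a) (y + ?b) p = b' (x + ?a) (y + ?b) p" if "x \<in> {0..1}" "y \<in> {0..1}" for x y
    using continuous_AE_zero[of "\<lambda>z. b (fst z + ?a) (snd z + ?b) p - b' (fst z + ?a) (snd z + ?b) p" "(x, y)"] that by simp
  define x where "x = frac (X - ?a)"
  define y where "y = frac (Y - ?b)"
  have X: "X = (x + ?a) + of_int \<lfloor>X - ?a\<rfloor>" by (simp add: x_def frac_def)
  have Y: "Y = (y + ?b) + of_int \<lfloor>Y - ?b\<rfloor>" by (simp add: y_def frac_def)
  have "x \<in> {0..1}" "y \<in> {0..1}" by (simp_all add: x_def y_def less_imp_le[OF frac_lt_1])
  from sq[OF this] have "b (x + ?a) ((y + ?b) + of_int \<lfloor>Y - ?b\<rfloor>) p = b' (x + ?a) ((y + ?b) + of_int \<lfloor>Y - ?b\<rfloor>) p"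
    by (simp only: qhm_periodic_int[OF q(1)] qhm_periodic_int[OF q(2)])
  then have "b (x + ?a) Y p = b' (x + ?a) Y p" by (simp only: Y[symmetric])
  then have "b ((x + ?a) + of_int \<lfloor>X - ?a\<rfloor>) Y p = b' ((x + ?a) + of_int \<lfloor>X - ?a\<rfloor>) Y p"
    by (simp only: qhm_shift[OF q(1)] qhm_shift[OF q(2)])
  then show "b X Y p = b' X Y p" by (simp only: X[symmetric])
qed

section \<open>The commutator\<close>

definition spin_weight :: "2 \<Rightarrow> heis_basis \<times> 2 \<Rightarrow> complex" where
  "spin_weight k = (\<lambda>(j, l). \<i> * pauli j $ k $ l)"

abbreviation spin_index :: "(heis_basis \<times> 2) set" where
  "spin_index \<equiv> {HX, HY, HZ} \<times> UNIV"

text \<open>The common shape of \<open>dirac\<close> and of its commutators: component k of the sum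
  over j of \<i> h \<otimes> \<sigma>. Flattening the two indices into one finite index set lets
  linearity, boundedness and congruence be proved once.\<close>

definition spin_sum :: "2 \<Rightarrow> (heis_basis \<Rightarrow> 2 \<Rightarrow> qfun) \<Rightarrow> qfun" where
  "spin_sum k h = (\<lambda>x y p. \<Sum>i\<in>spin_index. spin_weight k i * h (fst i) (snd i) x y p)"

lemma spin_sum_iterated: 
  "spin_sum k h = (\<lambda>x y p. \<Sum>j\<in>{HX, HY, HZ}. \<i> * (\<Sum>l\<in>UNIV. pauli j $ k $ l * h j l x y p))"
  unfolding spin_sum_def spin_weight_def sum_distrib_left sum.cartesian_product
  by (intro ext sum.cong refl) (auto simp: mult.assoc)

lemma dirac_nth: "dirac c \<mu> F $ k = spin_sum k (\<lambda>j l. hdelta c \<mu> j (F $ l))"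
  unfolding dirac_def spin_sum_iterated by simp

lemma spin_weight_le: "cmod (spin_weight k i) \<le> 1"
proof (cases i)
  case (Pair j l)
  have "k = 1 \<or> k = 2" "l = 1 \<or> l = 2" using exhaust_2 by blast+
  then show ?thesis unfolding Pair spin_weight_def by (cases j) (auto simp: norm_mult)
qed

lemma spin_sum_hilb: "(\<And>j l. h j l \<in> hilb) \<Longrightarrow> spin_sum k h \<in> hilb"
  unfolding spin_sum_def by (intro hilb_sum hilb_cmult)

lemma spin_sum_heq:
  assumes "\<And>j l. heq (h j l) (h' j l)" shows "heq (spin_sum k h) (spin_sum k h')"
proof -
  have "AE z in Sq. \<forall>i\<in>spin_index. \<forall>p. fld (h (fst i) (snd i)) z p = fld (h' (fst i) (snd i)) z p"
    using heqD[OF assms] by (intro eventually_ball_finite ballI) auto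
  then show ?thesis unfolding heq_iff spin_sum_def
  proof eventually_elim
    case (elim z)
    show ?case by (intro allI sum.cong refl arg_cong2[where f = "(*)"] elim[rule_format])
  qed
qed

lemma spin_sum_add: 
  "spin_sum k (\<lambda>j l x y p. h j l x y p + h' j l x y p) = (\<lambda>x y p. spin_sum k h x y p + spin_sum k h' x y p)"
  unfolding spin_sum_def by (simp add: distrib_left sum.distrib)

lemma spin_sum_lincomb: 
  "spin_sum k (\<lambda>j l x y p. \<alpha> * h j l x y p + \<beta> * h' j l x y p) = (\<lambda>x y p. \<alpha> * spin_sum k h x y p + \<beta> * spin_sum k h' x y p)"
  unfolding spin_sum_def by (simp add: distrib_left sum.distrib sum_distrib_left mult.left_commute)

text \<open>Each summand added costs one more factor 2, hence the crude power of 2; for a fixed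
  finite index set it is just a constant.\<close>

lemma hnorm2_sum:
  assumes "finite I" "\<And>i. i \<in> I \<Longrightarrow> f i \<in> hilb"
  shows "hnorm2 (\<lambda>x y p. \<Sum>i\<in>I. f i x y p) \<le> 2 ^ card I * (\<Sum>i\<in>I. hnorm2 (f i))"
  using assms
proof (induction I rule: finite_induct)
  case (insert i I)
  have "hnorm2 (\<lambda>x y p. f i x y p + (\<Sum>i\<in>I. f i x y p)) \<le> 2 * hnorm2 (f i) + 2 * hnorm2 (\<lambda>x y p. \<Sum>i\<in>I. f i x y p)"
    using insert by (intro hnorm2_add hilb_sum) auto
  also have "\<dots> \<le> 2 * (2 ^ card I * hnorm2 (f i)) + 2 * (2 ^ card I * (\<Sum>i\<in>I. hnorm2 (f i)))"
  proof (intro add_mono mult_left_mono)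
    have "1 * hnorm2 (f i) \<le> 2 ^ card I * hnorm2 (f i)" by (intro mult_right_mono one_le_power) auto
    then show "hnorm2 (f i) \<le> 2 ^ card I * hnorm2 (f i)" by simp
    show "hnorm2 (\<lambda>x y p. \<Sum>i\<in>I. f i x y p) \<le> 2 ^ card I * (\<Sum>i\<in>I. hnorm2 (f i))" using insert by auto
  qed auto
  also have "\<dots> = 2 ^ card (insert i I) * (\<Sum>i\<in>insert i I. hnorm2 (f i))"
    using insert by (simp add: distrib_left mult.assoc)
  finally show ?case using insert by simp
qed (simp add: hnorm2_def l2_square_def)

lemma spin_sum_hnorm2:
  assumes "\<And>j l. h j l \<in> hilb"
  shows "hnorm2 (spin_sum k h) \<le> 2 ^ card spin_index * (\<Sum>i\<in>spin_index. hnorm2 (h (fst i) (snd i)))"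
proof -
  have "hnorm2 (spin_sum k h) \<le> 2 ^ card spin_index * (\<Sum>i\<in>spin_index. hnorm2 (\<lambda>x y p. spin_weight k i * h (fst i) (snd i) x y p))"
    unfolding spin_sum_def by (intro hnorm2_sum hilb_cmult assms) auto
  also have "\<dots> \<le> 2 ^ card spin_index * (\<Sum>i\<in>spin_index. hnorm2 (h (fst i) (snd i)))"
  proof (intro mult_left_mono sum_mono)
    fix i
    show "hnorm2 (\<lambda>x y p. spin_weight k i * h (fst i) (snd i) x y p) \<le> hnorm2 (h (fst i) (snd i))"
      using hnorm2_mult[OF assms, of 1 "\<lambda>x y p. spin_weight k i" "fst i" "snd i"] spin_weight_le[of k i] by simp
  qed auto
  finally show ?thesis .
qed

lemma rep_sum:
  assumes a: "a \<in> qhm c \<mu> \<nu>" and "finite I" "\<And>i. i \<in> I \<Longrightarrow> f i \<in> hilb"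
  shows "heq (rep (- \<mu>) (- \<nu>) a (\<lambda>x y p. \<Sum>i\<in>I. k i * f i x y p)) (\<lambda>x y p. \<Sum>i\<in>I. k i * rep (- \<mu>) (- \<nu>) a (f i) x y p)"
  using assms(2,3)
proof (induction I rule: finite_induct)
  case (insert i I)
  have S: "(\<lambda>x y p. \<Sum>i\<in>I. k i * f i x y p) \<in> hilb" using insert by (intro hilb_sum hilb_cmult) auto
  have 1: "heq (rep (- \<mu>) (- \<nu>) a (\<lambda>x y p. k i * f i x y p + 1 * (\<Sum>i\<in>I. k i * f i x y p)))
    (\<lambda>x y p. k i * rep (- \<mu>) (- \<nu>) a (f i) x y p + 1 * rep (- \<mu>) (- \<nu>) a (\<lambda>x y p. \<Sum>i\<in>I. k i * f i x y p) x y p)"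
    using insert by (intro rep_lincomb[OF a _ S]) auto
  have IH: "heq (rep (- \<mu>) (- \<nu>) a (\<lambda>x y p. \<Sum>i\<in>I. k i * f i x y p)) (\<lambda>x y p. \<Sum>i\<in>I. k i * rep (- \<mu>) (- \<nu>) a (f i) x y p)"
    by (rule insert.IH) (simp add: insert.prems)
  have 2: "heq (\<lambda>x y p. k i * rep (- \<mu>) (- \<nu>) a (f i) x y p + 1 * rep (- \<mu>) (- \<nu>) a (\<lambda>x y p. \<Sum>i\<in>I. k i * f i x y p) x y p)
     (\<lambda>x y p. k i * rep (- \<mu>) (- \<nu>) a (f i) x y p + (\<Sum>i\<in>I. k i * rep (- \<mu>) (- \<nu>) a (f i) x y p))"
    unfolding heq_iff using heqD[OF IH] by eventually_elim simp
  from heq_trans[OF 1 2] show ?case unfolding sum.insert[OF insert(1,2)] mult_1_left .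
qed (simp add: rep_def heq_refl)

lemma rep_spin_sum:
  assumes a: "a \<in> qhm c \<mu> \<nu>" and h: "\<And>j l. h j l \<in> hilb"
  shows "heq (rep (- \<mu>) (- \<nu>) a (spin_sum k h)) (spin_sum k (\<lambda>j l. rep (- \<mu>) (- \<nu>) a (h j l)))"
  unfolding spin_sum_def by (rule rep_sum[OF a]) (auto simp: h)

text \<open>The derivations are those of the algebra for \<mu> and \<nu>, whereas the representation
  carries the opposite signs, like the rest of the Hilbert space data.\<close>

definition spin_commutator :: "int \<Rightarrow> real \<Rightarrow> real \<Rightarrow> qfun \<Rightarrow> spinor \<Rightarrow> spinor" where
  "spin_commutator c \<mu> \<nu> P F = (\<chi> k. spin_sum k (\<lambda>j l. rep (- \<mu>) (- \<nu>) (qdelta c \<mu> j P) (F $ l)))"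

lemma hilb2D: "F \<in> hilb2 \<Longrightarrow> F $ k \<in> hilb" by (simp add: hilb2_def)

context
  fixes c :: int and \<mu> \<nu> :: real and P :: qfun
  assumes P: "P \<in> smooth_qhm c \<mu> \<nu>"
begin

lemma spin_commutator_nth: "spin_commutator c \<mu> \<nu> P F $ k = spin_sum k (\<lambda>j l. rep (- \<mu>) (- \<nu>) (qdelta c \<mu> j P) (F $ l))"
  by (simp add: spin_commutator_def)

lemma spin_commutator_hilb2: 
  assumes "F \<in> hilb2" shows "spin_commutator c \<mu> \<nu> P F \<in> hilb2"
proof -
  have "spin_commutator c \<mu> \<nu> P F $ k \<in> hilb" for k
    unfolding spin_commutator_nth by (rule spin_sum_hilb[OF rep_hilb[OF smooth_qhm_qdelta[OF P] hilb2D[OF assms]]])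
  then show ?thesis by (simp add: hilb2_def)
qed

lemma spin_commutator_heq2: 
  assumes "heq2 F G" shows "heq2 (spin_commutator c \<mu> \<nu> P F) (spin_commutator c \<mu> \<nu> P G)"
  by (rule heq2I) (unfold spin_commutator_nth, rule spin_sum_heq[OF rep_cong[OF heq2D[OF assms]]])

lemma spin_commutator_bounded: "bounded_op2 (spin_commutator c \<mu> \<nu> P)"
  unfolding bounded_op2_def
proof (intro conjI ballI allI)
  fix F assume "F \<in> hilb2" then show "spin_commutator c \<mu> \<nu> P F \<in> hilb2" by (rule spin_commutator_hilb2)
next
  fix F G \<alpha> \<beta> assume F: "F \<in> hilb2" and G: "G \<in> hilb2"
  show "heq2 (spin_commutator c \<mu> \<nu> P (lincomb2 \<alpha> F \<beta> G)) (lincomb2 \<alpha> (spin_commutator c \<mu> \<nu> P F) \<beta> (spin_commutator c \<mu> \<nu> P G))"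
  proof (rule heq2I)
    fix k
    show "heq (spin_commutator c \<mu> \<nu> P (lincomb2 \<alpha> F \<beta> G) $ k) (lincomb2 \<alpha> (spin_commutator c \<mu> \<nu> P F) \<beta> (spin_commutator c \<mu> \<nu> P G) $ k)"
      unfolding lincomb2_nth spin_commutator_nth spin_sum_lincomb[symmetric]
      by (intro spin_sum_heq rep_lincomb[OF smooth_qhm_qdelta[OF P]] hilb2D F G)
  qed
next
  have "\<forall>j. \<exists>C. qhm_bound \<mu> \<nu> (qdelta c \<mu> j P) C" using qhm_bounded[OF smooth_qhm_qdelta[OF P]] by metis
  then obtain C where C: "\<And>j. qhm_bound \<mu> \<nu> (qdelta c \<mu> j P) (C j)" by metis
  define K where "K = (\<Sum>k\<in>(UNIV::2 set). 2 ^ card spin_index * (\<Sum>i\<in>spin_index. ennreal ((C (fst i))\<^sup>2)))"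
  have "K < \<infinity>" unfolding K_def by (simp add: sum_2 ennreal_mult_less_top)
  then obtain K' where K': "K = ennreal K'" by (cases K) auto
  have "\<forall>F\<in>hilb2. (\<Sum>k\<in>UNIV. hnorm2 (spin_commutator c \<mu> \<nu> P F $ k)) \<le> K * (\<Sum>k\<in>UNIV. hnorm2 (F $ k))"
  proof
    fix F assume F: "F \<in> hilb2"
    let ?N = "\<Sum>k\<in>UNIV. hnorm2 (F $ k)"
    have "(\<Sum>k\<in>UNIV. hnorm2 (spin_commutator c \<mu> \<nu> P F $ k)) \<le> 
      (\<Sum>k\<in>(UNIV::2 set). 2 ^ card spin_index * (\<Sum>i\<in>spin_index. hnorm2 (rep (- \<mu>) (- \<nu>) (qdelta c \<mu> (fst i) P) (F $ snd i))))"
      unfolding spin_commutator_nth by (intro sum_mono spin_sum_hnorm2 rep_hilb[OF smooth_qhm_qdelta[OF P]] hilb2D F)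
    also have "\<dots> \<le> (\<Sum>k\<in>(UNIV::2 set). 2 ^ card spin_index * (\<Sum>i\<in>spin_index. ennreal ((C (fst i))\<^sup>2) * ?N))"
    proof (intro sum_mono mult_left_mono)
      fix i :: "heis_basis \<times> 2"
      have "hnorm2 (rep (- \<mu>) (- \<nu>) (qdelta c \<mu> (fst i) P) (F $ snd i)) \<le> ennreal ((C (fst i))\<^sup>2) * hnorm2 (F $ snd i)"
        by (rule rep_hilb_aux(2)[OF smooth_qhm_qdelta[OF P] C hilb2D[OF F]])
      also have "\<dots> \<le> ennreal ((C (fst i))\<^sup>2) * ?N" by (intro mult_left_mono member_le_sum) auto
      finally show "hnorm2 (rep (- \<mu>) (- \<nu>) (qdelta c \<mu> (fst i) P) (F $ snd i)) \<le> ennreal ((C (fst i))\<^sup>2) * ?N" .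
    qed auto
    also have "\<dots> = K * ?N" unfolding K_def sum_distrib_right[symmetric] mult.assoc[symmetric] ..
    finally show "(\<Sum>k\<in>UNIV. hnorm2 (spin_commutator c \<mu> \<nu> P F $ k)) \<le> K * ?N" .
  qed
  then show "\<exists>C. \<forall>F\<in>hilb2. (\<Sum>k\<in>UNIV. hnorm2 (spin_commutator c \<mu> \<nu> P F $ k)) \<le> ennreal C * (\<Sum>k\<in>UNIV. hnorm2 (F $ k))"
    unfolding K' by blast
qed

lemma spin_commutator_is_commutator: "is_dirac_commutator c (- \<mu>) (- \<nu>) P (spin_commutator c \<mu> \<nu> P)"
  unfolding is_dirac_commutator_def
proof (intro conjI ballI spin_commutator_bounded)
  fix F assume F: "F \<in> dirac_dom c (- \<mu>) (- \<nu>)"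
  then have Fk: "F $ k \<in> dirac_dom1 c (- \<mu>) (- \<nu>)" for k by (simp add: dirac_dom_def)
  have rn: "rep2 (- \<mu>) (- \<nu>) P G $ k = rep (- \<mu>) (- \<nu>) P (G $ k)" for G k by (simp add: rep2_def)
  show "rep2 (- \<mu>) (- \<nu>) P F \<in> dirac_dom c (- \<mu>) (- \<nu>)"
    using rep_dirac_dom1[OF P Fk] by (simp add: dirac_dom_def rn)
  let ?R = "rep (- \<mu>) (- \<nu>)"
  show "heq2 (spin_commutator c \<mu> \<nu> P F) (lincomb2 1 (dirac c (- \<mu>) (rep2 (- \<mu>) (- \<nu>) P F)) (- 1) (rep2 (- \<mu>) (- \<nu>) P (dirac c (- \<mu>) F)))"
  proof (rule heq2I)
    fix k
    have 1: "heq (dirac c (- \<mu>) (rep2 (- \<mu>) (- \<nu>) P F) $ k) 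
      (spin_sum k (\<lambda>j l x y p. ?R P (hdelta c (- \<mu>) j (F $ l)) x y p + ?R (qdelta c \<mu> j P) (F $ l) x y p))"
      unfolding dirac_nth rn by (rule spin_sum_heq) (rule hdelta_rep[OF P Fk])
    have 2: "heq (rep2 (- \<mu>) (- \<nu>) P (dirac c (- \<mu>) F) $ k) (spin_sum k (\<lambda>j l. ?R P (hdelta c (- \<mu>) j (F $ l))))"
      unfolding rn dirac_nth by (rule rep_spin_sum[OF P_qhm[OF P] hdelta_hilb[OF Fk]])
    show "heq (spin_commutator c \<mu> \<nu> P F $ k) (lincomb2 1 (dirac c (- \<mu>) (rep2 (- \<mu>) (- \<nu>) P F)) (- 1) (rep2 (- \<mu>) (- \<nu>) P (dirac c (- \<mu>) F)) $ k)"
      unfolding heq_iff using heqD[OF 1] heqD[OF 2]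
      by eventually_elim (simp add: lincomb2_nth spin_commutator_nth spin_sum_add del: qdelta.simps hdelta.simps)
  qed
qed

text \<open>\<open>dirac_commutator\<close> is merely chosen. Existence of the explicit operator
  makes the choice a genuine commutator, and uniqueness identifies the two up to null sets.\<close>

lemma dirac_commutator_heq2:
  assumes "F \<in> hilb2" shows "heq2 (dirac_commutator c (- \<mu>) (- \<nu>) P F) (spin_commutator c \<mu> \<nu> P F)"
proof -
  have "is_dirac_commutator c (- \<mu>) (- \<nu>) P (dirac_commutator c (- \<mu>) (- \<nu>) P)"
    unfolding dirac_commutator_def by (rule someI[of "is_dirac_commutator c (- \<mu>) (- \<nu>) P", OF spin_commutator_is_commutator])
  from dirac_commutator_unique[OF this spin_commutator_is_commutator assms] show ?thesis .
qed

lemma dirac_commutator_hilb2: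
  assumes "F \<in> hilb2" shows "dirac_commutator c (- \<mu>) (- \<nu>) P F \<in> hilb2"
proof -
  have "heq (spin_commutator c \<mu> \<nu> P F $ k) (dirac_commutator c (- \<mu>) (- \<nu>) P F $ k)" for k
    by (rule heq_sym[OF heq2D[OF dirac_commutator_heq2[OF assms]]])
  then show ?thesis using hilb_heq[OF hilb2D[OF spin_commutator_hilb2[OF assms]]] unfolding hilb2_def by blast
qed

section \<open>The symbol of the 2-chain\<close>

definition symbol :: qfun where
  "symbol = (\<lambda>x y p. - 2 * (\<Sum>j\<in>{HX, HY, HZ}. qmult \<mu> \<nu> (qdelta c \<mu> j P) (qdelta c \<mu> j P) x y p))"

lemma square_qhm: "qmult \<mu> \<nu> (qdelta c \<mu> i P) (qdelta c \<mu> j P) \<in> qhm c \<mu> \<nu>"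
  by (rule qhm_qmult[OF smooth_qhm_qdelta[OF P] smooth_qhm_qdelta[OF P]])

abbreviation (input) square_op where
  "square_op \<xi> i j \<equiv> rep (- \<mu>) (- \<nu>) (qmult \<mu> \<nu> (qdelta c \<mu> i P) (qdelta c \<mu> j P)) \<xi>"

text \<open>Written as nested binary combinations, with an explicit factor 1, to match
  \<open>rep_lincomb_left\<close> applied twice.\<close>

lemma symbol_eq:
  "symbol = (\<lambda>x y p. - 2 * qmult \<mu> \<nu> (qdelta c \<mu> HX P) (qdelta c \<mu> HX P) x y p + 1 * (
     - 2 * qmult \<mu> \<nu> (qdelta c \<mu> HY P) (qdelta c \<mu> HY P) x y p + - 2 * qmult \<mu> \<nu> (qdelta c \<mu> HZ P) (qdelta c \<mu> HZ P) x y p))"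
  unfolding symbol_def by (simp add: algebra_simps del: qdelta.simps)

lemma symbol_qhm: "symbol \<in> qhm c \<mu> \<nu>"
  unfolding symbol_eq by (intro qhm_add qhm_scale square_qhm)

lemma rep_symbol:
  assumes "\<xi> \<in> hilb"
  shows "heq (rep (- \<mu>) (- \<nu>) symbol \<xi>) (\<lambda>x y p. - 2 * (\<Sum>j\<in>{HX, HY, HZ}. square_op \<xi> j j x y p))"
proof -
  have 0: "(\<lambda>x y p. - 2 * qmult \<mu> \<nu> (qdelta c \<mu> HY P) (qdelta c \<mu> HY P) x y p + 
      - 2 * qmult \<mu> \<nu> (qdelta c \<mu> HZ P) (qdelta c \<mu> HZ P) x y p) \<in> qhm c \<mu> \<nu>"
    by (intro qhm_add qhm_scale square_qhm)
  note 1 = rep_lincomb_left[OF square_qhm[of HX HX] 0 assms, of "- 2" 1]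
  note 2 = rep_lincomb_left[OF square_qhm[of HY HY] square_qhm[of HZ HZ] assms, of "- 2" "- 2"]
  show ?thesis unfolding heq_iff symbol_eq using heqD[OF 1] heqD[OF 2]
  proof eventually_elim
    case (elim z)
    show ?case
      by (intro allI, simp only: elim(1)[rule_format] elim(2)[rule_format]) (simp add: algebra_simps del: qdelta.simps)
  qed
qed

lemma spin_commutator_spin_commutator:
  assumes F: "F \<in> hilb2"
  shows "heq (spin_commutator c \<mu> \<nu> P (spin_commutator c \<mu> \<nu> P F) $ k) (spin_sum k (\<lambda>i l. spin_sum l (\<lambda>j m. square_op (F $ m) i j)))"
  unfolding spin_commutator_nth
proof (rule spin_sum_heq)
  fix i l
  note q = smooth_qhm_qdelta[OF P]
  have "heq (rep (- \<mu>) (- \<nu>) (qdelta c \<mu> i P) (spin_sum l (\<lambda>j m. rep (- \<mu>) (- \<nu>) (qdelta c \<mu> j P) (F $ m))))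
    (spin_sum l (\<lambda>j m. rep (- \<mu>) (- \<nu>) (qdelta c \<mu> i P) (rep (- \<mu>) (- \<nu>) (qdelta c \<mu> j P) (F $ m))))"
    by (rule rep_spin_sum[OF q rep_hilb[OF q hilb2D[OF F]]])
  moreover have "heq (spin_sum l (\<lambda>j m. rep (- \<mu>) (- \<nu>) (qdelta c \<mu> i P) (rep (- \<mu>) (- \<nu>) (qdelta c \<mu> j P) (F $ m))))
     (spin_sum l (\<lambda>j m. square_op (F $ m) i j))"
    by (rule spin_sum_heq) (rule rep_qmult[OF q q hilb2D[OF F]])
  ultimately show "heq (rep (- \<mu>) (- \<nu>) (qdelta c \<mu> i P) (spin_sum l (\<lambda>j m. rep (- \<mu>) (- \<nu>) (qdelta c \<mu> j P) (F $ m))))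
     (spin_sum l (\<lambda>j m. square_op (F $ m) i j))" by (rule heq_trans)
qed

text \<open>\<open>Tr (\<sigma>\<^sub>i \<sigma>\<^sub>j) = 2 \<delta>\<^sub>i\<^sub>j\<close>\<close>

lemma pauli_trace:
  "(\<Sum>k\<in>UNIV. spin_sum k (\<lambda>i l. spin_sum l (\<lambda>j m x y p. R i j x y p * axis k 1 $ m)) x y p) = 
    - 2 * (\<Sum>j\<in>{HX, HY, HZ}. R j j x y p)"
  unfolding spin_sum_iterated by (simp add: sum_2 axis_def algebra_simps)

lemma tensor_hilb2:
  assumes "\<xi> \<in> hilb" shows "tensor \<xi> u \<in> hilb2"
  using hilb_cmult[OF assms] by (simp add: hilb2_def tensor_def mult.commute[of _ "u $ _"])

lemma rep_times: "rep \<mu>' \<nu>' a (\<lambda>x y p. \<xi> x y p * w) = (\<lambda>x y p. rep \<mu>' \<nu>' a \<xi> x y p * w)"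
  by (intro ext) (simp add: rep_def infsum_cmult_left' flip: mult.assoc)

lemma psi2_represents: "represents c \<mu> \<nu> symbol (psi2 c (- \<mu>) (- \<nu>) qunit P P)"
  unfolding represents_def
proof (intro conjI ballI symbol_qhm)
  fix \<xi> assume \<xi>: "\<xi> \<in> hilb"
  let ?T = "dirac_commutator c (- \<mu>) (- \<nu>) P" and ?C = "spin_commutator c \<mu> \<nu> P"
  let ?t = "\<lambda>k. tensor \<xi> (axis k 1)"
  have unit: "rep2 (- \<mu>) (- \<nu>) qunit F = F" for F by (simp add: rep2_def rep_qunit vec_eq_iff)
  have k: "heq (?T (?T (?t k)) $ k) (spin_sum k (\<lambda>i l. spin_sum l (\<lambda>j m x y p. square_op \<xi> i j x y p * axis k 1 $ m)))" for k :: 2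
  proof -
    note t = tensor_hilb2[OF \<xi>, of "axis k 1"]
    \<comment> \<open>The outer factor is replaced before the inner one: the explicit operator
      respects equality up to null sets, by \<open>spin_commutator_heq2\<close>, whereas for the
      chosen operator this is not part of the definition.\<close>
    have 1: "heq (?T (?T (?t k)) $ k) (?C (?T (?t k)) $ k)"
      by (rule heq2D[OF dirac_commutator_heq2[OF dirac_commutator_hilb2[OF t]]])
    have 2: "heq (?C (?T (?t k)) $ k) (?C (?C (?t k)) $ k)"
      by (rule heq2D[OF spin_commutator_heq2[OF dirac_commutator_heq2[OF t]]])
    have 3: "heq (?C (?C (?t k)) $ k) (spin_sum k (\<lambda>i l. spin_sum l (\<lambda>j m. square_op (?t k $ m) i j)))"
      by (rule spin_commutator_spin_commutator[OF t])
    have 4: "square_op (?t k $ m) i j = (\<lambda>x y p. square_op \<xi> i j x y p * axis k 1 $ m)" for i j m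
      unfolding tensor_def by (simp add: rep_times del: qdelta.simps)
    from heq_trans[OF 1 heq_trans[OF 2 3]] show ?thesis unfolding 4 .
  qed
  have "AE z in Sq. \<forall>k. \<forall>p. fld (?T (?T (?t k)) $ k) z p = 
     fld (spin_sum k (\<lambda>i l. spin_sum l (\<lambda>j m x y p. square_op \<xi> i j x y p * axis k 1 $ m))) z p"
    by (rule eventually_all_finite) (rule heqD[OF k])
  then have "heq (psi2 c (- \<mu>) (- \<nu>) qunit P P \<xi>) (\<lambda>x y p. - 2 * (\<Sum>j\<in>{HX, HY, HZ}. square_op \<xi> j j x y p))"
    unfolding heq_iff
  proof eventually_elim
    case (elim z)
    show ?case
    proof
      fix p
      have "fld (psi2 c (- \<mu>) (- \<nu>) qunit P P \<xi>) z p = (\<Sum>k\<in>UNIV. fld (?T (?T (?t k)) $ k) z p)"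
        by (simp only: psi2_def matrix_trace_def o_apply unit)
      also have "\<dots> = (\<Sum>k\<in>UNIV. fld (spin_sum k (\<lambda>i l. spin_sum l (\<lambda>j m x y p. square_op \<xi> i j x y p * axis k 1 $ m))) z p)"
        by (intro sum.cong refl elim[rule_format])
      also have "\<dots> = - 2 * (\<Sum>j\<in>{HX, HY, HZ}. fld (square_op \<xi> j j) z p)" by (rule pauli_trace)
      finally show "fld (psi2 c (- \<mu>) (- \<nu>) qunit P P \<xi>) z p = - 2 * (\<Sum>j\<in>{HX, HY, HZ}. fld (square_op \<xi> j j) z p)" .
    qed
  qed
  from heq_trans[OF this heq_sym[OF rep_symbol[OF \<xi>]]]
  show "heq (psi2 c (- \<mu>) (- \<nu>) qunit P P \<xi>) (rep (- \<mu>) (- \<nu>) symbol \<xi>)" .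
qed

end

theorem proposition4p1:
  fixes c :: int and \<mu> \<nu> :: real and P :: qfun
  assumes "c > 0" and "P \<in> qprojections c \<mu> \<nu>"
  shows "(\<exists>T. is_dirac_commutator c (- \<mu>) (- \<nu>) P T) \<and>
    (\<exists>!b. represents c \<mu> \<nu> b (psi2 c (- \<mu>) (- \<nu>) qunit P P)) \<and>
    action_functional c \<mu> \<nu> P =
      2 * qtrace (\<lambda>x y p. \<Sum>j\<in>{HX, HY, HZ}.
        qmult \<mu> \<nu> (qdelta c \<mu> j P) (qdelta c \<mu> j P) x y p)"
proof (intro conjI)
  have P: "P \<in> smooth_qhm c \<mu> \<nu>" using assms(2) by (simp add: qprojections_def)
  show "\<exists>T. is_dirac_commutator c (- \<mu>) (- \<nu>) P T" using spin_commutator_is_commutator[OF P] by blast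
  note rep = psi2_represents[OF P]
  show "\<exists>!b. represents c \<mu> \<nu> b (psi2 c (- \<mu>) (- \<nu>) qunit P P)"
    using rep represents_unique by blast
  have "(THE b. represents c \<mu> \<nu> b (psi2 c (- \<mu>) (- \<nu>) qunit P P)) = symbol c \<mu> \<nu> P"
    using rep represents_unique by (intro the_equality) blast+
  then show "action_functional c \<mu> \<nu> P =
      2 * qtrace (\<lambda>x y p. \<Sum>j\<in>{HX, HY, HZ}.
        qmult \<mu> \<nu> (qdelta c \<mu> j P) (qdelta c \<mu> j P) x y p)"
    \<comment> \<open>The factor -2 of the symbol leaves the integral by a rule without
      integrability conditions, and the minus sign of the functional turns it into 2.\<close>
    unfolding action_functional_def qtrace_op_def qtrace_def symbol_def[OF P]
    by (simp only: integral_mult_right_zero) simp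
qed

end
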